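(* Let $\alpha\in(1,2)$ and $d>(\alpha+\beta_1+\beta_2)\wedge2$. For any $\varepsilon\in(0,1/4)$ there exists a constant $C>0$ such that for all $w\in\partial\mathbb R^d_+$, $R>0$ and $x,y\in B(w,(1-\varepsilon)R)\cap\mathbb R^d_+$, $$G^{B(w,R)\cap\mathbb R^d_+}(x,y)\ge C\Big(\tfrac{x_d}{|x-y|}\wedge1\Big)^{\alpha-1}\Big(\tfrac{y_d}{|x-y|}\wedge1\Big)^{\alpha-1}\frac{1}{|x-y|^{d-\alpha}}.$$
   Context: Write $x=(\widetilde x,x_d)$, $\mathbb R^d_+=\{x:x_d>0\}$, $\partial\mathbb R^d_+=\{x_d=0\}$. Fix $\beta_1,\beta_2,\beta_3,\beta_4\ge0$ with $\beta_1>0$ if $\beta_3>0$ and $\beta_2>0$ if $\beta_4>0$, and set $$\widetilde B(x,y)=\Big(\tfrac{x_d\wedge y_d}{|x-y|}\wedge1\Big)^{\beta_1}\Big(\tfrac{x_d\vee y_d}{|x-y|}\wedge1\Big)^{\beta_2}\Big[\log\Big(1+\tfrac{(x_d\vee y_d)\wedge|x-y|}{x_d\wedge y_d\wedge|x-y|}\Big)\Big]^{\beta_3}\Big[\log\Big(1+\tfrac{|x-y|}{(x_d\vee y_d)\wedge|x-y|}\Big)\Big]^{\beta_4}.$$ Let $\mathcal B:\mathbb R^d_+\times\mathbb R^d_+\to[0,\infty)$ satisfy: (A1) symmetry; (A2) there exist $\theta>\alpha-1$, $C>0$ with $|\mathcal B(x,x)-\mathcal B(x,y)|\le C(|x-y|/(x_d\wedge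 y_d))^{\theta}$; (A3) $C^{-1}\widetilde B\le\mathcal B\le C\widetilde B$ for some $C\ge1$; (A4) $\mathcal B(ax,ay)=\mathcal B(x,y)$ for $a>0$ and, if $d\ge2$, $\mathcal B(x+(\widetilde z,0),y+(\widetilde z,0))=\mathcal B(x,y)$; and $\mathcal B(x,x)=1$. Let $J(x,y)=|x-y|^{-d-\alpha}\mathcal B(x,y)$, $\mathcal E(u,v)=\frac12\int_{\mathbb R^d_+}\int_{\mathbb R^d_+}(u(x)-u(y))(v(x)-v(y))J(x,y)\,dy\,dx$, $\mathcal F$ the closure of $C_c^\infty(\mathbb R^d_+)$ under $\mathcal E_1=\mathcal E+(\cdot,\cdot)_{L^2}$. $Y=(Y_t,\mathbb P_x)$ is the associated Hunt process, defined for every $x\in\mathbb R^d_+$, with lifetime $\zeta$. For an open $V\subset\mathbb R^d_+$, $\tau_V=\inf\{t>0:Y_t\notin V\}$ and $G^V$ is the Green function of $Y$ killed upon exiting $V$, i.e. the symmetric function with $\mathbb E_x\int_0^{\tau_V}f(Y_t)\,dt=\int_V G^V(x,y)f(y)\,dy$ for Borel $f\ge0$.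
   Formalization: The occupation identity fixes G^V(x,·) only almost everywhere, so G^V is taken to be the version for which y ↦ G^V(x,y) is continuous on V∖{x}; the bound is stated for x≠y, since on the diagonal its right-hand side is infinite. *)

theory Defs
  imports "HOL-Probability.Probability"
begin

text \<open>Points of R^d are vectors real^'n with d = CARD('n). The distinguished
  coordinate k plays the role of the last coordinate x_d.\<close>

definition halfsp :: "'n::finite \<Rightarrow> (real^'n) set" where
  "halfsp k = {x. 0 < x $ k}"

definition Btil :: "'n::finite \<Rightarrow> real \<Rightarrow> real \<Rightarrow> real \<Rightarrow> real \<Rightarrow> real^'n \<Rightarrow> real^'n \<Rightarrow> real" where
  "Btil k b1 b2 b3 b4 x y =
     (let r = norm (x - y); a = min (x $ k) (y $ k); b = max (x $ k) (y $ k) in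
       (min (a / r) 1) powr b1 * (min (b / r) 1) powr b2
       * (ln (1 + min b r / min a r)) powr b3
       * (ln (1 + r / min b r)) powr b4)"

definition B_hyps :: "'n::finite \<Rightarrow> real \<Rightarrow> real \<Rightarrow> real \<Rightarrow> real \<Rightarrow> real \<Rightarrow> (real^'n \<Rightarrow> real^'n \<Rightarrow> real) \<Rightarrow> bool" where
  "B_hyps k \<alpha> b1 b2 b3 b4 B \<longleftrightarrow>
     (\<lambda>z. B (fst z) (snd z)) \<in> borel_measurable borel
   \<and> (\<forall>x\<in>halfsp k. \<forall>y\<in>halfsp k. 0 \<le> B x y)
   \<and> (\<forall>x\<in>halfsp k. \<forall>y\<in>halfsp k. B x y = B y x)
   \<and> (\<exists>\<theta> C. \<theta> > \<alpha> - 1 \<and> C > 0 \<and> (\<forall>x\<in>halfsp k. \<forall>y\<in>halfsp k.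
         \<bar>B x x - B x y\<bar> \<le> C * (norm (x - y) / min (x $ k) (y $ k)) powr \<theta>))
   \<and> (\<exists>C\<ge>1. \<forall>x\<in>halfsp k. \<forall>y\<in>halfsp k. x \<noteq> y \<longrightarrow>
         Btil k b1 b2 b3 b4 x y / C \<le> B x y \<and> B x y \<le> C * Btil k b1 b2 b3 b4 x y)
   \<and> (\<forall>a>0. \<forall>x\<in>halfsp k. \<forall>y\<in>halfsp k. B (a *\<^sub>R x) (a *\<^sub>R y) = B x y)
   \<and> (\<forall>z. z $ k = 0 \<longrightarrow> (\<forall>x\<in>halfsp k. \<forall>y\<in>halfsp k. B (x + z) (y + z) = B x y))
   \<and> (\<forall>x\<in>halfsp k. B x x = 1)"

definition Jk :: "real \<Rightarrow> (real^'n::finite \<Rightarrow> real^'n \<Rightarrow> real) \<Rightarrow> real^'n \<Rightarrow> real^'n \<Rightarrow> real" where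
  "Jk \<alpha> B x y = B x y / norm (x - y) powr (real CARD('n) + \<alpha>)"

text \<open>C-infinity functions on an open set: a class of functions stable under
  partial differentiation, all of whose members are differentiable.\<close>
definition smooth_on :: "('a::euclidean_space) set \<Rightarrow> ('a \<Rightarrow> real) \<Rightarrow> bool" where
  "smooth_on S f \<longleftrightarrow> (\<exists>D. f \<in> D \<and> (\<forall>g\<in>D. g differentiable_on S \<and>
      (\<forall>i\<in>Basis. (\<lambda>x. frechet_derivative g (at x) i) \<in> D)))"

definition Cc_inf :: "('a::euclidean_space) set \<Rightarrow> ('a \<Rightarrow> real) set" where
  "Cc_inf S = {\<phi>. smooth_on UNIV \<phi> \<and> compact (closure {x. \<phi> x \<noteq> 0})
                   \<and> closure {x. \<phi> x \<noteq> 0} \<subseteq> S}"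

definition energy :: "'n::finite \<Rightarrow> (real^'n \<Rightarrow> real^'n \<Rightarrow> real) \<Rightarrow> (real^'n \<Rightarrow> real) \<Rightarrow> ennreal" where
  "energy k J u = (\<integral>\<^sup>+x\<in>halfsp k. (\<integral>\<^sup>+y\<in>halfsp k. ennreal ((u x - u y)\<^sup>2 * J x y) \<partial>lborel) \<partial>lborel) / 2"

definition L2norm_sq :: "'n::finite \<Rightarrow> (real^'n \<Rightarrow> real) \<Rightarrow> ennreal" where
  "L2norm_sq k u = (\<integral>\<^sup>+x\<in>halfsp k. ennreal ((u x)\<^sup>2) \<partial>lborel)"

definition form_dom :: "'n::finite \<Rightarrow> (real^'n \<Rightarrow> real^'n \<Rightarrow> real) \<Rightarrow> (real^'n \<Rightarrow> real) set" where
  "form_dom k J = {u. u \<in> borel_measurable lborel \<and> L2norm_sq k u < \<infinity> \<and>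
      (\<exists>\<phi>. (\<forall>n. \<phi> n \<in> Cc_inf (halfsp k)) \<and>
         (\<lambda>n. energy k J (\<lambda>x. u x - \<phi> n x) + L2norm_sq k (\<lambda>x. u x - \<phi> n x)) \<longlonglongrightarrow> 0)}"

definition form :: "'n::finite \<Rightarrow> (real^'n \<Rightarrow> real^'n \<Rightarrow> real) \<Rightarrow> (real^'n \<Rightarrow> real) \<Rightarrow> (real^'n \<Rightarrow> real) \<Rightarrow> real" where
  "form k J u v = (set_lebesgue_integral (lborel \<Otimes>\<^sub>M lborel) (halfsp k \<times> halfsp k)
       (\<lambda>z. (u (fst z) - u (snd z)) * (v (fst z) - v (snd z)) * J (fst z) (snd z))) / 2"

text \<open>A process is given by a measurable space Msp of outcomes, laws P x, paths Y t w
  (meaningful for t < lifetime z w; for t >= z w the process is at the cemetery), and a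
  filtration F.\<close>

definition stop_time :: "'w measure \<Rightarrow> (real \<Rightarrow> 'w set set) \<Rightarrow> ('w \<Rightarrow> ennreal) \<Rightarrow> bool" where
  "stop_time Msp F T \<longleftrightarrow> T \<in> borel_measurable Msp \<and>
     (\<forall>t\<ge>0. {w \<in> space Msp. T w \<le> ennreal t} \<in> F t)"

definition stopped_sets :: "'w measure \<Rightarrow> (real \<Rightarrow> 'w set set) \<Rightarrow> ('w \<Rightarrow> ennreal) \<Rightarrow> 'w set set" where
  "stopped_sets Msp F T = {A \<in> sets Msp. \<forall>t\<ge>0. {w \<in> A. T w \<le> ennreal t} \<in> F t}"

definition trans_op :: "('a \<Rightarrow> 'w measure) \<Rightarrow> (real \<Rightarrow> 'w \<Rightarrow> 'a) \<Rightarrow> ('w \<Rightarrow> ennreal) \<Rightarrow> real \<Rightarrow> ('a \<Rightarrow> real) \<Rightarrow> 'a \<Rightarrow> ennreal" where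
  "trans_op P Y \<zeta> s f z = (\<integral>\<^sup>+w. indicator {w. ennreal s < \<zeta> w} w * ennreal (f (Y s w)) \<partial>P z)"

text \<open>"Y_s tends to the cemetery" (convergence to the point at infinity of the one-point
  compactification of the state space E): eventually outside every compact subset of E
  (or already killed).\<close>
definition to_cemetery :: "'a::topological_space set \<Rightarrow> ('b \<Rightarrow> 'a) \<Rightarrow> ('b \<Rightarrow> bool) \<Rightarrow> 'b filter \<Rightarrow> bool" where
  "to_cemetery E y killed F \<longleftrightarrow> (\<forall>K. compact K \<and> K \<subseteq> E \<longrightarrow> eventually (\<lambda>s. killed s \<or> y s \<notin> K) F)"

definition hunt_process :: "('a::{euclidean_space}) set \<Rightarrow> 'w measure \<Rightarrow> ('a \<Rightarrow> 'w measure) \<Rightarrow> (real \<Rightarrow> 'w \<Rightarrow> 'a)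
     \<Rightarrow> ('w \<Rightarrow> ennreal) \<Rightarrow> (real \<Rightarrow> 'w set set) \<Rightarrow> bool" where
  "hunt_process E Msp P Y \<zeta> F \<longleftrightarrow>
     \<comment> \<open>laws\<close>
     (\<forall>x\<in>E. prob_space (P x) \<and> sets (P x) = sets Msp)
   \<and> (\<forall>A\<in>sets Msp. (\<lambda>x. emeasure (P x) A) \<in> borel_measurable (restrict_space lebesgue E))
     \<comment> \<open>filtration: right-continuous, containing the sets null for every P x\<close>
   \<and> (\<forall>t\<ge>0. sigma_algebra (space Msp) (F t) \<and> F t \<subseteq> sets Msp)
   \<and> (\<forall>s t. 0 \<le> s \<and> s \<le> t \<longrightarrow> F s \<subseteq> F t)
   \<and> (\<forall>t\<ge>0. (\<Inter>s\<in>{t<..}. F s) = F t)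
   \<and> (\<forall>N\<in>sets Msp. (\<forall>x\<in>E. emeasure (P x) N = 0) \<longrightarrow> N \<in> F 0)
     \<comment> \<open>adaptedness of the killed process\<close>
   \<and> (\<forall>t\<ge>0. {w \<in> space Msp. ennreal t < \<zeta> w} \<in> F t \<and>
        (\<forall>A\<in>sets borel. {w \<in> space Msp. ennreal t < \<zeta> w \<and> Y t w \<in> A} \<in> F t))
     \<comment> \<open>normality\<close>
   \<and> (\<forall>x\<in>E. AE w in P x. 0 < \<zeta> w \<and> Y 0 w = x)
     \<comment> \<open>paths: in E and right-continuous before the lifetime, left limits in E plus cemetery\<close>
   \<and> (\<forall>w\<in>space Msp. \<forall>t\<ge>0. ennreal t < \<zeta> w \<longrightarrow>
        Y t w \<in> E \<and> ((\<lambda>s. Y s w) \<longlongrightarrow> Y t w) (at_right t))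
   \<and> (\<forall>w\<in>space Msp. \<forall>t>0. ennreal t \<le> \<zeta> w \<longrightarrow>
        (\<exists>l\<in>E. ((\<lambda>s. Y s w) \<longlongrightarrow> l) (at_left t)) \<or> to_cemetery E (\<lambda>s. Y s w) (\<lambda>s. False) (at_left t))
     \<comment> \<open>strong Markov property\<close>
   \<and> (\<forall>x\<in>E. \<forall>T. stop_time Msp F T \<longrightarrow> (\<forall>A\<in>stopped_sets Msp F T. \<forall>s\<ge>0. \<forall>f.
        f \<in> borel_measurable borel \<and> (\<forall>z. 0 \<le> f z) \<and> bounded (range f) \<longrightarrow>
        (\<integral>\<^sup>+w. indicator A w * indicator {w. T w + ennreal s < \<zeta> w} w
                 * ennreal (f (Y (enn2real (T w) + s) w)) \<partial>P x)
        = (\<integral>\<^sup>+w. indicator A w * indicator {w. T w < \<zeta> w} w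
                 * trans_op P Y \<zeta> s f (Y (enn2real (T w)) w) \<partial>P x)))
     \<comment> \<open>quasi-left-continuity on (0,oo)\<close>
   \<and> (\<forall>x\<in>E. \<forall>T Tn. stop_time Msp F T \<and> (\<forall>n. stop_time Msp F (Tn n))
        \<and> (\<forall>w. incseq (\<lambda>n. Tn n w) \<and> (\<lambda>n. Tn n w) \<longlonglongrightarrow> T w) \<longrightarrow>
        (AE w in P x. T w < \<infinity> \<longrightarrow>
           (if T w < \<zeta> w then (\<lambda>n. Y (enn2real (Tn n w)) w) \<longlonglongrightarrow> Y (enn2real (T w)) w
            else to_cemetery E (\<lambda>n. Y (enn2real (Tn n w)) w) (\<lambda>n. \<zeta> w \<le> Tn n w) sequentially)))"

text \<open>Association with the Dirichlet form (E,F) via the resolvents: for beta > 0 and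
  bounded Borel f >= 0 with compact support in E, x |-> E_x int_0^zeta e^(-beta t) f(Y_t) dt
  is an a.e.-version of the resolvent G_beta f, i.e. of the unique u in F with
  E(u,v) + beta (u,v) = (f,v) for all v in F (equivalently for all v in the core C_c^infinity).\<close>
definition resolvent_proc :: "('a \<Rightarrow> 'w measure) \<Rightarrow> (real \<Rightarrow> 'w \<Rightarrow> 'a) \<Rightarrow> ('w \<Rightarrow> ennreal) \<Rightarrow> real \<Rightarrow> ('a \<Rightarrow> real) \<Rightarrow> 'a \<Rightarrow> real" where
  "resolvent_proc P Y \<zeta> \<beta> f x = enn2real (\<integral>\<^sup>+w. (\<integral>\<^sup>+t\<in>{0..}. indicator {t. ennreal t < \<zeta> w} t
         * ennreal (exp (- \<beta> * t) * f (Y t w)) \<partial>lborel) \<partial>P x)"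

definition associated :: "'n::finite \<Rightarrow> (real^'n \<Rightarrow> real^'n \<Rightarrow> real) \<Rightarrow> (real^'n \<Rightarrow> 'w measure)
     \<Rightarrow> (real \<Rightarrow> 'w \<Rightarrow> real^'n) \<Rightarrow> ('w \<Rightarrow> ennreal) \<Rightarrow> bool" where
  "associated k J P Y \<zeta> \<longleftrightarrow>
     (\<forall>\<beta>>0. \<forall>f. f \<in> borel_measurable borel \<and> (\<forall>z. 0 \<le> f z) \<and> bounded (range f)
        \<and> compact (closure {x. f x \<noteq> 0}) \<and> closure {x. f x \<noteq> 0} \<subseteq> halfsp k \<longrightarrow>
        (\<exists>u\<in>form_dom k J. (AE x in lborel. x \<in> halfsp k \<longrightarrow> u x = resolvent_proc P Y \<zeta> \<beta> f x)
           \<and> (\<forall>v\<in>Cc_inf (halfsp k). form k J u v + \<beta> * (\<integral>x\<in>halfsp k. u x * v x \<partial>lborel)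
                 = (\<integral>x\<in>halfsp k. f x * v x \<partial>lborel))))"

text \<open>tau_V = inf {t > 0 : Y_t not in V} (the cemetery is not in V).\<close>
definition exit_time :: "'a set \<Rightarrow> (real \<Rightarrow> 'w \<Rightarrow> 'a) \<Rightarrow> ('w \<Rightarrow> ennreal) \<Rightarrow> 'w \<Rightarrow> ennreal" where
  "exit_time V Y \<zeta> w = (INF t\<in>{t. 0 < t \<and> (\<zeta> w \<le> ennreal t \<or> Y t w \<notin> V)}. ennreal t)"

text \<open>g is the Green function of Y killed upon exiting V: symmetric, nonnegative, continuous
  off the diagonal (fixing the canonical version) and
  E_x int_0^tau_V f(Y_t) dt = int_V g(x,y) f(y) dy for all Borel f >= 0 and x in V.\<close>
definition green_fun :: "('a::euclidean_space) set \<Rightarrow> ('a \<Rightarrow> 'w measure) \<Rightarrow> (real \<Rightarrow> 'w \<Rightarrow> 'a)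
     \<Rightarrow> ('w \<Rightarrow> ennreal) \<Rightarrow> ('a \<Rightarrow> 'a \<Rightarrow> real) \<Rightarrow> bool" where
  "green_fun V P Y \<zeta> g \<longleftrightarrow>
     (\<forall>x\<in>V. \<forall>y\<in>V. g x y = g y x \<and> 0 \<le> g x y)
   \<and> (\<forall>x\<in>V. continuous_on (V - {x}) (g x))
   \<and> (\<forall>f. f \<in> borel_measurable borel \<and> (\<forall>z. 0 \<le> f z) \<longrightarrow> (\<forall>x\<in>V.
        (\<integral>\<^sup>+w. (\<integral>\<^sup>+t\<in>{0..}. indicator {t. ennreal t < exit_time V Y \<zeta> w} t * ennreal (f (Y t w)) \<partial>lborel) \<partial>P x)
        = (\<integral>\<^sup>+y\<in>V. ennreal (g x y * f y) \<partial>lborel)))"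

end

(* The maps y |-> xi + a y with a > 0 and xi tangential act simply transitively on the half-space and,
   by (A4), preserve J up to a factor. In these coordinates the generator acts on smooth functions through
   a symmetrised difference, so no principal value occurs. Its Dirichlet form identifies it with the
   process through the resolvent, first for almost every starting point and then everywhere by right
   continuity, which gives Dynkin's formula up to exit times. With r a small multiple of |x - y|, the
   barrier x_k powr (alpha-1) + x_k powr (alpha/2) - |x|^2, rescaled by r, shows that the process spends
   time of order r powr alpha * min(x_k/r, 1) powr (alpha-1) within distance 5r of x and at height
   comparable to r, and likewise for y. The two occupation measures are joined by one jump, whose density
   is bounded below by (A3). Bump functions that are transported by the group and whose generators are
   dual in the two points replace the symmetry of the Green function in this last step. *)
theory Submission
 imports Defs
begin

section \<open>Smooth functions with compact support in the half-space\<close>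

text \<open>Two gaps between the hypotheses and the classical argument shape the proof. The laws
  \<open>P x\<close> depend on \<open>x\<close> only Lebesgue measurably and
  \<open>associated\<close> holds only almost everywhere, so every identity carries an exceptional
  null set. The Green functions of half-balls close this gap: they dominate occupation measures by
  measures with a density, so at almost every time the path avoids a given null set. Moreover,
  \<open>Lop u\<close> is in general neither compactly supported nor of one sign, while
  \<open>associated\<close> speaks of nonnegative data with compact support; decay of
  \<open>Lop u\<close> and an energy estimate for truncations bridge this.

  All occupation measures are discounted by exp(-\<beta> t), hence finite without any transience
  estimate; the discount at \<open>x\<close> tends to 0 only in the last inequality.

  The exponent \<alpha> - 1 in the bound is the one whose power of the height has vanishing
  symmetrised difference. The exponent \<alpha>/2 lies strictly between it and 1: being larger, it
  makes the generator positive; being below 1, it dominates the error terms near the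
  boundary.\<close>

abbreviation bmeas :: "('a::topological_space => 'b::topological_space) => bool" where
 "bmeas f \<equiv> f \<in> borel_measurable borel"

text \<open>For \<open>n = 0\<close> this is the classical flat function exp(-1/t). The extra powers
  of 1/t close the family under differentiation, which is the form in which \<open>smooth_on\<close>
  asks for smoothness.\<close>

definition gexp :: "nat => real => real" where
 "gexp n t = (if t > 0 then exp (- (1 / t)) / t ^ n else 0)"

lemma gexp_tendsto_0: "(gexp n \<longlongrightarrow> 0) (at 0)"
proof -
 have "((\<lambda>s::real. s ^ n / exp s) \<longlongrightarrow> 0) at_top"
  by (rule tendsto_power_div_exp_0)
 then have "((\<lambda>t::real. (inverse t) ^ n / exp (inverse t)) \<longlongrightarrow> 0) (at_right 0)"
  by (rule filterlim_compose) (rule filterlim_inverse_at_top_right)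
 then have "(gexp n \<longlongrightarrow> 0) (at_right 0)"
  by (rule Lim_transform_eventually)
    (auto simp: gexp_def eventually_at_filter exp_minus field_simps)
 moreover have "(gexp n \<longlongrightarrow> 0) (at_left 0)"
  by (rule Lim_transform_eventually[OF tendsto_const])
    (auto simp: gexp_def eventually_at_filter)
 ultimately show ?thesis
  by (simp add: filterlim_at_split)
qed

lemma gexp_has_deriv:
 "(gexp n has_real_derivative (gexp (n + 2) t - real n * gexp (n + 1) t)) (at t)"
proof -
 consider "t > 0" | "t < 0" | "t = 0" by linarith
 then show ?thesis
 proof cases
  case 1
  have "((\<lambda>t. exp (- (1 / t)) / t ^ n) has_real_derivative
    (exp (- (1 / t)) * (1 / t^2) * t ^ n - exp (- (1 / t)) * (real n * t ^ (n - 1))) / (t ^ n * t ^ n)) (at t)"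
   using 1 by (auto intro!: derivative_eq_intros simp: power2_eq_square)
  moreover have "(exp (- (1 / t)) * (1 / t^2) * t ^ n - exp (- (1 / t)) * (real n * t ^ (n - 1))) / (t ^ n * t ^ n)
    = gexp (n + 2) t - real n * gexp (n + 1) t"
  proof (cases n)
   case (Suc m)
   then have "t ^ n = t * t ^ m" "t ^ (n - 1) = t ^ m" "t ^ (n + 2) = t * t * t * t ^ m" "t ^ (n + 1) = t * t * t ^ m"
    by auto
   then show ?thesis using 1 by (simp add: gexp_def divide_simps power2_eq_square) (simp add: algebra_simps)
  qed (use 1 in \<open>simp add: gexp_def power2_eq_square\<close>)
  ultimately have "((\<lambda>t. exp (- (1 / t)) / t ^ n) has_real_derivative (gexp (n + 2) t - real n * gexp (n + 1) t)) (at t)"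
   by simp
  then show ?thesis
   by (rule has_field_derivative_transform_within_open[where S="{0<..}"]) (use 1 in \<open>auto simp: gexp_def\<close>)
 next
  case 2
  have "((\<lambda>t. 0) has_real_derivative (gexp (n + 2) t - real n * gexp (n + 1) t)) (at t)"
   using 2 by (auto simp: gexp_def)
  then show ?thesis
   by (rule has_field_derivative_transform_within_open[where S="{..<0}"]) (use 2 in \<open>auto simp: gexp_def\<close>)
 next
  case 3
  \<comment> \<open>The difference quotient of \<open>gexp n\<close> at 0 is
    \<open>gexp (Suc n)\<close>, so the derivative at 0 is the limit already computed.\<close>
  have "((\<lambda>y. (gexp n y - gexp n 0) / (y - 0)) \<longlongrightarrow> 0) (at 0)"
   by (rule Lim_transform_eventually[OF gexp_tendsto_0[of "Suc n"]])
     (auto simp: gexp_def eventually_at_filter)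
  then have "(gexp n has_real_derivative 0) (at 0)"
   unfolding has_field_derivative_iff by simp
  with 3 show ?thesis by (simp add: gexp_def)
 qed
qed

text \<open>A syntactic class closed under partial derivatives, so that smoothness becomes an
  induction over terms. Powers of the \<open>k\<close>-th coordinate have arbitrary real exponents,
  and therefore derivatives are considered on the half-space only.\<close>

inductive_set hsmooth :: "'n::finite => (real^'n => real) set" for k where
 hsm_const: "(\<lambda>x. c) \<in> hsmooth k"
| hsm_coord: "(\<lambda>x. x $ i) \<in> hsmooth k"
| hsm_powr: "(\<lambda>x. (x $ k) powr q) \<in> hsmooth k"
| hsm_add: "f \<in> hsmooth k ==> g \<in> hsmooth k ==> (\<lambda>x. f x + g x) \<in> hsmooth k"
| hsm_mult: "f \<in> hsmooth k ==> g \<in> hsmooth k ==> (\<lambda>x. f x * g x) \<in> hsmooth k"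
| hsm_gexp: "f \<in> hsmooth k ==> (\<lambda>x. gexp n (f x)) \<in> hsmooth k"

lemma hsm_cmult: "f \<in> hsmooth k ==> (\<lambda>x. c * f x) \<in> hsmooth k"
 by (intro hsm_mult hsm_const)

lemma hsm_diff: "f \<in> hsmooth k ==> g \<in> hsmooth k ==> (\<lambda>x. f x - g x) \<in> hsmooth k"
 using hsm_add[OF _ hsm_cmult[of g k "-1"], of f] by simp

lemma hsm_sum: "finite I ==> (\<And>i. i \<in> I ==> f i \<in> hsmooth k) ==> (\<lambda>x. \<Sum>i\<in>I. f i x) \<in> hsmooth k"
 by (induction I rule: finite_induct) (auto intro: hsm_const hsm_add)

lemma hsm_norm_sq: "(\<And>i. (\<lambda>x. f x $ i) \<in> hsmooth k) ==> (\<lambda>x. (norm (f x :: real^'m::finite))^2) \<in> hsmooth k"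
 unfolding power2_norm_eq_inner inner_vec_def inner_real_def
 by (intro hsm_sum hsm_mult) auto

lemma halfsp_open: "open (halfsp k)"
 unfolding halfsp_def by (intro open_Collect_less continuous_intros)

lemma halfsp_borel [measurable]: "halfsp k \<in> sets borel"
 by (intro borel_open halfsp_open)

text \<open>The partial derivatives are returned as members of the same class, so the statement can
  be iterated to all orders.\<close>

lemma hsmooth_deriv:
 assumes "f \<in> hsmooth k"
 shows "\<exists>d. (\<forall>i. d i \<in> hsmooth k) \<and> (\<forall>x\<in>halfsp k. (f has_derivative (\<lambda>v. \<Sum>i\<in>UNIV. d i x * v $ i)) (at x))"
 using assms
proof induction
 case (hsm_const c)
 show ?case by (rule exI[of _ "\<lambda>i x. 0"]) (auto intro: hsmooth.intros)
next
 case (hsm_coord j)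
 have "(\<lambda>v::real^'a. \<Sum>i\<in>UNIV. (if i = j then 1 else 0) * v $ i) = (\<lambda>v. v $ j)"
  by (auto simp: if_distrib[of "\<lambda>x. x * _"] cong: if_cong)
 then show ?case
  by (intro exI[of _ "\<lambda>i x. if i = j then 1 else 0"])
    (auto intro!: hsmooth.intros bounded_linear.has_derivative[OF bounded_linear_vec_nth])
next
 case (hsm_powr q)
 show ?case
 proof (intro exI[of _ "\<lambda>i x. if i = k then q * (x $ k) powr (q - 1) else 0"] conjI allI ballI)
  fix i show "(\<lambda>x. if i = k then q * (x $ k) powr (q - 1) else 0) \<in> hsmooth k"
   by (cases "i = k") (auto intro: hsmooth.intros)
 next
  fix x assume x: "x \<in> halfsp k"
  have "((\<lambda>t. t powr q) has_real_derivative q * (x $ k) powr (q - 1)) (at (x $ k))"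
   using x by (intro has_real_derivative_powr) (auto simp: halfsp_def)
  then have "((\<lambda>t. t powr q) has_derivative (\<lambda>v. q * (x $ k) powr (q - 1) * v)) (at (x $ k))"
   by (simp add: has_field_derivative_def)
  from diff_chain_at[OF bounded_linear.has_derivative[OF bounded_linear_vec_nth[of k] has_derivative_ident[of "at x"]] this]
  have "((\<lambda>x. (x $ k) powr q) has_derivative (\<lambda>v. q * (x $ k) powr (q - 1) * v $ k)) (at x)"
   by (simp add: o_def)
  then show "((\<lambda>x. (x $ k) powr q) has_derivative (\<lambda>v. \<Sum>i\<in>UNIV. (if i = k then q * (x $ k) powr (q - 1) else 0) * v $ i)) (at x)"
   by (auto simp: if_distrib[of "\<lambda>x. x * _"] cong: if_cong)
 qed
next
 case (hsm_add f g)
 from hsm_add.IH(1) obtain d1 where d1: "\<forall>i. d1 i \<in> hsmooth k"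
  and D1: "\<forall>x\<in>halfsp k. (f has_derivative (\<lambda>v. \<Sum>i\<in>UNIV. d1 i x * v $ i)) (at x)" by blast
 from hsm_add.IH(2) obtain d2 where d2: "\<forall>i. d2 i \<in> hsmooth k"
  and D2: "\<forall>x\<in>halfsp k. (g has_derivative (\<lambda>v. \<Sum>i\<in>UNIV. d2 i x * v $ i)) (at x)" by blast
 show ?case
 proof (intro exI[of _ "\<lambda>i x. d1 i x + d2 i x"] conjI allI ballI hsmooth.hsm_add)
  fix x assume x: "x \<in> halfsp k"
  show "((\<lambda>x. f x + g x) has_derivative (\<lambda>v. \<Sum>i\<in>UNIV. (d1 i x + d2 i x) * v $ i)) (at x)"
   using has_derivative_add[OF bspec[OF D1 x] bspec[OF D2 x]] by (simp add: sum.distrib ring_distribs)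
 qed (use d1 d2 in auto)
next
 case (hsm_mult f g)
 from hsm_mult.IH(1) obtain d1 where d1: "\<forall>i. d1 i \<in> hsmooth k"
  and D1: "\<forall>x\<in>halfsp k. (f has_derivative (\<lambda>v. \<Sum>i\<in>UNIV. d1 i x * v $ i)) (at x)" by blast
 from hsm_mult.IH(2) obtain d2 where d2: "\<forall>i. d2 i \<in> hsmooth k"
  and D2: "\<forall>x\<in>halfsp k. (g has_derivative (\<lambda>v. \<Sum>i\<in>UNIV. d2 i x * v $ i)) (at x)" by blast
 show ?case
 proof (intro exI[of _ "\<lambda>i x. f x * d2 i x + d1 i x * g x"] conjI allI ballI hsmooth.hsm_add hsmooth.hsm_mult)
  fix x assume x: "x \<in> halfsp k"
  show "((\<lambda>x. f x * g x) has_derivative (\<lambda>v. \<Sum>i\<in>UNIV. (f x * d2 i x + d1 i x * g x) * v $ i)) (at x)"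
   using has_derivative_mult[OF bspec[OF D1 x] bspec[OF D2 x]]
   by (simp add: sum.distrib ring_distribs sum_distrib_left sum_distrib_right mult_ac)
 qed (use d1 d2 hsm_mult.hyps in auto)
next
 case (hsm_gexp f n)
 from hsm_gexp.IH obtain d where d: "\<forall>i. d i \<in> hsmooth k"
  and D': "\<forall>x\<in>halfsp k. (f has_derivative (\<lambda>v. \<Sum>i\<in>UNIV. d i x * v $ i)) (at x)" by blast
 note D = bspec[OF D']
 show ?case
 proof (intro exI[of _ "\<lambda>i x. (gexp (n + 2) (f x) - real n * gexp (n + 1) (f x)) * d i x"] conjI allI ballI)
  fix i show "(\<lambda>x. (gexp (n + 2) (f x) - real n * gexp (n + 1) (f x)) * d i x) \<in> hsmooth k"
   using d hsm_gexp by (intro hsmooth.hsm_mult hsm_diff hsm_cmult hsmooth.hsm_gexp) auto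
 next
  fix x assume x: "x \<in> halfsp k"
  have "(gexp n has_derivative (\<lambda>v. (gexp (n + 2) (f x) - real n * gexp (n + 1) (f x)) * v)) (at (f x))"
   using gexp_has_deriv[of n "f x"] by (simp add: has_field_derivative_def)
  from diff_chain_at[OF D[OF x] this]
  show "((\<lambda>x. gexp n (f x)) has_derivative (\<lambda>v. \<Sum>i\<in>UNIV. (gexp (n + 2) (f x) - real n * gexp (n + 1) (f x)) * d i x * v $ i)) (at x)"
   by (simp add: o_def sum_distrib_left sum_distrib_right mult_ac)
 qed
qed

text \<open>The open sets \<open>halfsp k\<close> and \<open>- K\<close> cover the space; on the
  first the extension is \<open>f\<close>, on the second it is 0, so it is differentiable
  everywhere.\<close>

lemma Cc_inf_hsmooth:
 fixes f :: "real^'n::finite => real"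
 assumes f: "f \<in> hsmooth k" and K: "compact K" "K \<subseteq> halfsp k"
  and zero: "\<And>x. x \<in> halfsp k ==> x \<notin> K ==> f x = 0"
 shows "(\<lambda>x. if x \<in> halfsp k then f x else 0) \<in> Cc_inf (halfsp k)"
proof -
 define ex where "ex g = (\<lambda>x. if x \<in> halfsp k then g x else (0::real))" for g :: "real^'n => real"
 \<comment> \<open>The extensions by zero of all members of the class that vanish off
   \<open>K\<close> form the derivative-stable family required by \<open>smooth_on\<close>.\<close>
 define D where "D = {ex g |g. g \<in> hsmooth k \<and> (\<forall>x\<in>halfsp k - K. g x = 0)}"
 have openK: "open (- K)" using K(1) by (auto intro: compact_imp_closed)
 have step: "ex g differentiable_on UNIV \<and> (\<forall>i\<in>Basis. (\<lambda>x. frechet_derivative (ex g) (at x) i) \<in> D)"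
  if g: "g \<in> hsmooth k" "\<forall>x\<in>halfsp k - K. g x = 0" for g
 proof -
  obtain d where d: "\<forall>i. d i \<in> hsmooth k"
   and gd': "\<forall>x\<in>halfsp k. (g has_derivative (\<lambda>v. \<Sum>i\<in>UNIV. d i x * v $ i)) (at x)"
   using hsmooth_deriv[OF g(1)] by blast
  note gd = bspec[OF gd']
  have in_H: "(ex g has_derivative (\<lambda>v. \<Sum>i\<in>UNIV. d i x * v $ i)) (at x)" if "x \<in> halfsp k" for x
   by (rule has_derivative_transform_within_open[OF gd[OF that] halfsp_open that]) (simp add: ex_def)
  have out_K: "(ex g has_derivative (\<lambda>v. 0)) (at x)" if "x \<notin> K" for x
   by (rule has_derivative_transform_within_open[OF has_derivative_const[of 0] openK])
     (use that g(2) in \<open>auto simp: ex_def\<close>)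
  \<comment> \<open>At a point of the half-space off \<open>K\<close> both descriptions of the
    derivative apply, and uniqueness forces the partial derivatives to vanish; hence their
    extensions belong to \<open>D\<close> again.\<close>
  have d0: "d i x = 0" if "x \<in> halfsp k - K" for i x
  proof -
   have "(\<lambda>v. \<Sum>j\<in>UNIV. d j x * v $ j) = (\<lambda>v. 0)"
    using has_derivative_unique[OF in_H out_K] that by auto
   from fun_cong[OF this, of "axis i 1"] show ?thesis
    by (simp add: axis_def if_distrib cong: if_cong)
  qed
  have full: "(ex g has_derivative (\<lambda>v. \<Sum>i\<in>UNIV. ex (d i) x * v $ i)) (at x)" for x
  proof (cases "x \<in> halfsp k")
   case True then show ?thesis using in_H by (simp add: ex_def)
  next
   case False
   then have "x \<notin> K" using K by auto
   from out_K[OF this] False show ?thesis by (simp add: ex_def)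
  qed
  have "(\<lambda>x. frechet_derivative (ex g) (at x) b) \<in> D" if "b \<in> Basis" for b
  proof -
   from that obtain i where b: "b = axis i 1" by (auto simp: Basis_vec_def)
   have "(\<lambda>x. frechet_derivative (ex g) (at x) b) = ex (d i)"
    by (rule ext, subst frechet_derivative_at[OF full, symmetric])
      (auto simp: b axis_def if_distrib cong: if_cong)
   then show ?thesis using d d0 unfolding D_def by blast
  qed
  then show ?thesis using full by (auto simp: differentiable_on_def differentiable_def intro: has_derivative_at_withinI)
 qed
 have "smooth_on UNIV (ex f)"
  unfolding smooth_on_def
  by (rule exI[of _ D]) (use step f zero in \<open>auto simp: D_def\<close>)
 moreover have cl: "closure {x. ex f x \<noteq> 0} \<subseteq> K"
  using K(1) zero by (intro closure_minimal compact_imp_closed) (auto simp: ex_def split: if_splits)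
 moreover have "compact (closure {x. ex f x \<noteq> 0})"
  using cl K(1) by (metis closed_closure compact_Int_closed inf.absorb_iff2)
 ultimately show ?thesis using K(2) by (auto simp: Cc_inf_def ex_def)
qed

lemma Cc_inf_continuous:
 assumes "u \<in> Cc_inf S" shows "continuous_on UNIV u"
 using assms by (auto simp: Cc_inf_def smooth_on_def intro: differentiable_imp_continuous_on)

lemma Cc_inf_borel [measurable_dest]:
 assumes "u \<in> Cc_inf S" shows "bmeas u"
 using Cc_inf_continuous[OF assms] by (rule borel_measurable_continuous_onI)

lemma Cc_inf_zero:
 assumes "u \<in> Cc_inf S" "x \<notin> S" shows "u x = 0"
 using assms closure_subset[of "{x. u x \<noteq> 0}"] by (auto simp: Cc_inf_def)

text \<open>The form in which smoothness enters the generator estimates: a single constant controls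
  the function, its gradient and the second-order remainder, uniformly in the point.\<close>

definition taylor2 :: "real => (real^'n::finite => real) => bool" where
 "taylor2 M u \<longleftrightarrow> 0 <= M \<and> (\<forall>x. \<bar>u x\<bar> <= M) \<and>
   (\<exists>g. \<forall>x z. \<bar>g x \<bullet> z\<bar> <= M * norm z \<and> \<bar>u (x + z) - u x - g x \<bullet> z\<bar> <= M * (norm z)^2)"

lemma cont_compact_support_bounded:
 fixes g :: "'a::euclidean_space => real"
 assumes "continuous_on UNIV g" "compact K" "\<And>x. x \<notin> K ==> g x = 0"
 shows "\<exists>M\<ge>0. \<forall>x. \<bar>g x\<bar> <= M"
proof -
 have "compact (g ` K)" using assms by (intro compact_continuous_image) (auto intro: continuous_on_subset)
 then obtain M where M: "\<forall>y\<in>g ` K. norm y <= M" using compact_imp_bounded bounded_iff by metis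
 have "\<bar>g x\<bar> <= max M 0" for x
  using M assms(3)[of x] by (cases "x \<in> K") auto
 then show ?thesis by (intro exI[of _ "max M 0"]) auto
qed

lemma abs_sum_nth_le:
 fixes v :: "real^'n::finite"
 assumes "\<And>j. \<bar>a j\<bar> <= m j" shows "\<bar>\<Sum>j\<in>UNIV. a j * v $ j\<bar> <= (\<Sum>j\<in>UNIV. m j) * norm v"
proof -
 have "\<bar>\<Sum>j\<in>UNIV. a j * v $ j\<bar> <= (\<Sum>j\<in>UNIV. \<bar>a j * v $ j\<bar>)" by (rule sum_abs)
 also have "... <= (\<Sum>j\<in>UNIV. m j * norm v)"
  using assms by (intro sum_mono) (auto simp: abs_mult intro!: mult_mono component_le_norm_cart intro: order_trans[OF abs_ge_zero])
 finally show ?thesis by (simp add: sum_distrib_right)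
qed

text \<open>Partial derivatives up to order two are continuous and vanish off the support, hence are
  bounded. The mean value inequality is then used twice: for the gradient, and along the segment
  from \<open>x\<close> to \<open>x + z\<close>.\<close>

lemma Cc_inf_taylor2:
 fixes u :: "real^'n::finite => real"
 assumes u: "u \<in> Cc_inf S"
 shows "\<exists>M. taylor2 M u"
proof -
 define K where "K = closure {x. u x \<noteq> 0}"
 from u obtain D where D: "u \<in> D" "\<And>g. g \<in> D ==> g differentiable_on UNIV"
   "\<And>g i. g \<in> D ==> i \<in> Basis ==> (\<lambda>x. frechet_derivative g (at x) i) \<in> D"
  and K: "compact K"
  by (auto simp: Cc_inf_def smooth_on_def K_def)
 define pd where "pd g j x = frechet_derivative g (at x) (axis j 1)" for g :: "real^'n => real" and j x
 have pdD: "pd g j \<in> D" if "g \<in> D" for g j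
  using D(3)[OF that, of "axis j 1"] by (simp add: pd_def[abs_def] axis_in_Basis_iff)
 have der: "(g has_derivative (\<lambda>v. \<Sum>j\<in>UNIV. pd g j x * v $ j)) (at x)" if "g \<in> D" for g x
 proof -
  have "g differentiable (at x)" using D(2)[OF that] by (auto simp: differentiable_on_def)
  then have fd: "(g has_derivative frechet_derivative g (at x)) (at x)"
   by (simp add: frechet_derivative_works)
  then have lin: "linear (frechet_derivative g (at x))" by (rule has_derivative_linear)
  have "frechet_derivative g (at x) v = (\<Sum>j\<in>UNIV. pd g j x * v $ j)" for v
  proof -
   have "frechet_derivative g (at x) v = frechet_derivative g (at x) (\<Sum>j\<in>UNIV. (v $ j) *\<^sub>R axis j 1)"
    by (simp add: basis_expansion[symmetric] scalar_mult_eq_scaleR[symmetric] basis_expansion)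
   also have "... = (\<Sum>j\<in>UNIV. pd g j x * v $ j)"
    by (simp add: linear_sum[OF lin] linear_scale[OF lin] pd_def mult.commute)
   finally show ?thesis .
  qed
  then have "frechet_derivative g (at x) = (\<lambda>v. \<Sum>j\<in>UNIV. pd g j x * v $ j)" by auto
  with fd show ?thesis by simp
 qed
 have openK: "open (- K)" using K by (auto intro: compact_imp_closed)
 have z: "pd g j x = 0" if "g \<in> D" "\<And>x. x \<notin> K ==> g x = 0" "x \<notin> K" for g j x
 proof -
  have "(g has_derivative (\<lambda>v. 0)) (at x)"
   by (rule has_derivative_transform_within_open[OF has_derivative_const[of 0] openK])
     (use that in auto)
  then show ?thesis using frechet_derivative_at[of g "\<lambda>v. 0" x] by (auto simp: pd_def fun_eq_iff)
 qed
 have u0: "u x = 0" if "x \<notin> K" for x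
  using that closure_subset[of "{x. u x \<noteq> 0}"] by (auto simp: K_def)
 have bnd: "\<exists>M\<ge>0. \<forall>x. \<bar>g x\<bar> <= M" if "g \<in> D" "\<And>x. x \<notin> K ==> g x = 0" for g
  using cont_compact_support_bounded[OF differentiable_imp_continuous_on[OF D(2)[OF that(1)]] K] that(2) by auto
 have p0: "pd u j x = 0" if "x \<notin> K" for j x using z[OF D(1) u0 that] by auto
 have pp0: "pd (pd u i) j x = 0" if "x \<notin> K" for i j x using z[OF pdD[OF D(1)] p0 that] by auto
 obtain M0 where M0: "M0 \<ge> 0" "\<And>x. \<bar>u x\<bar> <= M0" using bnd[OF D(1) u0] by auto
 have "\<forall>j. \<exists>M\<ge>0. \<forall>x. \<bar>pd u j x\<bar> <= M" using bnd[OF pdD[OF D(1)] p0] by blast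
 then obtain M1 where M1: "\<And>j. M1 j \<ge> 0" "\<And>j x. \<bar>pd u j x\<bar> <= M1 j" by metis
 have "\<forall>i j. \<exists>M\<ge>0. \<forall>x. \<bar>pd (pd u i) j x\<bar> <= M" using bnd[OF pdD[OF pdD[OF D(1)]] pp0] by blast
 then obtain M2 where M2: "\<And>i j. M2 i j \<ge> 0" "\<And>i j x. \<bar>pd (pd u i) j x\<bar> <= M2 i j" by metis
 define C1 where "C1 = (\<Sum>j\<in>UNIV. M1 j)"
 define C2 where "C2 = (\<Sum>i\<in>UNIV. \<Sum>j\<in>UNIV. M2 i j)"
 have C1: "C1 \<ge> 0" and C2: "C2 \<ge> 0" using M1 M2 by (auto simp: C1_def C2_def intro!: sum_nonneg)
 define M where "M = M0 + C1 + C2"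
 define g where "g x = (\<chi> j. pd u j x)" for x
 have gz: "g x \<bullet> z = (\<Sum>j\<in>UNIV. pd u j x * z $ j)" for x z
  by (simp add: g_def inner_vec_def)
 have b1: "\<bar>g x \<bullet> z\<bar> <= C1 * norm z" for x z unfolding gz C1_def by (rule abs_sum_nth_le[OF M1(2)])
 have lip: "\<bar>pd u i (x + z) - pd u i x\<bar> <= (\<Sum>j\<in>UNIV. M2 i j) * norm z" for i x z
 proof -
  have "norm (pd u i (x + z) - pd u i x) <= (\<Sum>j\<in>UNIV. M2 i j) * norm ((x + z) - x)"
  proof (rule differentiable_bound[where S=UNIV])
   fix y show "(pd u i has_derivative (\<lambda>v. \<Sum>j\<in>UNIV. pd (pd u i) j y * v $ j)) (at y within UNIV)"
    using der[OF pdD[OF D(1)]] by simp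
   show "onorm (\<lambda>v. \<Sum>j\<in>UNIV. pd (pd u i) j y * v $ j) <= (\<Sum>j\<in>UNIV. M2 i j)"
    by (rule onorm_le) (use abs_sum_nth_le[OF M2(2)] in simp)
  qed auto
  then show ?thesis by simp
 qed
 have b2: "\<bar>u (x + z) - u x - g x \<bullet> z\<bar> <= C2 * (norm z)^2" for x z
 proof -
  \<comment> \<open>Subtracting the linear part leaves a function of one variable whose derivative
    is the increment of the gradient paired with \<open>z\<close>, of order |z|^2.\<close>
  define \<phi> where "\<phi> s = u (x + s *\<^sub>R z) - s * (g x \<bullet> z)" for s
  have d\<phi>: "(\<phi> has_derivative (\<lambda>v. v * (g (x + s *\<^sub>R z) \<bullet> z - g x \<bullet> z))) (at s)" for s
  proof -
   have "((\<lambda>s. x + s *\<^sub>R z) has_derivative (\<lambda>v. v *\<^sub>R z)) (at s)"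
    by (auto intro!: derivative_eq_intros)
   from diff_chain_at[OF this der[OF D(1)]]
   have "((\<lambda>s. u (x + s *\<^sub>R z)) has_derivative (\<lambda>v. v * (g (x + s *\<^sub>R z) \<bullet> z))) (at s)"
    by (simp add: o_def gz sum_distrib_left mult_ac)
   then show ?thesis unfolding \<phi>_def
    by (auto intro!: derivative_eq_intros simp: ring_distribs)
  qed
  have "norm (\<phi> 1 - \<phi> 0) <= (C2 * (norm z)^2) * norm (1 - 0 :: real)"
  proof (rule differentiable_bound[where S="{0..1}"])
   fix s :: real assume s: "s \<in> {0..1}"
   show "(\<phi> has_derivative (\<lambda>v. v * (g (x + s *\<^sub>R z) \<bullet> z - g x \<bullet> z))) (at s within {0..1})"
    using d\<phi> by (rule has_derivative_at_withinI)
   have "\<bar>g (x + s *\<^sub>R z) \<bullet> z - g x \<bullet> z\<bar> = \<bar>\<Sum>j\<in>UNIV. (pd u j (x + s *\<^sub>R z) - pd u j x) * z $ j\<bar>"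
    by (simp add: gz sum_subtractf left_diff_distrib)
   also have "... <= (\<Sum>j\<in>UNIV. (\<Sum>i\<in>UNIV. M2 j i) * norm z) * norm z"
   proof (rule abs_sum_nth_le)
    fix j
    have "\<bar>pd u j (x + s *\<^sub>R z) - pd u j x\<bar> <= (\<Sum>i\<in>UNIV. M2 j i) * norm (s *\<^sub>R z)" by (rule lip)
    also have "... <= (\<Sum>i\<in>UNIV. M2 j i) * norm z"
     using s M2 by (intro mult_left_mono) (auto intro: sum_nonneg mult_left_le_one_le)
    finally show "\<bar>pd u j (x + s *\<^sub>R z) - pd u j x\<bar> <= (\<Sum>i\<in>UNIV. M2 j i) * norm z" .
   qed
   also have "... = C2 * (norm z)^2"
    by (simp add: C2_def sum_distrib_right power2_eq_square mult.assoc)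
   finally have *: "\<bar>g (x + s *\<^sub>R z) \<bullet> z - g x \<bullet> z\<bar> <= C2 * (norm z)^2" .
   show "onorm (\<lambda>v. v * (g (x + s *\<^sub>R z) \<bullet> z - g x \<bullet> z)) <= C2 * (norm z)^2"
   proof (rule onorm_le)
    fix v :: real
    show "norm (v * (g (x + s *\<^sub>R z) \<bullet> z - g x \<bullet> z)) <= C2 * (norm z)^2 * norm v"
     using mult_right_mono[OF *, of "\<bar>v\<bar>"] by (simp add: abs_mult mult.commute)
   qed
  qed auto
  then show ?thesis by (simp add: \<phi>_def)
 qed
 have "M0 <= M" "C1 <= M" "C2 <= M" "0 <= M" using M0 C1 C2 by (auto simp: M_def)
 then have "\<bar>u x\<bar> <= M" for x using M0(2)[of x] by linarith
 moreover have "\<bar>g x \<bullet> z\<bar> <= M * norm z" for x z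
  using b1[of x z] mult_right_mono[OF \<open>C1 <= M\<close> norm_ge_zero[of z]] by linarith
 moreover have "\<bar>u (x + z) - u x - g x \<bullet> z\<bar> <= M * (norm z)^2" for x z
  using b2[of x z] mult_right_mono[OF \<open>C2 <= M\<close> zero_le_power2[of "norm z"]] by linarith
 ultimately show ?thesis using \<open>0 <= M\<close> unfolding taylor2_def by blast
qed

section \<open>Radial integrals and linear substitutions\<close>

abbreviation nn_lborel :: "('a::euclidean_space => ennreal) => ennreal" (binder "NI " 10) where
 "nn_lborel f \<equiv> nn_integral lborel f"

abbreviation int_lborel :: "('a::euclidean_space => real) => real" (binder "LI " 10) where
 "int_lborel f \<equiv> integral\<^sup>L lborel f"

lemma dyadic_bracket:
 assumes "1 <= (t::real)" shows "\<exists>j::nat. 2 ^ j <= t \<and> t <= 2 * 2 ^ j"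
proof -
 have ex: "\<exists>n. t < 2 ^ n" by (rule real_arch_pow) simp
 define n where "n = (LEAST n. t < 2 ^ n)"
 have n: "t < 2 ^ n" unfolding n_def by (rule LeastI_ex[OF ex])
 then obtain j where j: "n = Suc j" using assms by (cases n) auto
 then have "\<not> t < 2 ^ j" using not_less_Least[of j "\<lambda>n. t < 2 ^ n"] by (simp add: n_def)
 then show ?thesis using n j by (intro exI[of _ j]) auto
qed

text \<open>A ball of radius comparable to r = \<sigma> b^j has volume of order r^d, and on the
  shell the integrand is of order r^(p-d). So each shell contributes r^p, a geometric series of
  ratio b^p. The outer integrals take b = 2 with p < 0, the inner ones b = 1/2 with p > 0.\<close>

lemma radial_shells:
 fixes b p :: real
 assumes b: "0 < b" and q: "b powr p < 1"
 shows "\<exists>C\<ge>0. \<forall>\<sigma>>0. \<forall>A. (\<forall>z\<in>A. z \<noteq> 0 --> (\<exists>j. \<sigma> * b ^ j <= norm z \<and> norm z <= 2 * (\<sigma> * b ^ j))) -->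
   (NI (z::real^'n::finite). indicator A z * ennreal (norm z powr (p - real CARD('n)))) <= ennreal (C * \<sigma> powr p)"
proof -
 let ?d = "real CARD('n)"
 \<comment> \<open>On a shell the ratio of the norm to the radius lies in [1,2]; the absolute value
   in the exponent covers both signs of \<open>p - ?d\<close>.\<close>
 let ?M = "2 powr \<bar>p - ?d\<bar>"
 define D where "D = ?M * (unit_ball_vol ?d * 2 ^ CARD('n))"
 have D: "0 <= D" by (simp add: D_def)
 have main: "(NI (z::real^'n). indicator A z * ennreal (norm z powr (p - ?d))) <= ennreal (D / (1 - b powr p) * \<sigma> powr p)"
  if \<sigma>: "0 < \<sigma>" and A: "\<forall>z\<in>A. z \<noteq> 0 --> (\<exists>j. \<sigma> * b ^ j <= norm z \<and> norm z <= 2 * (\<sigma> * b ^ j))" for \<sigma> A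
 proof -
  define r where "r j = \<sigma> * b ^ j" for j :: nat
  have r: "0 < r j" for j using \<sigma> b by (simp add: r_def)
  define f :: "nat => real^'n => ennreal" where "f j z = ennreal (?M * r j powr (p - ?d)) * indicator (cball 0 (2 * r j)) z" for j z
  have le: "indicator A z * ennreal (norm z powr (p - ?d)) <= (\<Sum>j. f j z)" for z
  proof (cases "z \<in> A \<and> z \<noteq> 0")
   case True
   then obtain j where j: "r j <= norm z" "norm z <= 2 * r j" using A by (auto simp: r_def)
   define u where "u = norm z / r j"
   have u: "1 <= u" "u <= 2" "norm z = r j * u" using j r[of j] by (auto simp: u_def field_simps)
   have "u powr (p - ?d) <= u powr \<bar>p - ?d\<bar>" using u by (intro powr_mono) auto
   also have "... <= ?M" using u by (intro powr_mono2) auto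
   finally have "norm z powr (p - ?d) <= ?M * r j powr (p - ?d)"
    unfolding u(3) using u r[of j] by (simp add: powr_mult mult.commute[of ?M] mult_left_mono)
   then have "ennreal (norm z powr (p - ?d)) <= f j z" using j by (simp add: f_def ennreal_leI)
   also have "... <= (\<Sum>j. f j z)" using sum_le_suminf[of "\<lambda>j. f j z" "{j}"] by auto
   finally show ?thesis using True by simp
  qed auto
  have trm: "(NI z. f j z) = ennreal (D * \<sigma> powr p * (b powr p) ^ j)" for j
  proof -
   have "(NI z. f j z) = ennreal (?M * r j powr (p - ?d)) * emeasure lborel (cball (0::real^'n) (2 * r j))"
    unfolding f_def by (rule nn_integral_cmult_indicator) simp
   also have "... = ennreal (?M * r j powr (p - ?d) * (unit_ball_vol ?d * (2 * r j) ^ CARD('n)))"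
    using r[of j] by (simp add: emeasure_cball ennreal_mult)
   also have "?M * r j powr (p - ?d) * (unit_ball_vol ?d * (2 * r j) ^ CARD('n)) = D * (r j powr (p - ?d) * r j powr ?d)"
    using r[of j] by (simp add: D_def power_mult_distrib powr_realpow)
   also have "r j powr (p - ?d) * r j powr ?d = r j powr p" by (simp add: powr_add[symmetric])
   also have "... = \<sigma> powr p * (b powr p) ^ j"
    using \<sigma> b by (simp add: r_def powr_mult powr_power powr_powr mult.commute flip: powr_realpow)
   finally show ?thesis by (simp add: mult.assoc)
  qed
  have "(NI z. indicator A z * ennreal (norm z powr (p - ?d))) <= (NI z. \<Sum>j. f j z)" by (intro nn_integral_mono le)
  also have "... = (\<Sum>j. NI z. f j z)"
   unfolding f_def by (intro nn_integral_suminf borel_measurable_times_ennreal borel_measurable_const borel_measurable_indicator) auto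
  also have "... = ennreal (D / (1 - b powr p) * \<sigma> powr p)" unfolding trm
  proof (rule suminf_ennreal_eq)
   show "(\<lambda>j. D * \<sigma> powr p * (b powr p) ^ j) sums (D / (1 - b powr p) * \<sigma> powr p)"
    using sums_mult[OF geometric_sums[of "b powr p"], of "D * \<sigma> powr p"] q by (simp add: mult_ac)
  qed (use D in auto)
  finally show ?thesis .
 qed
 show ?thesis by (rule exI[of _ "D / (1 - b powr p)"]) (use main D q in auto)
qed

lemma nn_integral_radial_outer:
 fixes s :: real assumes s: "s > 0"
 shows "\<exists>C\<ge>0. \<forall>\<sigma>>0. (NI (z::real^'n::finite). indicator {z. \<sigma> <= norm z} z * ennreal (norm z powr (- (real CARD('n) + s)))) <= ennreal (C * \<sigma> powr (- s))"
proof -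
 have sh: "\<exists>j. \<sigma> * 2 ^ j <= norm z \<and> norm z <= 2 * (\<sigma> * 2 ^ j)" if "0 < \<sigma>" "\<sigma> <= norm z" for \<sigma> and z :: "real^'n"
  using dyadic_bracket[of "norm z / \<sigma>"] that by (auto simp: field_simps)
 have "(2::real) powr (- s) < 1" using s by (simp add: powr_less_one)
 then obtain C where C: "C \<ge> 0" "\<forall>\<sigma>>0. \<forall>A. (\<forall>z\<in>A. z \<noteq> 0 --> (\<exists>j. \<sigma> * 2 ^ j <= norm z \<and> norm z <= 2 * (\<sigma> * 2 ^ j))) -->
   (NI (z::real^'n). indicator A z * ennreal (norm z powr (- s - real CARD('n)))) <= ennreal (C * \<sigma> powr (- s))"
  using radial_shells[where 'n='n, of 2 "- s"] by auto
 show ?thesis using C(1) C(2)[rule_format, of _ "{z. _ <= norm z}"] sh by (intro exI[of _ C]) (auto simp: algebra_simps)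
qed

lemma nn_integral_radial_inner:
 fixes s :: real assumes s: "s > 0"
 shows "\<exists>C\<ge>0. \<forall>\<sigma>>0. (NI (z::real^'n::finite). indicator {z. norm z < \<sigma>} z * ennreal (norm z powr (s - real CARD('n)))) <= ennreal (C * \<sigma> powr s)"
proof -
 \<comment> \<open>The shells run downwards from \<sigma>; as each one extends to twice its radius,
   the first radius is \<sigma>/2.\<close>
 have sh: "\<exists>j. \<sigma> / 2 * (1 / 2) ^ j <= norm z \<and> norm z <= 2 * (\<sigma> / 2 * (1 / 2) ^ j)" if "0 < \<sigma>" "norm z < \<sigma>" "z \<noteq> 0" for \<sigma> and z :: "real^'n"
  using dyadic_bracket[of "\<sigma> / norm z"] that by (auto simp: field_simps)
 have "(1 / 2 :: real) powr s < 1" using s powr_less_mono2[of s "1/2" 1] by simp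
 then obtain C where C: "C \<ge> 0" "\<forall>\<sigma>>0. \<forall>A. (\<forall>z\<in>A. z \<noteq> 0 --> (\<exists>j. \<sigma> * (1 / 2) ^ j <= norm z \<and> norm z <= 2 * (\<sigma> * (1 / 2) ^ j))) -->
   (NI (z::real^'n). indicator A z * ennreal (norm z powr (s - real CARD('n)))) <= ennreal (C * \<sigma> powr s)"
  using radial_shells[where 'n='n, of "1/2" s] by auto
 have "(NI (z::real^'n). indicator {z. norm z < \<sigma>} z * ennreal (norm z powr (s - real CARD('n)))) <= ennreal (C * \<sigma> powr s)" if \<sigma>: "0 < \<sigma>" for \<sigma>
 proof -
  have "(\<sigma> / 2) powr s <= \<sigma> powr s" using \<sigma> s by (intro powr_mono2) auto
  then have "ennreal (C * (\<sigma> / 2) powr s) <= ennreal (C * \<sigma> powr s)" using C(1) by (intro ennreal_leI mult_left_mono)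
  then show ?thesis using C(2)[rule_format, of "\<sigma> / 2" "{z. norm z < \<sigma>}"] sh[OF \<sigma>] \<sigma> by (auto intro: order_trans)
 qed
 then show ?thesis using C(1) by blast
qed

definition ek :: "'n::finite => real^'n" where "ek k = axis k 1"

text \<open>The affine maps \<open>y \<mapsto> \<xi> + a y\<close> with \<open>\<xi>\<close> tangential and \<open>a > 0\<close> act simply transitively on
 the half-space, so every point \<open>x\<close> encodes the map sending \<open>ek k\<close> to \<open>x\<close>, and
 \<open>gmul k x \<eta>\<close> is the image of \<open>\<eta>\<close> under it; \<open>ginv k\<close> is the group inverse.\<close>
definition gmul :: "'n::finite => real^'n => real^'n => real^'n" where
 "gmul k x \<eta> = x + (x $ k) *\<^sub>R (\<eta> - ek k)"

definition ginv :: "'n::finite => real^'n => real^'n" where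
 "ginv k \<eta> = ek k - (1 / \<eta> $ k) *\<^sub>R (\<eta> - ek k)"

lemma ek_nth [simp]: "ek k $ k = 1" by (simp add: ek_def)
lemma ek_halfsp [simp]: "ek k \<in> halfsp k" by (simp add: halfsp_def)
lemma norm_ek [simp]: "norm (ek k) = 1" by (simp add: ek_def)
lemma gmul_nth [simp]: "gmul k x \<eta> $ k = x $ k * \<eta> $ k"
 by (simp add: gmul_def algebra_simps)
lemma ginv_nth [simp]: "\<eta> $ k \<noteq> 0 ==> ginv k \<eta> $ k = 1 / \<eta> $ k"
 by (simp add: ginv_def field_simps)
lemma gmul_halfsp: "x \<in> halfsp k ==> \<eta> \<in> halfsp k ==> gmul k x \<eta> \<in> halfsp k"
 by (simp add: halfsp_def)
lemma gmul_halfsp_iff: "\<eta> \<in> halfsp k ==> gmul k x \<eta> \<in> halfsp k \<longleftrightarrow> x \<in> halfsp k"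
 by (simp add: halfsp_def zero_less_mult_iff)
lemma ginv_halfsp: "\<eta> \<in> halfsp k ==> ginv k \<eta> \<in> halfsp k"
 by (simp add: halfsp_def)
lemma gmul_ek [simp]: "gmul k x (ek k) = x" by (simp add: gmul_def)
lemma ek_gmul [simp]: "gmul k (ek k) x = x" by (simp add: gmul_def)
lemma gmul_assoc: "gmul k (gmul k x y) z = gmul k x (gmul k y z)"
 by (simp add: gmul_def vec_eq_iff algebra_simps)
lemma gmul_ginv [simp]: "\<eta> \<in> halfsp k ==> gmul k \<eta> (ginv k \<eta>) = ek k"
 by (simp add: gmul_def ginv_def halfsp_def)
lemma ginv_gmul [simp]: "\<eta> \<in> halfsp k ==> gmul k (ginv k \<eta>) \<eta> = ek k"
 by (simp add: gmul_def ginv_def halfsp_def vec_eq_iff field_simps)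
lemma ginv_ginv [simp]: "\<eta> \<in> halfsp k ==> ginv k (ginv k \<eta>) = \<eta>"
 using gmul_assoc[of k "ginv k (ginv k \<eta>)" "ginv k \<eta>" \<eta>] by (simp add: ginv_halfsp)

lemma gmul_continuous: "continuous_on UNIV (\<lambda>p. gmul k (fst p) (snd p))"
 unfolding gmul_def by (intro continuous_intros)

lemma gmul_measurable [measurable (raw)]:
 fixes f g :: "'b => real^'n::finite"
 assumes "f \<in> borel_measurable M" "g \<in> borel_measurable M"
 shows "(\<lambda>w. gmul k (f w) (g w)) \<in> borel_measurable M"
 using borel_measurable_continuous_Pair[OF assms gmul_continuous[of k]]
 by simp

lemma vec_nth_measurable [measurable (raw)]:
 fixes f :: "'b => real^'n::finite"
 assumes "f \<in> borel_measurable M"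
 shows "(\<lambda>w. f w $ i) \<in> borel_measurable M"
 by (intro measurable_compose[OF assms] borel_measurable_continuous_onI continuous_intros)

lemma ginv_measurable [measurable]: "ginv k \<in> borel \<rightarrow>\<^sub>M borel"
 unfolding ginv_def by measurable

text \<open>On each line in direction \<open>b\<close> the coefficient \<open>g\<close> is constant,
  so the shear is a translation there; Fubini in the coordinate \<open>b\<close> reduces the claim
  to translation invariance on the line.\<close>

lemma nn_integral_shear:
 fixes b :: "'a::euclidean_space" and g :: "'a => real"
 assumes b: "b \<in> Basis" and [measurable]: "bmeas g" "bmeas f"
  and g: "\<And>x s. g (x + s *\<^sub>R b) = g x"
 shows "(NI x. f (x + g x *\<^sub>R b)) = (NI x. f x)"
proof -
 interpret product_sigma_finite "\<lambda>_::'a. lborel :: real measure" ..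
 define E where "E h = (\<Sum>c\<in>Basis. h c *\<^sub>R c)" for h :: "'a => real"
 have E [measurable]: "E \<in> borel_measurable (Pi\<^sub>M Basis (\<lambda>_. lborel))"
  unfolding E_def by measurable
 have ins: "insert b (Basis - {b}) = Basis" using b by auto
 have fub: "(NI x. F x) = (\<integral>\<^sup>+h. (NI y. F (E h - h b *\<^sub>R b + y *\<^sub>R b)) \<partial>Pi\<^sub>M (Basis - {b}) (\<lambda>_. lborel))"
  if [measurable]: "bmeas F" for F :: "'a => ennreal"
 proof -
  have "(NI x. F x) = (\<integral>\<^sup>+h. F (E h) \<partial>Pi\<^sub>M Basis (\<lambda>_. lborel))"
   by (subst lborel_eq) (simp add: nn_integral_distr E_def[symmetric])
  also have "... = (\<integral>\<^sup>+h. (NI y. F (E (h(b := y)))) \<partial>Pi\<^sub>M (Basis - {b}) (\<lambda>_. lborel))"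
   using product_nn_integral_insert[of "Basis - {b}" b "\<lambda>h. F (E h)", unfolded ins] by simp
  also have "(\<lambda>h y. F (E (h(b := y)))) = (\<lambda>h y. F (E h - h b *\<^sub>R b + y *\<^sub>R b))"
  proof (intro ext arg_cong[of _ _ F])
   fix h y
   have "(\<Sum>c\<in>Basis - {b}. (h(b := y)) c *\<^sub>R c) = (\<Sum>c\<in>Basis - {b}. h c *\<^sub>R c)"
    by (intro sum.cong) auto
   then show "E (h(b := y)) = E h - h b *\<^sub>R b + y *\<^sub>R b"
    unfolding E_def sum.remove[OF finite_Basis b] by simp
  qed
  finally show ?thesis .
 qed
 have "(NI x. f (x + g x *\<^sub>R b))
   = (\<integral>\<^sup>+h. (NI y. f (E h - h b *\<^sub>R b + (g (E h - h b *\<^sub>R b) + 1 * y) *\<^sub>R b)) \<partial>Pi\<^sub>M (Basis - {b}) (\<lambda>_. lborel))"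
  by (subst fub) (simp, intro nn_integral_cong, simp only: g, simp add: algebra_simps)
 also have "... = (\<integral>\<^sup>+h. (NI y. f (E h - h b *\<^sub>R b + y *\<^sub>R b)) \<partial>Pi\<^sub>M (Basis - {b}) (\<lambda>_. lborel))"
 proof (rule nn_integral_cong)
  fix h
  show "(NI y. f (E h - h b *\<^sub>R b + (g (E h - h b *\<^sub>R b) + 1 * y) *\<^sub>R b))
    = (NI y. f (E h - h b *\<^sub>R b + y *\<^sub>R b))"
   by (subst nn_integral_real_affine[where c=1 and f="\<lambda>y. f (E h - h b *\<^sub>R b + y *\<^sub>R b)" and t="g (E h - h b *\<^sub>R b)"])
     simp_all
 qed
 also have "... = (NI x. f x)" by (subst fub) simp_all
 finally show ?thesis .
qed

text \<open>As a function of \<open>x\<close> the product is linear: tangential shears followed by a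
  dilation of the \<open>k\<close>-th coordinate alone. Hence the determinant is
  \<open>\<eta> $ k\<close>, whereas the product as a function of \<open>\<eta>\<close> dilates all
  coordinates by \<open>x $ k\<close>. These two Jacobians produce the weights
  \<open>\<eta> $ k powr (\<alpha> - 1)\<close> below.\<close>

lemma nn_integral_gmul_left:
 fixes \<eta> :: "real^'n::finite"
 assumes \<eta>: "\<eta> \<in> halfsp k" and f [measurable]: "bmeas f"
 shows "(NI x. f x) = ennreal (\<eta> $ k) * (NI x. f (gmul k x \<eta>))"
proof -
 have t: "\<eta> $ k > 0" using \<eta> by (simp add: halfsp_def)
 define sh where "sh J x = x + (\<Sum>j\<in>J. (x $ k * \<eta> $ j) *\<^sub>R axis j 1)" for J and x :: "real^'n"
 have sh_meas [measurable]: "bmeas (sh J)" for J unfolding sh_def by measurable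
 have shear: "(NI x. F (sh J x)) = (NI x. F x)"
  if "finite J" "k \<notin> J" "bmeas F" for J and F :: "real^'n => ennreal"
  using that
 proof (induction J arbitrary: F rule: finite_induct)
  case empty then show ?case by (simp add: sh_def)
 next
  case (insert j J)
  have [measurable]: "bmeas F" by fact
  have shk: "sh J x $ k = x $ k" for x
   using insert by (auto simp: sh_def axis_def intro!: sum.neutral)
  have "(NI x. F (sh (insert j J) x)) = (NI x. F (sh J x + (sh J x $ k * \<eta> $ j) *\<^sub>R axis j 1))"
   using insert by (simp add: shk) (simp add: sh_def algebra_simps)
  also have "... = (NI x. F (x + (x $ k * \<eta> $ j) *\<^sub>R axis j 1))"
   using insert by (intro insert.IH[of "\<lambda>x. F (x + (x $ k * \<eta> $ j) *\<^sub>R axis j 1)"]) auto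
  also have "... = (NI x. F x)"
  proof (rule nn_integral_shear)
   have "axis j 1 $ k = (0::real)" using insert by (auto simp: axis_def)
   then show "(x + s *\<^sub>R axis j 1) $ k * \<eta> $ j = x $ k * \<eta> $ j" for x s by simp
  qed (auto simp: axis_in_Basis_iff)
  finally show ?case .
 qed
 define c where "c b = (if b = axis k 1 then \<eta> $ k else 1)" for b :: "real^'n"
 define T where "T x = (\<Sum>b\<in>Basis. (c b * (x \<bullet> b)) *\<^sub>R b)" for x :: "real^'n"
 have T [measurable]: "bmeas T" unfolding T_def by measurable
 have "(\<Prod>b\<in>Basis. \<bar>c b\<bar>) = \<eta> $ k"
  using t by (subst prod.remove[of _ "axis k 1"]) (auto simp: c_def axis_in_Basis_iff intro!: prod.neutral)
 then have "lborel = density (distr lborel borel T) (\<lambda>_. ennreal (\<eta> $ k))"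
  using lborel_affine_euclidean[of c 0] t by (simp add: T_def[abs_def] c_def[abs_def])
 then have "(NI x. f x) = (\<integral>\<^sup>+x. f x \<partial>density (distr lborel borel T) (\<lambda>_. ennreal (\<eta> $ k)))"
  by simp
 also have "... = ennreal (\<eta> $ k) * (NI x. f (T x))"
  by (simp add: nn_integral_density nn_integral_distr nn_integral_cmult)
 also have "(NI x. f (T x)) = (NI x. f (T (sh (UNIV - {k}) x)))"
  by (subst shear[of "UNIV - {k}" "\<lambda>x. f (T x)"]) auto
 also have "(\<lambda>x. T (sh (UNIV - {k}) x)) = (\<lambda>x. gmul k x \<eta>)"
 proof
  fix x :: "real^'n"
  have inner: "T y $ i = (if i = k then \<eta> $ k * y $ k else y $ i)" for y i
  proof -
   have "T y $ i = T y \<bullet> axis i 1" by (simp add: inner_axis)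
   also have "... = c (axis i 1) * (y \<bullet> axis i 1)"
    unfolding T_def inner_sum_left
    by (subst sum.remove[of _ "axis i 1"]) (auto simp: axis_in_Basis_iff inner_Basis intro!: sum.neutral)
   finally show ?thesis by (auto simp: c_def inner_axis axis_eq_axis)
  qed
  have shi: "sh (UNIV - {k}) x $ i = (if i = k then x $ k else x $ i + x $ k * \<eta> $ i)" for i
  proof (cases "i = k")
   case True then show ?thesis by (auto simp: sh_def axis_def intro!: sum.neutral)
  next
   case False
   then show ?thesis
    unfolding sh_def by (subst sum.remove[of _ i]) (auto simp: axis_def intro!: sum.neutral)
  qed
  show "T (sh (UNIV - {k}) x) = gmul k x \<eta>"
   by (simp add: vec_eq_iff inner shi gmul_def ek_def axis_def algebra_simps)
 qed
 finally show ?thesis .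
qed

lemma lborel_gmul:
 fixes \<eta> :: "real^'n::finite"
 assumes \<eta>: "\<eta> \<in> halfsp k"
 shows "lborel = density (distr lborel borel (\<lambda>x. gmul k x \<eta>)) (\<lambda>_. ennreal (\<eta> $ k))"
proof (rule measure_eqI)
 fix A :: "(real^'n) set" assume "A \<in> sets lborel"
 then have [measurable]: "A \<in> sets borel" by simp
 show "emeasure lborel A = emeasure (density (distr lborel borel (\<lambda>x. gmul k x \<eta>)) (\<lambda>_. ennreal (\<eta> $ k))) A"
  using nn_integral_gmul_left[OF \<eta>, of "indicator A"]
   nn_integral_distr[of "\<lambda>x. gmul k x \<eta>" lborel borel "indicator A"]
  by (simp add: emeasure_density nn_integral_cmult)
qed simp

lemma lebesgue_integral_gmul_left:
 fixes f :: "real^'n::finite => real"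
 assumes \<eta>: "\<eta> \<in> halfsp k" and f [measurable]: "bmeas f"
 shows "(LI x. f x) = \<eta> $ k * (LI x. f (gmul k x \<eta>))"
 using \<eta> by (subst lborel_gmul[OF \<eta>]) (simp add: integral_density integral_distr halfsp_def less_imp_le)

lemma lborel_gmul_right:
 fixes x :: "real^'n::finite"
 assumes x: "x \<in> halfsp k"
 shows "lborel = density (distr lborel borel (gmul k x)) (\<lambda>_. ennreal ((x $ k) ^ CARD('n)))"
proof -
 have "gmul k x = (\<lambda>\<eta>. (x - (x $ k) *\<^sub>R ek k) + (x $ k) *\<^sub>R \<eta>)"
  by (auto simp: gmul_def algebra_simps)
 then show ?thesis
  using lborel_affine[of "x $ k" "x - (x $ k) *\<^sub>R ek k"] x by (simp add: halfsp_def)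
qed

lemma nn_integral_gmul_right:
 fixes x :: "real^'n::finite"
 assumes x: "x \<in> halfsp k" and f [measurable]: "bmeas f"
 shows "(NI y. f y) = ennreal ((x $ k) ^ CARD('n)) * (NI \<eta>. f (gmul k x \<eta>))"
 by (subst lborel_gmul_right[OF x]) (simp add: nn_integral_density nn_integral_distr nn_integral_cmult)

lemma lebesgue_integral_gmul_right:
 fixes x :: "real^'n::finite" and f :: "real^'n => real"
 assumes x: "x \<in> halfsp k" and f [measurable]: "bmeas f"
 shows "(LI y. f y) = (x $ k) ^ CARD('n) * (LI \<eta>. f (gmul k x \<eta>))"
 using x by (subst lborel_gmul_right[OF x]) (simp add: integral_density integral_distr halfsp_def less_imp_le)

section \<open>The jump kernel and its generator\<close>

lemma ginv_gmul_left:
 assumes "x \<in> halfsp k" "y \<in> halfsp k"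
 shows "gmul k (ginv k (gmul k x y)) x = ginv k y"
proof -
 have "gmul k (gmul k (ginv k (gmul k x y)) x) (gmul k y (ginv k y)) = ginv k y"
 proof -
  have "gmul k (gmul k (ginv k (gmul k x y)) x) (gmul k y (ginv k y)) = gmul k (gmul k (ginv k (gmul k x y)) (gmul k x y)) (ginv k y)"
   by (simp only: gmul_assoc)
  then show ?thesis using assms by (simp add: gmul_halfsp)
 qed
 then show ?thesis using assms by simp
qed

lemma gmul_ginv_cancel:
 assumes "x \<in> halfsp k" shows "gmul k (ginv k x) (gmul k x y) = y"
 using assms by (simp add: gmul_assoc[symmetric])

lemma gmul_ginv_cancel2:
 assumes "x \<in> halfsp k" shows "gmul k x (gmul k (ginv k x) y) = y"
 using assms by (simp add: gmul_assoc[symmetric])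

text \<open>A hyperbolic ball about \<open>ek k\<close>: in the half-space metric, |\<eta> - e|^2
  divided by the height of \<eta> is a function of the distance to \<open>ek k\<close>. Unlike a
  Euclidean ball it is invariant under \<open>ginv k\<close>, so both points of a symmetrised
  difference are near or far together.\<close>

definition nearset :: "'n::finite => real => (real^'n) set" where
 "nearset k \<kappa> = {\<eta> \<in> halfsp k. (norm (\<eta> - ek k))^2 < \<kappa>^2 * \<eta> $ k}"

lemma nearset_meas [measurable]: "nearset k \<kappa> \<in> sets borel"
 unfolding nearset_def halfsp_def by measurable

lemma abs_nth_sub_1_le: "\<bar>\<eta> $ k - 1\<bar> <= norm (\<eta> - ek k)"
 using component_le_norm_cart[of "\<eta> - ek k" k] by simp

lemma ginv_minus_ek: "ginv k \<eta> - ek k = - (1 / \<eta> $ k) *\<^sub>R (\<eta> - ek k)"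
 by (simp add: ginv_def)

lemma ginv_nearset:
 assumes "\<eta> \<in> halfsp k" shows "ginv k \<eta> \<in> nearset k \<kappa> \<longleftrightarrow> \<eta> \<in> nearset k \<kappa>"
proof -
 have t: "\<eta> $ k > 0" using assms by (simp add: halfsp_def)
 have "(norm (ginv k \<eta> - ek k))^2 = (norm (\<eta> - ek k))^2 / (\<eta> $ k)^2"
  using t by (simp add: ginv_minus_ek power_divide)
 moreover have "a / t^2 < \<kappa>^2 * (1 / t) \<longleftrightarrow> a < \<kappa>^2 * t" if "t > 0" for a t :: real
  using that by (simp add: divide_simps power2_eq_square)
 ultimately show ?thesis using t assms
  by (simp add: nearset_def ginv_halfsp)
qed

lemma nearset_bounds:
 assumes \<kappa>: "0 < \<kappa>" "\<kappa> <= 1/2" and n: "\<eta> \<in> nearset k \<kappa>"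
 shows "norm (\<eta> - ek k) < 2 * \<kappa>" "1/4 <= \<eta> $ k" "\<eta> $ k <= 2"
proof -
 define q where "q = norm (\<eta> - ek k)"
 define t where "t = \<eta> $ k"
 have q0: "0 <= q" by (simp add: q_def)
 have tq: "\<bar>t - 1\<bar> <= q" unfolding t_def q_def by (rule abs_nth_sub_1_le)
 have lt: "q\<^sup>2 < \<kappa>^2 * t" using n by (simp add: nearset_def q_def t_def)
 have k2: "\<kappa>\<^sup>2 <= \<kappa> / 2" using \<kappa> by (simp add: power2_eq_square)
 show *: "norm (\<eta> - ek k) < 2 * \<kappa>"
 proof (rule ccontr)
  assume "\<not> ?thesis"
  then have c: "2 * \<kappa> <= q" by (simp add: q_def)
  have "q\<^sup>2 < \<kappa>^2 * (1 + q)" using lt tq \<kappa> by (smt (verit) mult_left_mono zero_le_power2)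
  moreover have "\<kappa>\<^sup>2 <= (q/2)^2" using c \<kappa> by (intro power_mono) auto
  moreover have "\<kappa>\<^sup>2 * q <= q / 4 * q" using k2 c q0 by (intro mult_right_mono) auto
  moreover have "(q/2)^2 = q^2 / 4" "q / 4 * q = q^2 / 4" "\<kappa>\<^sup>2 * (1 + q) = \<kappa>^2 + \<kappa>^2 * q"
   by (simp_all add: power2_eq_square algebra_simps)
  moreover have "0 < q^2" using c \<kappa> by simp
  ultimately show False by linarith
 qed
 then have q1: "q < 1" using \<kappa> by (simp add: q_def)
 show "\<eta> $ k <= 2" using tq q1 by (simp add: t_def)
 show "1/4 <= \<eta> $ k"
 proof (rule ccontr)
  assume "\<not> ?thesis"
  then have t: "t < 1/4" by (simp add: t_def)
  then have "3/4 < q" using tq by linarith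
  then have "(3/4)^2 < q^2" by (intro power_strict_mono) auto
  moreover have "\<kappa>\<^sup>2 * t <= (1/4) * (1/4)"
   using t \<kappa> k2 n by (intro mult_mono) (auto simp: t_def nearset_def halfsp_def)
  ultimately show False using lt by (simp add: power2_eq_square)
 qed
qed

lemma farset_bound:
 assumes \<kappa>: "0 < \<kappa>" "\<kappa> <= 1/2" and n: "\<eta> \<in> halfsp k" "\<eta> \<notin> nearset k \<kappa>"
 shows "\<kappa> / 2 <= norm (\<eta> - ek k)"
proof (rule ccontr)
 assume c: "\<not> ?thesis"
 define q where "q = norm (\<eta> - ek k)"
 have "3/4 <= \<eta> $ k" using abs_nth_sub_1_le[of \<eta> k] c \<kappa> by linarith
 then have "\<kappa>\<^sup>2 * (3/4) <= \<kappa>^2 * \<eta> $ k" by (intro mult_left_mono) auto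
 also have "... <= q^2" using n by (simp add: nearset_def q_def)
 also have "... <= (\<kappa>/2)^2" using c by (intro power_mono) (auto simp: q_def)
 finally show False using \<kappa> by (simp add: power2_eq_square)
qed

text \<open>The kernel enters the analysis as a bounded, symmetric, invariant function.
  \<open>B_low\<close> bounds it below only for pairs whose distance is at most a multiple of both
  heights, where its boundary decay is not felt.\<close>

locale bkernel =
 fixes k :: "'n::finite" and d \<alpha> CB :: real and B :: "real^'n => real^'n => real"
 assumes d_eq: "d = real CARD('n)"
  and alpha: "1 < \<alpha>" "\<alpha> < 2"
  and B_meas: "bmeas (\<lambda>z. B (fst z) (snd z))"
  and B_nonneg: "x \<in> halfsp k ==> y \<in> halfsp k ==> 0 <= B x y"
  and B_sym: "x \<in> halfsp k ==> y \<in> halfsp k ==> B x y = B y x"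
  and CB: "0 <= CB"
  and B_bound: "x \<in> halfsp k ==> y \<in> halfsp k ==> x \<noteq> y ==> B x y <= CB"
  and B_scale: "0 < a ==> x \<in> halfsp k ==> y \<in> halfsp k ==> B (a *\<^sub>R x) (a *\<^sub>R y) = B x y"
  and B_trans: "z $ k = 0 ==> x \<in> halfsp k ==> y \<in> halfsp k ==> B (x + z) (y + z) = B x y"
  and B_low: "0 < c ==> \<exists>b>0. \<forall>x\<in>halfsp k. \<forall>y\<in>halfsp k. x \<noteq> y -->
         c * norm (x - y) <= min (x $ k) (y $ k) --> b <= B x y"
begin

abbreviation "H \<equiv> halfsp k"
abbreviation "e \<equiv> ek k"
abbreviation gm (infixl "\<odot>" 70) where "x \<odot> y \<equiv> gmul k x y"
abbreviation "J \<equiv> Jk \<alpha> B"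

definition jj :: "real^'n => real" where
 "jj \<eta> = (if \<eta> \<in> H then J e \<eta> else 0)"

lemma B_meas2 [measurable (raw)]:
 assumes "f \<in> borel_measurable M" "g \<in> borel_measurable M"
 shows "(\<lambda>w. B (f w) (g w)) \<in> borel_measurable M"
proof -
 have "(\<lambda>w. (f w, g w)) \<in> M \<rightarrow>\<^sub>M borel" unfolding borel_prod[symmetric] using assms by measurable
 from measurable_compose[OF this B_meas] show ?thesis by simp
qed

lemma J_meas [measurable (raw)]:
 assumes [measurable]: "f \<in> borel_measurable M" "g \<in> borel_measurable M"
 shows "(\<lambda>w. J (f w) (g w)) \<in> borel_measurable M"
 unfolding Jk_def by measurable

lemma jj_meas [measurable]: "bmeas jj"
 unfolding jj_def[abs_def] by measurable

lemma jj_nonneg: "0 <= jj \<eta>"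
 using B_nonneg[of e \<eta>] by (simp add: jj_def Jk_def)

lemma J_sym: "x \<in> H ==> y \<in> H ==> J x y = J y x"
 using B_sym[of x y] by (simp add: Jk_def norm_minus_commute)

lemma J_nonneg: "x \<in> H ==> y \<in> H ==> 0 <= J x y"
 using B_nonneg[of x y] by (simp add: Jk_def)

lemma powr_dm: "x powr (- (d + \<alpha>)) = inverse (x powr (real CARD('n) + \<alpha>))"
 by (simp only: d_eq powr_minus)

lemma J_bound:
 assumes "x \<in> H" "y \<in> H" shows "J x y <= CB * norm (x - y) powr (- (d + \<alpha>))"
proof (cases "x = y")
 case False
 then show ?thesis using B_bound[OF assms False]
  by (simp add: Jk_def powr_dm divide_inverse mult_right_mono del: minus_add_distrib add_uminus_conv_diff)
qed (simp add: Jk_def)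

lemma jj_bound: "jj \<eta> <= CB * norm (\<eta> - e) powr (- (d + \<alpha>))"
 using J_bound[of e \<eta>] CB by (simp add: jj_def norm_minus_commute)

lemma jj_zero: "\<eta> \<notin> H ==> jj \<eta> = 0" by (simp add: jj_def)

text \<open>Every point of \<open>H\<close> is \<open>e\<close> scaled by its height and shifted
  tangentially, so the two invariances bring \<open>B\<close> back to the base point; the power of
  \<open>x $ k\<close> comes from the norm in \<open>J\<close>.\<close>

lemma J_gmul:
 assumes x: "x \<in> H" and \<eta>: "\<eta> \<in> H"
 shows "J x (x \<odot> \<eta>) = x $ k powr (- (d + \<alpha>)) * jj \<eta>"
proof -
 have xk: "x $ k > 0" using x by (simp add: halfsp_def)
 define z where "z = x - (x $ k) *\<^sub>R e"
 have z: "z $ k = 0" by (simp add: z_def)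
 have "B x (x \<odot> \<eta>) = B ((x $ k) *\<^sub>R e + z) ((x $ k) *\<^sub>R \<eta> + z)"
  by (simp add: z_def gmul_def algebra_simps)
 also have "... = B ((x $ k) *\<^sub>R e) ((x $ k) *\<^sub>R \<eta>)"
  using xk \<eta> by (intro B_trans z) (auto simp: halfsp_def)
 also have "... = B e \<eta>" using xk \<eta> by (intro B_scale) auto
 finally have B: "B x (x \<odot> \<eta>) = B e \<eta>" .
 have "norm (x - x \<odot> \<eta>) = x $ k * norm (e - \<eta>)"
  using xk by (simp add: gmul_def norm_minus_commute)
 then show ?thesis using xk \<eta> B
  unfolding powr_dm by (simp add: Jk_def jj_def powr_mult divide_inverse)
qed

lemma powr_d_cancel: "x $ k > 0 ==> (x $ k) ^ CARD('n) * x $ k powr (- (d + \<alpha>)) = x $ k powr (- \<alpha>)" for x :: "real^'n"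
 by (simp add: d_eq powr_realpow[symmetric] powr_add[symmetric])

text \<open>Symmetry of \<open>J\<close> in the coordinates \<open>y = x \<odot> \<eta>\<close>: both sides are, up to the
 constant \<open>c\<close>, the same double integral with the roles of the two points exchanged.\<close>
lemma nn_integral_jj_ginv:
 assumes [measurable]: "bmeas g"
 shows "(NI \<eta>. ennreal (\<eta> $ k powr (\<alpha> - 1)) * g (ginv k \<eta>) * ennreal (jj \<eta>))
    = (NI \<eta>. g \<eta> * ennreal (jj \<eta>))"
proof -
 \<comment> \<open>Any Borel set in \<open>H\<close> of finite positive measure would serve: it
   makes the free integral over \<open>x\<close> finite, and its measure \<open>c\<close> cancels at
   the end.\<close>
 define S where "S = ball e (1/2)"
 define c where "c = emeasure lborel S"
 \<comment> \<open>The weight \<open>x $ k powr \<alpha>\<close> cancels the Jacobian together with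
   the homogeneity of \<open>J\<close>, so the inner integral does not depend on \<open>x\<close>
   inside \<open>S\<close>.\<close>
 define F where "F x y = indicator S x * ennreal (x $ k powr \<alpha>) * g (ginv k x \<odot> y) * (if x \<in> H \<and> y \<in> H then ennreal (J x y) else 0)" for x y
 let ?q = "\<lambda>x \<eta>. ennreal (\<eta> $ k powr \<alpha>) * g (ginv k \<eta>) * ennreal (jj \<eta>) * indicator S (x \<odot> \<eta>)"
 let ?p = "\<lambda>x \<eta>. indicator S x * (g \<eta> * ennreal (jj \<eta>))"
 let ?V = "\<lambda>x. ennreal ((x $ k) ^ CARD('n))"
 have Sm [measurable]: "S \<in> sets borel" by (simp add: S_def)
 have Fm [measurable (raw)]: "(\<lambda>w. F (f1 w) (f2 w)) \<in> borel_measurable M"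
  if [measurable]: "f1 \<in> borel_measurable M" "f2 \<in> borel_measurable M" for M :: "'z measure" and f1 f2
  unfolding F_def by measurable
 have SH: "x \<in> H" if "x \<in> S" for x
 proof -
  have "\<bar>x $ k - 1\<bar> < 1/2"
   using that abs_nth_sub_1_le[of x k] by (auto simp: S_def dist_norm norm_minus_commute)
  then show ?thesis unfolding halfsp_def mem_Collect_eq by linarith
 qed
 define V where "V = unit_ball_vol (real CARD('n)) * (1/2) ^ CARD('n)"
 have "0 < V" "c = ennreal V" by (simp_all add: V_def c_def S_def emeasure_ball)
 then have c: "c \<noteq> 0" "c \<noteq> \<top>" by auto
 have p: "?V x * F x (x \<odot> \<eta>) = ?p x \<eta>"
  "?V x * F (x \<odot> \<eta>) x = ?q x \<eta>"
  if x: "x \<in> H" for x \<eta>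
 proof -
  have xk: "0 < x $ k" using x by (simp add: halfsp_def)
  have 1: "(x $ k) ^ CARD('n) * x $ k powr (- (d + \<alpha>)) * x $ k powr \<alpha> = 1"
   unfolding powr_d_cancel[OF xk] using xk by (simp add: powr_add[symmetric])
  have "?V x * F x (x \<odot> \<eta>) = ?p x \<eta> \<and>
   ?V x * F (x \<odot> \<eta>) x = ?q x \<eta>"
  proof (cases "\<eta> \<in> H")
   case False
   then have "x \<odot> \<eta> \<notin> H" using xk by (simp add: halfsp_def zero_less_mult_iff)
   then show ?thesis using False by (simp add: F_def jj_zero)
  next
   case True
   have xe: "x \<odot> \<eta> \<in> H" by (rule gmul_halfsp[OF x True])
   have t: "0 < \<eta> $ k" using True by (simp add: halfsp_def)
   have J: "J x (x \<odot> \<eta>) = x $ k powr (- (d + \<alpha>)) * jj \<eta>" "J (x \<odot> \<eta>) x = x $ k powr (- (d + \<alpha>)) * jj \<eta>"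
    using J_gmul[OF x True] J_sym[OF xe x] by auto
   let ?X = "?V x" and ?Y = "ennreal (x $ k powr \<alpha>)" and ?W = "ennreal (x $ k powr (- (d + \<alpha>)))"
   have XYW: "?X * ?Y * ?W = 1" using 1 xk by (simp add: ennreal_mult[symmetric] mult_ac)
   have "F x (x \<odot> \<eta>) = indicator S x * ?Y * g \<eta> * (?W * ennreal (jj \<eta>))"
    using x xe unfolding F_def J by (simp add: gmul_ginv_cancel ennreal_mult jj_nonneg)
   then have "?X * F x (x \<odot> \<eta>) = (?X * ?Y * ?W) * (?p x \<eta>)" by (simp only: mult_ac)
   moreover have "F (x \<odot> \<eta>) x = indicator S (x \<odot> \<eta>) * (?Y * ennreal (\<eta> $ k powr \<alpha>)) * g (ginv k \<eta>) * (?W * ennreal (jj \<eta>))"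
    using x xe True xk t unfolding F_def J by (simp add: ginv_gmul_left ennreal_mult jj_nonneg powr_mult)
   then have "?X * F (x \<odot> \<eta>) x = (?X * ?Y * ?W) * (?q x \<eta>)"
    by (simp only: mult_ac)
   ultimately show ?thesis unfolding XYW by simp
  qed
  then show "?V x * F x (x \<odot> \<eta>) = ?p x \<eta>"
   "?V x * F (x \<odot> \<eta>) x = ?q x \<eta>" by auto
 qed
 have sub: "(NI y. f y) = (NI \<eta>. ?V x * f (x \<odot> \<eta>))" if "x \<in> H" and [measurable]: "bmeas f" for x f
  using nn_integral_gmul_right[OF that] by (simp add: nn_integral_cmult)
 have "(NI x. NI y. F x y) = (NI x. indicator S x * (NI \<eta>. g \<eta> * ennreal (jj \<eta>)))"
 proof (rule nn_integral_cong)
  fix x :: "real^'n"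
  show "(NI y. F x y) = indicator S x * (NI \<eta>. g \<eta> * ennreal (jj \<eta>))"
  proof (cases "x \<in> H")
   case True
   then show ?thesis using sub[OF True, of "F x"] by (simp add: p nn_integral_cmult)
  next
   case False
   then have "x \<notin> S" using SH by blast
   then show ?thesis by (simp add: F_def)
  qed
 qed
 also have "... = c * (NI \<eta>. g \<eta> * ennreal (jj \<eta>))" by (subst nn_integral_multc) (simp_all add: c_def)
 finally have I1: "(NI x. NI y. F x y) = c * (NI \<eta>. g \<eta> * ennreal (jj \<eta>))" .
 have "(NI x. NI y. F x y) = (NI y. NI x. F x y)"
  by (rule lborel_pair.Fubini'[symmetric]) (simp add: split_beta')
 also have "... = (NI x. NI \<eta>. ?q x \<eta>)"
 proof (rule nn_integral_cong)
  fix x :: "real^'n"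
  show "(NI y. F y x) = (NI \<eta>. ?q x \<eta>)"
  proof (cases "x \<in> H")
   case True
   then show ?thesis using sub[OF True, of "\<lambda>y. F y x"] by (simp add: p)
  next
   case False
   then have Z: "a * ennreal (jj \<eta>) * indicator S (x \<odot> \<eta>) = 0" for \<eta> a
    using SH[of "x \<odot> \<eta>"] by (cases "\<eta> \<in> H") (auto simp: gmul_halfsp_iff jj_zero indicator_def)
   show ?thesis unfolding Z using False by (simp add: F_def)
  qed
 qed
 also have "... = (NI \<eta>. NI x. ?q x \<eta>)"
  by (rule lborel_pair.Fubini'[symmetric]) (simp add: split_beta')
 \<comment> \<open>For fixed \<open>\<eta>\<close> the set of \<open>x\<close> with
   \<open>x \<odot> \<eta>\<close> in \<open>S\<close> has measure \<open>c\<close> divided by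
   \<open>\<eta> $ k\<close>, which lowers the exponent from \<alpha> to \<alpha> - 1.\<close>
 also have "... = (NI \<eta>. c * (ennreal (\<eta> $ k powr (\<alpha> - 1)) * g (ginv k \<eta>) * ennreal (jj \<eta>)))"
 proof (rule nn_integral_cong)
  fix \<eta> :: "real^'n"
  show "(NI x. ?q x \<eta>)
    = c * (ennreal (\<eta> $ k powr (\<alpha> - 1)) * g (ginv k \<eta>) * ennreal (jj \<eta>))"
  proof (cases "\<eta> \<in> H")
   case True
   then have t: "0 < \<eta> $ k" by (simp add: halfsp_def)
   have "c = ennreal (\<eta> $ k) * (NI x. indicator S (x \<odot> \<eta>))"
    using nn_integral_gmul_left[OF True, of "indicator S"] by (simp add: c_def)
   moreover have "ennreal (\<eta> $ k powr \<alpha>) = ennreal (\<eta> $ k powr (\<alpha> - 1)) * ennreal (\<eta> $ k)"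
    using t by (simp add: ennreal_mult[symmetric] powr_diff)
   ultimately show ?thesis by (subst nn_integral_cmult) (simp_all add: mult_ac)
  qed (simp add: jj_zero)
 qed
 also have "... = c * (NI \<eta>. ennreal (\<eta> $ k powr (\<alpha> - 1)) * g (ginv k \<eta>) * ennreal (jj \<eta>))"
  by (rule nn_integral_cmult) auto
 finally show ?thesis using I1 c by (auto simp: ennreal_mult_cancel_left)
qed

end

lemma bochner_of_nn_bound:
 fixes f :: "'a => real"
 assumes "f \<in> borel_measurable M" "\<And>x. 0 <= f x" "(\<integral>\<^sup>+x. ennreal (f x) \<partial>M) <= ennreal C" "0 <= C"
 shows "integrable M f" "integral\<^sup>L M f <= C"
proof -
 have "(\<integral>\<^sup>+x. ennreal (f x) \<partial>M) < \<infinity>" using assms(3) by (rule le_less_trans) simp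
 then show i: "integrable M f" using assms by (intro integrableI_nonneg) auto
 have "ennreal (integral\<^sup>L M f) = (\<integral>\<^sup>+x. ennreal (f x) \<partial>M)"
  using i assms by (intro nn_integral_eq_integral[symmetric]) auto
 then show "integral\<^sup>L M f <= C" using assms(3,4) by (metis ennreal_le_iff)
qed

lemma nn_integral_translate:
 fixes f :: "'a::euclidean_space => ennreal"
 assumes [measurable]: "bmeas f"
 shows "(NI x. f (x - c)) = (NI x. f x)"
proof -
 have "(lborel :: 'a measure) = distr lborel borel (\<lambda>x. - c + x)"
  using lborel_affine[of 1 "- c"] by (simp add: density_1)
 then have "(NI x. f x) = (\<integral>\<^sup>+x. f x \<partial>distr lborel borel (\<lambda>x. - c + x))" by simp
 also have "... = (NI x. f (- c + x))" by (rule nn_integral_distr) auto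
 finally show ?thesis by simp
qed

context bkernel begin

lemma jj_int:
 fixes f \<phi> :: "real^'n => real"
 assumes [measurable]: "bmeas f" "\<phi> \<in> borel_measurable borel" and f: "\<And>\<eta>. 0 <= f \<eta>"
  and le: "\<And>\<eta>. f \<eta> * jj \<eta> <= CB * \<phi> (\<eta> - e)" and \<phi>: "\<And>z. 0 <= \<phi> z" "(NI z. ennreal (\<phi> z)) <= ennreal c" "0 <= c"
 shows "integrable lborel (\<lambda>\<eta>. f \<eta> * jj \<eta>) \<and> (LI \<eta>. f \<eta> * jj \<eta>) <= CB * c"
proof -
 have "(NI \<eta>. ennreal (f \<eta> * jj \<eta>)) <= (NI \<eta>. ennreal CB * ennreal (\<phi> (\<eta> - e)))"
  using CB \<phi>(1) le by (intro nn_integral_mono) (simp add: ennreal_mult[symmetric] ennreal_leI)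
 also have "... = ennreal CB * (NI \<eta>. ennreal (\<phi> (\<eta> - e)))" by (rule nn_integral_cmult) measurable
 also have "(NI \<eta>. ennreal (\<phi> (\<eta> - e))) = (NI z. ennreal (\<phi> z))" by (rule nn_integral_translate) measurable
 also have "ennreal CB * ... <= ennreal (CB * c)" using \<phi>(2,3) CB by (simp add: ennreal_mult mult_left_mono)
 finally show ?thesis using bochner_of_nn_bound[of "\<lambda>\<eta>. f \<eta> * jj \<eta>" lborel "CB * c"] f CB \<phi>(3) jj_nonneg by auto
qed

abbreviation "farset \<kappa> \<equiv> H - nearset k \<kappa>"
abbreviation near :: "real => real^'n => real" where "near \<kappa> \<equiv> indicator (nearset k \<kappa>)"
abbreviation far :: "real => real^'n => real" where "far \<kappa> \<equiv> indicator (farset \<kappa>)"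
abbreviation near_q :: "real => real^'n => real" where "near_q \<kappa> \<eta> \<equiv> near \<kappa> \<eta> * (norm (\<eta> - e))^2 * jj \<eta>"

text \<open>The squared distance compensates the singularity because \<alpha> < 2. The rate in
  \<kappa> is recorded since the interior barrier shrinks the near set in proportion to the inverse
  height.\<close>

lemma near_int:
 "\<exists>C\<ge>0. \<forall>\<kappa>. 0 < \<kappa> \<and> \<kappa> <= 1/2 -->
   integrable lborel (near_q \<kappa>) \<and>
   (LI \<eta>. near_q \<kappa> \<eta>) <= C * \<kappa> powr (2 - \<alpha>)"
proof -
 obtain C1 where C1: "C1 \<ge> 0" "\<And>\<sigma>. \<sigma> > 0 ==> (NI (z::real^'n). indicator {z. norm z < \<sigma>} z * ennreal (norm z powr ((2 - \<alpha>) - real CARD('n)))) <= ennreal (C1 * \<sigma> powr (2 - \<alpha>))"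
  using nn_integral_radial_inner[of "2 - \<alpha>", where 'n='n] alpha by auto
 have "integrable lborel (near_q \<kappa>) \<and>
   (LI \<eta>. near_q \<kappa> \<eta>) <= (CB * (C1 * 2 powr (2 - \<alpha>))) * \<kappa> powr (2 - \<alpha>)"
  if \<kappa>: "0 < \<kappa>" "\<kappa> <= 1/2" for \<kappa>
 proof -
  have e: "(CB * (C1 * 2 powr (2 - \<alpha>))) * \<kappa> powr (2 - \<alpha>) = CB * (C1 * (2 * \<kappa>) powr (2 - \<alpha>))"
   using \<kappa> by (simp add: powr_mult)
  show ?thesis unfolding e
  proof (rule jj_int[where \<phi>="\<lambda>z. indicator {z. norm z < 2 * \<kappa>} z * norm z powr ((2 - \<alpha>) - d)"])
  show "near_q \<kappa> \<eta> <= CB * (indicator {z. norm z < 2 * \<kappa>} (\<eta> - e) * norm (\<eta> - e) powr ((2 - \<alpha>) - d))" for \<eta>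
  proof (cases "\<eta> \<in> nearset k \<kappa> \<and> \<eta> \<noteq> e")
   case True
   have "(norm (\<eta> - e))^2 * jj \<eta> <= (norm (\<eta> - e))^2 * (CB * norm (\<eta> - e) powr (- (d + \<alpha>)))"
    by (intro mult_left_mono jj_bound) auto
   moreover have "norm (\<eta> - e) powr ((2 - \<alpha>) - d) = (norm (\<eta> - e))^2 * norm (\<eta> - e) powr (- (d + \<alpha>))"
    using True powr_add[of "norm (\<eta> - e)" 2 "- (d + \<alpha>)"] by (simp add: algebra_simps)
   ultimately show ?thesis using True nearset_bounds(1)[OF \<kappa>, of \<eta> k] by (simp add: mult.left_commute)
  next
   case False then show ?thesis using CB by (cases "\<eta> = e") auto
  qed
  show "(NI (z::real^'n). ennreal (indicator {z. norm z < 2 * \<kappa>} z * norm z powr ((2 - \<alpha>) - d))) <= ennreal (C1 * (2 * \<kappa>) powr (2 - \<alpha>))"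
   using C1(2)[of "2 * \<kappa>"] \<kappa> by (simp add: d_eq ennreal_mult ennreal_indicator)
  qed (use C1(1) in auto)
 qed
 moreover have "0 <= CB * (C1 * 2 powr (2 - \<alpha>))" using CB C1(1) by simp
 ultimately show ?thesis by blast
qed


text \<open>Used with \<open>s = 0\<close> and \<open>s = 1\<close>; the latter is where \<alpha> >
  1 gives the far jumps a finite first moment.\<close>

lemma far_int:
 assumes s: "s < \<alpha>"
 shows "\<exists>C\<ge>0. \<forall>\<kappa>. 0 < \<kappa> \<and> \<kappa> <= 1/2 -->
   integrable lborel (\<lambda>\<eta>. far \<kappa> \<eta> * norm (\<eta> - e) powr s * jj \<eta>) \<and>
   (LI \<eta>. far \<kappa> \<eta> * norm (\<eta> - e) powr s * jj \<eta>) <= C * \<kappa> powr (s - \<alpha>)"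
proof -
 obtain C1 where C1: "C1 \<ge> 0" "\<And>\<sigma>. \<sigma> > 0 ==> (NI (z::real^'n). indicator {z. \<sigma> <= norm z} z * ennreal (norm z powr (- (real CARD('n) + (\<alpha> - s))))) <= ennreal (C1 * \<sigma> powr (- (\<alpha> - s)))"
  using nn_integral_radial_outer[of "\<alpha> - s", where 'n='n] s by auto
 have "integrable lborel (\<lambda>\<eta>. far \<kappa> \<eta> * norm (\<eta> - e) powr s * jj \<eta>) \<and>
   (LI \<eta>. far \<kappa> \<eta> * norm (\<eta> - e) powr s * jj \<eta>) <= (CB * (C1 * (1/2) powr (s - \<alpha>))) * \<kappa> powr (s - \<alpha>)"
  if \<kappa>: "0 < \<kappa>" "\<kappa> <= 1/2" for \<kappa>
 proof -
  have e: "(CB * (C1 * (1/2) powr (s - \<alpha>))) * \<kappa> powr (s - \<alpha>) = CB * (C1 * (\<kappa> / 2) powr (- (\<alpha> - s)))"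
   using \<kappa> by (simp add: powr_mult[symmetric])
  show ?thesis unfolding e
  proof (rule jj_int[where \<phi>="\<lambda>z. indicator {z. \<kappa> / 2 <= norm z} z * norm z powr (- (d + (\<alpha> - s)))"])
  show "far \<kappa> \<eta> * norm (\<eta> - e) powr s * jj \<eta> <= CB * (indicator {z. \<kappa> / 2 <= norm z} (\<eta> - e) * norm (\<eta> - e) powr (- (d + (\<alpha> - s))))" for \<eta>
  proof (cases "\<eta> \<in> farset \<kappa>")
   case True
   have "norm (\<eta> - e) powr s * jj \<eta> <= norm (\<eta> - e) powr s * (CB * norm (\<eta> - e) powr (- (d + \<alpha>)))"
    by (intro mult_left_mono jj_bound) auto
   also have "... = CB * (norm (\<eta> - e) powr s * norm (\<eta> - e) powr (- (d + \<alpha>)))" by simp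
   also have "... = CB * norm (\<eta> - e) powr (- (d + (\<alpha> - s)))" by (simp add: powr_add[symmetric] algebra_simps)
   finally show ?thesis using True farset_bound[OF \<kappa>, of \<eta> k] by simp
  qed (use CB in auto)
  show "(NI (z::real^'n). ennreal (indicator {z. \<kappa> / 2 <= norm z} z * norm z powr (- (d + (\<alpha> - s))))) <= ennreal (C1 * (\<kappa> / 2) powr (- (\<alpha> - s)))"
   using C1(2)[of "\<kappa> / 2"] \<kappa> by (simp add: d_eq ennreal_mult ennreal_indicator)
  qed (use C1(1) in auto)
 qed
 moreover have "0 <= CB * (C1 * (1/2) powr (s - \<alpha>))" using CB C1(1) by simp
 ultimately show ?thesis by blast
qed

lemma far_int0:
 "\<exists>C\<ge>0. \<forall>\<kappa>. 0 < \<kappa> \<and> \<kappa> <= 1/2 -->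
   integrable lborel (\<lambda>\<eta>. far \<kappa> \<eta> * jj \<eta>) \<and>
   (LI \<eta>. far \<kappa> \<eta> * jj \<eta>) <= C * \<kappa> powr (- \<alpha>)"
proof -
 have "(\<lambda>\<eta>. far \<kappa> \<eta> * norm (\<eta> - e) powr 0 * jj \<eta>) = (\<lambda>\<eta>. far \<kappa> \<eta> * jj \<eta>)" if "0 < \<kappa>" for \<kappa>
  using that by (auto simp: fun_eq_iff nearset_def indicator_def)
 then show ?thesis using far_int[of 0] alpha by simp
qed

lemma integral_jj_ginv:
 fixes g :: "real^'n => real"
 assumes [measurable]: "bmeas g" and g: "\<And>\<eta>. 0 <= g \<eta>"
  and i: "integrable lborel (\<lambda>\<eta>. g \<eta> * jj \<eta>)"
 shows "integrable lborel (\<lambda>\<eta>. \<eta> $ k powr (\<alpha> - 1) * g (ginv k \<eta>) * jj \<eta>)"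
  and "(LI \<eta>. \<eta> $ k powr (\<alpha> - 1) * g (ginv k \<eta>) * jj \<eta>) = (LI \<eta>. g \<eta> * jj \<eta>)"
proof -
 have eq: "(NI \<eta>. ennreal (\<eta> $ k powr (\<alpha> - 1) * g (ginv k \<eta>) * jj \<eta>)) = (NI \<eta>. ennreal (g \<eta> * jj \<eta>))"
  using nn_integral_jj_ginv[of "\<lambda>\<eta>. ennreal (g \<eta>)"] g by (simp add: ennreal_mult jj_nonneg mult.assoc)
 have "(NI \<eta>. ennreal (g \<eta> * jj \<eta>)) < \<infinity>"
  using i g by (subst nn_integral_eq_integral) (auto simp: jj_nonneg)
 then show "integrable lborel (\<lambda>\<eta>. \<eta> $ k powr (\<alpha> - 1) * g (ginv k \<eta>) * jj \<eta>)"
  using eq g by (intro integrableI_nonneg) (auto simp: jj_nonneg)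
 show "(LI \<eta>. \<eta> $ k powr (\<alpha> - 1) * g (ginv k \<eta>) * jj \<eta>) = (LI \<eta>. g \<eta> * jj \<eta>)"
  using g eq by (subst (1 2) integral_eq_nn_integral) (auto simp: jj_nonneg)
qed

text \<open>The weight is that of \<open>nn_integral_jj_ginv\<close>: against \<open>jj\<close> the
  two increments have formally equal integrals, and the factor 1/2 in \<open>Lop\<close> undoes the
  doubling.\<close>

definition Dop :: "(real^'n => real) => real^'n => real^'n => real" where
 "Dop u x \<eta> = u (x \<odot> \<eta>) - u x + \<eta> $ k powr (\<alpha> - 1) * (u (x \<odot> ginv k \<eta>) - u x)"

text \<open>The symmetrised difference \<open>Dop u x \<eta>\<close> is \<open>O(|\<eta> - e|^2)\<close> because the two points
 move in opposite directions, so no principal value is needed.\<close>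
definition Lop :: "(real^'n => real) => real^'n => real" where
 "Lop u x = x $ k powr (- \<alpha>) / 2 * (LI \<eta>. Dop u x \<eta> * jj \<eta>)"

lemma Dop_meas [measurable (raw)]:
 assumes [measurable]: "bmeas u" "f \<in> borel_measurable M" "g \<in> borel_measurable M"
 shows "(\<lambda>w. Dop u (f w) (g w)) \<in> borel_measurable M"
 unfolding Dop_def by measurable

text \<open>The majorant of \<open>Dop u x \<eta> * jj \<eta>\<close> up to a factor depending on
  \<open>u\<close> and on the height of \<open>x\<close>. The two far terms dominate the two
  increments of \<open>Dop\<close>.\<close>

definition Gf :: "real^'n => real" where
 "Gf \<eta> = (near (1/2) \<eta> * (norm (\<eta> - e))^2 + far (1/2) \<eta> * (1 + \<eta> $ k powr (\<alpha> - 1))) * jj \<eta>"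

lemma Gf_nonneg: "0 <= Gf \<eta>" by (simp add: Gf_def jj_nonneg)

lemma Gf_integrable: "integrable lborel Gf"
proof -
 have 1: "integrable lborel (near_q (1/2))"
  using near_int by auto
 have 2: "integrable lborel (\<lambda>\<eta>. far (1/2) \<eta> * jj \<eta>)" using far_int0 by auto
 \<comment> \<open>The term with weight \<open>\<eta> $ k powr (\<alpha> - 1)\<close> needs no
   estimate of its own: inversion preserves the far set and turns the unweighted integral into
   it.\<close>
 have "integrable lborel (\<lambda>\<eta>. \<eta> $ k powr (\<alpha> - 1) * indicator (farset (1/2)) (ginv k \<eta>) * jj \<eta>)"
  using 2 by (intro integral_jj_ginv) auto
 moreover have "(\<lambda>\<eta>. \<eta> $ k powr (\<alpha> - 1) * indicator (farset (1/2)) (ginv k \<eta>) * jj \<eta>) = (\<lambda>\<eta>. far (1/2) \<eta> * \<eta> $ k powr (\<alpha> - 1) * jj \<eta>)"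
 proof
  fix \<eta>
  show "\<eta> $ k powr (\<alpha> - 1) * indicator (farset (1/2)) (ginv k \<eta>) * jj \<eta> = far (1/2) \<eta> * \<eta> $ k powr (\<alpha> - 1) * jj \<eta>"
   by (cases "\<eta> \<in> H") (simp_all add: indicator_def ginv_nearset ginv_halfsp jj_zero)
 qed
 ultimately have 3: "integrable lborel (\<lambda>\<eta>. far (1/2) \<eta> * \<eta> $ k powr (\<alpha> - 1) * jj \<eta>)" by simp
 have "Gf = (\<lambda>\<eta>. near_q (1/2) \<eta> + (far (1/2) \<eta> * jj \<eta> + far (1/2) \<eta> * \<eta> $ k powr (\<alpha> - 1) * jj \<eta>))"
  by (auto simp: Gf_def fun_eq_iff algebra_simps)
 then show ?thesis using 1 2 3 by simp
qed

lemma powr_near: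
 assumes t: "1/4 <= t" "t <= (2::real)"
 shows "\<bar>1 - t powr (\<alpha> - 2)\<bar> <= 16 * \<bar>t - 1\<bar>" "t powr (\<alpha> - 3) <= 16"
proof -
 have 16: "s powr (\<alpha> - 3) <= 16" if "1/4 <= s" for s :: real
 proof -
  have "s powr (\<alpha> - 3) <= (1/4) powr (\<alpha> - 3)" using that alpha by (intro powr_mono2') auto
  also have "... = 4 powr (3 - \<alpha>)" by (simp add: powr_divide powr_minus_divide[symmetric])
  also have "... <= 4 powr 2" using alpha by (intro powr_mono) auto
  finally show ?thesis by simp
 qed
 then show "t powr (\<alpha> - 3) <= 16" using t by simp
 have "norm (t powr (\<alpha> - 2) - 1 powr (\<alpha> - 2)) <= 16 * norm (t - 1)"
 proof (rule differentiable_bound[where S="{1/4..2}"])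
  fix s :: real assume s: "s \<in> {1/4..2}"
  have "((\<lambda>t. t powr (\<alpha> - 2)) has_real_derivative (\<alpha> - 2) * s powr (\<alpha> - 3)) (at s)"
   using has_real_derivative_powr[of s "\<alpha> - 2"] s by simp
  then show "((\<lambda>t. t powr (\<alpha> - 2)) has_derivative (\<lambda>v. ((\<alpha> - 2) * s powr (\<alpha> - 3)) * v)) (at s within {1/4..2})"
   by (simp add: has_field_derivative_def has_derivative_at_withinI)
  show "onorm (\<lambda>v. ((\<alpha> - 2) * s powr (\<alpha> - 3)) * v) <= 16"
  proof (rule onorm_le)
   fix v :: real
   have "\<bar>\<alpha> - 2\<bar> * s powr (\<alpha> - 3) <= 1 * 16" using 16[of s] s alpha by (intro mult_mono) auto
   then show "norm ((\<alpha> - 2) * s powr (\<alpha> - 3) * v) <= 16 * norm v"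
    by (simp add: abs_mult mult_right_mono)
  qed
 qed (use t in auto)
 then show "\<bar>1 - t powr (\<alpha> - 2)\<bar> <= 16 * \<bar>t - 1\<bar>" by (simp add: abs_minus_commute)
qed

lemma gmul_eq: "x \<odot> \<eta> = x + (x $ k) *\<^sub>R (\<eta> - e)" by (simp add: gmul_def)

lemma gmul_ginv_eq: "x \<odot> ginv k \<eta> = x - (x $ k / \<eta> $ k) *\<^sub>R (\<eta> - e)"
 by (simp add: gmul_def ginv_minus_ek)

text \<open>To first order the two moves are \<open>z\<close> and \<open>- z / t\<close>, so the
  gradient terms combine to \<open>g x \<bullet> z * (1 - t powr (\<alpha> - 2))\<close>. Both
  factors are of order |\<eta> - e|, so the product is quadratic like the Taylor remainders.\<close>

lemma Dop_bound:
 assumes u: "taylor2 M u" and x: "x \<in> H" and \<eta>: "\<eta> \<in> H"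
 shows "\<bar>Dop u x \<eta> * jj \<eta>\<bar> <= M * (17 * (x $ k + (x $ k)^2) + 2) * Gf \<eta>"
proof -
 from u obtain g where M: "0 <= M" and uM: "\<And>x. \<bar>u x\<bar> <= M"
  and g: "\<And>x z. \<bar>g x \<bullet> z\<bar> <= M * norm z" "\<And>x z. \<bar>u (x + z) - u x - g x \<bullet> z\<bar> <= M * (norm z)^2"
  unfolding taylor2_def by blast
 define s where "s = x $ k"
 define t where "t = \<eta> $ k"
 define q where "q = \<eta> - e"
 have s: "s > 0" and t: "t > 0" using x \<eta> by (auto simp: halfsp_def s_def t_def)
 have "\<bar>Dop u x \<eta>\<bar> <= M * (17 * (s + s^2) + 2) * (near (1/2) \<eta> * (norm q)^2 + far (1/2) \<eta> * (1 + t powr (\<alpha> - 1)))"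
 proof (cases "\<eta> \<in> nearset k (1/2)")
  case True
  have tb: "1/4 <= t" "t <= 2" using nearset_bounds[OF _ _ True] by (auto simp: t_def)
  define z where "z = s *\<^sub>R q"
  define E1 where "E1 = u (x + z) - u x - g x \<bullet> z"
  define E2 where "E2 = u (x + (- (1/t)) *\<^sub>R z) - u x - g x \<bullet> ((- (1/t)) *\<^sub>R z)"
  have E1: "\<bar>E1\<bar> <= M * (norm z)^2" unfolding E1_def by (rule g(2))
  have "\<bar>E2\<bar> <= M * (norm ((- (1/t)) *\<^sub>R z))^2" unfolding E2_def by (rule g(2))
  then have E2: "\<bar>E2\<bar> <= M * ((norm z)^2 / t^2)" using t by (simp add: power_divide)
  have "Dop u x \<eta> = g x \<bullet> z * (1 - t powr (\<alpha> - 1) / t) + E1 + t powr (\<alpha> - 1) * E2"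
   unfolding Dop_def gmul_ginv_eq
   unfolding E1_def E2_def gmul_eq z_def q_def s_def t_def
   by (simp add: inner_scaleR_right algebra_simps)
  also have "t powr (\<alpha> - 1) / t = t powr (\<alpha> - 2)" using t by (simp add: powr_diff power2_eq_square)
  finally have D: "Dop u x \<eta> = g x \<bullet> z * (1 - t powr (\<alpha> - 2)) + E1 + t powr (\<alpha> - 1) * E2" .
  have nz: "norm z = s * norm q" using s by (simp add: z_def)
  have "\<bar>g x \<bullet> z * (1 - t powr (\<alpha> - 2))\<bar> <= (M * norm z) * (16 * norm q)"
   unfolding abs_mult
   using powr_near(1)[OF tb] abs_nth_sub_1_le[of \<eta> k] M
   by (intro mult_mono g(1)) (auto simp: t_def q_def)
  then have b1: "\<bar>g x \<bullet> z * (1 - t powr (\<alpha> - 2))\<bar> <= 16 * M * s * (norm q)^2"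
   by (simp add: nz power2_eq_square mult_ac)
  have "\<bar>t powr (\<alpha> - 1) * E2\<bar> <= t powr (\<alpha> - 1) * (M * ((norm z)^2 / t^2))"
   using mult_left_mono[OF E2, of "t powr (\<alpha> - 1)"] by (simp only: abs_mult) simp
  also have "... = t powr (\<alpha> - 3) * (M * (norm z)^2)"
  proof -
   have "t powr (\<alpha> - 3) = t powr (\<alpha> - 1) / t powr 2" by (simp add: powr_diff[symmetric])
   then show ?thesis using t by simp
  qed
  also have "... <= 16 * (M * (norm z)^2)" using powr_near(2)[OF tb] M by (intro mult_right_mono) auto
  finally have b2: "\<bar>t powr (\<alpha> - 1) * E2\<bar> <= 16 * M * s^2 * (norm q)^2"
   by (simp add: nz power_mult_distrib mult_ac)
  have b3: "\<bar>E1\<bar> <= M * s^2 * (norm q)^2" using E1 by (simp add: nz power_mult_distrib mult_ac)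
  have "\<bar>Dop u x \<eta>\<bar> <= 16 * M * s * (norm q)^2 + M * s^2 * (norm q)^2 + 16 * M * s^2 * (norm q)^2"
   unfolding D using b1 b2 b3 by linarith
  \<comment> \<open>The slack lets one constant serve both the near case and the far case, where
    \<open>2 * M\<close> bounds each increment.\<close>
  also have "... <= 16 * M * s * (norm q)^2 + M * s^2 * (norm q)^2 + 16 * M * s^2 * (norm q)^2 + (M * s * (norm q)^2 + 2 * M * (norm q)^2)"
   using M s by simp
  also have "... = M * (17 * (s + s^2) + 2) * (norm q)^2" by (simp add: algebra_simps)
  finally show ?thesis using True by simp
 next
  case False
  have "\<bar>Dop u x \<eta>\<bar> <= \<bar>u (x \<odot> \<eta>) - u x\<bar> + t powr (\<alpha> - 1) * \<bar>u (x \<odot> ginv k \<eta>) - u x\<bar>"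
   unfolding Dop_def t_def by (rule order_trans[OF abs_triangle_ineq]) (simp add: abs_mult)
  also have "... <= 2 * M + t powr (\<alpha> - 1) * (2 * M)"
   using uM[of x] uM[of "x \<odot> \<eta>"] uM[of "x \<odot> ginv k \<eta>"] by (intro add_mono mult_left_mono) auto
  also have "... = 2 * M * (1 + t powr (\<alpha> - 1))" by (simp add: algebra_simps)
  also have "... <= M * (17 * (s + s^2) + 2) * (1 + t powr (\<alpha> - 1))"
   using M s by (intro mult_right_mono) (auto simp: algebra_simps)
  finally show ?thesis using False \<eta> by simp
 qed
 then have "\<bar>Dop u x \<eta>\<bar> * jj \<eta> <= M * (17 * (s + s^2) + 2) * (near (1/2) \<eta> * (norm q)^2 + far (1/2) \<eta> * (1 + t powr (\<alpha> - 1))) * jj \<eta>"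
  using jj_nonneg by (intro mult_right_mono)
 then show ?thesis using jj_nonneg[of \<eta>] by (simp add: Gf_def abs_mult q_def t_def s_def mult.assoc)
qed

lemma Dop_bound':
 assumes u: "taylor2 M u" and x: "x \<in> H"
 shows "\<bar>Dop u x \<eta> * jj \<eta>\<bar> <= M * (17 * (x $ k + (x $ k)^2) + 2) * Gf \<eta>"
proof (cases "\<eta> \<in> H")
 case True then show ?thesis using Dop_bound[OF u x] by simp
qed (simp add: jj_zero Gf_def)

lemma Dop_integrable:
 assumes u: "taylor2 M u" "bmeas u" and x: "x \<in> H"
 shows "integrable lborel (\<lambda>\<eta>. Dop u x \<eta> * jj \<eta>)"
 by (rule Bochner_Integration.integrable_bound[OF integrable_mult_right[OF Gf_integrable, of "M * (17 * (x $ k + (x $ k)^2) + 2)"]])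
   (use Dop_bound'[OF u(1) x] u(2) in \<open>auto intro: order_trans[OF _ abs_ge_self]\<close>)

lemma Lop_bound:
 assumes u: "taylor2 M u" "bmeas u" and x: "x \<in> H"
 shows "\<bar>Lop u x\<bar> <= x $ k powr (- \<alpha>) / 2 * (M * (17 * (x $ k + (x $ k)^2) + 2) * integral\<^sup>L lborel Gf)"
proof -
 have "\<bar>(LI \<eta>. Dop u x \<eta> * jj \<eta>)\<bar> <= (LI \<eta>. M * (17 * (x $ k + (x $ k)^2) + 2) * Gf \<eta>)"
  by (rule order_trans[OF integral_abs_bound])
    (intro integral_mono integrable_abs Dop_integrable[OF u x] integrable_mult_right Gf_integrable Dop_bound'[OF u(1) x])
 also have "... = M * (17 * (x $ k + (x $ k)^2) + 2) * integral\<^sup>L lborel Gf" by (rule integral_mult_right_zero)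
 finally show ?thesis by (simp add: Lop_def abs_mult mult_left_mono)
qed

lemma Lop_continuous:
 assumes u: "taylor2 M u" "continuous_on UNIV u"
 shows "continuous_on H (Lop u)"
proof (rule continuous_on_sequentiallyI)
 fix X :: "nat => real^'n" and a assume X: "\<forall>n. X n \<in> H" and a: "a \<in> H" and lim: "X \<longlonglongrightarrow> a"
 have [measurable]: "bmeas u" using u(2) by (rule borel_measurable_continuous_onI)
 have limk: "(\<lambda>n. X n $ k) \<longlonglongrightarrow> a $ k" using lim by (intro tendsto_intros)
 then have "Bseq (\<lambda>n. X n $ k)" by (intro convergent_imp_Bseq) (auto simp: convergent_def)
 then obtain S where S: "\<And>n. \<bar>X n $ k\<bar> <= S" unfolding Bseq_def by auto
 have S0: "0 <= S" using S[of 0] by linarith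
 have M: "0 <= M" using u(1) by (simp add: taylor2_def)
 have ul: "(\<lambda>n. u (f n)) \<longlonglongrightarrow> u b" if "f \<longlonglongrightarrow> b" for f b
  using continuous_on_tendsto_compose[OF u(2) that] by simp
 have "(\<lambda>n. (LI \<eta>. Dop u (X n) \<eta> * jj \<eta>)) \<longlonglongrightarrow> (LI \<eta>. Dop u a \<eta> * jj \<eta>)"
 proof (rule integral_dominated_convergence[where w="\<lambda>\<eta>. M * (17 * (S + S^2) + 2) * Gf \<eta>"])
  show "integrable lborel (\<lambda>\<eta>. M * (17 * (S + S^2) + 2) * Gf \<eta>)" using Gf_integrable by simp
  show "AE \<eta> in lborel. (\<lambda>n. Dop u (X n) \<eta> * jj \<eta>) \<longlonglongrightarrow> Dop u a \<eta> * jj \<eta>"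
   unfolding Dop_def gmul_def by (intro AE_I2 tendsto_intros ul lim limk)
  fix n
  have Xk: "0 < X n $ k" using X by (simp add: halfsp_def)
  show "AE \<eta> in lborel. norm (Dop u (X n) \<eta> * jj \<eta>) <= M * (17 * (S + S^2) + 2) * Gf \<eta>"
  proof (rule AE_I2)
   fix \<eta>
   have "norm (Dop u (X n) \<eta> * jj \<eta>) <= M * (17 * (X n $ k + (X n $ k)^2) + 2) * Gf \<eta>"
    using Dop_bound'[OF u(1)] X by simp
   also have "... <= M * (17 * (S + S^2) + 2) * Gf \<eta>"
   proof (intro mult_right_mono mult_left_mono Gf_nonneg M add_right_mono add_mono)
    show "X n $ k <= S" using S[of n] by linarith
    then show "(X n $ k)^2 <= S^2" using Xk by (intro power_mono) auto
   qed auto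
   finally show "norm (Dop u (X n) \<eta> * jj \<eta>) <= M * (17 * (S + S^2) + 2) * Gf \<eta>" .
  qed
 qed auto
 moreover have "(\<lambda>n. X n $ k powr (- \<alpha>)) \<longlonglongrightarrow> a $ k powr (- \<alpha>)"
  using a by (intro tendsto_powr limk tendsto_const) (auto simp: halfsp_def)
 ultimately show "(\<lambda>n. Lop u (X n)) \<longlonglongrightarrow> Lop u a"
  unfolding Lop_def by (intro tendsto_mult tendsto_divide tendsto_const) auto
qed

text \<open>At a zero of a nonnegative \<open>u\<close> both summands of \<open>Dop\<close> are
  nonnegative, hence separately integrable, and inversion makes their integrals equal; the generator
  becomes the plain jump integral.\<close>

lemma Lop_zero:
 assumes u: "taylor2 M u" "bmeas u" and x: "x \<in> H" and nn: "\<And>y. 0 <= u y" and ux: "u x = 0"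
 shows "Lop u x = (LI y. indicator H y * (u y * J x y))"
proof -
 note u(2)[measurable]
 have xk: "x $ k > 0" using x by (simp add: halfsp_def)
 define f where "f \<eta> = u (x \<odot> \<eta>)" for \<eta>
 have [measurable]: "bmeas f" unfolding f_def by measurable
 have D: "Dop u x \<eta> = f \<eta> + \<eta> $ k powr (\<alpha> - 1) * f (ginv k \<eta>)" for \<eta>
  by (simp add: Dop_def f_def ux)
 have f0: "0 <= f \<eta>" for \<eta> by (simp add: f_def nn)
 have i: "integrable lborel (\<lambda>\<eta>. f \<eta> * jj \<eta>)"
  by (rule Bochner_Integration.integrable_bound[OF Dop_integrable[OF u x]])
    (auto simp: D f0 jj_nonneg intro!: mult_right_mono)
 note 2 = integral_jj_ginv[OF _ f0 i, simplified]
 have "(LI \<eta>. Dop u x \<eta> * jj \<eta>) = (LI \<eta>. f \<eta> * jj \<eta> + \<eta> $ k powr (\<alpha> - 1) * f (ginv k \<eta>) * jj \<eta>)"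
  by (simp add: D ring_distribs)
 also have "... = 2 * (LI \<eta>. f \<eta> * jj \<eta>)"
  using i 2 by simp
 finally have L: "Lop u x = x $ k powr (- \<alpha>) * (LI \<eta>. f \<eta> * jj \<eta>)" by (simp add: Lop_def)
 have "(LI y. indicator H y * (u y * J x y))
   = (x $ k) ^ CARD('n) * (LI \<eta>. indicator H (x \<odot> \<eta>) * (u (x \<odot> \<eta>) * J x (x \<odot> \<eta>)))"
  using x by (intro lebesgue_integral_gmul_right) auto
 also have "(\<lambda>\<eta>. indicator H (x \<odot> \<eta>) * (u (x \<odot> \<eta>) * J x (x \<odot> \<eta>))) = (\<lambda>\<eta>. x $ k powr (- (d + \<alpha>)) * (f \<eta> * jj \<eta>))"
 proof
  fix \<eta>
  show "indicator H (x \<odot> \<eta>) * (u (x \<odot> \<eta>) * J x (x \<odot> \<eta>)) = x $ k powr (- (d + \<alpha>)) * (f \<eta> * jj \<eta>)"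
  proof (cases "\<eta> \<in> H")
   case True then show ?thesis using J_gmul[OF x True] x by (simp add: gmul_halfsp f_def)
  next
   case False
   then have "x \<odot> \<eta> \<notin> H" using xk by (simp add: halfsp_def zero_less_mult_iff)
   then show ?thesis using False by (simp add: jj_zero)
  qed
 qed
 also have "(x $ k) ^ CARD('n) * (LI \<eta>. x $ k powr (- (d + \<alpha>)) * (f \<eta> * jj \<eta>)) = x $ k powr (- \<alpha>) * (LI \<eta>. f \<eta> * jj \<eta>)"
  by (subst integral_mult_right_zero) (simp only: mult.assoc[symmetric] powr_d_cancel[OF xk])
 finally show ?thesis using L by simp
qed

end

lemma Cc_inf_support:
 fixes u :: "real^'n::finite => real"
 assumes u: "u \<in> Cc_inf (halfsp k)"
 obtains K h R where "compact K" "K \<subseteq> halfsp k" "\<And>x. x \<notin> K ==> u x = 0" "0 < h" "1 <= R"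
  "\<And>x. x \<in> K ==> h <= x $ k" "\<And>x. x \<in> K ==> norm x <= R"
proof -
 define K where "K = closure {x. u x \<noteq> 0}"
 have K: "compact K" "K \<subseteq> halfsp k" using u by (auto simp: Cc_inf_def K_def)
 have z: "u x = 0" if "x \<notin> K" for x using that closure_subset[of "{x. u x \<noteq> 0}"] by (auto simp: K_def)
 obtain R0 where R0: "\<forall>x\<in>K. norm x <= R0" using compact_imp_bounded[OF K(1)] by (auto simp: bounded_iff)
 obtain h where h: "0 < h" "\<forall>x\<in>K. h <= x $ k"
 proof (cases "K = {}")
  case True then show ?thesis using that[of 1] by auto
 next
  case False
  have "continuous_on K (\<lambda>x. x $ k)" by (intro continuous_intros)
  then obtain a where "a \<in> K" "\<forall>y\<in>K. a $ k <= y $ k" using continuous_attains_inf[OF K(1) False] by blast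
  then show ?thesis using that[of "a $ k"] K(2) by (auto simp: halfsp_def)
 qed
 show ?thesis
  using K z h R0 by (intro that[of K h "max 1 R0"]) auto
qed

context bkernel begin

lemma compact_finite_lborel: "compact (K :: (real^'n) set) ==> emeasure lborel K < \<infinity>"
 using emeasure_bounded_finite[OF compact_imp_bounded[of K]] by simp

lemma decay_integrable: "integrable lborel (\<lambda>x::real^'n. (1 + norm x) powr (- (d + \<alpha>)))"
proof -
 obtain C1 where C1: "\<And>\<sigma>. \<sigma> > 0 ==> (NI (z::real^'n). indicator {z. \<sigma> <= norm z} z * ennreal (norm z powr (- (real CARD('n) + \<alpha>)))) <= ennreal (C1 * \<sigma> powr (- \<alpha>))"
  using nn_integral_radial_outer[of \<alpha>, where 'n='n] alpha by auto
 have da: "0 <= d + \<alpha>" using alpha by (simp add: d_eq)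
 have "(NI (x::real^'n). ennreal ((1 + norm x) powr (- (d + \<alpha>))))
   <= (NI (x::real^'n). indicator (cball 0 1) x + indicator {z. 1 <= norm z} x * ennreal (norm x powr (- (d + \<alpha>))))"
 proof (rule nn_integral_mono)
  fix x :: "real^'n"
  show "ennreal ((1 + norm x) powr (- (d + \<alpha>))) <= indicator (cball 0 1) x + indicator {z. 1 <= norm z} x * ennreal (norm x powr (- (d + \<alpha>)))"
  proof (cases "1 <= norm x")
   case True
   have "(1 + norm x) powr (- (d + \<alpha>)) <= norm x powr (- (d + \<alpha>))"
    using True da by (intro powr_mono2') auto
   then have "ennreal ((1 + norm x) powr (- (d + \<alpha>))) <= ennreal (norm x powr (- (d + \<alpha>)))" by (rule ennreal_leI)
   also have "... <= indicator (cball 0 1) x + ennreal (norm x powr (- (d + \<alpha>)))" by (simp add: add_increasing)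
   finally show ?thesis using True by simp
  next
   case False
   have "(1 + norm x) powr (- (d + \<alpha>)) <= 1 powr (- (d + \<alpha>))"
    using da by (intro powr_mono2') auto
   then show ?thesis using False by (simp add: ennreal_leI[where y=1, simplified])
  qed
 qed
 also have "... = emeasure lborel (cball (0::real^'n) 1) + (NI (x::real^'n). indicator {z. 1 <= norm z} x * ennreal (norm x powr (- (d + \<alpha>))))"
  by (subst nn_integral_add) (auto intro!: borel_measurable_indicator)
 also have "... < \<infinity>"
  using C1[of 1] emeasure_lborel_cball_finite[of "0::real^'n" 1]
  by (auto simp: d_eq intro: le_less_trans)
 finally show ?thesis by (intro integrableI_nonneg) auto
qed

text \<open>Near the support \<open>Lop_bound\<close> applies. Elsewhere \<open>u\<close> vanishes
  at \<open>x\<close>, and \<open>Lop_zero\<close> gives a jump integral over the support, whose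
  points are at distance at least a multiple of 1 + |x|. In particular \<open>Lop u\<close> stays
  bounded up to the boundary.\<close>

lemma Lop_decay:
 assumes u: "u \<in> Cc_inf H" and nn: "\<And>y. 0 <= u y"
 shows "\<exists>C\<ge>0. \<forall>x\<in>H. \<bar>Lop u x\<bar> <= C * (1 + norm x) powr (- (d + \<alpha>))"
proof -
 obtain M where M: "taylor2 M u" using Cc_inf_taylor2[OF u] by auto
 then have M0: "0 <= M" "\<And>x. u x <= M" using nn by (auto simp: taylor2_def)
 have [measurable]: "bmeas u" by (rule Cc_inf_borel[OF u])
 obtain K h R where K: "compact K" "K \<subseteq> H" "\<And>x. x \<notin> K ==> u x = 0" "0 < h" "1 <= R"
  "\<And>x. x \<in> K ==> h <= x $ k" "\<And>x. x \<in> K ==> norm x <= R" using Cc_inf_support[OF u] by blast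
 have [measurable]: "K \<in> sets borel" using K(1) by (simp add: compact_imp_closed borel_closed)
 have Kfin: "emeasure lborel K < \<infinity>" using compact_finite_lborel[OF K(1)] .
 have da: "0 <= d + \<alpha>" using alpha by (simp add: d_eq)
 define G where "G = integral\<^sup>L lborel Gf"
 have G: "0 <= G" unfolding G_def by (rule Bochner_Integration.integral_nonneg) (simp add: Gf_nonneg)
 define C1 where "C1 = (h/2) powr (- \<alpha>) / 2 * (M * (17 * (2*R + (2*R)^2) + 2) * G)"
 have C1: "0 <= C1" using M0 G K by (auto simp: C1_def)
 \<comment> \<open>The value 1/4 serves points of norm above \<open>2 * R\<close>; the other value
   serves points below half the minimal height of the support.\<close>
 define c0 where "c0 = min (1/4) (h / 2 / (1 + 2 * R))"
 have c0: "0 < c0" using K by (simp add: c0_def)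
 have c0_le: "c0 <= 1/4" "c0 <= h / 2 / (1 + 2 * R)" unfolding c0_def by (rule min.cobounded1 min.cobounded2)+
 define C2 where "C2 = M * CB * c0 powr (- (d + \<alpha>)) * measure lborel K"
 have C2: "0 <= C2" using M0 CB by (simp add: C2_def)
 define C where "C = C1 / (1 + 2 * R) powr (- (d + \<alpha>)) + C2"
 have C: "0 <= C" using C1 C2 by (simp add: C_def)
 show ?thesis
 proof (intro exI[of _ C] conjI C ballI)
  fix x assume x: "x \<in> H"
  have xk: "0 < x $ k" using x by (simp add: halfsp_def)
  define p where "p = (1 + norm x) powr (- (d + \<alpha>))"
  have p: "0 <= p" by (simp add: p_def)
  show "\<bar>Lop u x\<bar> <= C * (1 + norm x) powr (- (d + \<alpha>))"
  proof (cases "h / 2 <= x $ k \<and> norm x <= 2 * R")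
   case True
   have xR: "x $ k <= 2 * R" using True component_le_norm_cart[of x k] by linarith
   have "\<bar>Lop u x\<bar> <= x $ k powr (- \<alpha>) / 2 * (M * (17 * (x $ k + (x $ k)^2) + 2) * G)"
    unfolding G_def by (rule Lop_bound[OF M _ x]) simp
   also have "... <= C1" unfolding C1_def
    using True xk xR M0 G K(4) alpha
    by (intro mult_mono divide_right_mono mult_left_mono add_right_mono add_mono mult_right_mono power_mono powr_mono2' mult_nonneg_nonneg) auto
   also have "... <= C1 / (1 + 2 * R) powr (- (d + \<alpha>)) * p"
   proof -
    have "(1 + 2 * R) powr (- (d + \<alpha>)) <= p" unfolding p_def
     using True da K(5) by (intro powr_mono2') (auto intro: add_pos_nonneg)
    then have "1 <= p / (1 + 2 * R) powr (- (d + \<alpha>))" using K(5) by (simp add: le_divide_eq)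
    from mult_left_mono[OF this C1] show ?thesis by simp
   qed
   also have "... <= C * p" using p C2 by (intro mult_right_mono) (auto simp: C_def)
   finally show ?thesis by (simp add: p_def)
  next
   case False
   have xK: "x \<notin> K" using False K(4,5) K(6)[of x] K(7)[of x] by auto
   have far: "c0 * (1 + norm x) <= norm (x - y)" if y: "y \<in> K" for y
   proof (cases "norm x <= 2 * R")
    case True
    then have "x $ k < h / 2" using False by auto
    then have "h / 2 <= \<bar>x $ k - y $ k\<bar>" using K(6)[OF y] by linarith
    then have "h / 2 <= norm (x - y)" using component_le_norm_cart[of "x - y" k] by simp
    moreover have "c0 * (1 + norm x) <= h / 2 / (1 + 2 * R) * (1 + 2 * R)"
     using True K(4,5) c0_le by (intro mult_mono) auto
    moreover have "h / 2 / (1 + 2 * R) * (1 + 2 * R) = h / 2"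
     using K(5) nonzero_divide_eq_eq[of "1 + 2 * R" "h / 2" "h / 2 / (1 + 2 * R)"] by linarith
    ultimately show ?thesis by linarith
   next
    case False
    have "norm x - norm y <= norm (x - y)" by (rule norm_triangle_ineq2)
    then have "1 / 4 * (1 + norm x) <= norm (x - y)" using K(7)[OF y] K(5) False by simp
    moreover have "c0 * (1 + norm x) <= 1 / 4 * (1 + norm x)" using c0_le by (intro mult_right_mono) auto
    ultimately show ?thesis by linarith
   qed
   have "Lop u x = (LI y. indicator H y * (u y * J x y))"
    by (rule Lop_zero[OF M _ x nn K(3)[OF xK]]) simp
   moreover have "0 <= (LI y. indicator H y * (u y * J x y))"
    using nn J_nonneg[OF x] by (intro Bochner_Integration.integral_nonneg) (auto simp: indicator_def)
   moreover have "(LI y. indicator H y * (u y * J x y)) <= (LI y. M * CB * (c0 powr (- (d + \<alpha>)) * p) * indicator K y)"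
   proof (rule integral_mono')
    show "integrable lborel (\<lambda>y. M * CB * (c0 powr (- (d + \<alpha>)) * p) * indicator K y)" using Kfin by simp
    fix y
    show "indicator H y * (u y * J x y) <= M * CB * (c0 powr (- (d + \<alpha>)) * p) * indicator K y"
    proof (cases "y \<in> K")
     case True
     then have yH: "y \<in> H" using K(2) by auto
     have "J x y <= CB * norm (x - y) powr (- (d + \<alpha>))" by (rule J_bound[OF x yH])
     also have "... <= CB * (c0 * (1 + norm x)) powr (- (d + \<alpha>))"
      using far[OF True] c0 da CB by (intro mult_left_mono powr_mono2') (auto simp: add_pos_nonneg)
     also have "(c0 * (1 + norm x)) powr (- (d + \<alpha>)) = c0 powr (- (d + \<alpha>)) * p"
      unfolding p_def by (simp add: powr_mult)
     finally have "J x y <= CB * (c0 powr (- (d + \<alpha>)) * p)" .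
     then have "u y * J x y <= M * (CB * (c0 powr (- (d + \<alpha>)) * p))"
      using M0 nn J_nonneg[OF x yH] by (intro mult_mono) auto
     then show ?thesis using True yH by (simp add: mult.assoc)
    qed (simp add: K(3))
    show "0 <= M * CB * (c0 powr (- (d + \<alpha>)) * p) * indicator K y" using M0 CB p by simp
   qed
   moreover have "(LI y. M * CB * (c0 powr (- (d + \<alpha>)) * p) * indicator K y) = C2 * p"
    using Kfin by (simp add: C2_def)
   moreover have "C2 * p <= C * p" using p C1 K(5) by (intro mult_right_mono) (auto simp: C_def)
   ultimately show ?thesis unfolding p_def[symmetric] by linarith
  qed
 qed
qed

definition PJ :: "real^'n => real^'n => real" where
 "PJ x y = (if x \<in> H \<and> y \<in> H then J x y else 0)"

lemma PJ_meas [measurable (raw)]: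
 assumes [measurable]: "f \<in> borel_measurable M" "g \<in> borel_measurable M"
 shows "(\<lambda>w. PJ (f w) (g w)) \<in> borel_measurable M"
 unfolding PJ_def by measurable

lemma PJ_nonneg: "0 <= PJ x y" using J_nonneg by (simp add: PJ_def)
lemma PJ_sym: "PJ x y = PJ y x" using J_sym by (auto simp: PJ_def)

lemma PJ_gmul: "x \<in> H ==> PJ x (x \<odot> \<eta>) = x $ k powr (- (d + \<alpha>)) * jj \<eta>"
 using J_gmul[of x \<eta>]
 by (cases "\<eta> \<in> H") (auto simp: PJ_def gmul_halfsp jj_zero, auto simp: halfsp_def zero_less_mult_iff)

lemma energy_PJ:
 assumes [measurable]: "bmeas u"
 shows "energy k J u = (NI x. NI y. ennreal ((u x - u y)^2 * PJ x y)) / 2"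
proof -
 have "(\<integral>\<^sup>+x\<in>H. (\<integral>\<^sup>+y\<in>H. ennreal ((u x - u y)^2 * J x y) \<partial>lborel) \<partial>lborel)
   = (NI x. NI y. ennreal ((u x - u y)^2 * PJ x y))"
  by (intro nn_integral_cong) (auto simp: PJ_def indicator_def intro!: nn_integral_cong)
 then show ?thesis by (simp add: energy_def)
qed

lemma nn_integral_y_gmul:
 assumes [measurable]: "bmeas f" and x: "x \<in> H" and f: "\<And>y. 0 <= f y"
 shows "(NI y. ennreal (f y * PJ x y)) = ennreal (x $ k powr (- \<alpha>)) * (NI \<eta>. ennreal (f (x \<odot> \<eta>) * jj \<eta>))"
proof -
 have xk: "x $ k > 0" using x by (simp add: halfsp_def)
 have "(NI y. ennreal (f y * PJ x y)) = ennreal ((x $ k) ^ CARD('n)) * (NI \<eta>. ennreal (f (x \<odot> \<eta>) * PJ x (x \<odot> \<eta>)))"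
  using x by (intro nn_integral_gmul_right) auto
 also have "... = ennreal ((x $ k) ^ CARD('n)) * (ennreal (x $ k powr (- (d + \<alpha>))) * (NI \<eta>. ennreal (f (x \<odot> \<eta>) * jj \<eta>)))"
  by (subst nn_integral_cmult[symmetric]) (auto simp: PJ_gmul[OF x] ennreal_mult[symmetric] f jj_nonneg mult_ac)
 also have "... = ennreal (x $ k powr (- \<alpha>)) * (NI \<eta>. ennreal (f (x \<odot> \<eta>) * jj \<eta>))"
  using powr_d_cancel[OF xk] xk by (simp add: mult.assoc[symmetric] ennreal_mult[symmetric])
 finally show ?thesis .
qed

text \<open>The integrand vanishes unless one of the two points lies in \<open>K\<close>, and by
  symmetry the first may be taken there. The inner integral in group coordinates is then dominated
  by \<open>Gf\<close>, uniformly over \<open>K\<close>.\<close>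

lemma energy_Cc_inf:
 assumes u: "u \<in> Cc_inf H"
 shows "(NI x. NI y. ennreal ((u x - u y)^2 * PJ x y)) < \<infinity>"
proof -
 have [measurable]: "bmeas u" by (rule Cc_inf_borel[OF u])
 obtain M where M: "taylor2 M u" using Cc_inf_taylor2[OF u] by auto
 then obtain g where M0: "0 <= M" "\<And>x. \<bar>u x\<bar> <= M"
  and g: "\<And>x z. \<bar>g x \<bullet> z\<bar> <= M * norm z" "\<And>x z. \<bar>u (x + z) - u x - g x \<bullet> z\<bar> <= M * (norm z)^2"
  unfolding taylor2_def by blast
 obtain K h R where K: "compact K" "K \<subseteq> H" "\<And>x. x \<notin> K ==> u x = 0" "0 < h" "1 <= R"
  "\<And>x. x \<in> K ==> h <= x $ k" "\<And>x. x \<in> K ==> norm x <= R" using Cc_inf_support[OF u] by blast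
 have [measurable]: "K \<in> sets borel" using K(1) by (simp add: compact_imp_closed borel_closed)
 have Kfin: "emeasure lborel K < \<infinity>" using compact_finite_lborel[OF K(1)] .
 define E where "E x y = ennreal ((u x - u y)^2 * PJ x y)" for x y
 have Esym: "E x y = E y x" for x y by (simp add: E_def PJ_sym power2_commute)
 have [measurable (raw)]: "(\<lambda>w. E (f1 w) (f2 w)) \<in> borel_measurable N"
  if [measurable]: "f1 \<in> borel_measurable N" "f2 \<in> borel_measurable N" for N :: "'z measure" and f1 f2
  unfolding E_def by measurable
 define A where "A = (M * (R + R^2))^2 + (2 * M)^2"
 have A: "0 <= A" by (simp add: A_def)
 define G where "G = integral\<^sup>L lborel Gf"
 have G: "(NI \<eta>. ennreal (Gf \<eta>)) = ennreal G"
  unfolding G_def by (rule nn_integral_eq_integral[OF Gf_integrable]) (simp add: Gf_nonneg)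
 have inner: "(NI y. E x y) <= ennreal (h powr (- \<alpha>)) * (ennreal A * ennreal G)" if x: "x \<in> K" for x
 proof -
  have xH: "x \<in> H" using x K by auto
  have xk: "0 < x $ k" "x $ k <= R" using xH K(7)[OF x] component_le_norm_cart[of x k] by (auto simp: halfsp_def)
  have "(u x - u (x \<odot> \<eta>))^2 * jj \<eta> <= A * Gf \<eta>" for \<eta>
  proof (cases "\<eta> \<in> H")
   case True
   have "(u x - u (x \<odot> \<eta>))^2 <= A * (near (1/2) \<eta> * (norm (\<eta> - e))^2 + far (1/2) \<eta> * (1 + \<eta> $ k powr (\<alpha> - 1)))"
   proof (cases "\<eta> \<in> nearset k (1/2)")
    case near: True
    have q: "norm (\<eta> - e) <= 1" using nearset_bounds(1)[OF _ _ near] by simp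
    define z where "z = (x $ k) *\<^sub>R (\<eta> - e)"
    have nz: "norm z = x $ k * norm (\<eta> - e)" using xk by (simp add: z_def)
    have "\<bar>u (x + z) - u x\<bar> <= M * norm z + M * (norm z)^2" using g(1)[of x z] g(2)[of x z] by linarith
    also have "... <= M * (R * norm (\<eta> - e)) + M * (R^2 * norm (\<eta> - e))"
    proof (intro add_mono mult_left_mono M0(1))
     show "norm z <= R * norm (\<eta> - e)" unfolding nz using xk by (intro mult_right_mono) auto
     have "(norm z)^2 = (x $ k)^2 * (norm (\<eta> - e) * norm (\<eta> - e))" by (simp add: nz power2_eq_square)
     also have "... <= R^2 * (1 * norm (\<eta> - e))"
      using xk q by (intro mult_mono power_mono mult_right_mono) auto
     finally show "(norm z)^2 <= R^2 * norm (\<eta> - e)" by simp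
    qed
    also have "... = M * (R + R^2) * norm (\<eta> - e)" by (simp add: algebra_simps)
    finally have "\<bar>u x - u (x \<odot> \<eta>)\<bar>\<^sup>2 <= (M * (R + R^2) * norm (\<eta> - e))^2"
     by (intro power_mono) (auto simp: gmul_eq z_def abs_minus_commute)
    also have "... = (M * (R + R^2))^2 * (norm (\<eta> - e))^2" by (rule power_mult_distrib)
    also have "... <= A * (norm (\<eta> - e))^2" by (intro mult_right_mono) (auto simp: A_def)
    finally show ?thesis using near by simp
   next
    case False
    have "\<bar>u x - u (x \<odot> \<eta>)\<bar>\<^sup>2 <= (2 * M)^2" using M0(2)[of x] M0(2)[of "x \<odot> \<eta>"] by (intro power_mono) auto
    also have "... <= A * 1" by (simp add: A_def)
    also have "... <= A * (1 + \<eta> $ k powr (\<alpha> - 1))" using A by (intro mult_left_mono) auto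
    finally show ?thesis using False True by simp
   qed
   from mult_right_mono[OF this jj_nonneg[of \<eta>]] show ?thesis by (simp add: Gf_def mult.assoc)
  qed (simp add: jj_zero Gf_def)
  then have "(NI \<eta>. ennreal ((u x - u (x \<odot> \<eta>))^2 * jj \<eta>)) <= (NI \<eta>. ennreal A * ennreal (Gf \<eta>))"
   using A by (intro nn_integral_mono) (simp add: ennreal_mult[symmetric] Gf_nonneg ennreal_leI)
  also have "... = ennreal A * ennreal G" unfolding G[symmetric] using Gf_integrable by (intro nn_integral_cmult) auto
  finally have 1: "(NI \<eta>. ennreal ((u x - u (x \<odot> \<eta>))^2 * jj \<eta>)) <= ennreal A * ennreal G" .
  have "(NI y. E x y) = ennreal (x $ k powr (- \<alpha>)) * (NI \<eta>. ennreal ((u x - u (x \<odot> \<eta>))^2 * jj \<eta>))"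
   unfolding E_def by (rule nn_integral_y_gmul[of "\<lambda>y. (u x - u y)^2", OF _ xH]) auto
  also have "... <= ennreal (h powr (- \<alpha>)) * (ennreal A * ennreal G)"
   using 1 K(4) K(6)[OF x] alpha by (intro mult_mono ennreal_leI powr_mono2') auto
  finally show ?thesis .
 qed
 have E0: "E x y <= indicator K x * E x y + indicator K y * E x y" for x y
  using K(3)[of x] K(3)[of y] by (cases "x \<in> K"; cases "y \<in> K") (auto simp: E_def)
 have half: "(NI x. NI y. indicator K x * E x y) < \<infinity>"
 proof -
  have "(NI x. NI y. indicator K x * E x y) <= (NI x. (ennreal (h powr (- \<alpha>)) * (ennreal A * ennreal G)) * indicator K x)"
   using inner by (intro nn_integral_mono) (auto simp: indicator_def)
  also have "... = (ennreal (h powr (- \<alpha>)) * (ennreal A * ennreal G)) * emeasure lborel K"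
   by (rule nn_integral_cmult_indicator) simp
  also have "... < \<infinity>" using Kfin by (simp add: ennreal_mult_less_top)
  finally show ?thesis .
 qed
 have half2: "(NI x. NI y. indicator K y * E x y) = (NI x. NI y. indicator K x * E x y)"
  by (subst lborel_pair.Fubini') (auto simp: split_beta' Esym)
 have "(NI x. NI y. E x y) <= (NI x. NI y. indicator K x * E x y + indicator K y * E x y)"
  by (intro nn_integral_mono E0)
 also have "... = (NI x. (NI y. indicator K x * E x y) + (NI y. indicator K y * E x y))"
  by (intro nn_integral_cong nn_integral_add) auto
 also have "... = (NI x. NI y. indicator K x * E x y) + (NI x. NI y. indicator K y * E x y)"
  by (intro nn_integral_add) auto
 also have "... < \<infinity>" using half half2 by simp
 finally show ?thesis by (simp add: E_def)
qed

end

lemma integrable_gmul_left: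
 fixes f :: "real^'n::finite => real"
 assumes \<eta>: "\<eta> \<in> halfsp k" and [measurable]: "bmeas f"
  and i: "integrable lborel (\<lambda>x. f (gmul k x \<eta>))"
 shows "integrable lborel f"
proof -
 have "integrable (density (distr lborel borel (\<lambda>x. gmul k x \<eta>)) (\<lambda>_. ennreal (\<eta> $ k))) f"
  using i \<eta> by (subst integrable_density) (auto simp: integrable_distr_eq halfsp_def)
 then show ?thesis by (subst lborel_gmul[OF \<eta>])
qed

lemma integrable_mult_sq:
 fixes f g h :: "'a => real"
 assumes m [measurable]: "f \<in> borel_measurable M" "g \<in> borel_measurable M" "h \<in> borel_measurable M" and h: "\<And>x. 0 <= h x"
  and sq: "(\<integral>\<^sup>+x. ennreal ((f x)^2 * h x) \<partial>M) < \<infinity>" "(\<integral>\<^sup>+x. ennreal ((g x)^2 * h x) \<partial>M) < \<infinity>"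
 shows "integrable M (\<lambda>x. f x * g x * h x)"
proof (rule Bochner_Integration.integrable_bound)
 show "integrable M (\<lambda>x. (f x)^2 * h x + (g x)^2 * h x)"
  using sq h by (intro Bochner_Integration.integrable_add integrableI_nonneg) auto
 show "AE x in M. norm (f x * g x * h x) <= norm ((f x)^2 * h x + (g x)^2 * h x)"
 proof (rule AE_I2)
  fix x
  have "2 * (\<bar>f x\<bar> * \<bar>g x\<bar>) <= (f x)^2 + (g x)^2" using sum_squares_bound[of "\<bar>f x\<bar>" "\<bar>g x\<bar>"] by simp
  then have "\<bar>f x * g x\<bar> <= (f x)^2 + (g x)^2" unfolding abs_mult using mult_nonneg_nonneg[OF abs_ge_zero abs_ge_zero, of "f x" "g x"] by linarith
  from mult_right_mono[OF this h[of x]] show "norm (f x * g x * h x) <= norm ((f x)^2 * h x + (g x)^2 * h x)"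
   using h[of x] by (simp add: abs_mult distrib_right)
 qed
qed measurable

context bkernel begin

lemma Cc_Cc_integrable:
 assumes "\<And>x. \<bar>u x\<bar> <= M" "bmeas u" and v: "v \<in> Cc_inf H"
 shows "integrable lborel (\<lambda>x. indicator H x * x $ k powr (- \<alpha>) * u x * v x)"
proof -
 note [measurable] = Cc_inf_borel[OF v] assms(2)
 obtain Mv where Mv: "taylor2 Mv v" using Cc_inf_taylor2[OF v] by auto
 obtain K h R where K: "compact K" "K \<subseteq> H" "\<And>x. x \<notin> K ==> v x = 0" "0 < h" "1 <= R"
  "\<And>x. x \<in> K ==> h <= x $ k" "\<And>x. x \<in> K ==> norm x <= R" using Cc_inf_support[OF v] by blast
 have [measurable]: "K \<in> sets borel" using K(1) by (simp add: compact_imp_closed borel_closed)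
 have "integrable lborel (\<lambda>x. (h powr (- \<alpha>) * M * Mv) * indicator K x)"
  using compact_finite_lborel[OF K(1)] by simp
 then show ?thesis
 proof (rule Bochner_Integration.integrable_bound)
  show "AE x in lborel. norm (indicator H x * x $ k powr (- \<alpha>) * u x * v x) <= norm ((h powr (- \<alpha>) * M * Mv) * indicator K x)"
  proof (rule AE_I2)
   fix x
   show "norm (indicator H x * x $ k powr (- \<alpha>) * u x * v x) <= norm ((h powr (- \<alpha>) * M * Mv) * indicator K x)"
   proof (cases "x \<in> K")
    case True
    have "x $ k powr (- \<alpha>) * \<bar>u x\<bar> * \<bar>v x\<bar> <= h powr (- \<alpha>) * M * Mv"
     using K(4) K(6)[OF True] alpha assms(1)[of x] Mv
     by (intro mult_mono powr_mono2' mult_nonneg_nonneg) (auto simp: taylor2_def intro: order_trans[OF abs_ge_zero])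
    moreover have "x \<in> H" "0 <= M" "0 <= Mv" using True K(2) assms(1)[of x] Mv by (auto simp: taylor2_def)
    ultimately show ?thesis using True by (simp add: abs_mult)
   qed (simp add: K(3))
  qed
 qed measurable
qed

lemma form_PJ:
 "form k J u v = (\<integral>z. (u (fst z) - u (snd z)) * (v (fst z) - v (snd z)) * PJ (fst z) (snd z) \<partial>(lborel \<Otimes>\<^sub>M lborel)) / 2"
proof -
 have "indicator (H \<times> H) z *\<^sub>R ((u (fst z) - u (snd z)) * (v (fst z) - v (snd z)) * J (fst z) (snd z))
  = (u (fst z) - u (snd z)) * (v (fst z) - v (snd z)) * PJ (fst z) (snd z)" for z
  by (cases z) (auto simp: PJ_def indicator_def)
 then show ?thesis unfolding form_def set_lebesgue_integral_def by (simp only:)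
qed

lemma form_integrable:
 assumes [measurable]: "bmeas u" "bmeas v"
  and f: "(NI x. NI y. ennreal ((u x - u y)^2 * PJ x y)) < \<infinity>" "(NI x. NI y. ennreal ((v x - v y)^2 * PJ x y)) < \<infinity>"
 shows "integrable (lborel \<Otimes>\<^sub>M lborel) (\<lambda>z. (u (fst z) - u (snd z)) * (v (fst z) - v (snd z)) * PJ (fst z) (snd z))"
proof -
 have "(\<integral>\<^sup>+z. ennreal ((f (fst z) - f (snd z))^2 * PJ (fst z) (snd z)) \<partial>(lborel \<Otimes>\<^sub>M lborel)) = (NI x. NI y. ennreal ((f x - f y)^2 * PJ x y))"
  if [measurable]: "bmeas f" for f by (subst lborel.nn_integral_fst[symmetric]) auto
 then show ?thesis using f by (intro integrable_mult_sq) (auto simp: PJ_nonneg)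
qed

text \<open>For fixed \<open>\<eta>\<close> the substitution \<open>x \<mapsto> x \<odot> \<eta>\<close> is linear, and it turns
 the second half of the form into the second half of \<open>Dop\<close>.\<close>
lemma weak_slice:
 assumes u: "u \<in> Cc_inf H" and v: "v \<in> Cc_inf H" and \<eta>: "\<eta> \<in> H"
 shows "(LI x. indicator H x * x $ k powr (- \<alpha>) * (u x - u (x \<odot> \<eta>)) * (v x - v (x \<odot> \<eta>)))
    = - (LI x. indicator H x * x $ k powr (- \<alpha>) * Dop u x \<eta> * v x)"
proof -
 note [measurable] = Cc_inf_borel[OF v] Cc_inf_borel[OF u]
 obtain M where M: "\<And>x. \<bar>u x\<bar> <= M" using Cc_inf_taylor2[OF u] by (auto simp: taylor2_def)
 define t where "t = \<eta> $ k"
 have t: "t > 0" using \<eta> by (simp add: t_def halfsp_def)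
 define f1 where "f1 x = indicator H x * x $ k powr (- \<alpha>) * (u x - u (x \<odot> \<eta>)) * v x" for x
 define f2 where "f2 x = indicator H x * x $ k powr (- \<alpha>) * (u x - u (x \<odot> \<eta>)) * v (x \<odot> \<eta>)" for x
 define f3 where "f3 x = indicator H x * x $ k powr (- \<alpha>) * (u (x \<odot> ginv k \<eta>) - u x) * v x" for x
 have b: "\<bar>u x - u y\<bar> <= 2 * M" for x y using M[of x] M[of y] by linarith
 have [measurable]: "bmeas f1" "bmeas f2" "bmeas f3"
  unfolding f1_def f2_def f3_def by measurable
 have i1: "integrable lborel f1" unfolding f1_def
  by (rule Cc_Cc_integrable[OF b _ v]) measurable
 have i3: "integrable lborel f3" unfolding f3_def
  by (rule Cc_Cc_integrable[OF b _ v]) measurable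
 have f23: "f2 (x \<odot> ginv k \<eta>) = t powr \<alpha> * f3 x" for x
 proof (cases "x \<in> H")
  case True
  have "(x \<odot> ginv k \<eta>) \<odot> \<eta> = x" using \<eta> by (simp add: gmul_assoc)
  moreover have "(x $ k / t) powr (- \<alpha>) = t powr \<alpha> * x $ k powr (- \<alpha>)"
   using t True by (simp add: powr_divide powr_minus_divide halfsp_def)
  moreover have "x \<odot> ginv k \<eta> \<in> H" using True \<eta> by (simp add: gmul_halfsp ginv_halfsp)
  ultimately show ?thesis using True t by (simp add: f2_def f3_def t_def)
 next
  case False
  then have "x \<odot> ginv k \<eta> \<notin> H" using \<eta> by (simp add: gmul_halfsp_iff ginv_halfsp)
  then show ?thesis using False by (simp add: f2_def f3_def)
 qed
 have i2: "integrable lborel f2"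
  by (rule integrable_gmul_left[OF ginv_halfsp[OF \<eta>]]) (auto simp: f23 i3)
 \<comment> \<open>The substitution yields t^\<alpha> from the power of the height and 1/t from the
   Jacobian, together the factor t^(\<alpha> - 1) of \<open>Dop\<close>.\<close>
 have "(LI x. f2 x) = ginv k \<eta> $ k * (LI x. f2 (x \<odot> ginv k \<eta>))"
  using \<eta> by (intro lebesgue_integral_gmul_left ginv_halfsp) auto
 also have "... = t powr (\<alpha> - 1) * (LI x. f3 x)"
  using t by (simp add: f23 t_def[symmetric] powr_diff)
 finally have I2: "(LI x. f2 x) = t powr (\<alpha> - 1) * (LI x. f3 x)" .
 have "(LI x. indicator H x * x $ k powr (- \<alpha>) * (u x - u (x \<odot> \<eta>)) * (v x - v (x \<odot> \<eta>))) = (LI x. f1 x - f2 x)"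
  by (intro Bochner_Integration.integral_cong) (auto simp: f1_def f2_def right_diff_distrib)
 also have "... = (LI x. f1 x) - t powr (\<alpha> - 1) * (LI x. f3 x)"
  using i1 i2 I2 by simp
 also have "... = (LI x. f1 x - t powr (\<alpha> - 1) * f3 x)"
  using i1 i3 by simp
 also have "(\<lambda>x. f1 x - t powr (\<alpha> - 1) * f3 x) = (\<lambda>x. - (indicator H x * x $ k powr (- \<alpha>) * Dop u x \<eta> * v x))"
  by (auto simp: f1_def f3_def Dop_def t_def algebra_simps)
 finally show ?thesis by simp
qed

text \<open>In the coordinates (x, \<eta>) the form is a double integral of \<open>\<Psi>\<close>,
  and exchanging the order produces the slices at fixed \<open>\<eta>\<close> that
  \<open>weak_slice\<close> turns into slices of \<open>\<Theta>\<close>. Both double integrals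
  converge absolutely, while the two halves of \<open>\<Psi>\<close> taken apart are only of first
  order in \<eta> - e, too weak for \<alpha> > 1.\<close>

lemma weak_form:
 assumes u: "u \<in> Cc_inf H" and v: "v \<in> Cc_inf H"
 shows "form k J u v = - (LI x. indicator H x * (v x * Lop u x))"
proof -
 note [measurable] = Cc_inf_borel[OF v] Cc_inf_borel[OF u]
 obtain M where M: "taylor2 M u" using Cc_inf_taylor2[OF u] by auto
 obtain Mv where Mv: "taylor2 Mv v" using Cc_inf_taylor2[OF v] by auto
 have M0: "0 <= M" "0 <= Mv" "\<And>x. \<bar>v x\<bar> <= Mv" using M Mv by (auto simp: taylor2_def)
 define \<Phi> where "\<Phi> x y = (u x - u y) * (v x - v y) * PJ x y" for x y
 define \<Psi> where "\<Psi> x \<eta> = indicator H x * x $ k powr (- \<alpha>) * (u x - u (x \<odot> \<eta>)) * (v x - v (x \<odot> \<eta>)) * jj \<eta>" for x \<eta>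
 define \<Theta> where "\<Theta> x \<eta> = indicator H x * x $ k powr (- \<alpha>) * Dop u x \<eta> * v x * jj \<eta>" for x \<eta>
 have i\<Phi>: "integrable (lborel \<Otimes>\<^sub>M lborel) (\<lambda>z. \<Phi> (fst z) (snd z))"
  unfolding \<Phi>_def by (rule form_integrable) (auto intro: energy_Cc_inf[OF u] energy_Cc_inf[OF v] simp del: infinity_ennreal_def)
 have m\<Phi> [measurable (raw)]: "(\<lambda>w. \<Phi> (f w) (g w)) \<in> borel_measurable N"
  if [measurable]: "f \<in> borel_measurable N" "g \<in> borel_measurable N" for N :: "'z measure" and f g
  unfolding \<Phi>_def by measurable
 have m\<Psi> [measurable (raw)]: "(\<lambda>w. \<Psi> (f w) (g w)) \<in> borel_measurable N"
  if [measurable]: "f \<in> borel_measurable N" "g \<in> borel_measurable N" for N :: "'z measure" and f g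
  unfolding \<Psi>_def by measurable
 have m\<Theta> [measurable (raw)]: "(\<lambda>w. \<Theta> (f w) (g w)) \<in> borel_measurable N"
  if [measurable]: "f \<in> borel_measurable N" "g \<in> borel_measurable N" for N :: "'z measure" and f g
  unfolding \<Theta>_def by measurable
 \<comment> \<open>Passing to group coordinates at fixed \<open>x\<close>: the Jacobian x_k^d and
   the homogeneity of \<open>J\<close> leave the weight x_k^(-\<alpha>).\<close>
 have slice: "(LI y. \<Phi> x y) = (LI \<eta>. \<Psi> x \<eta>)" for x
 proof (cases "x \<in> H")
  case True
  then have xk: "x $ k > 0" by (simp add: halfsp_def)
  have "(LI y. \<Phi> x y) = (x $ k) ^ CARD('n) * (LI \<eta>. \<Phi> x (x \<odot> \<eta>))"
   using True by (intro lebesgue_integral_gmul_right) auto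
  also have "... = (LI \<eta>. (x $ k) ^ CARD('n) * \<Phi> x (x \<odot> \<eta>))" by (rule integral_mult_right_zero[symmetric])
  also have "(\<lambda>\<eta>. (x $ k) ^ CARD('n) * \<Phi> x (x \<odot> \<eta>)) = \<Psi> x"
  proof
   fix \<eta>
   have "(x $ k) ^ CARD('n) * \<Phi> x (x \<odot> \<eta>) = ((x $ k) ^ CARD('n) * x $ k powr (- (d + \<alpha>))) * ((u x - u (x \<odot> \<eta>)) * (v x - v (x \<odot> \<eta>)) * jj \<eta>)"
    unfolding \<Phi>_def PJ_gmul[OF True] by (simp only: mult_ac)
   then show "(x $ k) ^ CARD('n) * \<Phi> x (x \<odot> \<eta>) = \<Psi> x \<eta>"
    unfolding powr_d_cancel[OF xk] using True by (simp add: \<Psi>_def mult_ac)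
  qed
  finally show ?thesis .
 qed (simp add: \<Phi>_def \<Psi>_def PJ_def)
 have i\<Psi>: "integrable (lborel \<Otimes>\<^sub>M lborel) (\<lambda>(x, \<eta>). \<Psi> x \<eta>)"
 proof (rule integrableI_bounded)
  show "(\<lambda>(x, \<eta>). \<Psi> x \<eta>) \<in> borel_measurable (lborel \<Otimes>\<^sub>M lborel)" by (simp add: split_beta')
  have "(\<integral>\<^sup>+z. ennreal (norm (case z of (x, \<eta>) => \<Psi> x \<eta>)) \<partial>(lborel \<Otimes>\<^sub>M lborel)) = (NI x. NI \<eta>. ennreal \<bar>\<Psi> x \<eta>\<bar>)"
   by (subst lborel.nn_integral_fst[symmetric]) (auto simp: split_beta')
  also have "... = (NI x. NI y. ennreal \<bar>\<Phi> x y\<bar>)"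
  proof (rule nn_integral_cong)
   fix x :: "real^'n"
   show "(NI \<eta>. ennreal \<bar>\<Psi> x \<eta>\<bar>) = (NI y. ennreal \<bar>\<Phi> x y\<bar>)"
   proof (cases "x \<in> H")
    case True
    have "(NI y. ennreal \<bar>\<Phi> x y\<bar>) = (NI y. ennreal ((\<bar>u x - u y\<bar> * \<bar>v x - v y\<bar>) * PJ x y))"
     by (intro nn_integral_cong) (simp add: \<Phi>_def abs_mult PJ_nonneg)
    also have "... = ennreal (x $ k powr (- \<alpha>)) * (NI \<eta>. ennreal ((\<bar>u x - u (x \<odot> \<eta>)\<bar> * \<bar>v x - v (x \<odot> \<eta>)\<bar>) * jj \<eta>))"
     by (rule nn_integral_y_gmul[OF _ True]) auto
    also have "... = (NI \<eta>. ennreal \<bar>\<Psi> x \<eta>\<bar>)"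
     using True by (subst nn_integral_cmult[symmetric]) (auto simp: \<Psi>_def abs_mult jj_nonneg ennreal_mult[symmetric] mult_ac)
    finally show ?thesis by simp
   qed (simp add: \<Phi>_def \<Psi>_def PJ_def)
  qed
  also have "... = (\<integral>\<^sup>+z. ennreal (norm (\<Phi> (fst z) (snd z))) \<partial>(lborel \<Otimes>\<^sub>M lborel))"
   by (subst lborel.nn_integral_fst[symmetric]) auto
  also have "... < \<infinity>" using i\<Phi> by (simp add: integrable_iff_bounded)
  finally show "(\<integral>\<^sup>+z. ennreal (norm (case z of (x, \<eta>) => \<Psi> x \<eta>)) \<partial>(lborel \<Otimes>\<^sub>M lborel)) < \<infinity>" .
 qed
 obtain K h R where K: "compact K" "K \<subseteq> H" "\<And>x. x \<notin> K ==> v x = 0" "0 < h" "1 <= R"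
  "\<And>x. x \<in> K ==> h <= x $ k" "\<And>x. x \<in> K ==> norm x <= R" using Cc_inf_support[OF v] by blast
 have [measurable]: "K \<in> sets borel" using K(1) by (simp add: compact_imp_closed borel_closed)
 define C where "C = h powr (- \<alpha>) * (M * (17 * (R + R^2) + 2)) * Mv"
 have C: "0 <= C" using M0 K by (auto simp: C_def)
 have \<Theta>b: "\<bar>\<Theta> x \<eta>\<bar> <= C * indicator K x * Gf \<eta>" for x \<eta>
 proof (cases "x \<in> K")
  case True
  then have xH: "x \<in> H" using K by auto
  have xk: "0 < x $ k" "x $ k <= R" using xH K(7)[OF True] component_le_norm_cart[of x k] by (auto simp: halfsp_def)
  have "\<bar>\<Theta> x \<eta>\<bar> = x $ k powr (- \<alpha>) * \<bar>Dop u x \<eta> * jj \<eta>\<bar> * \<bar>v x\<bar>"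
   using xH by (simp add: \<Theta>_def abs_mult jj_nonneg)
  also have "... <= h powr (- \<alpha>) * (M * (17 * (R + R^2) + 2) * Gf \<eta>) * Mv"
  proof (intro mult_mono)
   have "\<bar>Dop u x \<eta> * jj \<eta>\<bar> <= M * (17 * (x $ k + (x $ k)^2) + 2) * Gf \<eta>" by (rule Dop_bound'[OF M xH])
   also have "... <= M * (17 * (R + R^2) + 2) * Gf \<eta>"
    using xk M0 by (intro mult_right_mono mult_left_mono add_right_mono add_mono power_mono Gf_nonneg) auto
   finally show "\<bar>Dop u x \<eta> * jj \<eta>\<bar> <= M * (17 * (R + R^2) + 2) * Gf \<eta>" .
  qed (use K(4) K(6)[OF True] alpha M0 Gf_nonneg K(5) in \<open>auto intro!: powr_mono2' mult_nonneg_nonneg\<close>)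
  finally show ?thesis using True by (simp add: C_def mult_ac)
 qed (simp add: \<Theta>_def K(3))
 have i\<Theta>: "integrable (lborel \<Otimes>\<^sub>M lborel) (\<lambda>(x, \<eta>). \<Theta> x \<eta>)"
 proof (rule Bochner_Integration.integrable_bound)
  show "integrable (lborel \<Otimes>\<^sub>M lborel) (\<lambda>(x, \<eta>). C * indicator K x * Gf \<eta>)"
   using compact_finite_lborel[OF K(1)] Gf_integrable by (intro lborel_pair.Fubini_integrable) (auto simp: abs_mult split_beta')
  show "AE z in lborel \<Otimes>\<^sub>M lborel. norm (case z of (x, \<eta>) => \<Theta> x \<eta>) <= norm (case z of (x, \<eta>) => C * indicator K x * Gf \<eta>)"
   using \<Theta>b by (intro AE_I2) (auto intro: order_trans[OF _ abs_ge_self])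
 qed (simp add: split_beta')
 have "2 * form k J u v = (\<integral>z. \<Phi> (fst z) (snd z) \<partial>(lborel \<Otimes>\<^sub>M lborel))"
  unfolding form_PJ \<Phi>_def by simp
 also have "... = (LI x. LI y. \<Phi> x y)"
  using lborel_pair.integral_fst'[OF i\<Phi>] by simp
 also have "... = (LI x. LI \<eta>. \<Psi> x \<eta>)" by (simp add: slice)
 also have "... = (LI \<eta>. LI x. \<Psi> x \<eta>)"
  by (rule lborel_pair.Fubini_integral[OF i\<Psi>, symmetric])
 also have "... = (LI \<eta>. - (LI x. \<Theta> x \<eta>))"
 proof (rule Bochner_Integration.integral_cong[OF refl])
  fix \<eta> :: "real^'n"
  show "(LI x. \<Psi> x \<eta>) = - (LI x. \<Theta> x \<eta>)"
  proof (cases "\<eta> \<in> H")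
   case True
   show ?thesis unfolding \<Psi>_def \<Theta>_def using weak_slice[OF u v True] by simp
  qed (simp add: \<Psi>_def \<Theta>_def jj_zero)
 qed
 also have "... = - (LI \<eta>. LI x. \<Theta> x \<eta>)" by simp
 also have "(LI \<eta>. LI x. \<Theta> x \<eta>) = (LI x. LI \<eta>. \<Theta> x \<eta>)"
  by (rule lborel_pair.Fubini_integral[OF i\<Theta>])
 also have "... = (LI x. 2 * (indicator H x * (v x * Lop u x)))"
 proof (rule Bochner_Integration.integral_cong[OF refl])
  fix x :: "real^'n"
  have "(LI \<eta>. \<Theta> x \<eta>) = (LI \<eta>. (indicator H x * x $ k powr (- \<alpha>) * v x) * (Dop u x \<eta> * jj \<eta>))"
   by (simp add: \<Theta>_def mult_ac)
  also have "... = (indicator H x * x $ k powr (- \<alpha>) * v x) * (LI \<eta>. Dop u x \<eta> * jj \<eta>)"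
   by (rule integral_mult_right_zero)
  finally show "(LI \<eta>. \<Theta> x \<eta>) = 2 * (indicator H x * (v x * Lop u x))"
   by (simp add: Lop_def mult_ac)
 qed
 finally show ?thesis by simp
qed

end

section \<open>Identification of the resolvent\<close>

context bkernel begin

definition En :: "(real^'n => real) => ennreal" where
 "En u = (NI x. NI y. ennreal ((u x - u y)^2 * PJ x y))"

definition L2 :: "(real^'n => real) => ennreal" where
 "L2 u = (NI x. ennreal (indicator H x * (u x)^2))"

definition finE :: "(real^'n => real) => bool" where
 "finE u \<longleftrightarrow> u \<in> borel_measurable borel \<and> En u < \<infinity> \<and> L2 u < \<infinity>"

lemma finE_meas [measurable_dest]: "finE u ==> u \<in> borel_measurable borel"
 by (simp add: finE_def)

lemma L2norm_sq_L2: "L2norm_sq k u = L2 u"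
 unfolding L2norm_sq_def L2_def by (intro nn_integral_cong) (auto simp: indicator_def)

lemma sq_add_le: "(a + b)^2 <= 2 * a^2 + 2 * b^2" for a b :: real
 using sum_squares_bound[of a b] by (simp add: power2_eq_square algebra_simps)

lemma En_add:
 assumes [measurable]: "bmeas u" "bmeas v"
 shows "En (\<lambda>x. u x + v x) <= 2 * En u + 2 * En v"
proof -
 have "En (\<lambda>x. u x + v x) <= (NI x. NI y. 2 * ennreal ((u x - u y)^2 * PJ x y) + 2 * ennreal ((v x - v y)^2 * PJ x y))"
  unfolding En_def
 proof (intro nn_integral_mono)
  fix x y
  have "(u x + v x - (u y + v y))^2 <= 2 * (u x - u y)^2 + 2 * (v x - v y)^2"
   using sq_add_le[of "u x - u y" "v x - v y"] by (simp add: algebra_simps)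
  from mult_right_mono[OF this PJ_nonneg[of x y]]
  have "ennreal ((u x + v x - (u y + v y))^2 * PJ x y) <= ennreal (2 * ((u x - u y)^2 * PJ x y) + 2 * ((v x - v y)^2 * PJ x y))"
   by (intro ennreal_leI) (simp add: ring_distribs mult.assoc)
  also have "... = 2 * ennreal ((u x - u y)^2 * PJ x y) + 2 * ennreal ((v x - v y)^2 * PJ x y)"
   using PJ_nonneg[of x y] by (simp add: ennreal_plus ennreal_mult ennreal_numeral[symmetric] del: ennreal_numeral)
  finally show "ennreal ((u x + v x - (u y + v y))^2 * PJ x y) <= 2 * ennreal ((u x - u y)^2 * PJ x y) + 2 * ennreal ((v x - v y)^2 * PJ x y)" .
 qed
 also have "... = (NI x. 2 * (NI y. ennreal ((u x - u y)^2 * PJ x y)) + 2 * (NI y. ennreal ((v x - v y)^2 * PJ x y)))"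
  by (intro nn_integral_cong) (subst nn_integral_add, auto simp: nn_integral_cmult)
 also have "... = 2 * En u + 2 * En v"
  unfolding En_def by (subst nn_integral_add) (auto simp: nn_integral_cmult)
 finally show ?thesis .
qed

lemma L2_add:
 assumes [measurable]: "bmeas u" "bmeas v"
 shows "L2 (\<lambda>x. u x + v x) <= 2 * L2 u + 2 * L2 v"
proof -
 have "L2 (\<lambda>x. u x + v x) <= (NI x. 2 * ennreal (indicator H x * (u x)^2) + 2 * ennreal (indicator H x * (v x)^2))"
  unfolding L2_def
 proof (intro nn_integral_mono)
  fix x
  have "ennreal (indicator H x * (u x + v x)^2) <= ennreal (2 * (indicator H x * (u x)^2) + 2 * (indicator H x * (v x)^2))"
   using sq_add_le[of "u x" "v x"] by (intro ennreal_leI) (auto simp: indicator_def)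
  also have "... = 2 * ennreal (indicator H x * (u x)^2) + 2 * ennreal (indicator H x * (v x)^2)"
   by (simp add: ennreal_plus ennreal_mult ennreal_numeral[symmetric] del: ennreal_numeral)
  finally show "ennreal (indicator H x * (u x + v x)^2) <= 2 * ennreal (indicator H x * (u x)^2) + 2 * ennreal (indicator H x * (v x)^2)" .
 qed
 also have "... = 2 * L2 u + 2 * L2 v"
  unfolding L2_def by (subst nn_integral_add) (auto simp: nn_integral_cmult)
 finally show ?thesis .
qed

lemma En_uminus: "En (\<lambda>x. - u x) = En u"
 unfolding En_def by (intro nn_integral_cong) (simp add: power2_commute)

lemma L2_uminus: "L2 (\<lambda>x. - u x) = L2 u"
 unfolding L2_def by simp

lemma finE_add: "finE u ==> finE v ==> finE (\<lambda>x. u x + v x)"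
 unfolding finE_def using En_add[of u v] L2_add[of u v]
 by (auto simp: ennreal_mult_less_top intro: le_less_trans)

lemma finE_uminus: "finE u ==> finE (\<lambda>x. - u x)"
 unfolding finE_def by (simp add: En_uminus L2_uminus)

lemma finE_diff: "finE u ==> finE v ==> finE (\<lambda>x. u x - v x)"
 using finE_add[OF _ finE_uminus, of u v] by simp

lemma finE_Cc_inf:
 assumes u: "u \<in> Cc_inf H" shows "finE u"
proof -
 note [measurable] = Cc_inf_borel[OF u]
 obtain M where M: "0 <= M" "\<And>x. \<bar>u x\<bar> <= M" using Cc_inf_taylor2[OF u] by (auto simp: taylor2_def)
 obtain K where K: "compact K" "\<And>x. x \<notin> K ==> u x = 0" using Cc_inf_support[OF u] by metis
 have [measurable]: "K \<in> sets borel" using K(1) by (simp add: compact_imp_closed borel_closed)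
 have "L2 u <= (NI x. ennreal (M^2) * indicator K x)"
  unfolding L2_def
 proof (intro nn_integral_mono)
  fix x
  have "indicator H x * (u x)^2 <= M^2 * indicator K x"
   using power_mono[OF M(2)[of x], of 2] K(2)[of x] by (auto simp: indicator_def)
  then show "ennreal (indicator H x * (u x)^2) <= ennreal (M^2) * indicator K x"
   by (auto simp: indicator_def split: if_splits intro: ennreal_leI)
 qed
 also have "... = ennreal (M^2) * emeasure lborel K" by (rule nn_integral_cmult_indicator) simp
 also have "... < \<infinity>" using compact_finite_lborel[OF K(1)] by (simp add: ennreal_mult_less_top)
 finally show ?thesis using energy_Cc_inf[OF u] by (simp add: finE_def En_def)
qed

lemma form_dom_approx:
 assumes u: "u \<in> form_dom k J"
 obtains \<phi> where "\<And>n. \<phi> n \<in> Cc_inf H" "(\<lambda>n. En (\<lambda>x. u x - \<phi> n x)) \<longlonglongrightarrow> 0" "(\<lambda>n. L2 (\<lambda>x. u x - \<phi> n x)) \<longlonglongrightarrow> 0"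
  "finE u"
proof -
 let ?r = "\<lambda>\<phi> n. (\<lambda>x. u x - \<phi> n x)"
 have [measurable]: "bmeas u" using u by (simp add: form_dom_def)
 obtain \<phi> where \<phi>: "\<And>n. \<phi> n \<in> Cc_inf H"
  and lim: "(\<lambda>n. energy k J (?r \<phi> n) + L2norm_sq k (?r \<phi> n)) \<longlonglongrightarrow> 0"
  using u by (auto simp: form_dom_def)
 have [measurable]: "\<phi> n \<in> borel_measurable borel" for n by (rule Cc_inf_borel[OF \<phi>])
 have E: "energy k J (?r \<phi> n) = En (?r \<phi> n) / 2" for n
  by (subst energy_PJ) (auto simp: En_def)
 have lim2: "(\<lambda>n. En (?r \<phi> n) / 2 + L2 (?r \<phi> n)) \<longlonglongrightarrow> 0"
  using lim by (simp add: E L2norm_sq_L2)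
 have a: "(\<lambda>n. En (?r \<phi> n) / 2) \<longlonglongrightarrow> 0"
  by (rule tendsto_sandwich[OF _ _ tendsto_const lim2]) (auto simp: add_increasing2)
 have b: "(\<lambda>n. L2 (?r \<phi> n)) \<longlonglongrightarrow> 0"
  by (rule tendsto_sandwich[OF _ _ tendsto_const lim2]) (auto simp: add_increasing)
 have "(\<lambda>n. 2 * (En (?r \<phi> n) / 2)) \<longlonglongrightarrow> 2 * 0"
  by (rule tendsto_mult_ennreal[OF tendsto_const a]) auto
 then have c: "(\<lambda>n. En (?r \<phi> n)) \<longlonglongrightarrow> 0"
  by (simp add: ennreal_times_divide mult_divide_eq_ennreal mult.commute[of 2])
 have "\<forall>\<^sub>F n in sequentially. En (?r \<phi> n) < 1 \<and> L2 (?r \<phi> n) < 1"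
  using order_tendstoD(2)[OF c, of 1] order_tendstoD(2)[OF b, of 1] by (auto intro: eventually_conj)
 then obtain n where n: "En (?r \<phi> n) < 1" "L2 (?r \<phi> n) < 1"
  by (auto simp: eventually_sequentially)
 then have "finE (?r \<phi> n)" by (auto simp: finE_def intro: less_trans[OF _ ennreal_one_less_top])
 from finE_add[OF this finE_Cc_inf[OF \<phi>[of n]]] have "finE u" by simp
 with \<phi> b c that show ?thesis by blast
qed

lemma form_int:
 assumes "finE u" "finE v"
 shows "integrable (lborel \<Otimes>\<^sub>M lborel) (\<lambda>z. (u (fst z) - u (snd z)) * (v (fst z) - v (snd z)) * PJ (fst z) (snd z))"
 using assms by (intro form_integrable) (auto simp: finE_def En_def)

lemma form_sym: "form k J u v = form k J v u"
 by (simp add: form_PJ mult_ac)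

lemma form_diff_left:
 assumes "finE u" "finE v" "finE w"
 shows "form k J (\<lambda>x. u x - v x) w = form k J u w - form k J v w"
proof -
 have "(\<lambda>z. (u (fst z) - v (fst z) - (u (snd z) - v (snd z))) * (w (fst z) - w (snd z)) * PJ (fst z) (snd z))
   = (\<lambda>z. (u (fst z) - u (snd z)) * (w (fst z) - w (snd z)) * PJ (fst z) (snd z)
     - (v (fst z) - v (snd z)) * (w (fst z) - w (snd z)) * PJ (fst z) (snd z))"
  by (auto simp: algebra_simps)
 then show ?thesis using form_int assms by (simp add: form_PJ diff_divide_distrib)
qed

lemma form_diff_right:
 assumes "finE u" "finE v" "finE w"
 shows "form k J w (\<lambda>x. u x - v x) = form k J w u - form k J w v"
 using form_diff_left[OF assms] by (simp add: form_sym)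

lemma form_nonneg: "0 <= form k J u u"
 unfolding form_PJ by (auto intro!: Bochner_Integration.integral_nonneg simp: PJ_nonneg)

lemma form_En:
 assumes "finE u" shows "2 * form k J u u = enn2real (En u)"
proof -
 have [measurable]: "bmeas u" using assms by (simp add: finE_def)
 have "(\<integral>z. (u (fst z) - u (snd z)) * (u (fst z) - u (snd z)) * PJ (fst z) (snd z) \<partial>(lborel \<Otimes>\<^sub>M lborel))
   = enn2real (\<integral>\<^sup>+z. ennreal ((u (fst z) - u (snd z))^2 * PJ (fst z) (snd z)) \<partial>(lborel \<Otimes>\<^sub>M lborel))"
  by (subst integral_eq_nn_integral) (auto simp: PJ_nonneg power2_eq_square)
 also have "(\<integral>\<^sup>+z. ennreal ((u (fst z) - u (snd z))^2 * PJ (fst z) (snd z)) \<partial>(lborel \<Otimes>\<^sub>M lborel)) = En u"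
  unfolding En_def by (subst lborel.nn_integral_fst[symmetric]) auto
 finally show ?thesis by (simp add: form_PJ)
qed

text \<open>Young's inequality with a free parameter takes the role of Cauchy-Schwarz: the first
  square can be made negligible by \<open>s\<close>, after the second one has been sent to
  0.\<close>

lemma young_integral:
 fixes f g h :: "'b => real"
 assumes i: "integrable M (\<lambda>x. f x * g x * h x)" "integrable M (\<lambda>x. f x * f x * h x)" "integrable M (\<lambda>x. g x * g x * h x)"
  and h: "\<And>x. 0 <= h x" and s: "0 < s"
 shows "\<bar>\<integral>x. f x * g x * h x \<partial>M\<bar> <= s / 4 * (\<integral>x. f x * f x * h x \<partial>M) + (\<integral>x. g x * g x * h x \<partial>M) / s"
proof -
 have "\<bar>a * b\<bar> <= s / 4 * (a * a) + b * b / s" for a b :: real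
 proof -
  have "0 <= (sqrt s / 2 * \<bar>a\<bar> - \<bar>b\<bar> / sqrt s)^2" by simp
  also have "... = s / 4 * (a * a) + b * b / s - \<bar>a * b\<bar>"
   using s by (simp add: power2_diff power_mult_distrib power_divide power2_eq_square[of a] power2_eq_square[of b] abs_mult)
  finally show ?thesis by simp
 qed
 from mult_right_mono[OF this h]
 have "\<bar>f x * g x * h x\<bar> <= s / 4 * (f x * f x * h x) + g x * g x * h x / s" for x
  using h[of x] by (simp add: abs_mult distrib_right mult.assoc)
 then have "(\<integral>x. \<bar>f x * g x * h x\<bar> \<partial>M) <= (\<integral>x. s / 4 * (f x * f x * h x) + g x * g x * h x / s \<partial>M)"
  using i by (intro integral_mono) auto
 from order_trans[OF integral_abs_bound this] show ?thesis using i by simp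
qed

lemma form_young:
 assumes "finE w" "finE r" "0 < s"
 shows "\<bar>form k J w r\<bar> <= s / 4 * form k J w w + form k J r r / s"
 using divide_right_mono[OF young_integral[OF form_int[OF assms(1,2)] form_int[OF assms(1,1)] form_int[OF assms(2,2)] PJ_nonneg assms(3)], of 2]
 by (simp add: form_PJ add_divide_distrib)

definition ip :: "(real^'n => real) => (real^'n => real) => real" where
 "ip f g = (LI x. indicator H x * (f x * g x))"

lemma ip_int:
 assumes [measurable]: "bmeas f" "bmeas g" and "L2 f < \<infinity>" "L2 g < \<infinity>"
 shows "integrable lborel (\<lambda>x. indicator H x * (f x * g x))"
 using integrable_mult_sq[of f lborel g "indicator H"] assms(3,4) by (simp add: L2_def mult.commute)

lemma ip_sym: "ip f g = ip g f" by (simp add: ip_def mult.commute)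

lemma ip_diff_left:
 assumes "bmeas u" "bmeas v" "bmeas w"
  "L2 u < \<infinity>" "L2 v < \<infinity>" "L2 w < \<infinity>"
 shows "ip (\<lambda>x. u x - v x) w = ip u w - ip v w"
 unfolding ip_def using ip_int[of u w] ip_int[of v w] assms
 by (simp add: left_diff_distrib right_diff_distrib)

lemma ip_L2: "u \<in> borel_measurable borel ==> ip u u = enn2real (L2 u)"
 unfolding ip_def L2_def by (subst integral_eq_nn_integral) (auto simp: power2_eq_square)

lemma ip_diff_right:
 assumes "bmeas u" "bmeas v" "bmeas w"
  "L2 u < \<infinity>" "L2 v < \<infinity>" "L2 w < \<infinity>"
 shows "ip w (\<lambda>x. u x - v x) = ip w u - ip w v"
 using ip_diff_left[OF assms] by (simp add: ip_sym)

lemma ip_young: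
 assumes "bmeas f" "bmeas g" "L2 f < \<infinity>" "L2 g < \<infinity>" "0 < s"
 shows "\<bar>ip f g\<bar> <= s / 4 * ip f f + ip g g / s"
 using young_integral[of lborel f g "indicator H" s] ip_int assms by (simp add: ip_def mult.commute)

text \<open>The defect \<open>\<Lambda>\<close> vanishes on the core, so its value at
  \<open>U\<close> equals its value at \<open>U - \<phi> m\<close>. Young's inequality bounds that
  by \<open>s / 4 * A\<close> plus a term tending to 0 with \<open>m\<close> for fixed
  \<open>s\<close>; then \<open>s\<close> tends to 0.\<close>

lemma weak_eq_form_dom:
 assumes w: "finE w" and g: "bmeas g" "L2 g < \<infinity>" and \<beta>: "0 < \<beta>"
  and eq: "\<And>v. v \<in> Cc_inf H ==> form k J w v + \<beta> * ip w v = ip g v" and U: "U \<in> form_dom k J"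
 shows "form k J w U + \<beta> * ip w U = ip g U"
proof -
 obtain \<phi> where \<phi>: "\<And>m. \<phi> m \<in> Cc_inf H" "(\<lambda>m. En (\<lambda>x. U x - \<phi> m x)) \<longlonglongrightarrow> 0" "(\<lambda>m. L2 (\<lambda>x. U x - \<phi> m x)) \<longlonglongrightarrow> 0"
  and fU: "finE U" using form_dom_approx[OF U] by blast
 note f\<phi> = finE_Cc_inf[OF \<phi>(1)]
 define r where "r m x = U x - \<phi> m x" for m x
 have r: "finE (r m)" for m unfolding r_def using fU f\<phi> by (rule finE_diff)
 define \<Lambda> where "\<Lambda> v = form k J w v + \<beta> * ip w v - ip g v" for v
 have \<Lambda>r: "\<Lambda> U = \<Lambda> (r m)" for m
  using eq[OF \<phi>(1)[of m]] fU f\<phi>[of m] w g unfolding \<Lambda>_def r_def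
  by (simp add: form_diff_right ip_diff_right finE_def algebra_simps)
 define A where "A = form k J w w + \<beta> * ip w w + ip g g"
 have "0 <= ip f f" for f unfolding ip_def by (rule Bochner_Integration.integral_nonneg) simp
 then have A: "0 <= A" using form_nonneg[of w] \<beta> unfolding A_def by simp
 have le: "\<bar>\<Lambda> U\<bar> <= s / 4 * A" if s: "0 < s" for s
 proof -
  have "\<bar>\<Lambda> U\<bar> <= s / 4 * A + (enn2real (En (r m)) / 2 + (\<beta> + 1) * enn2real (L2 (r m))) / s" for m
  proof -
   note fs = w[unfolded finE_def] r[of m, unfolded finE_def]
   have y: "\<bar>form k J w (r m)\<bar> <= s / 4 * form k J w w + form k J (r m) (r m) / s"
    "\<bar>ip w (r m)\<bar> <= s / 4 * ip w w + ip (r m) (r m) / s" "\<bar>ip g (r m)\<bar> <= s / 4 * ip g g + ip (r m) (r m) / s"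
    using form_young[OF w r s, of m] ip_young[of w "r m" s] ip_young[of g "r m" s] fs g s by auto
   have "\<bar>\<Lambda> U\<bar> <= \<bar>form k J w (r m)\<bar> + \<beta> * \<bar>ip w (r m)\<bar> + \<bar>ip g (r m)\<bar>"
    unfolding \<Lambda>r[of m] unfolding \<Lambda>_def using \<beta> abs_mult[of \<beta> "ip w (r m)"] by linarith
   also have "... <= (s / 4 * form k J w w + form k J (r m) (r m) / s) + \<beta> * (s / 4 * ip w w + ip (r m) (r m) / s) + (s / 4 * ip g g + ip (r m) (r m) / s)"
    using y \<beta> by (intro add_mono mult_left_mono) auto
   also have "... = s / 4 * A + (form k J (r m) (r m) + (\<beta> + 1) * ip (r m) (r m)) / s"
    by (simp add: A_def algebra_simps add_divide_distrib)
   also have "form k J (r m) (r m) = enn2real (En (r m)) / 2" using form_En[OF r[of m]] by simp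
   finally show ?thesis using fs by (simp add: ip_L2)
  qed
  moreover have "(\<lambda>m. s / 4 * A + (enn2real (En (r m)) / 2 + (\<beta> + 1) * enn2real (L2 (r m))) / s) \<longlonglongrightarrow> s / 4 * A + (enn2real 0 / 2 + (\<beta> + 1) * enn2real 0) / s"
   using \<phi>(2,3) s unfolding r_def by (intro tendsto_intros) auto
  ultimately show ?thesis using LIMSEQ_le_const[of _ _ "\<bar>\<Lambda> U\<bar>"] by fastforce
 qed
 have "\<bar>\<Lambda> U\<bar> <= 0 + e" if "0 < e" for e
 proof -
  have "4 * e / (A + 1) / 4 * A <= e" using A that by (simp add: field_simps)
  then show ?thesis using le[of "4 * e / (A + 1)"] A that by simp
 qed
 then have "\<Lambda> U = 0" using field_le_epsilon[of "\<bar>\<Lambda> U\<bar>" 0] by simp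
 then show ?thesis by (simp add: \<Lambda>_def)
qed

text \<open>A compact exhaustion of \<open>H\<close>, needed because \<open>associated\<close>
  accepts only data with compact support there.\<close>

definition Kn :: "nat => (real^'n) set" where
 "Kn n = {x. 1 / real (Suc n) <= x $ k \<and> norm x <= real n}"

lemma Kn_compact: "compact (Kn n)"
proof -
 have "closed (Kn n)" unfolding Kn_def by (intro closed_Collect_conj closed_Collect_le continuous_intros)
 moreover have "bounded (Kn n)" by (auto simp: Kn_def bounded_iff)
 ultimately show ?thesis by (simp add: compact_eq_bounded_closed)
qed

lemma Kn_sub: "Kn n \<subseteq> H"
 by (auto simp: Kn_def halfsp_def intro: less_le_trans[rotated])

lemma Kn_meas [measurable]: "Kn n \<in> sets borel"
 using Kn_compact by (simp add: compact_imp_closed borel_closed)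

lemma Kn_mono: "m <= n ==> Kn m \<subseteq> Kn n"
proof
 fix x assume "m <= n" "x \<in> Kn m"
 moreover have "1 / real (Suc n) <= 1 / real (Suc m)" using \<open>m <= n\<close> by (intro divide_left_mono) auto
 ultimately show "x \<in> Kn n" by (auto simp: Kn_def intro: order_trans)
qed

lemma Kn_ex: assumes "x \<in> H" shows "\<exists>n0. \<forall>n\<ge>n0. x \<in> Kn n"
proof -
 have xk: "0 < x $ k" using assms by (simp add: halfsp_def)
 obtain n1 where n1: "1 / x $ k < real n1" using reals_Archimedean2 by blast
 obtain n2 where n2: "norm x < real n2" using reals_Archimedean2 by blast
 have "x \<in> Kn (max n1 n2)"
 proof -
  have "1 / x $ k < real (Suc (max n1 n2))" using n1 by (simp add: less_max_iff_disj)
  then have "1 < real (Suc (max n1 n2)) * x $ k" using xk by (simp only: pos_divide_less_eq)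
  then have "1 / real (Suc (max n1 n2)) <= x $ k" by (simp only: pos_divide_le_eq of_nat_0_less_iff zero_less_Suc mult.commute less_imp_le)
  then show ?thesis using n2 by (simp add: Kn_def)
 qed
 then show ?thesis using Kn_mono by blast
qed

end

context bkernel begin

text \<open>The datum whose \<beta>-resolvent is \<open>u\<close>. The value 0 off \<open>H\<close>
  makes it vanish at the point that later replaces the cemetery.\<close>

definition hf :: "real => (real^'n => real) => real^'n => real" where
 "hf \<beta> u x = (if x \<in> H then \<beta> * u x - Lop u x else 0)"

lemma Lop_cont_Cc: "u \<in> Cc_inf H ==> continuous_on H (Lop u)"
 using Cc_inf_taylor2[of u] Lop_continuous Cc_inf_continuous by blast

lemma hf_cont: "u \<in> Cc_inf H ==> continuous_on H (hf \<beta> u)"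
proof -
 assume u: "u \<in> Cc_inf H"
 have "continuous_on H (\<lambda>x. \<beta> * u x - Lop u x)"
  using continuous_on_subset[OF Cc_inf_continuous[OF u]] by (intro continuous_intros Lop_cont_Cc u) auto
 then show ?thesis by (rule continuous_on_eq) (simp add: hf_def)
qed

lemma hf_meas: "u \<in> Cc_inf H ==> hf \<beta> u \<in> borel_measurable borel"
proof -
 assume u: "u \<in> Cc_inf H"
 have "bmeas (\<lambda>x. if x \<in> H then hf \<beta> u x else 0)"
  by (intro borel_measurable_continuous_on_if hf_cont u) auto
 moreover have "(\<lambda>x. if x \<in> H then hf \<beta> u x else 0) = hf \<beta> u" by (auto simp: hf_def)
 ultimately show ?thesis by simp
qed

lemma hf_decay:
 assumes u: "u \<in> Cc_inf H" and nn: "\<And>y. 0 <= u y"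
 shows "\<exists>C\<ge>0. \<forall>x. \<bar>hf \<beta> u x\<bar> <= C * (1 + norm x) powr (- (d + \<alpha>))"
proof -
 obtain C1 where C1: "C1 \<ge> 0" "\<And>x. x \<in> H ==> \<bar>Lop u x\<bar> <= C1 * (1 + norm x) powr (- (d + \<alpha>))"
  using Lop_decay[OF u nn] by auto
 obtain M where M: "0 <= M" "\<And>x. \<bar>u x\<bar> <= M" using Cc_inf_taylor2[OF u] by (auto simp: taylor2_def)
 obtain K h R where K: "\<And>x. x \<notin> K ==> u x = 0" "1 <= R" "\<And>x. x \<in> K ==> norm x <= R" using Cc_inf_support[OF u] by metis
 have da: "0 <= d + \<alpha>" using alpha by (simp add: d_eq)
 define C2 where "C2 = \<bar>\<beta>\<bar> * M / (1 + R) powr (- (d + \<alpha>))"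
 have C2: "0 <= C2" using M by (simp add: C2_def)
 have b2: "\<bar>\<beta> * u x\<bar> <= C2 * (1 + norm x) powr (- (d + \<alpha>))" for x
 proof (cases "x \<in> K")
  case True
  have R: "0 < (1 + R) powr (- (d + \<alpha>))" using K(2) by simp
  have "(1 + R) powr (- (d + \<alpha>)) <= (1 + norm x) powr (- (d + \<alpha>))"
   using K(3)[OF True] da by (intro powr_mono2') (auto intro: add_pos_nonneg)
  then have "1 <= (1 + norm x) powr (- (d + \<alpha>)) / (1 + R) powr (- (d + \<alpha>))" using R by (simp add: le_divide_eq)
  then have "(\<bar>\<beta>\<bar> * M) * 1 <= (\<bar>\<beta>\<bar> * M) * ((1 + norm x) powr (- (d + \<alpha>)) / (1 + R) powr (- (d + \<alpha>)))"
   using M by (intro mult_left_mono) auto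
  moreover have "\<bar>\<beta> * u x\<bar> <= \<bar>\<beta>\<bar> * M" unfolding abs_mult using M by (intro mult_left_mono) auto
  ultimately show ?thesis by (simp add: C2_def)
 qed (use C2 K(1) in simp)
 have "\<bar>hf \<beta> u x\<bar> <= (C1 + C2) * (1 + norm x) powr (- (d + \<alpha>))" for x
 proof (cases "x \<in> H")
  case True
  then show ?thesis using C1(2)[OF True] b2[of x] by (simp add: hf_def distrib_right)
 qed (use C1 C2 in \<open>simp add: hf_def\<close>)
 then show ?thesis using C1 C2 by (intro exI[of _ "C1 + C2"]) auto
qed

lemma hf_bounded:
 assumes u: "u \<in> Cc_inf H" and nn: "\<And>y. 0 <= u y"
 shows "\<exists>C\<ge>0. \<forall>x. \<bar>hf \<beta> u x\<bar> <= C"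
proof -
 obtain C where C: "C \<ge> 0" "\<And>x. \<bar>hf \<beta> u x\<bar> <= C * (1 + norm x) powr (- (d + \<alpha>))" using hf_decay[OF u nn] by blast
 have "(1 + norm x) powr (- (d + \<alpha>)) <= 1 powr (- (d + \<alpha>))" for x :: "real^'n"
  using alpha by (intro powr_mono2') (auto simp: d_eq)
 then have "C * (1 + norm x) powr (- (d + \<alpha>)) <= C * 1" for x :: "real^'n"
  using C(1) by (intro mult_left_mono) auto
 then show ?thesis using C by (intro exI[of _ C]) (auto intro: order_trans)
qed

lemma hf_L2:
 assumes u: "u \<in> Cc_inf H" and nn: "\<And>y. 0 <= u y"
 shows "L2 (hf \<beta> u) < \<infinity>"
proof -
 note [measurable] = hf_meas[OF u]
 obtain C where C: "C \<ge> 0" "\<And>x. \<bar>hf \<beta> u x\<bar> <= C * (1 + norm x) powr (- (d + \<alpha>))" using hf_decay[OF u nn] by blast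
 obtain C' where C': "C' \<ge> 0" "\<And>x. \<bar>hf \<beta> u x\<bar> <= C'" using hf_bounded[OF u nn] by blast
 have i: "integrable lborel (\<lambda>x::real^'n. C' * (C * (1 + norm x) powr (- (d + \<alpha>))))" using decay_integrable by simp
 have "L2 (hf \<beta> u) <= (NI (x::real^'n). ennreal (C' * (C * (1 + norm x) powr (- (d + \<alpha>)))))"
  unfolding L2_def
 proof (intro nn_integral_mono ennreal_leI)
  fix x
  have "\<bar>hf \<beta> u x\<bar> * \<bar>hf \<beta> u x\<bar> <= C' * (C * (1 + norm x) powr (- (d + \<alpha>)))"
   using C C' by (intro mult_mono) auto
  then show "indicator H x * (hf \<beta> u x)^2 <= C' * (C * (1 + norm x) powr (- (d + \<alpha>)))"
   using C C' by (auto simp: indicator_def power2_eq_square)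
 qed
 also have "... < \<infinity>" using nn_integral_eq_integral[OF i] C C' by simp
 finally show ?thesis .
qed

lemma form_hf:
 assumes u: "u \<in> Cc_inf H" and nn: "\<And>y. 0 <= u y" and v: "v \<in> Cc_inf H"
 shows "form k J u v + \<beta> * ip u v = ip (hf \<beta> u) v"
proof -
 note fu = finE_Cc_inf[OF u, unfolded finE_def] and fv = finE_Cc_inf[OF v, unfolded finE_def]
 have i1: "integrable lborel (\<lambda>x. indicator H x * (u x * v x))" using fu fv by (intro ip_int) auto
 have "integrable lborel (\<lambda>x. indicator H x * (hf 0 u x * v x))"
  using fv hf_meas[OF u] hf_L2[OF u nn] by (intro ip_int) auto
 moreover have "(\<lambda>x. indicator H x * (hf 0 u x * v x)) = (\<lambda>x. - (indicator H x * (v x * Lop u x)))"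
  by (auto simp: hf_def indicator_def)
 ultimately have i2: "integrable lborel (\<lambda>x. indicator H x * (v x * Lop u x))" by simp
 have "ip (hf \<beta> u) v = (LI x. \<beta> * (indicator H x * (u x * v x)) - indicator H x * (v x * Lop u x))"
  unfolding ip_def by (intro Bochner_Integration.integral_cong) (auto simp: hf_def indicator_def algebra_simps)
 also have "... = \<beta> * ip u v - (LI x. indicator H x * (v x * Lop u x))"
  using i1 i2 by (simp add: ip_def)
 finally show ?thesis using weak_form[OF u v] by simp
qed

end

locale bassoc = bkernel k d \<alpha> CB B for k :: "'n::finite" and d \<alpha> CB B +
 fixes P :: "real^'n => 'w measure" and Y :: "real => 'w => real^'n" and \<zeta> :: "'w => ennreal"
 assumes assoc: "associated k (Jk \<alpha> B) P Y \<zeta>"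
begin

lemma resolvent_exists:
 assumes \<beta>: "0 < \<beta>" and f: "bmeas f" "\<And>z. 0 <= f z" "\<And>z. f z <= C"
  and z: "\<And>z. z \<notin> Kn n ==> f z = 0"
 obtains U where "U \<in> form_dom k J" "AE x in lborel. x \<in> H --> U x = resolvent_proc P Y \<zeta> \<beta> f x"
  "\<And>v. v \<in> Cc_inf H ==> form k J U v + \<beta> * ip U v = ip f v"
proof -
 have "bounded (range f)" using f by (auto simp: bounded_iff intro!: exI[of _ C])
 moreover have cl: "closure {x. f x \<noteq> 0} \<subseteq> Kn n"
  using z by (intro closure_minimal compact_imp_closed Kn_compact) auto
 moreover have "compact (closure {x. f x \<noteq> 0})"
  using cl Kn_compact[of n] by (metis closed_closure compact_Int_closed inf.absorb_iff2)
 ultimately have "\<exists>u\<in>form_dom k J. (AE x in lborel. x \<in> H --> u x = resolvent_proc P Y \<zeta> \<beta> f x)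
      \<and> (\<forall>v\<in>Cc_inf H. form k J u v + \<beta> * (\<integral>x\<in>H. u x * v x \<partial>lborel)
         = (\<integral>x\<in>H. f x * v x \<partial>lborel))"
  using assoc[unfolded associated_def, rule_format, of \<beta> f] \<beta> f subset_trans[OF cl Kn_sub] by auto
 then show ?thesis using that by (auto simp: ip_def set_lebesgue_integral_def)
qed

text \<open>The positive and negative parts of \<open>hf \<beta> u\<close>, cut off to
  \<open>Kn n\<close>, are admissible data. The difference of their resolvents deviates from
  \<open>u\<close> by \<open>w n\<close>, which solves the resolvent equation for the discarded tail
  \<open>g n\<close>. Hence the L2 norm of \<open>w n\<close> is at most that of \<open>g n\<close>
  divided by \<beta>, and it tends to 0.\<close>

lemma resolvent_AE:
 assumes u: "u \<in> Cc_inf H" and nn: "\<And>y. 0 <= u y" and \<beta>: "0 < \<beta>"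
  and rp: "\<And>x. x \<in> H ==> (\<lambda>n. resolvent_proc P Y \<zeta> \<beta> (\<lambda>y. indicator (Kn n) y * max (hf \<beta> u y) 0) x) \<longlonglongrightarrow> rp x"
  and rm: "\<And>x. x \<in> H ==> (\<lambda>n. resolvent_proc P Y \<zeta> \<beta> (\<lambda>y. indicator (Kn n) y * max (- hf \<beta> u y) 0) x) \<longlonglongrightarrow> rm x"
 shows "AE x in lborel. x \<in> H --> u x = rp x - rm x"
proof -
 let ?R = "resolvent_proc P Y \<zeta> \<beta>"
 note [measurable] = hf_meas[OF u] Cc_inf_borel[OF u]
 obtain C where C: "C \<ge> 0" "\<And>x. \<bar>hf \<beta> u x\<bar> <= C" using hf_bounded[OF u nn] by blast
 define fp where "fp n y = indicator (Kn n) y * max (hf \<beta> u y) 0" for n y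
 define fm where "fm n y = indicator (Kn n) y * max (- hf \<beta> u y) 0" for n y
 define g where "g n y = hf \<beta> u y - (fp n y - fm n y)" for n y
 have g_eq: "g n y = indicator (- Kn n) y * hf \<beta> u y" for n y
  by (auto simp: g_def fp_def fm_def indicator_def)
 have [measurable]: "bmeas (fp n)" "bmeas (fm n)" "bmeas (g n)" for n
  unfolding g_def fp_def fm_def by measurable
 have hL2: "L2 (hf \<beta> u) < \<infinity>" by (rule hf_L2[OF u nn])
 have le_h: "L2 f < \<infinity>" if "\<And>y. \<bar>f y\<bar> <= \<bar>hf \<beta> u y\<bar>" for f
 proof -
  have "L2 f <= L2 (hf \<beta> u)" unfolding L2_def
   using that by (intro nn_integral_mono ennreal_leI mult_left_mono) (auto simp: abs_le_square_iff[symmetric])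
  then show ?thesis using hL2 by (rule le_less_trans)
 qed
 have L2p: "L2 (fp n) < \<infinity>" for n by (rule le_h) (auto simp: fp_def indicator_def)
 have L2m: "L2 (fm n) < \<infinity>" for n by (rule le_h) (auto simp: fm_def indicator_def)
 have L2g: "L2 (g n) < \<infinity>" for n by (rule le_h) (auto simp: g_eq indicator_def)
 note L2s = L2p L2m L2g
 have bp: "fp n z <= C" "fm n z <= C" for n z
  using C(1) C(2)[of z] by (auto simp: fp_def fm_def indicator_def abs_le_iff)
 have fp0: "0 <= fp n z" "z \<notin> Kn n ==> fp n z = 0" "0 <= fm n z" "z \<notin> Kn n ==> fm n z = 0" for n z
  by (auto simp: fp_def fm_def)
 have ex: "\<exists>U. \<forall>n. U n \<in> form_dom k J \<and> (AE x in lborel. x \<in> H --> U n x = ?R (f n) x)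
   \<and> (\<forall>v\<in>Cc_inf H. form k J (U n) v + \<beta> * ip (U n) v = ip (f n) v)"
  if "\<And>n. f n \<in> borel_measurable borel" "\<And>n z. 0 <= f n z" "\<And>n z. f n z <= C" "\<And>n z. z \<notin> Kn n ==> f n z = 0" for f
 proof (intro choice allI)
  fix n
  show "\<exists>U. U \<in> form_dom k J \<and> (AE x in lborel. x \<in> H --> U x = ?R (f n) x)
   \<and> (\<forall>v\<in>Cc_inf H. form k J U v + \<beta> * ip U v = ip (f n) v)"
   by (rule resolvent_exists[OF \<beta> that(1)[of n] that(2)[of n] that(3)[of n] that(4)[of _ n]]) blast+
 qed
 obtain Up where Up: "\<And>n. Up n \<in> form_dom k J" "\<And>n. AE x in lborel. x \<in> H --> Up n x = ?R (fp n) x"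
  "\<And>v n. v \<in> Cc_inf H ==> form k J (Up n) v + \<beta> * ip (Up n) v = ip (fp n) v"
  using ex[of fp, OF _ fp0(1) bp(1) fp0(2)] by auto
 obtain Um where Um: "\<And>n. Um n \<in> form_dom k J" "\<And>n. AE x in lborel. x \<in> H --> Um n x = ?R (fm n) x"
  "\<And>v n. v \<in> Cc_inf H ==> form k J (Um n) v + \<beta> * ip (Um n) v = ip (fm n) v"
  using ex[of fm, OF _ fp0(3) bp(2) fp0(4)] by auto
 have fUp: "finE (Up n)" and fUm: "finE (Um n)" for n using form_dom_approx[OF Up(1)] form_dom_approx[OF Um(1)] by metis+
 note fu = finE_Cc_inf[OF u]
 define w where "w n x = u x - (Up n x - Um n x)" for n x
 have fw: "finE (w n)" for n unfolding w_def by (intro finE_diff fu fUp fUm)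
 have [measurable]: "bmeas (w n)" for n using fw by (simp add: finE_def)
 \<comment> \<open>The estimate comes from testing the equation with \<open>w n\<close> itself. The
   equation holds for core functions first; \<open>weak_eq_form_dom\<close> admits the two
   resolvents as test functions, and \<open>w n\<close> is a combination of these with
   \<open>u\<close>.\<close>
 have est: "ip (w n) (w n) <= ip (g n) (g n) / \<beta>^2" for n
 proof -
  have Q: "form k J (w n) v + \<beta> * ip (w n) v = ip (g n) v" if v: "v \<in> Cc_inf H" for v
  proof -
   note fv = finE_Cc_inf[OF v]
   note ms = fu[unfolded finE_def] fv[unfolded finE_def] fUp[of n, unfolded finE_def] fUm[of n, unfolded finE_def]
   have 1: "form k J (w n) v = form k J u v - (form k J (Up n) v - form k J (Um n) v)"
    unfolding w_def using fu fv fUp fUm by (simp add: form_diff_left finE_diff)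
   have "finE (\<lambda>x. Up n x - Um n x)" by (intro finE_diff fUp fUm)
   then have 2: "ip (w n) v = ip u v - (ip (Up n) v - ip (Um n) v)"
    unfolding w_def using ms by (simp add: ip_diff_left finE_def)
   have "L2 (\<lambda>x. fp n x - fm n x) < \<infinity>" by (rule le_h) (auto simp: fp_def fm_def indicator_def)
   then have 3: "ip (g n) v = ip (hf \<beta> u) v - (ip (fp n) v - ip (fm n) v)"
    unfolding g_def using ms L2s hL2 by (simp add: ip_diff_left)
   show ?thesis using Up(3)[OF v, of n] Um(3)[OF v, of n] form_hf[OF u nn v, of \<beta>]
    unfolding 1 2 3 by (simp add: algebra_simps)
  qed
  have E: "form k J (w n) U + \<beta> * ip (w n) U = ip (g n) U" if "U \<in> form_dom k J" for U
   by (rule weak_eq_form_dom[OF fw _ L2g \<beta> Q that]) auto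
  have "form k J (w n) (w n) + \<beta> * ip (w n) (w n) = ip (g n) (w n)"
  proof -
   note fs = fu[unfolded finE_def] fUp[of n, unfolded finE_def] fUm[of n, unfolded finE_def] fw[of n, unfolded finE_def]
   have fd: "finE (\<lambda>x. Up n x - Um n x)" by (intro finE_diff fUp fUm)
   have 1: "form k J f (w n) = form k J f u - (form k J f (Up n) - form k J f (Um n))" if "finE f" for f
    unfolding w_def using fu fd fUp fUm that by (simp add: form_diff_right)
   have 2: "ip f (w n) = ip f u - (ip f (Up n) - ip f (Um n))" if "bmeas f" "L2 f < \<infinity>" for f
    unfolding w_def using fs fd that by (simp add: ip_diff_right finE_def)
   have a: "ip (w n) (w n) = ip (w n) u - (ip (w n) (Up n) - ip (w n) (Um n))" using fs by (intro 2) auto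
   have b: "ip (g n) (w n) = ip (g n) u - (ip (g n) (Up n) - ip (g n) (Um n))" using L2g by (intro 2) auto
   show ?thesis unfolding 1[OF fw] a b
    using Q[OF u] E[OF Up(1)[of n]] E[OF Um(1)[of n]] by (simp add: algebra_simps)
  qed
  moreover have "ip (g n) (w n) <= \<beta> / 2 * ip (w n) (w n) + ip (g n) (g n) / (2 * \<beta>)"
   using ip_young[of "w n" "g n" "2 * \<beta>"] fw[of n] L2g[of n] \<beta> by (simp add: finE_def ip_sym[of "g n" "w n"] abs_le_iff)
  ultimately have "\<beta> / 2 * ip (w n) (w n) <= ip (g n) (g n) / (2 * \<beta>)" using form_nonneg[of "w n"] by linarith
  then show ?thesis using \<beta> by (simp add: field_simps power2_eq_square)
 qed
 have "(\<lambda>n. (LI x. indicator H x * (g n x * g n x))) \<longlonglongrightarrow> (\<integral>x. (0::real) \<partial>(lborel :: (real^'n) measure))"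
 proof (rule integral_dominated_convergence[where w="\<lambda>x. indicator H x * (hf \<beta> u x * hf \<beta> u x)"])
  show "integrable lborel (\<lambda>x. indicator H x * (hf \<beta> u x * hf \<beta> u x))" using hL2 by (intro ip_int) auto
  show "AE x in lborel. (\<lambda>n. indicator H x * (g n x * g n x)) \<longlonglongrightarrow> 0"
  proof (rule AE_I2)
   fix x
   have "\<exists>n0. \<forall>n\<ge>n0. indicator H x * (g n x * g n x) = 0"
   proof (cases "x \<in> H")
    case True
    then obtain n0 where "\<forall>n\<ge>n0. x \<in> Kn n" using Kn_ex by blast
    then show ?thesis by (intro exI[of _ n0]) (simp add: g_eq)
   qed simp
   then have "\<forall>\<^sub>F n in sequentially. 0 = indicator H x * (g n x * g n x)"
    unfolding eventually_sequentially by (metis (no_types))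
   then show "(\<lambda>n. indicator H x * (g n x * g n x)) \<longlonglongrightarrow> 0" by (rule Lim_transform_eventually[OF tendsto_const])
  qed
  show "AE x in lborel. norm (indicator H x * (g n x * g n x)) <= indicator H x * (hf \<beta> u x * hf \<beta> u x)" for n
   by (auto simp: g_eq indicator_def)
 qed measurable
 then have gl: "(\<lambda>n. ip (g n) (g n)) \<longlonglongrightarrow> 0" by (simp add: ip_def)
 have wl: "(\<lambda>n. L2 (w n)) \<longlonglongrightarrow> 0"
 proof (rule tendsto_sandwich[OF _ _ tendsto_const])
  show "\<forall>\<^sub>F n in sequentially. L2 (w n) <= ennreal (ip (g n) (g n) / \<beta>^2)"
  proof (intro always_eventually allI)
   fix n
   have "L2 (w n) = ennreal (ip (w n) (w n))"
    using fw[of n] by (subst ip_L2) (auto simp: finE_def)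
   also have "... <= ennreal (ip (g n) (g n) / \<beta>^2)"
    by (intro ennreal_leI est)
   finally show "L2 (w n) <= ennreal (ip (g n) (g n) / \<beta>^2)" .
  qed
  have "(\<lambda>n. ennreal (ip (g n) (g n) / \<beta>^2)) \<longlonglongrightarrow> ennreal (0 / \<beta>^2)"
   using \<beta> by (intro tendsto_intros gl) auto
  then show "(\<lambda>n. ennreal (ip (g n) (g n) / \<beta>^2)) \<longlonglongrightarrow> 0" by simp
 qed simp
 \<comment> \<open>By Fatou's lemma the lower limit vanishes almost everywhere. This suffices
   without passing to subsequences, because \<open>rp\<close> and \<open>rm\<close> already provide
   pointwise limits.\<close>
 have "(NI x. liminf (\<lambda>n. ennreal (indicator H x * (w n x)^2))) <= liminf (\<lambda>n. L2 (w n))"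
  unfolding L2_def by (rule nn_integral_liminf) measurable
 also have "... = 0" using wl by (intro lim_imp_Liminf) auto
 finally have "(NI x. liminf (\<lambda>n. ennreal (indicator H x * (w n x)^2))) = 0" by simp
 then have "AE x in lborel. liminf (\<lambda>n. ennreal (indicator H x * (w n x)^2)) = 0"
  by (subst (asm) nn_integral_0_iff_AE) measurable
 moreover have "AE x in lborel. \<forall>n. x \<in> H --> Up n x = ?R (fp n) x"
  unfolding AE_all_countable using Up(2) by blast
 moreover have "AE x in lborel. \<forall>n. x \<in> H --> Um n x = ?R (fm n) x"
  unfolding AE_all_countable using Um(2) by blast
 ultimately show ?thesis
 proof eventually_elim
  case (elim x)
  show ?case
  proof
   assume x: "x \<in> H"
   have "(\<lambda>n. u x - (?R (fp n) x - ?R (fm n) x)) \<longlonglongrightarrow> u x - (rp x - rm x)"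
    using rp[OF x] rm[OF x] unfolding fp_def[abs_def] fm_def[abs_def] by (intro tendsto_intros)
   then have "(\<lambda>n. w n x) \<longlonglongrightarrow> u x - (rp x - rm x)" using elim(2,3) x by (simp add: w_def)
   then have "(\<lambda>n. ennreal (indicator H x * (w n x)^2)) \<longlonglongrightarrow> ennreal (indicator H x * (u x - (rp x - rm x))^2)"
    by (intro tendsto_intros)
   then have "liminf (\<lambda>n. ennreal (indicator H x * (w n x)^2)) = ennreal (indicator H x * (u x - (rp x - rm x))^2)"
    by (intro lim_imp_Liminf) auto
   then have "ennreal ((u x - (rp x - rm x))^2) = 0" using elim(1) x by simp
   then show "u x = rp x - rm x" by (simp add: ennreal_eq_0_iff)
  qed
 qed
qed

end

section \<open>Paths of the process and exit times\<close>

locale bproc = bassoc k d \<alpha> CB B P Y \<zeta>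
 for k :: "'n::finite" and d \<alpha> CB B and P :: "real^'n => 'w measure" and Y \<zeta> +
 fixes Msp :: "'w measure" and F :: "real => 'w set set" and G :: "(real^'n) set => real^'n => real^'n => real"
 assumes hunt: "hunt_process (halfsp k) Msp P Y \<zeta> F"
  and green: "w $ k = 0 ==> 0 < R ==> green_fun (ball w R \<inter> halfsp k) P Y \<zeta> (G (ball w R \<inter> halfsp k))"
begin

abbreviation exitH :: "(real^'n) set => 'w => ennreal" where "exitH C \<equiv> exit_time (C \<inter> H) Y \<zeta>"

lemmas hp = hunt[unfolded hunt_process_def]
lemmas hp_laws = hp[THEN conjunct1]
lemmas hp1 = hp[THEN conjunct2]
lemmas hp2 = hp1[THEN conjunct2]
lemmas hp3 = hp2[THEN conjunct2]
lemmas hp4 = hp3[THEN conjunct2]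
lemmas hp6 = hp4[THEN conjunct2, THEN conjunct2]
lemmas hp8 = hp6[THEN conjunct2, THEN conjunct2]
lemmas hp_kernel = hp1[THEN conjunct1]
lemmas hp_filt = hp2[THEN conjunct1]
lemmas hp_mono = hp3[THEN conjunct1]
lemmas hp_right = hp4[THEN conjunct1]
lemmas hp_adapted = hp6[THEN conjunct1]
lemmas hp_normal = hp6[THEN conjunct2, THEN conjunct1]
lemmas hp_path = hp8[THEN conjunct1]
lemmas hp_markov = hp8[THEN conjunct2, THEN conjunct2, THEN conjunct1]
lemmas hp_qlc = hp8[THEN conjunct2, THEN conjunct2, THEN conjunct2]

lemma prob: "x \<in> H ==> prob_space (P x)"
 and sets_P: "x \<in> H ==> sets (P x) = sets Msp"
 using hp_laws by auto

lemma kernel: "E \<in> sets Msp ==> (\<lambda>x. emeasure (P x) E) \<in> borel_measurable (restrict_space lebesgue H)"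
 using hp_kernel by blast

lemma F_sa: "0 <= t ==> sigma_algebra (space Msp) (F t)"
 and F_sub: "0 <= t ==> F t \<subseteq> sets Msp"
 using hp_filt by auto

lemma F_mono: "0 <= s ==> s <= t ==> F s \<subseteq> F t"
 using hp_mono by blast

lemma F_right: "0 <= t ==> (\<Inter>s\<in>{t<..}. F s) = F t"
 using hp_right by blast

lemma alive: "0 <= t ==> {w \<in> space Msp. ennreal t < \<zeta> w} \<in> F t"
 and adapted: "0 <= t ==> A \<in> sets borel ==> {w \<in> space Msp. ennreal t < \<zeta> w \<and> Y t w \<in> A} \<in> F t"
 using hp_adapted by auto

lemma normal: "x \<in> H ==> AE w in P x. 0 < \<zeta> w \<and> Y 0 w = x"
 using hp_normal by blast

lemma pathH: "w \<in> space Msp ==> 0 <= t ==> ennreal t < \<zeta> w ==> Y t w \<in> H"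
 and rcont: "w \<in> space Msp ==> 0 <= t ==> ennreal t < \<zeta> w ==> ((\<lambda>s. Y s w) \<longlongrightarrow> Y t w) (at_right t)"
 using hp_path by auto

lemma space_P: "x \<in> H ==> space (P x) = space Msp"
 using sets_P sets_eq_imp_space_eq by blast

lemma markov:
 assumes "x \<in> H" "stop_time Msp F T" "A \<in> stopped_sets Msp F T" "0 <= s"
  "bmeas f" "\<And>z. 0 <= f z" "bounded (range f)"
 shows "(\<integral>\<^sup>+w. indicator A w * indicator {w. T w + ennreal s < \<zeta> w} w
         * ennreal (f (Y (enn2real (T w) + s) w)) \<partial>P x)
    = (\<integral>\<^sup>+w. indicator A w * indicator {w. T w < \<zeta> w} w
         * trans_op P Y \<zeta> s f (Y (enn2real (T w)) w) \<partial>P x)"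
 using hp_markov assms by blast

lemma qlc:
 assumes "x \<in> H" "stop_time Msp F T" "\<And>n. stop_time Msp F (Tn n)"
  "\<And>w. incseq (\<lambda>n. Tn n w)" "\<And>w. (\<lambda>n. Tn n w) \<longlonglongrightarrow> T w"
 shows "AE w in P x. T w < \<infinity> -->
      (if T w < \<zeta> w then (\<lambda>n. Y (enn2real (Tn n w)) w) \<longlonglongrightarrow> Y (enn2real (T w)) w
      else to_cemetery H (\<lambda>n. Y (enn2real (Tn n w)) w) (\<lambda>n. \<zeta> w <= Tn n w) sequentially)"
 using hp_qlc assms by blast

text \<open>The killed path, with the point \<open>0\<close> of the boundary in place of the cemetery.\<close>
definition Z :: "real => 'w => real^'n" where
 "Z t w = (if 0 <= t \<and> ennreal t < \<zeta> w then Y t w else 0)"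

lemma zero_notin_H [simp]: "0 \<notin> H" by (simp add: halfsp_def)

lemma Z_H_iff: "w \<in> space Msp ==> Z t w \<in> H \<longleftrightarrow> 0 <= t \<and> ennreal t < \<zeta> w"
 using pathH by (auto simp: Z_def)

lemma Z_adapted:
 assumes t: "0 <= t" and A: "A \<in> sets borel"
 shows "{w \<in> space Msp. Z t w \<in> A} \<in> F t"
proof -
 interpret sigma_algebra "space Msp" "F t" by (rule F_sa[OF t])
 have "{w \<in> space Msp. Z t w \<in> A} = {w \<in> space Msp. ennreal t < \<zeta> w \<and> Y t w \<in> A} \<union> (if 0 \<in> A then space Msp - {w \<in> space Msp. ennreal t < \<zeta> w} else {})"
  using t by (auto simp: Z_def)
 also have "... \<in> F t" using adapted[OF t A] alive[OF t] by auto
 finally show ?thesis .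
qed

lemma Z_meas [measurable]: "Z t \<in> borel_measurable Msp"
proof (cases "0 <= t")
 case True
 show ?thesis
 proof (rule measurableI)
  fix A :: "(real^'n) set" assume "A \<in> sets borel"
  then have "{w \<in> space Msp. Z t w \<in> A} \<in> sets Msp" using Z_adapted[OF True] F_sub[OF True] by blast
  moreover have "Z t -` A \<inter> space Msp = {w \<in> space Msp. Z t w \<in> A}" by auto
  ultimately show "Z t -` A \<inter> space Msp \<in> sets Msp" by simp
 qed simp
qed (simp add: Z_def[abs_def])

lemma alive_nbhd:
 assumes "ennreal t < z" shows "\<exists>\<delta>>0. \<forall>s<t + \<delta>. ennreal s < z"
proof (cases z)
 case (real r)
 show ?thesis
 proof (cases "0 <= t")
  case True
  then have "t < r" using assms real by (simp add: ennreal_less_iff)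
  then show ?thesis using real True by (intro exI[of _ "r - t"]) (auto simp: ennreal_lessI)
 next
  case False
  then have "0 < r" using assms real by (simp add: ennreal_neg)
  then show ?thesis using real False by (intro exI[of _ "- t"]) (auto simp: ennreal_neg)
 qed
qed (auto intro!: exI[of _ 1])

lemma Z_rcont:
 assumes w: "w \<in> space Msp" and t: "0 <= t"
 shows "((\<lambda>s. Z s w) \<longlongrightarrow> Z t w) (at_right t)"
proof (cases "ennreal t < \<zeta> w")
 case True
 then obtain \<delta> where \<delta>: "\<delta> > 0" "\<And>s. s < t + \<delta> ==> ennreal s < \<zeta> w" using alive_nbhd by blast
 have "eventually (\<lambda>s. s \<in> {t<..<t + \<delta>}) (at_right t)"
  using \<delta>(1) by (intro eventually_at_right_real) auto
 then have "eventually (\<lambda>s. Y s w = Z s w) (at_right t)"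
  by eventually_elim (use t \<delta>(2) in \<open>auto simp: Z_def\<close>)
 moreover have "Z t w = Y t w" using True t by (simp add: Z_def)
 ultimately show ?thesis using rcont[OF w t True] by (auto intro: Lim_transform_eventually)
next
 case False
 have "eventually (\<lambda>s. 0 = Z s w) (at_right t)"
  unfolding eventually_at_filter
  by (intro always_eventually) (use False t in \<open>auto simp: Z_def intro: order_trans[OF _ ennreal_leI[of t]]\<close>,
     metis ennreal_leI less_imp_le not_le order_le_less_trans)
 moreover have "Z t w = 0" using False by (simp add: Z_def)
 ultimately show ?thesis by (auto intro: Lim_transform_eventually[OF tendsto_const])
qed

text \<open>Right-continuity lets a dyadic grid from the right recover the path.\<close>
definition dy :: "nat => real => real" where
 "dy n t = (of_int \<lfloor>2 ^ n * t\<rfloor> + 1) / 2 ^ n"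

text \<open>The left inequality is strict so that the grid times approach \<open>t\<close> within
  the filter \<open>at_right t\<close>.\<close>

lemma dy_bounds: "t < dy n t" "dy n t <= t + 1 / 2 ^ n"
 using floor_correct[of "2 ^ n * t"] unfolding dy_def by (auto simp: field_simps)

lemma dy_nonneg: "0 <= t ==> 0 <= dy n t" using dy_bounds(1)[of t n] by linarith

lemma dy_filterlim: "filterlim (\<lambda>n. dy n t) (at_right t) sequentially"
proof -
 have "(\<lambda>n. t + 1 / 2 ^ n) \<longlonglongrightarrow> t + 0"
  by (intro tendsto_add tendsto_const) (simp add: LIMSEQ_divide_realpow_zero)
 then have "(\<lambda>n. dy n t) \<longlonglongrightarrow> t"
  using dy_bounds by (intro tendsto_sandwich[of "\<lambda>_. t" "\<lambda>n. dy n t" sequentially "\<lambda>n. t + 1 / 2 ^ n"]) (auto intro!: always_eventually less_imp_le)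
 then show ?thesis using dy_bounds(1)
  by (auto simp: filterlim_at eventually_sequentially less_imp_neq[symmetric])
qed

lemma dy_conv:
 assumes "(f \<longlongrightarrow> l) (at_right t)" shows "(\<lambda>n. f (dy n t)) \<longlonglongrightarrow> l"
 using filterlim_compose[OF assms dy_filterlim] .

lemma dy_nat: "0 <= t ==> dy n t = (real (nat \<lfloor>2 ^ n * t\<rfloor>) + 1) / 2 ^ n"
 by (simp add: dy_def)

text \<open>Each grid approximation uses countably many times and is therefore jointly measurable;
  by right-continuity the approximations converge to the path.\<close>

lemma Z_joint: "(\<lambda>p. Z (fst p) (snd p)) \<in> borel_measurable (borel \<Otimes>\<^sub>M Msp)"
proof -
 define Zn where "Zn n p = (if 0 <= fst p then Z (dy n (fst p)) (snd p) else 0)" for n and p :: "real \<times> 'w"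
 have m: "Zn n \<in> borel_measurable (borel \<Otimes>\<^sub>M Msp)" for n
 proof -
  have fl: "(\<lambda>p::real \<times> 'w. nat \<lfloor>2 ^ n * fst p\<rfloor>) \<in> borel \<Otimes>\<^sub>M Msp \<rightarrow>\<^sub>M count_space UNIV"
  proof -
   have "(\<lambda>p::real \<times> 'w. 2 ^ n * fst p) \<in> borel_measurable (borel \<Otimes>\<^sub>M Msp)" by measurable
   from measurable_compose[OF this measurable_real_floor]
   have "(\<lambda>p::real \<times> 'w. \<lfloor>2 ^ n * fst p\<rfloor>) \<in> borel \<Otimes>\<^sub>M Msp \<rightarrow>\<^sub>M count_space UNIV" .
   from measurable_compose[OF this, of nat "count_space UNIV"] show ?thesis by simp
  qed
  have [measurable]: "(\<lambda>p::real \<times> 'w. Z ((real (nat \<lfloor>2 ^ n * fst p\<rfloor>) + 1) / 2 ^ n) (snd p)) \<in> borel_measurable (borel \<Otimes>\<^sub>M Msp)"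
   using measurable_compose_countable[where f="\<lambda>j p. Z ((real j + 1) / 2 ^ n) (snd p)", OF measurable_compose[OF measurable_snd Z_meas] fl] .
  have "Zn n = (\<lambda>p. if 0 <= fst p then Z ((real (nat \<lfloor>2 ^ n * fst p\<rfloor>) + 1) / 2 ^ n) (snd p) else 0)"
   by (auto simp: Zn_def dy_nat)
  then show ?thesis by simp
 qed
 show ?thesis
 proof (rule borel_measurable_LIMSEQ_metric[OF m])
  fix p :: "real \<times> 'w" assume p: "p \<in> space (borel \<Otimes>\<^sub>M Msp)"
  then have w: "snd p \<in> space Msp" by (auto simp: space_pair_measure)
  show "(\<lambda>n. Zn n p) \<longlonglongrightarrow> Z (fst p) (snd p)"
  proof (cases "0 <= fst p")
   case True
   then show ?thesis using dy_conv[OF Z_rcont[OF w True]] by (simp add: Zn_def)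
  qed (simp add: Zn_def Z_def)
 qed
qed

lemma Z_meas2 [measurable (raw)]:
 assumes "f \<in> borel_measurable M" "g \<in> M \<rightarrow>\<^sub>M Msp"
 shows "(\<lambda>p. Z (f p) (g p)) \<in> borel_measurable M"
 using measurable_compose[OF measurable_Pair[OF assms] Z_joint] by simp

lemma exit_time_le_zeta: "exit_time K Y \<zeta> w <= \<zeta> w"
proof (rule ccontr)
 assume c: "\<not> ?thesis"
 then obtain c where c: "\<zeta> w < c" "c < exit_time K Y \<zeta> w" using dense by (metis not_le)
 then obtain t where t: "c = ennreal t" "0 <= t" by (cases c) auto
 then have "0 < t" using c(1) by (cases "t = 0") auto
 then have "exit_time K Y \<zeta> w <= ennreal t" unfolding exit_time_def
  using c(1) t by (intro INF_lower) auto
 then show False using c(2) t by simp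
qed

lemma exit_time_mono: "K \<subseteq> V ==> exit_time K Y \<zeta> w <= exit_time V Y \<zeta> w"
 unfolding exit_time_def by (intro INF_superset_mono) auto

lemma before_exit:
 assumes w: "w \<in> space Msp" and t: "0 < t" "ennreal t < exit_time K Y \<zeta> w" shows "Z t w \<in> K"
proof (rule ccontr)
 assume "Z t w \<notin> K"
 moreover have "ennreal t < \<zeta> w" using t exit_time_le_zeta less_le_trans by blast
 ultimately have "exit_time K Y \<zeta> w <= ennreal t" unfolding exit_time_def
  using t by (intro INF_lower) (auto simp: Z_def)
 then show False using t by simp
qed

lemma exit_less_iff:
 assumes w: "w \<in> space Msp" and K: "K \<subseteq> H"
 shows "exit_time K Y \<zeta> w < c \<longleftrightarrow> (\<exists>t>0. ennreal t < c \<and> Z t w \<notin> K)"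
proof -
 have "Z t w \<notin> K \<longleftrightarrow> \<zeta> w <= ennreal t \<or> Y t w \<notin> K" if "0 < t" for t
  using that K by (auto simp: Z_def not_less[symmetric])
 then show ?thesis unfolding exit_time_def INF_less_iff by auto
qed

lemma Z_leaves_nbhd:
 assumes w: "w \<in> space Msp" and C: "closed C" and t: "0 <= t" and out: "Z t w \<notin> C \<inter> H"
 shows "\<exists>\<delta>>0. \<forall>s\<in>{t..<t + \<delta>}. Z s w \<notin> C \<inter> H"
proof (cases "Z t w \<in> H")
 case True
 have "Z t w \<in> - C" "open (- C)" using out True C by auto
 then have "eventually (\<lambda>s. Z s w \<in> - C) (at_right t)"
  using Z_rcont[OF w t] by (auto simp: tendsto_def)
 then obtain b where "b > t" "\<forall>y>t. y < b --> Z y w \<in> - C" unfolding eventually_at_right_field by blast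
 then show ?thesis using out by (intro exI[of _ "b - t"]) (auto simp: le_less)
next
 case False
 then have "\<not> ennreal t < \<zeta> w" using Z_H_iff[OF w] t by blast
 then have "Z s w = 0" if "t <= s" for s
  using that t by (auto simp: Z_def) (metis ennreal_leI le_less_trans)
 then show ?thesis by (intro exI[of _ 1]) auto
qed

text \<open>By right-continuity the path stays outside the closed set for a while after it is seen
  outside, and after the lifetime it stays out for ever; so a rational time detects the
  exit.\<close>

lemma exit_less_rat:
 assumes w: "w \<in> space Msp" and C: "closed C"
 shows "exitH C w < c \<longleftrightarrow> (\<exists>q\<in>\<rat>. 0 < q \<and> ennreal q < c \<and> Z q w \<notin> C \<inter> H)"
proof
 assume "exitH C w < c"
 then obtain t where t: "0 < t" "ennreal t < c" "Z t w \<notin> C \<inter> H" using exit_less_iff[OF w] by auto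
 obtain \<delta> where \<delta>: "\<delta> > 0" "\<forall>s\<in>{t..<t + \<delta>}. Z s w \<notin> C \<inter> H" using Z_leaves_nbhd[OF w C _ t(3)] t by auto
 obtain \<delta>' where \<delta>': "\<delta>' > 0" "\<forall>s<t + \<delta>'. ennreal s < c" using alive_nbhd[OF t(2)] by blast
 obtain q where "q \<in> \<rat>" "t < q" "q < t + min \<delta> \<delta>'" using Rats_dense_in_real[of t "t + min \<delta> \<delta>'"] \<delta> \<delta>' by auto
 then show "\<exists>q\<in>\<rat>. 0 < q \<and> ennreal q < c \<and> Z q w \<notin> C \<inter> H"
  using t \<delta> \<delta>' by (intro bexI[of _ q]) auto
next
 assume "\<exists>q\<in>\<rat>. 0 < q \<and> ennreal q < c \<and> Z q w \<notin> C \<inter> H"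
 then show "exitH C w < c" using exit_less_iff[OF w, of "C \<inter> H"] by auto
qed

lemma exit_less_F:
 assumes C: "closed C" and t: "0 <= t"
 shows "{w \<in> space Msp. exitH C w < ennreal t} \<in> F t"
proof -
 interpret sigma_algebra "space Msp" "F t" by (rule F_sa[OF t])
 have Cb: "- (C \<inter> H) \<in> sets borel" using C by (intro borel_comp sets.Int borel_closed halfsp_borel)
 have "{w \<in> space Msp. exitH C w < ennreal t} = (\<Union>q\<in>\<rat> \<inter> {0<..<t}. {w \<in> space Msp. Z q w \<in> - (C \<inter> H)})"
 proof (intro equalityI subsetI)
  fix w assume "w \<in> {w \<in> space Msp. exitH C w < ennreal t}"
  then obtain q where "w \<in> space Msp" "q \<in> \<rat>" "0 < q" "ennreal q < ennreal t" "Z q w \<notin> C \<inter> H"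
   using exit_less_rat[OF _ C, of w "ennreal t"] by blast
  then show "w \<in> (\<Union>q\<in>\<rat> \<inter> {0<..<t}. {w \<in> space Msp. Z q w \<in> - (C \<inter> H)})"
   by (intro UN_I[of q]) (auto simp: ennreal_less_iff)
 next
  fix w assume "w \<in> (\<Union>q\<in>\<rat> \<inter> {0<..<t}. {w \<in> space Msp. Z q w \<in> - (C \<inter> H)})"
  then obtain q where "q \<in> \<rat> \<inter> {0<..<t}" "w \<in> {w \<in> space Msp. Z q w \<in> - (C \<inter> H)}" by (rule UN_E)
  then have q: "w \<in> space Msp" "q \<in> \<rat>" "0 < q" "q < t" "Z q w \<notin> C \<inter> H" by simp_all
  have "exitH C w < ennreal t"
   unfolding exit_less_rat[OF q(1) C] using q by (intro bexI[of _ q] conjI) (simp_all add: ennreal_less_iff)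
  then show "w \<in> {w \<in> space Msp. exitH C w < ennreal t}" using q(1) by simp
 qed
 also have "... \<in> F t"
 proof (rule countable_UN'')
  show "countable (\<rat> \<inter> {0<..<t})" by (rule countable_subset[OF Int_lower1 countable_rat])
  fix q assume "q \<in> \<rat> \<inter> {0<..<t}"
  then have q: "0 <= q" "q <= t" by auto
  show "{w \<in> space Msp. Z q w \<in> - (C \<inter> H)} \<in> F t"
   by (rule subsetD[OF F_mono[OF q] Z_adapted[OF q(1) Cb]])
 qed
 finally show ?thesis .
qed

text \<open>Strict inequalities suffice because the filtration is right-continuous: the event that
  \<open>T\<close> is at most \<open>t\<close> is decided at every later time.\<close>

lemma stop_timeI:
 assumes "\<And>t. 0 <= t ==> {w \<in> space Msp. T w < ennreal t} \<in> F t"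
 shows "stop_time Msp F T"
 unfolding stop_time_def
proof (intro conjI allI impI)
 show "T \<in> borel_measurable Msp"
 proof (rule borel_measurableI_less)
  fix c :: ennreal
  show "{w \<in> space Msp. T w < c} \<in> sets Msp"
  proof (cases c)
   case (real r)
   then show ?thesis using assms[of r] F_sub[of r] by auto
  next
   case top
   have "{w \<in> space Msp. T w < c} = (\<Union>n. {w \<in> space Msp. T w < ennreal (real n)})"
   proof (intro equalityI subsetI)
    fix w assume w: "w \<in> {w \<in> space Msp. T w < c}"
    then obtain r where r: "T w = ennreal r" "0 <= r" by (cases "T w") (auto simp: top)
    obtain n where "r < real n" using reals_Archimedean2 by blast
    then show "w \<in> (\<Union>n. {w \<in> space Msp. T w < ennreal (real n)})" using w r by (auto simp: ennreal_less_iff)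
   qed (auto simp: top intro: less_trans[OF _ ennreal_less_top])
   moreover have "{w \<in> space Msp. T w < ennreal (real n)} \<in> sets Msp" for n
    using assms[of "real n"] F_sub[of "real n"] by auto
   ultimately show ?thesis by auto
  qed
 qed
 fix t :: real assume t: "0 <= t"
 have "{w \<in> space Msp. T w <= ennreal t} \<in> F s" if s: "t < s" for s
 proof -
  interpret sigma_algebra "space Msp" "F s" using s t by (intro F_sa) auto
  have "{w \<in> space Msp. T w <= ennreal t} = (\<Inter>n. {w \<in> space Msp. T w < ennreal (t + (s - t) / real (Suc n))})"
  proof (intro equalityI subsetI)
   fix w assume "w \<in> {w \<in> space Msp. T w <= ennreal t}"
   then show "w \<in> (\<Inter>n. {w \<in> space Msp. T w < ennreal (t + (s - t) / real (Suc n))})"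
    using s t by (auto intro!: le_less_trans[of "T w" "ennreal t"] simp: ennreal_less_iff)
  next
   fix w assume w: "w \<in> (\<Inter>n. {w \<in> space Msp. T w < ennreal (t + (s - t) / real (Suc n))})"
   have "(\<lambda>n. ennreal (t + (s - t) / real (Suc n))) \<longlonglongrightarrow> ennreal (t + 0)"
    by (intro tendsto_ennrealI tendsto_add tendsto_const LIMSEQ_Suc lim_const_over_n)
   then have "T w <= ennreal t"
    using w by (intro LIMSEQ_le_const[of _ "ennreal t"]) (auto intro!: less_imp_le)
   then show "w \<in> {w \<in> space Msp. T w <= ennreal t}" using w by auto
  qed
  also have "... \<in> F s"
  proof (rule countable_INT)
   show "range (\<lambda>n. {w \<in> space Msp. T w < ennreal (t + (s - t) / real (Suc n))}) \<subseteq> F s"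
   proof (rule image_subsetI)
    fix n
    have "(s - t) / real (Suc n) <= (s - t) / 1" using s by (intro divide_left_mono) auto
    then have "F (t + (s - t) / real (Suc n)) \<subseteq> F s" using s t by (intro F_mono) auto
    then show "{w \<in> space Msp. T w < ennreal (t + (s - t) / real (Suc n))} \<in> F s"
     using assms[of "t + (s - t) / real (Suc n)"] s t by auto
   qed
  qed simp
  finally show ?thesis .
 qed
 then show "{w \<in> space Msp. T w <= ennreal t} \<in> F t" using F_right[OF t] by auto
qed

lemma exit_stop: "closed C ==> stop_time Msp F (exitH C)"
 by (intro stop_timeI exit_less_F)

lemma stop_less:
 assumes T: "stop_time Msp F T" and t: "0 <= t"
 shows "{w \<in> space Msp. T w < ennreal t} \<in> F t"
proof -
 interpret sigma_algebra "space Msp" "F t" by (rule F_sa[OF t])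
 have "{w \<in> space Msp. T w < ennreal t} = (\<Union>q\<in>\<rat> \<inter> {0..<t}. {w \<in> space Msp. T w <= ennreal q})"
 proof (intro equalityI subsetI)
  fix w assume w: "w \<in> {w \<in> space Msp. T w < ennreal t}"
  then obtain r where r: "T w = ennreal r" "0 <= r" by (cases "T w") auto
  then have "r < t" using w by (simp add: ennreal_less_iff)
  then obtain q where "q \<in> \<rat>" "r < q" "q < t" using Rats_dense_in_real by blast
  then show "w \<in> (\<Union>q\<in>\<rat> \<inter> {0..<t}. {w \<in> space Msp. T w <= ennreal q})" using w r by (auto intro!: ennreal_leI bexI[of _ q])
 next
  fix w assume "w \<in> (\<Union>q\<in>\<rat> \<inter> {0..<t}. {w \<in> space Msp. T w <= ennreal q})"
  then show "w \<in> {w \<in> space Msp. T w < ennreal t}" by (auto simp: ennreal_less_iff intro: le_less_trans)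
 qed
 also have "... \<in> F t"
 proof (rule countable_UN'')
  show "countable (\<rat> \<inter> {0..<t})" by (rule countable_subset[OF Int_lower1 countable_rat])
  fix q assume "q \<in> \<rat> \<inter> {0..<t}"
  then show "{w \<in> space Msp. T w <= ennreal q} \<in> F t"
   using T F_mono[of q t] by (auto simp: stop_time_def)
 qed
 finally show ?thesis .
qed

text \<open>The exit time is an infimum of times outside \<open>K\<close>, so it cannot be followed
  at once by an interval inside \<open>K\<close>. The contradiction form is used to locate the path
  at its exit.\<close>

lemma at_exit:
 assumes w: "w \<in> space Msp" and K: "K \<subseteq> H" and T: "exit_time K Y \<zeta> w = ennreal \<tau>" "0 <= \<tau>"
  and \<delta>: "0 < \<delta>" "\<And>s. s \<in> {\<tau>..<\<tau> + \<delta>} ==> Z s w \<in> K"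
 shows False
proof -
 have "exit_time K Y \<zeta> w < ennreal (\<tau> + \<delta>)" using T \<delta> by (simp add: ennreal_less_iff)
 then obtain t where t: "t > 0" "ennreal t < ennreal (\<tau> + \<delta>)" "Z t w \<notin> K" using exit_less_iff[OF w K] by auto
 have "t < \<tau> + \<delta>" using t T \<delta> by (simp add: ennreal_less_iff del: ennreal_plus)
 moreover have "\<tau> <= t"
 proof (rule ccontr)
  assume "\<not> \<tau> <= t"
  then have "ennreal t < exit_time K Y \<zeta> w" using T t by (simp add: ennreal_less_iff)
  then show False using before_exit[OF w t(1)] t(3) by blast
 qed
 ultimately show False using \<delta>(2)[of t] t(3) by auto
qed

text \<open>If \<open>u\<close> were nonzero at the exit point, right-continuity would keep it
  nonzero for a while and so keep the path in \<open>K\<close>.\<close>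

lemma u_at_exit:
 assumes w: "w \<in> space Msp" and K: "K \<subseteq> H" and T: "exit_time K Y \<zeta> w < \<infinity>"
  and u: "continuous_on UNIV u" "\<And>x. x \<notin> K ==> u x = (0::real)"
 shows "u (Z (enn2real (exit_time K Y \<zeta> w)) w) = 0"
proof (rule ccontr)
 define \<tau> where "\<tau> = enn2real (exit_time K Y \<zeta> w)"
 have \<tau>: "exit_time K Y \<zeta> w = ennreal \<tau>" "0 <= \<tau>" using T by (auto simp: \<tau>_def)
 assume "u (Z (enn2real (exit_time K Y \<zeta> w)) w) \<noteq> 0"
 then have nz: "u (Z \<tau> w) \<noteq> 0" by (simp add: \<tau>_def)
 have "((\<lambda>s. u (Z s w)) \<longlongrightarrow> u (Z \<tau> w)) (at_right \<tau>)"
  using continuous_on_tendsto_compose[OF u(1) Z_rcont[OF w \<tau>(2)]] by simp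
 then have "eventually (\<lambda>s. u (Z s w) \<noteq> 0) (at_right \<tau>)" using nz by (rule tendsto_imp_eventually_ne)
 then obtain b where b: "b > \<tau>" "\<forall>y>\<tau>. y < b --> u (Z y w) \<noteq> 0" unfolding eventually_at_right_field by blast
 have "Z s w \<in> K" if "s \<in> {\<tau>..<\<tau> + (b - \<tau>)}" for s
  using that b nz u(2)[of "Z s w"] by (cases "s = \<tau>") auto
 then show False using b by (intro at_exit[OF w K \<tau>, of "b - \<tau>"]) auto
qed

end

context bproc begin

lemma stop_meas: "stop_time Msp F T ==> T \<in> borel_measurable Msp"
 by (simp add: stop_time_def)

lemma stop_time_SUP:
 assumes "\<And>n::nat. stop_time Msp F (T n)" shows "stop_time Msp F (\<lambda>w. SUP n. T n w)"
 unfolding stop_time_def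
proof (intro conjI allI impI)
 show "(\<lambda>w. SUP n. T n w) \<in> borel_measurable Msp"
  using assms stop_meas by (intro borel_measurable_SUP) auto
 fix t :: real assume t: "0 <= t"
 interpret sigma_algebra "space Msp" "F t" by (rule F_sa[OF t])
 have "{w \<in> space Msp. (SUP n. T n w) <= ennreal t} = (\<Inter>n. {w \<in> space Msp. T n w <= ennreal t})"
  by (auto simp: SUP_le_iff)
 also have "... \<in> F t" using assms t by (intro countable_INT) (auto simp: stop_time_def)
 finally show "{w \<in> space Msp. (SUP n. T n w) <= ennreal t} \<in> F t" .
qed

lemma exp_int: "0 < \<beta> ==> (NI r. indicator {0<..} r * ennreal (exp (- \<beta> * r))) = ennreal (1 / \<beta>)"
proof -
 assume b: "0 < \<beta>"
 interpret prob_space "density lborel (exponential_density \<beta>)" by (rule prob_space_exponential_density[OF b])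
 have "1 = (NI r. ennreal (exponential_density \<beta> r))"
  using emeasure_space_1 by (simp add: emeasure_density)
 also have "... = (NI r. ennreal \<beta> * (indicator {0<..} r * ennreal (exp (- \<beta> * r))))"
 proof (rule nn_integral_cong_AE)
  have "AE r in lborel. r \<noteq> (0::real)" by (rule AE_lborel_singleton)
  then show "AE r in lborel. ennreal (exponential_density \<beta> r) = ennreal \<beta> * (indicator {0<..} r * ennreal (exp (- \<beta> * r)))"
   by eventually_elim (use b in \<open>auto simp: exponential_density_def ennreal_mult[symmetric] mult.commute\<close>)
 qed
 also have "... = ennreal \<beta> * (NI r. indicator {0<..} r * ennreal (exp (- \<beta> * r)))"
  by (rule nn_integral_cmult) measurable
 finally have "ennreal (1 / \<beta>) * 1 = ennreal (1 / \<beta>) * (ennreal \<beta> * (NI r. indicator {0<..} r * ennreal (exp (- \<beta> * r))))"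
  by simp
 then show ?thesis using b by (simp add: mult.assoc[symmetric] ennreal_mult[symmetric])
qed

text \<open>The discount is carried by the time measure. For positive \<beta> its mass is 1/\<beta>,
  so Fubini and dominated convergence work with finite measures whether or not exit times are
  finite.\<close>

definition EM :: "real => real measure" where
 "EM \<beta> = density lborel (\<lambda>r. indicator {0<..} r * ennreal (exp (- \<beta> * r)))"

lemma sets_EM [measurable_cong, simp]: "sets (EM \<beta>) = sets borel" and space_EM [simp]: "space (EM \<beta>) = UNIV"
 by (simp_all add: EM_def)

lemma nn_EM:
 assumes "bmeas g"
 shows "(\<integral>\<^sup>+r. g r \<partial>EM \<beta>) = (NI r. indicator {0<..} r * ennreal (exp (- \<beta> * r)) * g r)"
 unfolding EM_def using assms by (intro nn_integral_density) auto

lemma EM_total: "0 < \<beta> ==> emeasure (EM \<beta>) UNIV = ennreal (1 / \<beta>)"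
 using exp_int[of \<beta>] by (simp add: EM_def emeasure_density)

lemma EM_finite: "0 < \<beta> ==> finite_measure (EM \<beta>)"
 by (rule finite_measureI) (simp add: EM_total)

lemma EM_pos: "AE r in EM \<beta>. 0 < r"
 unfolding EM_def by (subst AE_density) (auto simp: indicator_def)

abbreviation before :: "('w => ennreal) => real => 'w => ennreal" where
 "before T r w \<equiv> (if ennreal r < T w then 1 else 0)"

text \<open>The discounted occupation measure up to \<open>T\<close>, written as an image measure so
  that integrals against it are double integrals over paths and times.\<close>

definition occ :: "real => ('w => ennreal) => real^'n => (real^'n) measure" where
 "occ \<beta> T x = distr (density (P x \<Otimes>\<^sub>M EM \<beta>) (\<lambda>p. before T (snd p) (fst p))) borel (\<lambda>p. Z (snd p) (fst p))"

lemma sets_occ [measurable_cong, simp]: "sets (occ \<beta> T x) = sets borel" and space_occ [simp]: "space (occ \<beta> T x) = UNIV"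
 by (simp_all add: occ_def)

lemma nn_occ:
 assumes \<beta>: "0 < \<beta>" and x: "x \<in> H" and T [measurable]: "T \<in> borel_measurable Msp" and f [measurable]: "bmeas f"
 shows "(\<integral>\<^sup>+y. f y \<partial>occ \<beta> T x) = (\<integral>\<^sup>+w. \<integral>\<^sup>+r. before T r w * f (Z r w) \<partial>EM \<beta> \<partial>P x)"
proof -
 interpret Px: prob_space "P x" by (rule prob[OF x])
 interpret E: finite_measure "EM \<beta>" by (rule EM_finite[OF \<beta>])
 note [measurable_cong] = sets_P[OF x]
 have "(\<integral>\<^sup>+y. f y \<partial>occ \<beta> T x) = (\<integral>\<^sup>+p. f (Z (snd p) (fst p)) \<partial>density (P x \<Otimes>\<^sub>M EM \<beta>) (\<lambda>p. before T (snd p) (fst p)))"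
  unfolding occ_def by (rule nn_integral_distr) measurable
 also have "... = (\<integral>\<^sup>+p. before T (snd p) (fst p) * f (Z (snd p) (fst p)) \<partial>(P x \<Otimes>\<^sub>M EM \<beta>))"
  by (rule nn_integral_density) measurable
 also have "... = (\<integral>\<^sup>+w. \<integral>\<^sup>+r. before T r w * f (Z r w) \<partial>EM \<beta> \<partial>P x)"
  by (subst E.nn_integral_fst[symmetric]) (simp_all, measurable)
 finally show ?thesis .
qed

lemma occ_total:
 assumes \<beta>: "0 < \<beta>" and x: "x \<in> H" and T [measurable]: "T \<in> borel_measurable Msp"
 shows "emeasure (occ \<beta> T x) UNIV <= ennreal (1 / \<beta>)"
proof -
 interpret Px: prob_space "P x" by (rule prob[OF x])
 have "emeasure (occ \<beta> T x) UNIV = (\<integral>\<^sup>+y. 1 \<partial>occ \<beta> T x)" by simp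
 also have "... = (\<integral>\<^sup>+w. \<integral>\<^sup>+r. before T r w * 1 \<partial>EM \<beta> \<partial>P x)"
  by (rule nn_occ[OF \<beta> x T]) simp
 also have "... <= (\<integral>\<^sup>+w. \<integral>\<^sup>+r. 1 \<partial>EM \<beta> \<partial>P x)" by (intro nn_integral_mono) simp
 also have "... = ennreal (1 / \<beta>)" by (simp add: EM_total[OF \<beta>] Px.emeasure_space_1)
 finally show ?thesis .
qed

lemma occ_finite: "0 < \<beta> ==> x \<in> H ==> T \<in> borel_measurable Msp ==> finite_measure (occ \<beta> T x)"
 by (rule finite_measureI) (use occ_total[of \<beta> x T] in \<open>auto simp: top_unique\<close>)

text \<open>Dropping the discount and enlarging the set can only increase the occupation integral,
  and on the half-ball the defining identity of \<open>G\<close> evaluates it.\<close>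

lemma occ_le_green:
 assumes \<beta>: "0 < \<beta>" and C: "closed C" and w0: "w0 $ k = 0" "0 < R" and sub: "C \<inter> H \<subseteq> ball w0 R \<inter> H" and x: "x \<in> ball w0 R \<inter> H"
  and f: "bmeas f" "\<And>z. 0 <= f z"
 shows "(\<integral>\<^sup>+y. ennreal (f y) \<partial>occ \<beta> (exitH C) x) <= (\<integral>\<^sup>+y\<in>ball w0 R \<inter> H. ennreal (G (ball w0 R \<inter> H) x y * f y) \<partial>lborel)"
proof -
 let ?V = "ball w0 R \<inter> H" and ?T = "exitH C"
 have xH: "x \<in> H" using x by simp
 note [measurable] = f(1)
 have "(\<integral>\<^sup>+y. ennreal (f y) \<partial>occ \<beta> ?T x) = (\<integral>\<^sup>+w. \<integral>\<^sup>+r. before ?T r w * ennreal (f (Z r w)) \<partial>EM \<beta> \<partial>P x)"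
  by (rule nn_occ[OF \<beta> xH stop_meas[OF exit_stop[OF C]]]) measurable
 also have "... <= (\<integral>\<^sup>+w. (\<integral>\<^sup>+t\<in>{0..}. indicator {t. ennreal t < exit_time ?V Y \<zeta> w} t * ennreal (f (Y t w)) \<partial>lborel) \<partial>P x)"
 proof (rule nn_integral_mono)
  fix w assume "w \<in> space (P x)"
  then have w: "w \<in> space Msp" using space_P[OF xH] by simp
  have zm [measurable]: "bmeas (\<lambda>s. Z s w)" using w by measurable
  have "(\<integral>\<^sup>+r. before ?T r w * ennreal (f (Z r w)) \<partial>EM \<beta>)
   = (NI r. indicator {0<..} r * ennreal (exp (- \<beta> * r)) * (before ?T r w * ennreal (f (Z r w))))"
   by (rule nn_EM) measurable
  also have "... <= (\<integral>\<^sup>+t\<in>{0..}. indicator {t. ennreal t < exit_time ?V Y \<zeta> w} t * ennreal (f (Y t w)) \<partial>lborel)"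
  proof (rule nn_integral_mono)
   fix r :: real
   have "ennreal (exp (- \<beta> * r)) * ennreal (f (Z r w)) <= 1 * ennreal (f (Y r w))" "ennreal r < exit_time ?V Y \<zeta> w"
    if "0 < r" "ennreal r < ?T w"
   proof -
    have "ennreal r < \<zeta> w" using that(2) exit_time_le_zeta less_le_trans by blast
    then show "ennreal (exp (- \<beta> * r)) * ennreal (f (Z r w)) <= 1 * ennreal (f (Y r w))" unfolding Z_def
     using that \<beta> by (intro mult_mono ennreal_le_1[THEN iffD2]) auto
    show "ennreal r < exit_time ?V Y \<zeta> w" by (rule less_le_trans[OF that(2) exit_time_mono[OF sub]])
   qed
   then show "indicator {0<..} r * ennreal (exp (- \<beta> * r)) * (before ?T r w * ennreal (f (Z r w)))
     <= indicator {t. ennreal t < exit_time ?V Y \<zeta> w} r * ennreal (f (Y r w)) * indicator {0..} r"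
    by (auto simp: indicator_def)
  qed
  finally show "(\<integral>\<^sup>+r. before ?T r w * ennreal (f (Z r w)) \<partial>EM \<beta>)
   <= (\<integral>\<^sup>+t\<in>{0..}. indicator {t. ennreal t < exit_time ?V Y \<zeta> w} t * ennreal (f (Y t w)) \<partial>lborel)" .
 qed
 also have "... = (\<integral>\<^sup>+y\<in>?V. ennreal (G ?V x y * f y) \<partial>lborel)"
  using green[OF w0] f x unfolding green_fun_def by blast
 finally show ?thesis .
qed

text \<open>Exits from half-balls centred at the boundary point 0: the regions on which Green
  functions are available.\<close>

definition TK :: "nat => 'w => ennreal" where
 "TK n w = exit_time (cball 0 (real n) \<inter> H) Y \<zeta> w"

lemma TK_stop: "stop_time Msp F (TK n)"
 unfolding TK_def by (rule exit_stop) simp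

lemma TK_meas [measurable]: "TK n \<in> borel_measurable Msp"
 by (rule stop_meas[OF TK_stop])

lemma norm_at_TK:
 assumes w: "w \<in> space Msp" and T: "TK n w < \<zeta> w"
 shows "real n <= norm (Y (enn2real (TK n w)) w)"
proof (rule ccontr)
 assume c: "\<not> ?thesis"
 define \<tau> where "\<tau> = enn2real (TK n w)"
 have \<tau>: "TK n w = ennreal \<tau>" "0 <= \<tau>" using T by (auto simp: \<tau>_def less_top[symmetric] dest: less_le_trans[OF _ top_greatest])
 have \<tau>z: "ennreal \<tau> < \<zeta> w" using T \<tau> by simp
 have ZY: "Z \<tau> w = Y \<tau> w" using \<tau> \<tau>z by (simp add: Z_def)
 have "norm (Y \<tau> w) < real n" using c unfolding \<tau>_def by (rule not_le_imp_less)
 moreover have "Z \<tau> w \<in> H" using Z_H_iff[OF w] \<tau>(2) \<tau>z by blast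
 ultimately have Zt: "Z \<tau> w \<in> ball 0 (real n) \<inter> H" unfolding ZY by simp
 have "open (ball 0 (real n) \<inter> H)" by (intro open_Int open_ball halfsp_open)
 then have "eventually (\<lambda>s. Z s w \<in> ball 0 (real n) \<inter> H) (at_right \<tau>)"
  by (rule topological_tendstoD[OF Z_rcont[OF w \<tau>(2)] _ Zt])
 then obtain b where b: "b > \<tau>" "\<forall>y>\<tau>. y < b --> Z y w \<in> ball 0 (real n) \<inter> H" unfolding eventually_at_right_field by blast
 have K: "Z s w \<in> cball 0 (real n) \<inter> H" if "s \<in> {\<tau>..<\<tau> + (b - \<tau>)}" for s
 proof (cases "s = \<tau>")
  case True then show ?thesis using Zt by auto
 next
  case False
  then have "Z s w \<in> ball 0 (real n) \<inter> H" using that b(2) by auto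
  then show ?thesis by auto
 qed
 show False
  by (rule at_exit[OF w _ \<tau>(1)[unfolded TK_def] \<tau>(2), of "b - \<tau>"]) (use b K in auto)
qed

text \<open>If the exit times accumulated before the lifetime, quasi-left-continuity would make the
  positions at these times converge; but on exit from the half-ball of radius \<open>n\<close> the
  norm is at least \<open>n\<close>.\<close>

lemma TK_exhaust:
 assumes x: "x \<in> H"
 shows "AE w in P x. \<forall>t. ennreal t < \<zeta> w --> (\<exists>n. ennreal t < TK n w)"
proof -
 have mono: "incseq (\<lambda>n. TK n w)" for w
  unfolding TK_def incseq_def by (intro allI impI exit_time_mono) auto
 have "AE w in P x. (SUP n. TK n w) < \<infinity> -->
      (if (SUP n. TK n w) < \<zeta> w then (\<lambda>n. Y (enn2real (TK n w)) w) \<longlonglongrightarrow> Y (enn2real (SUP n. TK n w)) w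
      else to_cemetery H (\<lambda>n. Y (enn2real (TK n w)) w) (\<lambda>n. \<zeta> w <= TK n w) sequentially)"
  by (rule qlc[OF x stop_time_SUP[of TK, OF TK_stop] TK_stop mono LIMSEQ_SUP[OF mono]])
 moreover have "AE w in P x. w \<in> space Msp" using space_P[OF x] by (intro AE_I2) simp
 ultimately show ?thesis
 proof eventually_elim
  case (elim w)
  have "\<not> (SUP n. TK n w) < \<zeta> w"
  proof
   assume s: "(SUP n. TK n w) < \<zeta> w"
   then have "(SUP n. TK n w) < \<infinity>" using less_le_trans[OF s top_greatest] by simp
   then have "(\<lambda>n. Y (enn2real (TK n w)) w) \<longlonglongrightarrow> Y (enn2real (SUP n. TK n w)) w" using elim(1) s by simp
   then have "Bseq (\<lambda>n. Y (enn2real (TK n w)) w)" by (intro convergent_imp_Bseq) (auto simp: convergent_def)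
   then obtain B where B: "\<And>n. norm (Y (enn2real (TK n w)) w) <= B" unfolding Bseq_def by auto
   obtain n where "B < real n" using reals_Archimedean2 by blast
   moreover have "TK n w < \<zeta> w" using s by (rule le_less_trans[OF SUP_upper[OF UNIV_I]])
   ultimately show False using norm_at_TK[OF elim(2)] B[of n] by fastforce
  qed
  then have le: "\<zeta> w <= (SUP n. TK n w)" by simp
  show ?case
  proof (intro allI impI)
   fix t assume "ennreal t < \<zeta> w"
   then have "ennreal t < (SUP n. TK n w)" using le by (rule less_le_trans)
   then show "\<exists>n. ennreal t < TK n w" unfolding less_SUP_iff by blast
  qed
 qed
qed

text \<open>Up to \<open>TK n\<close> the occupation measure is dominated by a measure whose density
  is the Green function of a larger half-ball, so it does not charge null sets. Letting
  \<open>n\<close> grow covers all times before the lifetime.\<close>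

lemma ae_notin_null:
 assumes x: "x \<in> H" and N: "N \<in> sets borel" "emeasure lborel N = 0"
 shows "AE t in lborel. 0 < t --> (AE w in P x. Z t w \<notin> N \<inter> H)"
proof -
 interpret Px: prob_space "P x" by (rule prob[OF x])
 interpret E: finite_measure "EM 1" by (rule EM_finite) simp
 interpret pair_sigma_finite "EM 1" "P x" ..
 note [measurable_cong] = sets_P[OF x]
 note [measurable] = N(1)
 have "AE t in EM 1. AE w in P x. before (TK n) t w * ennreal (indicator N (Z t w)) = 0" for n
 proof -
  \<comment> \<open>Large enough for the half-ball of radius \<open>R\<close> to contain both
    \<open>x\<close> and the closed half-ball of radius \<open>n\<close>.\<close>
  define R where "R = real n + 1 + norm x"
  have R: "0 < R" "real n < R" "norm x < R" unfolding R_def using norm_ge_zero[of x] by linarith+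
  have "AE y in lborel. y \<notin> N" by (rule AE_not_in) (use N in auto)
  then have g0: "(\<integral>\<^sup>+y\<in>ball 0 R \<inter> H. ennreal (G (ball 0 R \<inter> H) x y * indicator N y) \<partial>lborel) = (NI (y::real^'n). 0)"
   by (intro nn_integral_cong_AE) (auto elim!: eventually_mono)
  have "(\<integral>\<^sup>+y. ennreal (indicator N y) \<partial>occ 1 (exit_time (cball 0 (real n) \<inter> H) Y \<zeta>) x)
   <= (\<integral>\<^sup>+y\<in>ball 0 R \<inter> H. ennreal (G (ball 0 R \<inter> H) x y * indicator N y) \<partial>lborel)"
   by (rule occ_le_green) (use x R in auto)
  then have "(\<integral>\<^sup>+y. ennreal (indicator N y) \<partial>occ 1 (TK n) x) = 0" unfolding g0 TK_def[abs_def] by simp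
  also have "(\<integral>\<^sup>+y. ennreal (indicator N y) \<partial>occ 1 (TK n) x) = (\<integral>\<^sup>+w. \<integral>\<^sup>+r. before (TK n) r w * ennreal (indicator N (Z r w)) \<partial>EM 1 \<partial>P x)"
   by (rule nn_occ[OF _ x TK_meas]) auto
  also have "... = (\<integral>\<^sup>+r. \<integral>\<^sup>+w. before (TK n) r w * ennreal (indicator N (Z r w)) \<partial>P x \<partial>EM 1)"
   by (rule Fubini') measurable
  finally have "AE t in EM 1. (\<integral>\<^sup>+w. before (TK n) t w * ennreal (indicator N (Z t w)) \<partial>P x) = 0"
   by (subst (asm) nn_integral_0_iff_AE) auto
  then show ?thesis
   by eventually_elim (subst (asm) nn_integral_0_iff_AE; simp)
 qed
 then have "AE t in EM 1. \<forall>n. AE w in P x. before (TK n) t w * ennreal (indicator N (Z t w)) = 0"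
  unfolding AE_all_countable by blast
 then have "AE t in EM 1. 0 < t --> (AE w in P x. Z t w \<notin> N \<inter> H)"
 proof eventually_elim
  case (elim t)
  show ?case
  proof
   assume t: "0 < t"
   have "AE w in P x. \<forall>n. before (TK n) t w * ennreal (indicator N (Z t w)) = 0"
    using elim unfolding AE_all_countable by blast
   then show "AE w in P x. Z t w \<notin> N \<inter> H" using TK_exhaust[OF x] AE_space
   proof eventually_elim
    case (elim w)
    show ?case
    proof
     assume *: "Z t w \<in> N \<inter> H"
     then have "ennreal t < \<zeta> w" using Z_H_iff[of w t] elim(3) space_P[OF x] t by auto
     then obtain n where "ennreal t < TK n w" using elim(2) by blast
     then show False using elim(1)[rule_format, of n] * by simp
    qed
   qed
  qed
 qed
 then show ?thesis unfolding EM_def by (subst (asm) AE_density) (auto simp: indicator_def elim!: eventually_mono)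
qed

lemma P_kernel: "P \<in> restrict_space lebesgue H \<rightarrow>\<^sub>M subprob_algebra Msp"
proof (rule measurable_subprob_algebra)
 fix a assume "a \<in> space (restrict_space lebesgue H)"
 then have a: "a \<in> H" by (simp add: space_restrict_space)
 then interpret prob_space "P a" by (rule prob)
 show "subprob_space (P a)" by unfold_locales
 show "sets (P a) = sets Msp" by (rule sets_P[OF a])
qed (rule kernel)

lemma kernel_nn_integral:
 assumes "f \<in> borel_measurable Msp"
 shows "(\<lambda>z. \<integral>\<^sup>+w. f w \<partial>P z) \<in> borel_measurable (restrict_space lebesgue H)"
 by (rule measurable_compose[OF P_kernel nn_integral_measurable_subprob_algebra[OF assms]])

text \<open>Measurability of \<open>P\<close> in the starting point refers to Lebesgue sets, so
  integrals against \<open>P z\<close> are Borel functions of \<open>z\<close> only off a null set,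
  which has to be carried along explicitly.\<close>

lemma borel_version:
 fixes f :: "real^'n => ennreal"
 assumes f: "f \<in> borel_measurable (restrict_space lebesgue H)"
 shows "\<exists>b N. b \<in> borel_measurable borel \<and> N \<in> sets borel \<and> emeasure lborel N = 0 \<and> (\<forall>z\<in>H - N. f z = b z)"
proof -
 have "(\<lambda>z. f z * indicator H z) \<in> borel_measurable lebesgue"
  using f by (subst (asm) borel_measurable_restrict_space_iff_ennreal) auto
 then obtain b where b: "b \<in> borel_measurable lborel" "AE z in lborel. f z * indicator H z = b z"
  using completion_ex_borel_measurable by blast
 from b(2) obtain N where N: "{z \<in> space lborel. f z * indicator H z \<noteq> b z} \<subseteq> N" "emeasure lborel N = 0" "N \<in> sets lborel"
  by (rule AE_E)
 have "f z = b z" if "z \<in> H - N" for z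
  using N(1) that by (force simp: indicator_def)
 then show ?thesis using b N by (intro exI[of _ b] exI[of _ N]) auto
qed

definition UR :: "real => (real^'n => real) => real^'n => ennreal" where
 "UR \<beta> f z = (\<integral>\<^sup>+w. \<integral>\<^sup>+s. ennreal (f (Z s w)) \<partial>EM \<beta> \<partial>P z)"

lemma UR_finite:
 assumes z: "z \<in> H" and \<beta>: "0 < \<beta>" and f: "\<And>y. f y <= C"
 shows "UR \<beta> f z < \<infinity>"
proof -
 interpret prob_space "P z" by (rule prob[OF z])
 have "UR \<beta> f z <= (\<integral>\<^sup>+w. \<integral>\<^sup>+s. ennreal C \<partial>EM \<beta> \<partial>P z)"
  unfolding UR_def by (intro nn_integral_mono ennreal_leI f)
 also have "... < \<infinity>" by (simp add: EM_total[OF \<beta>] emeasure_space_1 ennreal_mult_less_top)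
 finally show ?thesis .
qed

lemma resolvent_proc_UR:
 assumes z: "z \<in> H" and f [measurable]: "bmeas f" and f0: "f 0 = 0" "\<And>y. 0 <= f y"
 shows "resolvent_proc P Y \<zeta> \<beta> f z = enn2real (UR \<beta> f z)"
proof -
 have "(\<integral>\<^sup>+t\<in>{0..}. indicator {t. ennreal t < \<zeta> w} t * ennreal (exp (- \<beta> * t) * f (Y t w)) \<partial>lborel)
   = (\<integral>\<^sup>+s. ennreal (f (Z s w)) \<partial>EM \<beta>)" if "w \<in> space (P z)" for w
 proof -
  have "w \<in> space Msp" using that space_P[OF z] by simp
  then have m: "bmeas (\<lambda>s. ennreal (f (Z s w)))" by measurable
  show ?thesis unfolding nn_EM[OF m]
  proof (rule nn_integral_cong_AE)
   have "AE r in lborel. r \<noteq> (0::real)" by (rule AE_lborel_singleton)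
   then show "AE t in lborel. indicator {t. ennreal t < \<zeta> w} t * ennreal (exp (- \<beta> * t) * f (Y t w)) * indicator {0..} t = indicator {0<..} t * ennreal (exp (- \<beta> * t)) * ennreal (f (Z t w))"
    by eventually_elim (auto simp: Z_def f0 indicator_def ennreal_mult)
  qed
 qed
 then show ?thesis by (simp add: resolvent_proc_def UR_def cong: nn_integral_cong)
qed

text \<open>Dominated convergence supplies the limits of truncated resolvents that
  \<open>resolvent_AE\<close> asks for. The negative part stands on the right so that the identity
  lives in \<open>ennreal\<close> without subtraction.\<close>

lemma UR_AE:
 assumes u: "u \<in> Cc_inf H" and nn: "\<And>y. 0 <= u y" and \<beta>: "0 < \<beta>"
 shows "AE x in lborel. x \<in> H --> UR \<beta> (\<lambda>y. max (hf \<beta> u y) 0) x = UR \<beta> (\<lambda>y. max (- hf \<beta> u y) 0) x + ennreal (u x)"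
proof -
 note [measurable] = hf_meas[OF u]
 obtain C where C: "C \<ge> 0" "\<And>x. \<bar>hf \<beta> u x\<bar> <= C" using hf_bounded[OF u nn] by blast
 have conv: "(\<lambda>n. resolvent_proc P Y \<zeta> \<beta> (\<lambda>y. indicator (Kn n) y * f y) x) \<longlonglongrightarrow> enn2real (UR \<beta> f x)"
  if x: "x \<in> H" and fm [measurable]: "bmeas f" and f: "\<And>y. 0 <= f y" "\<And>y. f y <= C" "\<And>y. y \<notin> H ==> f y = 0" for f x
 proof -
  interpret Px: prob_space "P x" by (rule prob[OF x])
  interpret E: finite_measure "EM \<beta>" by (rule EM_finite[OF \<beta>])
  note [measurable_cong] = sets_P[OF x]
  let ?f = "\<lambda>n y. indicator (Kn n) y * f y"
  have lim: "(\<lambda>n. ennreal (?f n y)) \<longlonglongrightarrow> ennreal (f y)" for y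
  proof (cases "y \<in> H")
   case True
   then obtain n0 where n0: "\<forall>n\<ge>n0. y \<in> Kn n" using Kn_ex by blast
   have "\<forall>\<^sub>F n in sequentially. ennreal (f y) = ennreal (?f n y)"
    unfolding eventually_sequentially using n0 by (intro exI[of _ n0]) auto
   then show ?thesis by (rule Lim_transform_eventually[OF tendsto_const])
  qed (simp add: f(3))
  have le: "ennreal (?f n y) <= ennreal C" for n y
   using f(1,2)[of y] C(1) by (auto simp: indicator_def intro!: ennreal_leI)
  have "(\<lambda>n. UR \<beta> (?f n) x) \<longlonglongrightarrow> UR \<beta> f x" unfolding UR_def
  proof (rule nn_integral_dominated_convergence[where w="\<lambda>_. ennreal C * ennreal (1 / \<beta>)"])
   show "AE w in P x. (\<integral>\<^sup>+s. ennreal (?f n (Z s w)) \<partial>EM \<beta>) <= ennreal C * ennreal (1 / \<beta>)" for n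
    using nn_integral_mono[OF le, where M="EM \<beta>"] by (intro AE_I2) (simp add: EM_total[OF \<beta>])
   show "AE w in P x. (\<lambda>n. \<integral>\<^sup>+s. ennreal (?f n (Z s w)) \<partial>EM \<beta>) \<longlonglongrightarrow> (\<integral>\<^sup>+s. ennreal (f (Z s w)) \<partial>EM \<beta>)"
   proof (rule AE_I2)
    fix w assume "w \<in> space (P x)"
    then have "w \<in> space Msp" using space_P[OF x] by simp
    then have [measurable]: "bmeas (\<lambda>r. Z r w)" by measurable
    show "(\<lambda>n. \<integral>\<^sup>+s. ennreal (?f n (Z s w)) \<partial>EM \<beta>) \<longlonglongrightarrow> (\<integral>\<^sup>+s. ennreal (f (Z s w)) \<partial>EM \<beta>)"
     by (rule nn_integral_dominated_convergence[where w="\<lambda>_. ennreal C"])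
       (use le lim in \<open>auto simp: EM_total[OF \<beta>] ennreal_mult_less_top\<close>)
   qed
  qed (auto simp: Px.emeasure_space_1 ennreal_mult_less_top)
  then have "(\<lambda>n. enn2real (UR \<beta> (?f n) x)) \<longlonglongrightarrow> enn2real (UR \<beta> f x)"
   using UR_finite[OF x \<beta>, of f C] f(2) by (intro tendsto_enn2real) auto
  then show ?thesis using x f(1) f(3)[of 0] by (simp add: resolvent_proc_UR)
 qed
 have fin: "UR \<beta> (\<lambda>y. max (hf \<beta> u y) 0) x < \<infinity>" "UR \<beta> (\<lambda>y. max (- hf \<beta> u y) 0) x < \<infinity>" if x: "x \<in> H" for x
  using C by (intro UR_finite[OF x \<beta>, of _ C]; force simp: abs_le_iff)+
 have z: "y \<notin> H ==> hf \<beta> u y = 0" for y by (simp add: hf_def)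
 have "AE x in lborel. x \<in> H --> u x = enn2real (UR \<beta> (\<lambda>y. max (hf \<beta> u y) 0) x) - enn2real (UR \<beta> (\<lambda>y. max (- hf \<beta> u y) 0) x)"
  by (rule resolvent_AE[OF u nn \<beta>]; rule conv) (use C in \<open>auto simp: abs_le_iff z\<close>)
 then show ?thesis
 proof eventually_elim
  case (elim x)
  show ?case
  proof
   assume x: "x \<in> H"
   have "ennreal (enn2real (UR \<beta> (\<lambda>y. max (hf \<beta> u y) 0) x)) = ennreal (enn2real (UR \<beta> (\<lambda>y. max (- hf \<beta> u y) 0) x) + u x)"
    using elim x by simp
   then show "UR \<beta> (\<lambda>y. max (hf \<beta> u y) 0) x = UR \<beta> (\<lambda>y. max (- hf \<beta> u y) 0) x + ennreal (u x)"
    using fin[OF x] nn by (simp add: ennreal_plus)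
  qed
 qed
qed

end

section \<open>Markov property of the resolvent, optional stopping and Dynkin's formula\<close>

context bproc begin

abbreviation PI :: "'w set => real^'n => ('w => ennreal) => ennreal" where
 "PI A x X \<equiv> \<integral>\<^sup>+w. indicator A w * X w \<partial>P x"

abbreviation VT :: "real => (real^'n => real) => real => 'w => ennreal" where
 "VT \<beta> f t w \<equiv> \<integral>\<^sup>+s. ennreal (f (Z (t + s) w)) \<partial>EM \<beta>"

lemma dy_meas [measurable]: "bmeas (dy n)"
 unfolding dy_def by measurable

lemma EM_shift:
 assumes g [measurable]: "bmeas g" and t: "0 <= t"
 shows "(\<integral>\<^sup>+r. indicator {t<..} r * g r \<partial>EM \<beta>) = ennreal (exp (- \<beta> * t)) * (\<integral>\<^sup>+s. g (t + s) \<partial>EM \<beta>)"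
proof -
 have "(\<integral>\<^sup>+r. indicator {t<..} r * g r \<partial>EM \<beta>) = (NI r. indicator {0<..} r * ennreal (exp (- \<beta> * r)) * (indicator {t<..} r * g r))"
  by (rule nn_EM) measurable
 also have "... = (NI s. indicator {0<..} (t + s) * ennreal (exp (- \<beta> * (t + s))) * (indicator {t<..} (t + s) * g (t + s)))"
  using nn_integral_real_affine[of "\<lambda>r. indicator {0<..} r * ennreal (exp (- \<beta> * r)) * (indicator {t<..} r * g r)" 1 t] by simp
 also have "... = (NI s. ennreal (exp (- \<beta> * t)) * (indicator {0<..} s * ennreal (exp (- \<beta> * s)) * g (t + s)))"
  using t by (intro nn_integral_cong) (auto simp: indicator_def distrib_left exp_diff exp_minus exp_add ennreal_mult[symmetric] mult.assoc[symmetric] divide_inverse)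
 also have "... = ennreal (exp (- \<beta> * t)) * (NI s. indicator {0<..} s * ennreal (exp (- \<beta> * s)) * g (t + s))"
  by (rule nn_integral_cmult) measurable
 also have "... = ennreal (exp (- \<beta> * t)) * (\<integral>\<^sup>+s. g (t + s) \<partial>EM \<beta>)"
  by (subst nn_EM) measurable
 finally show ?thesis .
qed

text \<open>Vanishing off \<open>H\<close> matches the value 0 of \<open>Z\<close> after the
  lifetime, so that \<open>f (Z t w)\<close> is right-continuous in \<open>t\<close> although
  \<open>f\<close> may jump at the boundary.\<close>

definition adm :: "(real^'n => real) => real => bool" where
 "adm f C \<longleftrightarrow> f \<in> borel_measurable borel \<and> (\<forall>y. 0 <= f y \<and> f y <= C) \<and> (\<forall>y. y \<notin> H --> f y = 0) \<and> continuous_on H f"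

lemma adm_meas [measurable_dest]: "adm f C ==> f \<in> borel_measurable borel"
 and adm_nonneg: "adm f C ==> 0 <= f y" and adm_le: "adm f C ==> f y <= C"
 and adm_zero: "adm f C ==> y \<notin> H ==> f y = 0" and adm_cont: "adm f C ==> continuous_on H f"
 by (auto simp: adm_def)

lemma adm_rcont:
 assumes f: "adm f C" and w: "w \<in> space Msp" and t: "0 <= t"
 shows "((\<lambda>s. f (Z s w)) \<longlongrightarrow> f (Z t w)) (at_right t)"
proof (cases "Z t w \<in> H")
 case True
 have "isCont f (Z t w)" using adm_cont[OF f] True halfsp_open continuous_on_eq_continuous_at by blast
 then show ?thesis using Z_rcont[OF w t] by (rule isCont_tendsto_compose)
next
 case False
 then have "\<not> ennreal t < \<zeta> w" using Z_H_iff[OF w] t by blast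
 have "\<not> ennreal s < \<zeta> w" if "t < s" for s
 proof
  assume "ennreal s < \<zeta> w"
  then have "ennreal t < \<zeta> w" using that by (intro le_less_trans[OF ennreal_leI[of t s]]) auto
  then show False using \<open>\<not> ennreal t < \<zeta> w\<close> by simp
 qed
 then have "f (Z s w) = f (Z t w)" if "t < s" for s
  using that \<open>\<not> ennreal t < \<zeta> w\<close> by (simp add: Z_def)
 then have "eventually (\<lambda>s. f (Z t w) = f (Z s w)) (at_right t)"
  unfolding eventually_at_filter by auto
 then show ?thesis by (rule Lim_transform_eventually[OF tendsto_const])
qed

lemma adm_rcont_seq:
 assumes f: "adm f C" and w: "w \<in> space Msp" and t: "0 <= t" and q: "filterlim q (at_right t) sequentially"
 shows "(\<lambda>n. ennreal (f (Z (q n) w))) \<longlonglongrightarrow> ennreal (f (Z t w))"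
 by (rule tendsto_ennrealI[OF filterlim_compose[OF adm_rcont[OF f w t] q]])

lemma filterlim_at_right_shift:
 fixes t :: real shows "filterlim q (at_right s) F' ==> filterlim (\<lambda>n. t + q n) (at_right (t + s)) F'"
 unfolding filterlim_at by (auto intro: tendsto_intros elim!: eventually_mono)

text \<open>Rounding the integration time up to the grid leaves only countably many distinct times.
  This matters because each single time brings its own exceptional null set for the transition
  operator.\<close>

lemma RS:
 assumes x: "x \<in> H" and \<beta>: "0 < \<beta>" and t: "0 <= t" and A [measurable]: "A \<in> sets Msp" and f: "adm f C"
 shows "(\<lambda>n. \<integral>\<^sup>+s. (PI A x (\<lambda>w. ennreal (f (Z (t + dy n s) w)))) \<partial>EM \<beta>)
   \<longlonglongrightarrow> PI A x (VT \<beta> f t)"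
proof -
 interpret Px: prob_space "P x" by (rule prob[OF x])
 interpret E: finite_measure "EM \<beta>" by (rule EM_finite[OF \<beta>])
 interpret pair_sigma_finite "EM \<beta>" "P x" ..
 note [measurable_cong] = sets_P[OF x]
 note [measurable] = adm_meas[OF f]
 have "PI A x (VT \<beta> f t) = (\<integral>\<^sup>+w. (\<integral>\<^sup>+s. indicator A w * ennreal (f (Z (t + s) w)) \<partial>EM \<beta>) \<partial>P x)"
 proof (rule nn_integral_cong)
  fix w assume "w \<in> space (P x)"
  then have "w \<in> space Msp" using space_P[OF x] by simp
  then have [measurable]: "bmeas (\<lambda>s. Z (t + s) w)" by measurable
  show "indicator A w * (VT \<beta> f t w) = (\<integral>\<^sup>+s. indicator A w * ennreal (f (Z (t + s) w)) \<partial>EM \<beta>)"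
   by (subst nn_integral_cmult) measurable
 qed
 also have "... = (\<integral>\<^sup>+s. PI A x (\<lambda>w. ennreal (f (Z (t + s) w))) \<partial>EM \<beta>)"
  by (rule Fubini') measurable
 finally have eq: "PI A x (VT \<beta> f t) = (\<integral>\<^sup>+s. PI A x (\<lambda>w. ennreal (f (Z (t + s) w))) \<partial>EM \<beta>)" .
 have le: "indicator A w * ennreal (f (Z r w)) <= ennreal C" for r w
  using adm_le[OF f, of "Z r w"] by (auto simp: indicator_def intro: ennreal_leI)
 have lew: "PI A x (\<lambda>w. ennreal (f (Z r w))) <= ennreal C" for r
 proof -
  have "PI A x (\<lambda>w. ennreal (f (Z r w))) <= (\<integral>\<^sup>+w. ennreal C \<partial>P x)"
   by (intro nn_integral_mono le)
  then show ?thesis by (simp add: Px.emeasure_space_1)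
 qed
 show ?thesis unfolding eq
 proof (rule nn_integral_dominated_convergence[where w="\<lambda>_. ennreal C"])
  show "(\<integral>\<^sup>+s. ennreal C \<partial>EM \<beta>) < \<infinity>" by (simp add: EM_total[OF \<beta>] ennreal_mult_less_top)
  show "AE s in EM \<beta>. (\<lambda>n. PI A x (\<lambda>w. ennreal (f (Z (t + dy n s) w)))) \<longlonglongrightarrow> PI A x (\<lambda>w. ennreal (f (Z (t + s) w)))"
   using EM_pos
  proof eventually_elim
   case (elim s)
   show ?case
   proof (rule nn_integral_dominated_convergence[where w="\<lambda>_. ennreal C"])
    show "(\<integral>\<^sup>+s. ennreal C \<partial>P x) < \<infinity>" by (simp add: Px.emeasure_space_1)
    show "AE w in P x. (\<lambda>n. indicator A w * ennreal (f (Z (t + dy n s) w))) \<longlonglongrightarrow> indicator A w * ennreal (f (Z (t + s) w))"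
    proof (rule AE_I2)
     fix w assume "w \<in> space (P x)"
     then have w: "w \<in> space Msp" using space_P[OF x] by simp
     show "(\<lambda>n. indicator A w * ennreal (f (Z (t + dy n s) w))) \<longlonglongrightarrow> indicator A w * ennreal (f (Z (t + s) w))"
      using t elim by (intro tendsto_mult_ennreal tendsto_const adm_rcont_seq[OF f w] filterlim_at_right_shift dy_filterlim) (auto simp: indicator_def)
    qed
   qed (use le in auto)
  qed
 qed (use lew in auto)
qed

text \<open>The strong Markov property at the constant stopping time \<open>t\<close>, rewritten for
  the killed path.\<close>

lemma markov_Z:
 assumes x: "x \<in> H" and t: "0 <= t" and s: "0 <= s" and A: "A \<in> F t" and f: "adm f C"
 shows "PI A x (\<lambda>w. ennreal (f (Z (t + s) w)))
   = PI A x (\<lambda>w. indicator H (Z t w) * (\<integral>\<^sup>+v. ennreal (f (Z s v)) \<partial>P (Z t w)))"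
proof -
 have st: "stop_time Msp F (\<lambda>_. ennreal t)"
  unfolding stop_time_def
 proof (intro conjI allI impI)
  fix t' :: real assume "0 <= t'"
  then interpret sigma_algebra "space Msp" "F t'" by (rule F_sa)
  show "{w \<in> space Msp. ennreal t <= ennreal t'} \<in> F t'" by (cases "ennreal t <= ennreal t'") auto
 qed simp
 have As: "A \<in> stopped_sets Msp F (\<lambda>_. ennreal t)"
  unfolding stopped_sets_def
 proof (intro CollectI conjI allI impI)
  show "A \<in> sets Msp" using A F_sub[OF t] by auto
  fix t' :: real assume t': "0 <= t'"
  then interpret sigma_algebra "space Msp" "F t'" by (rule F_sa)
  show "{w \<in> A. ennreal t <= ennreal t'} \<in> F t'"
  proof (cases "t <= t'")
   case True
   then show ?thesis using A F_mono[OF t True] by (auto simp: ennreal_leI)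
  next
   case False
   then show ?thesis using t t' by auto
  qed
 qed
 have b: "bounded (range f)"
  using adm_nonneg[OF f] adm_le[OF f] by (intro boundedI[of _ C]) auto
 have f0: "f 0 = 0" by (rule adm_zero[OF f]) simp
 have "(\<integral>\<^sup>+w. indicator A w * indicator {w. ennreal t + ennreal s < \<zeta> w} w * ennreal (f (Y (enn2real (ennreal t) + s) w)) \<partial>P x)
   = (\<integral>\<^sup>+w. indicator A w * indicator {w. ennreal t < \<zeta> w} w * trans_op P Y \<zeta> s f (Y (enn2real (ennreal t)) w) \<partial>P x)"
  by (rule markov[OF x st As s adm_meas[OF f] adm_nonneg[OF f] b])
 moreover have "indicator A w * indicator {w. ennreal t + ennreal s < \<zeta> w} w * ennreal (f (Y (enn2real (ennreal t) + s) w)) = indicator A w * ennreal (f (Z (t + s) w))" for w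
  using t s f0 by (auto simp: Z_def indicator_def)
 moreover have "trans_op P Y \<zeta> s f z = (\<integral>\<^sup>+v. ennreal (f (Z s v)) \<partial>P z)" for z
  unfolding trans_op_def using s f0 by (intro nn_integral_cong) (auto simp: Z_def indicator_def)
 moreover have "(\<integral>\<^sup>+w. indicator A w * indicator {w. ennreal t < \<zeta> w} w * (\<integral>\<^sup>+v. ennreal (f (Z s v)) \<partial>P (Y (enn2real (ennreal t)) w)) \<partial>P x)
  = (\<integral>\<^sup>+w. indicator A w * (indicator H (Z t w) * (\<integral>\<^sup>+v. ennreal (f (Z s v)) \<partial>P (Z t w))) \<partial>P x)"
 proof (rule nn_integral_cong)
  fix w assume "w \<in> space (P x)"
  then have w: "w \<in> space Msp" using space_P[OF x] by simp
  show "indicator A w * indicator {w. ennreal t < \<zeta> w} w * (\<integral>\<^sup>+v. ennreal (f (Z s v)) \<partial>P (Y (enn2real (ennreal t)) w))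
   = indicator A w * (indicator H (Z t w) * (\<integral>\<^sup>+v. ennreal (f (Z s v)) \<partial>P (Z t w)))"
   using t pathH[OF w t] by (cases "ennreal t < \<zeta> w") (auto simp: Z_def)
 qed
 ultimately show ?thesis by simp
qed

text \<open>For each grid time the transition operator applied to \<open>f\<close> has a Borel
  version, and the union \<open>N\<close> of the countably many exceptional sets is still null.
  Riemann sums of the versions converge off \<open>N\<close> to the resolvent, which yields its
  Borel version \<open>b\<close>. The Markov property at time \<open>t\<close> passes to the limit
  once the path almost surely avoids \<open>N\<close> at that time.\<close>

lemma K_good:
 assumes \<beta>: "0 < \<beta>" and f: "adm f C"
 shows "\<exists>b N. b \<in> borel_measurable borel \<and> N \<in> sets borel \<and> emeasure lborel N = 0
  \<and> (\<forall>z\<in>H - N. b z = UR \<beta> f z)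
  \<and> (\<forall>x\<in>H. \<forall>t\<ge>0. (AE w in P x. Z t w \<notin> N \<inter> H) --> (\<forall>A\<in>F t.
    PI A x (VT \<beta> f t)
    = PI A x (\<lambda>w. indicator H (Z t w) * b (Z t w))))"
proof -
 note [measurable] = adm_meas[OF f]
 interpret E: finite_measure "EM \<beta>" by (rule EM_finite[OF \<beta>])
 have C: "0 <= C" using adm_nonneg[OF f, of 0] adm_le[OF f, of 0] by linarith
 define \<Phi> where "\<Phi> s z = (\<integral>\<^sup>+v. ennreal (f (Z s v)) \<partial>P z)" for s z
 have \<Phi>C: "\<Phi> s z <= ennreal C" if "z \<in> H" for s z
 proof -
  interpret prob_space "P z" by (rule prob[OF that])
  have "\<Phi> s z <= (\<integral>\<^sup>+v. ennreal C \<partial>P z)" unfolding \<Phi>_def by (intro nn_integral_mono ennreal_leI adm_le[OF f])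
  then show ?thesis by (simp add: emeasure_space_1)
 qed
 have "\<exists>b N. b \<in> borel_measurable borel \<and> N \<in> sets borel \<and> emeasure lborel N = 0 \<and> (\<forall>z\<in>H - N. \<Phi> s z = b z)" for s
  unfolding \<Phi>_def by (rule borel_version, rule kernel_nn_integral) measurable
 then obtain bb NN where bb: "\<And>s. bb s \<in> borel_measurable borel" "\<And>s. NN s \<in> sets borel" "\<And>s. emeasure lborel (NN s) = 0"
   "\<And>s z. z \<in> H - NN s ==> \<Phi> s z = bb s z" by metis
 define q where "q n j = (real j + 1) / 2 ^ n" for n j :: nat
 define N where "N = (\<Union>p. NN (q (fst p) (snd p)))"
 define ix where "ix n s = nat \<lfloor>2 ^ n * s\<rfloor>" for n and s :: real
 \<comment> \<open>The cut-off at \<open>C\<close> leaves the version unchanged off \<open>N\<close>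
   and bounds it everywhere, as dominated convergence requires.\<close>
 define bc where "bc n s z = min (bb (q n (ix n s)) z) (ennreal C)" for n s z
 have qix: "q n (ix n s) = dy n s" if "0 <= s" for n s using dy_nat[OF that] by (simp add: q_def ix_def)
 have bc\<Phi>: "bc n s z = \<Phi> (dy n s) z" if "0 < s" "z \<in> H - N" for n s z
 proof -
  have "z \<in> H - NN (q n (ix n s))" using that(2) unfolding N_def by auto
  then show ?thesis using bb(4)[of z "q n (ix n s)"] \<Phi>C[of z "dy n s"] that qix[of s n] by (simp add: bc_def min_absorb1)
 qed
 have ix: "ix n \<in> borel \<rightarrow>\<^sub>M count_space UNIV" for n
  unfolding ix_def by measurable
 have bcm: "(\<lambda>p. bc n (fst p) (snd p)) \<in> borel_measurable (borel \<Otimes>\<^sub>M borel)" for n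
 proof -
  note [measurable] = bb(1)
  have "(\<lambda>p. bb (q n j) (snd p)) \<in> borel_measurable (borel \<Otimes>\<^sub>M borel)" for j by measurable
  from measurable_compose_countable[where f="\<lambda>j p. bb (q n j) (snd p)" and g="\<lambda>p. ix n (fst p)", OF this measurable_compose[OF measurable_fst ix]]
  have [measurable]: "(\<lambda>p. bb (q n (ix n (fst p))) (snd p)) \<in> borel_measurable (borel \<Otimes>\<^sub>M borel)" .
  show ?thesis unfolding bc_def by measurable
 qed
 have bcm2 [measurable (raw)]: "(\<lambda>p. bc n (g p) (h p)) \<in> borel_measurable M" if "g \<in> borel_measurable M" "h \<in> borel_measurable M" for n g h and M :: "'z measure"
  using measurable_compose[OF measurable_Pair[OF that] bcm[of n]] by simp
 have bcm3: "(\<lambda>p. bc n (g p) (h p)) \<in> borel_measurable M" if "g \<in> borel_measurable M" "h \<in> borel_measurable M" for n g h and M :: "(real \<times> 'w) measure"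
  using measurable_compose[OF measurable_Pair[OF that] bcm[of n]] by simp
 define \<Psi> where "\<Psi> n z = (\<integral>\<^sup>+s. bc n s z \<partial>EM \<beta>)" for n z
 have \<Psi>m: "\<Psi> n \<in> borel_measurable borel" for n
 proof -
  have "(\<lambda>(z, s). bc n s z) \<in> borel_measurable (borel \<Otimes>\<^sub>M EM \<beta>)"
   using measurable_compose[OF measurable_Pair[OF measurable_snd measurable_fst] bcm[of n]] by (simp add: split_beta' cong: measurable_cong_sets)
  then show ?thesis unfolding \<Psi>_def by (rule E.borel_measurable_nn_integral)
 qed
 let ?Q = "\<lambda>A x t n. PI A x (\<lambda>w. indicator H (Z t w) * \<Psi> n (Z t w))"
 note [measurable] = \<Psi>m
 define b where "b z = liminf (\<lambda>n. \<Psi> n z)" for z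
 have bm: "bmeas b" unfolding b_def by measurable
 have Nb: "N \<in> sets borel" unfolding N_def using bb(2) by auto
 have N0: "emeasure lborel N = 0"
 proof -
  have "N \<in> null_sets lborel" unfolding N_def by (rule null_sets_UN) (use bb(2,3) in auto)
  then show ?thesis by auto
 qed
 have lim: "(\<lambda>n. \<Psi> n z) \<longlonglongrightarrow> UR \<beta> f z" if z: "z \<in> H - N" for z
 proof -
  have zH: "z \<in> H" using z by simp
  have "\<Psi> n z = (\<integral>\<^sup>+s. PI (space Msp) z (\<lambda>w. ennreal (f (Z (0 + dy n s) w))) \<partial>EM \<beta>)" for n
   unfolding \<Psi>_def
  proof (rule nn_integral_cong_AE)
   show "AE s in EM \<beta>. bc n s z = PI (space Msp) z (\<lambda>w. ennreal (f (Z (0 + dy n s) w)))"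
    using EM_pos
   proof eventually_elim
    case (elim s)
    have "PI (space Msp) z (\<lambda>w. ennreal (f (Z (0 + dy n s) w))) = (\<integral>\<^sup>+w. ennreal (f (Z (dy n s) w)) \<partial>P z)"
     by (intro nn_integral_cong) (simp add: space_P[OF zH])
    then show ?case using bc\<Phi>[OF elim z] by (simp add: \<Phi>_def)
   qed
  qed
  moreover have "PI (space Msp) z (\<lambda>w. VT \<beta> f 0 w) = UR \<beta> f z"
   unfolding UR_def by (intro nn_integral_cong) (simp add: space_P[OF zH])
  ultimately show ?thesis using RS[OF zH \<beta> order_refl sets.top f] by simp
 qed
 have b_eq: "b z = UR \<beta> f z" if "z \<in> H - N" for z
  unfolding b_def using lim_imp_Liminf[OF _ lim[OF that]] by simp
 have main: "PI A x (VT \<beta> f t)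
    = PI A x (\<lambda>w. indicator H (Z t w) * b (Z t w))"
  if x: "x \<in> H" and t: "0 <= t" and ae: "AE w in P x. Z t w \<notin> N \<inter> H" and A: "A \<in> F t" for x t A
 proof -
  interpret Px: prob_space "P x" by (rule prob[OF x])
  interpret pair_sigma_finite "EM \<beta>" "P x" ..
  note [measurable_cong] = sets_P[OF x]
  have [measurable]: "A \<in> sets Msp" using A F_sub[OF t] by auto
  note [measurable] = bm
  have e1: "?Q A x t n = (\<integral>\<^sup>+s. PI A x (\<lambda>w. ennreal (f (Z (t + dy n s) w))) \<partial>EM \<beta>)" for n
  proof -
   have m: "(\<lambda>p. indicator A (snd p) * (indicator H (Z t (snd p)) * bc n (fst p) (Z t (snd p)))) \<in> borel_measurable (EM \<beta> \<Otimes>\<^sub>M P x)"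
   proof -
    have [measurable]: "(\<lambda>p. bc n (fst p) (Z t (snd p))) \<in> borel_measurable (EM \<beta> \<Otimes>\<^sub>M P x)"
     by (rule bcm3) measurable
    show ?thesis by measurable
   qed
   have "?Q A x t n = (\<integral>\<^sup>+w. \<integral>\<^sup>+s. indicator A w * (indicator H (Z t w) * bc n s (Z t w)) \<partial>EM \<beta> \<partial>P x)"
   proof (rule nn_integral_cong)
    fix w
    have [measurable]: "(\<lambda>s. bc n s (Z t w)) \<in> borel_measurable (EM \<beta>)"
     using measurable_compose[OF measurable_Pair[OF measurable_ident measurable_const] bcm[of n]] by (simp cong: measurable_cong_sets)
    show "indicator A w * (indicator H (Z t w) * \<Psi> n (Z t w)) = (\<integral>\<^sup>+s. indicator A w * (indicator H (Z t w) * bc n s (Z t w)) \<partial>EM \<beta>)"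
     unfolding \<Psi>_def by (simp add: nn_integral_cmult)
   qed
   also have "... = (\<integral>\<^sup>+s. PI A x (\<lambda>w. indicator H (Z t w) * bc n s (Z t w)) \<partial>EM \<beta>)"
    by (rule Fubini') (use m in \<open>simp add: split_beta'\<close>)
   also have "... = (\<integral>\<^sup>+s. PI A x (\<lambda>w. ennreal (f (Z (t + dy n s) w))) \<partial>EM \<beta>)"
   proof (rule nn_integral_cong_AE)
    show "AE s in EM \<beta>. (PI A x (\<lambda>w. indicator H (Z t w) * bc n s (Z t w))) = PI A x (\<lambda>w. ennreal (f (Z (t + dy n s) w)))"
     using EM_pos
    proof eventually_elim
     case (elim s)
     have "PI A x (\<lambda>w. ennreal (f (Z (t + dy n s) w))) = PI A x (\<lambda>w. indicator H (Z t w) * \<Phi> (dy n s) (Z t w))"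
      unfolding \<Phi>_def using elim by (intro markov_Z[OF x t _ A f] dy_nonneg) auto
     also have "... = PI A x (\<lambda>w. indicator H (Z t w) * bc n s (Z t w))"
     proof (rule nn_integral_cong_AE)
      show "AE w in P x. indicator A w * (indicator H (Z t w) * \<Phi> (dy n s) (Z t w)) = indicator A w * (indicator H (Z t w) * bc n s (Z t w))"
       using ae
      proof eventually_elim
       case (elim w)
       then show ?case using bc\<Phi>[OF \<open>0 < s\<close>, of "Z t w" n] by (cases "Z t w \<in> H") auto
      qed
     qed
     finally show ?case by simp
    qed
   qed
   finally show ?thesis .
  qed
  have "(\<lambda>n. ?Q A x t n) \<longlonglongrightarrow> PI A x (\<lambda>w. indicator H (Z t w) * b (Z t w))"
  proof (rule nn_integral_dominated_convergence[where w="\<lambda>_. ennreal C * ennreal (1 / \<beta>)"])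
   show "(\<integral>\<^sup>+w. ennreal C * ennreal (1 / \<beta>) \<partial>P x) < \<infinity>" by (simp add: Px.emeasure_space_1 ennreal_mult_less_top)
   have "\<Psi> n z <= ennreal C * ennreal (1 / \<beta>)" for n z
   proof -
    have "\<Psi> n z <= (\<integral>\<^sup>+s. ennreal C \<partial>EM \<beta>)" unfolding \<Psi>_def bc_def by (intro nn_integral_mono) simp
    then show ?thesis by (simp add: EM_total[OF \<beta>])
   qed
   then show "AE w in P x. indicator A w * (indicator H (Z t w) * \<Psi> n (Z t w)) <= ennreal C * ennreal (1 / \<beta>)" for n
    by (auto simp: indicator_def)
   show "AE w in P x. (\<lambda>n. indicator A w * (indicator H (Z t w) * \<Psi> n (Z t w))) \<longlonglongrightarrow> indicator A w * (indicator H (Z t w) * b (Z t w))"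
    using ae
   proof eventually_elim
    case (elim w)
    have "(\<lambda>n. \<Psi> n (Z t w)) \<longlonglongrightarrow> b (Z t w)" if "Z t w \<in> H"
     using lim[of "Z t w"] b_eq[of "Z t w"] elim that by auto
    then show ?case by (cases "Z t w \<in> H"; cases "w \<in> A") auto
   qed
  qed measurable
  moreover have "(\<lambda>n. ?Q A x t n) \<longlonglongrightarrow> PI A x (VT \<beta> f t)"
   unfolding e1 by (rule RS[OF x \<beta> t _ f]) measurable
  ultimately show ?thesis using LIMSEQ_unique by blast
 qed
 show ?thesis
  by (intro exI[of _ b] exI[of _ N] conjI ballI allI impI bm Nb N0 b_eq main)
qed

end

lemma AE_ex_between:
 assumes "AE t in lborel. Q t" "a < (b::real)" shows "\<exists>t. a < t \<and> t < b \<and> Q t"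
proof (rule ccontr)
 assume c: "\<not> ?thesis"
 have "AE t in lborel. t \<notin> {a<..<b}" using assms(1) by eventually_elim (use c in auto)
 then have "{a<..<b} \<in> null_sets lborel" by (subst AE_iff_null_sets) auto
 then show False using assms(2) by (auto simp: null_sets_def)
qed

context bproc begin

definition hp :: "real => (real^'n => real) => real^'n => real" where "hp \<beta> u y = max (hf \<beta> u y) 0"
definition hm :: "real => (real^'n => real) => real^'n => real" where "hm \<beta> u y = max (- hf \<beta> u y) 0"

lemma adm_h:
 assumes u: "u \<in> Cc_inf H" and nn: "\<And>y. 0 <= u y"
 shows "\<exists>C. adm (hp \<beta> u) C \<and> adm (hm \<beta> u) C \<and> adm u C"
proof -
 obtain C where C: "C \<ge> 0" "\<And>x. \<bar>hf \<beta> u x\<bar> <= C" using hf_bounded[OF u nn] by blast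
 obtain D where D: "\<And>x. \<bar>u x\<bar> <= D"
 proof -
  obtain K h R where K: "compact K" "K \<subseteq> H" "\<And>x. x \<notin> K ==> u x = 0" "0 < h" "1 <= (R::real)"
   "\<And>x. x \<in> K ==> h <= x $ k" "\<And>x. x \<in> K ==> norm x <= R" by (rule Cc_inf_support[OF u]) (rule that)
  have "compact (u ` K)" by (rule compact_continuous_image[OF continuous_on_subset[OF Cc_inf_continuous[OF u] subset_UNIV] K(1)])
  then obtain D where D: "\<And>y. y \<in> u ` K ==> norm y <= D" using compact_imp_bounded[of "u ` K"] unfolding bounded_iff by blast
  have "\<bar>u x\<bar> <= max D 0" for x
  proof (cases "x \<in> K")
   case True then show ?thesis using D[of "u x"] by simp
  qed (simp add: K(3))
  then show ?thesis by (rule that)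
 qed
 have 0: "hf \<beta> u y = 0" if "y \<notin> H" for y using that by (simp add: hf_def)
 have u0: "u y = 0" if "y \<notin> H" for y using Cc_inf_zero[OF u that] .
 have *: "hp \<beta> u = (\<lambda>y. max (hf \<beta> u y) 0)" "hm \<beta> u = (\<lambda>y. max (- hf \<beta> u y) 0)" by (auto simp: hp_def hm_def)
 have c: "continuous_on H (hp \<beta> u)" "continuous_on H (hm \<beta> u)" "continuous_on H u"
  unfolding * using hf_cont[OF u] Cc_inf_continuous[OF u] by (auto intro!: continuous_intros intro: continuous_on_subset)
 have m: "hp \<beta> u \<in> borel_measurable borel" "hm \<beta> u \<in> borel_measurable borel" "bmeas u"
  unfolding * using hf_meas[OF u] Cc_inf_borel[OF u] by auto
 have "hp \<beta> u y <= max C D \<and> hm \<beta> u y <= max C D \<and> u y <= max C D" for y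
  using C(1) C(2)[of y] D[of y] by (auto simp: hp_def hm_def)
 then have "adm (hp \<beta> u) (max C D) \<and> adm (hm \<beta> u) (max C D) \<and> adm u (max C D)"
  unfolding adm_def using m c nn u0 0 by (auto simp: hp_def hm_def)
 then show ?thesis by blast
qed

text \<open>The Markov property expresses the integrals through the resolvents of
  \<open>hp \<beta> u\<close> and \<open>hm \<beta> u\<close> at the point \<open>Z t w\<close>,
  where \<open>UR_AE\<close> links them by the value of \<open>u\<close>. This is valid at times
  when the path almost surely misses the exceptional set.\<close>

lemma K_ae:
 assumes \<beta>: "0 < \<beta>" and u: "u \<in> Cc_inf H" and nn: "\<And>y. 0 <= u y"
 shows "\<exists>N. N \<in> sets borel \<and> emeasure lborel N = 0 \<and> (\<forall>x\<in>H. \<forall>t\<ge>0. (AE w in P x. Z t w \<notin> N \<inter> H) --> (\<forall>A\<in>F t.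
  (PI A x (VT \<beta> (hp \<beta> u) t))
  = PI A x (VT \<beta> (hm \<beta> u) t) + PI A x (\<lambda>w. ennreal (u (Z t w)))))"
proof -
 obtain C where C: "adm (hp \<beta> u) C" "adm (hm \<beta> u) C" "adm u C" using adm_h[OF u nn] by blast
 obtain b1 N1 where b1: "bmeas b1" "N1 \<in> sets borel" "emeasure lborel N1 = 0"
  "\<forall>z\<in>H - N1. b1 z = UR \<beta> (hp \<beta> u) z"
  "\<forall>x\<in>H. \<forall>t\<ge>0. (AE w in P x. Z t w \<notin> N1 \<inter> H) --> (\<forall>A\<in>F t.
    PI A x (VT \<beta> (hp \<beta> u) t)
    = PI A x (\<lambda>w. indicator H (Z t w) * b1 (Z t w)))"
  using K_good[OF \<beta> C(1)] by blast
 obtain b2 N2 where b2: "bmeas b2" "N2 \<in> sets borel" "emeasure lborel N2 = 0"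
  "\<forall>z\<in>H - N2. b2 z = UR \<beta> (hm \<beta> u) z"
  "\<forall>x\<in>H. \<forall>t\<ge>0. (AE w in P x. Z t w \<notin> N2 \<inter> H) --> (\<forall>A\<in>F t.
    PI A x (VT \<beta> (hm \<beta> u) t)
    = PI A x (\<lambda>w. indicator H (Z t w) * b2 (Z t w)))"
  using K_good[OF \<beta> C(2)] by blast
 have h: "(\<lambda>y. max (hf \<beta> u y) 0) = hp \<beta> u" "(\<lambda>y. max (- hf \<beta> u y) 0) = hm \<beta> u" by (auto simp: hp_def hm_def)
 obtain N3 where N3: "{z \<in> space lborel. \<not> (z \<in> H --> UR \<beta> (hp \<beta> u) z = UR \<beta> (hm \<beta> u) z + ennreal (u z))} \<subseteq> N3"
   "emeasure lborel N3 = 0" "N3 \<in> sets lborel"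
  using UR_AE[OF u nn \<beta>] unfolding h by (rule AE_E)
 define N where "N = N1 \<union> N2 \<union> N3"
 have Nb: "N \<in> sets borel" "emeasure lborel N = 0"
 proof -
  have "N \<in> null_sets lborel" unfolding N_def using b1 b2 N3 by (intro null_sets.Un) auto
  then show "N \<in> sets borel" "emeasure lborel N = 0" by auto
 qed
 have beq: "b1 z = b2 z + ennreal (u z)" if "z \<in> H - N" for z
  using that b1(4) b2(4) N3(1) by (auto simp: N_def)
 have u0: "u 0 = 0" using adm_zero[OF C(3)] by simp
 have main: "PI A x (VT \<beta> (hp \<beta> u) t)
  = PI A x (VT \<beta> (hm \<beta> u) t) + PI A x (\<lambda>w. ennreal (u (Z t w)))"
  if x: "x \<in> H" and t: "0 <= t" and ae: "AE w in P x. Z t w \<notin> N \<inter> H" and A: "A \<in> F t" for x t A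
 proof -
  note [measurable_cong] = sets_P[OF x]
  have [measurable]: "A \<in> sets Msp" using A F_sub[OF t] by auto
  note [measurable] = b1(1) b2(1) adm_meas[OF C(3)]
  have "AE w in P x. Z t w \<notin> N1 \<inter> H" "AE w in P x. Z t w \<notin> N2 \<inter> H"
   using ae by (auto simp: N_def elim!: eventually_mono)
  then have e: "PI A x (VT \<beta> (hp \<beta> u) t) = PI A x (\<lambda>w. indicator H (Z t w) * b1 (Z t w))"
    "PI A x (VT \<beta> (hm \<beta> u) t) = PI A x (\<lambda>w. indicator H (Z t w) * b2 (Z t w))"
   using b1(5) b2(5) x t A by blast+
  have "PI A x (\<lambda>w. indicator H (Z t w) * b1 (Z t w))
    = (\<integral>\<^sup>+w. indicator A w * (indicator H (Z t w) * b2 (Z t w)) + indicator A w * ennreal (u (Z t w)) \<partial>P x)"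
  proof (rule nn_integral_cong_AE)
   show "AE w in P x. indicator A w * (indicator H (Z t w) * b1 (Z t w)) = indicator A w * (indicator H (Z t w) * b2 (Z t w)) + indicator A w * ennreal (u (Z t w))"
    using ae
   proof eventually_elim
    case (elim w)
    then show ?case using beq[of "Z t w"] adm_zero[OF C(3), of "Z t w"] by (cases "Z t w \<in> H") (auto simp: distrib_left)
   qed
  qed
  also have "... = PI A x (\<lambda>w. indicator H (Z t w) * b2 (Z t w)) + PI A x (\<lambda>w. ennreal (u (Z t w)))"
   by (rule nn_integral_add) measurable
  finally show ?thesis unfolding e .
 qed
 show ?thesis by (intro exI[of _ N] conjI ballI allI impI Nb main)
qed

text \<open>What a passage to the limit along random times decreasing to \<open>T\<close> demands:
  measurability at random times, a uniform bound, and right-continuity along sequences.\<close>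

definition rc_proc :: "(real => 'w => ennreal) => bool" where
 "rc_proc X \<longleftrightarrow> (\<forall>T\<in>borel_measurable Msp. (\<lambda>w. X (T w) w) \<in> borel_measurable Msp) \<and>
  (\<exists>D<\<infinity>. \<forall>t\<ge>0. \<forall>w. X t w <= D) \<and>
  (\<forall>w\<in>space Msp. \<forall>t\<ge>0. \<forall>q. filterlim q (at_right t) sequentially --> (\<lambda>n. X (q n) w) \<longlonglongrightarrow> X t w)"

lemma rc_proc_meas: "rc_proc X ==> T \<in> borel_measurable Msp ==> (\<lambda>w. X (T w) w) \<in> borel_measurable Msp"
 and rc_proc_le: "rc_proc X ==> \<exists>D<\<infinity>. \<forall>t\<ge>0. \<forall>w. X t w <= D"
 by (auto simp: rc_proc_def)

lemma rc_proc_meas_const: "rc_proc X ==> X r \<in> borel_measurable Msp"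
 using rc_proc_meas[of X "\<lambda>_. r"] by simp

lemma rc_proc_lim:
 assumes X: "rc_proc X" and x: "x \<in> H" and A [measurable]: "A \<in> sets Msp" and S: "\<And>n. S n \<in> borel_measurable Msp" "\<And>n w. 0 <= S n w"
  and T: "T \<in> borel_measurable Msp" "\<And>w. 0 <= T w" and flt: "\<And>w. filterlim (\<lambda>n. S n w) (at_right (T w)) sequentially"
 shows "(\<lambda>n. PI A x (\<lambda>w. X (S n w) w)) \<longlonglongrightarrow> PI A x (\<lambda>w. X (T w) w)"
proof -
 interpret Px: prob_space "P x" by (rule prob[OF x])
 note [measurable_cong] = sets_P[OF x]
 note [measurable] = rc_proc_meas[OF X S(1)] rc_proc_meas[OF X T(1)]
 obtain D where D: "D < \<infinity>" "\<And>t w. 0 <= t ==> X t w <= D" using rc_proc_le[OF X] by blast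
 show ?thesis
 proof (rule nn_integral_dominated_convergence[where w="\<lambda>_. D"])
  show "AE w in P x. (\<lambda>n. indicator A w * X (S n w) w) \<longlonglongrightarrow> indicator A w * X (T w) w"
   using X T(2) flt by (intro AE_I2) (auto simp: rc_proc_def space_P[OF x] indicator_def)
 qed (use D S(2) in \<open>auto simp: Px.emeasure_space_1 indicator_def\<close>)
qed

text \<open>For nonnegative \<open>t\<close> this is the part after time \<open>t\<close> of the
  discounted integral of \<open>f\<close> along the path, as \<open>EM_shift\<close> shows.\<close>

definition XT :: "real => (real^'n => real) => real => 'w => ennreal" where
 "XT \<beta> f t w = ennreal (exp (- \<beta> * t)) * VT \<beta> f t w"

definition XU :: "real => (real^'n => real) => real => 'w => ennreal" where
 "XU \<beta> u t w = ennreal (exp (- \<beta> * t)) * ennreal (u (Z t w))"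

lemma exp_lim: "filterlim q (at_right t) sequentially ==> (\<lambda>n. ennreal (exp (- \<beta> * q n))) \<longlonglongrightarrow> ennreal (exp (- \<beta> * t))"
 by (intro tendsto_ennrealI tendsto_exp tendsto_mult tendsto_const) (simp add: filterlim_at)

lemma rc_proc_XT:
 assumes \<beta>: "0 < \<beta>" and f: "adm f C"
 shows "rc_proc (XT \<beta> f)"
proof -
 interpret E: finite_measure "EM \<beta>" by (rule EM_finite[OF \<beta>])
 note [measurable] = adm_meas[OF f]
 have fC: "ennreal (f y) <= ennreal C" for y by (intro ennreal_leI adm_le[OF f])
 have V: "VT \<beta> f t w <= ennreal C * ennreal (1 / \<beta>)" for t w
 proof -
  have "VT \<beta> f t w <= (\<integral>\<^sup>+s. ennreal C \<partial>EM \<beta>)" by (intro nn_integral_mono fC)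
  then show ?thesis by (simp add: EM_total[OF \<beta>])
 qed
 have fin: "VT \<beta> f t w \<noteq> \<infinity>" for t w
  using V[of t w] by (auto simp: top_unique ennreal_mult_eq_top_iff)
 have "(\<lambda>n. XT \<beta> f (q n) w) \<longlonglongrightarrow> XT \<beta> f t w" if w: "w \<in> space Msp" and t: "0 <= t" and q: "filterlim q (at_right t) sequentially" for w t q
  unfolding XT_def
 proof (rule tendsto_mult_ennreal[OF exp_lim[OF q]])
  have [measurable]: "bmeas (\<lambda>s. Z (r + s) w)" for r using w by measurable
  show "(\<lambda>n. \<integral>\<^sup>+s. ennreal (f (Z (q n + s) w)) \<partial>EM \<beta>) \<longlonglongrightarrow> VT \<beta> f t w"
  proof (rule nn_integral_dominated_convergence[where w="\<lambda>_. ennreal C"])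
   show "AE s in EM \<beta>. (\<lambda>n. ennreal (f (Z (q n + s) w))) \<longlonglongrightarrow> ennreal (f (Z (t + s) w))"
    using EM_pos
   proof eventually_elim
    case (elim s)
    have "filterlim (\<lambda>n. s + q n) (at_right (s + t)) sequentially" by (rule filterlim_at_right_shift[OF q])
    then show ?case using t elim by (intro adm_rcont_seq[OF f w]) (auto simp: add.commute)
   qed
  qed (use fC in \<open>auto simp: EM_total[OF \<beta>] ennreal_mult_less_top\<close>)
 qed (use fin in auto)
 moreover have "XT \<beta> f t w <= 1 * (ennreal C * ennreal (1 / \<beta>))" if "0 <= t" for t w
  unfolding XT_def using that \<beta> V by (intro mult_mono ennreal_le_1[THEN iffD2]) auto
 ultimately show ?thesis unfolding rc_proc_def
  by (intro conjI exI[of _ "ennreal C * ennreal (1 / \<beta>)"]) (auto simp: ennreal_mult_less_top XT_def)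
qed

lemma rc_proc_XU:
 assumes \<beta>: "0 < \<beta>" and f: "adm f C"
 shows "rc_proc (XU \<beta> f)"
proof -
 note [measurable] = adm_meas[OF f]
 have "(\<lambda>n. XU \<beta> f (q n) w) \<longlonglongrightarrow> XU \<beta> f t w" if "w \<in> space Msp" "0 <= t" "filterlim q (at_right t) sequentially" for w t q
  unfolding XU_def using adm_rcont_seq[OF f that] by (intro tendsto_mult_ennreal exp_lim that) auto
 moreover have "XU \<beta> f t w <= 1 * ennreal C" if "0 <= t" for t w
  unfolding XU_def using that \<beta> adm_le[OF f] by (intro mult_mono ennreal_le_1[THEN iffD2] ennreal_leI) auto
 ultimately show ?thesis unfolding rc_proc_def
  by (intro conjI exI[of _ "ennreal C"]) (auto simp: XU_def)
qed

text \<open>The good times of \<open>K_ae\<close> have full measure by \<open>ae_notin_null\<close>,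
  hence some of them decrease to \<open>t\<close>. Along these every term converges by
  right-continuity, and an event of \<open>F t\<close> belongs to the later sigma-algebras
  too.\<close>

lemma K_all:
 assumes \<beta>: "0 < \<beta>" and u: "u \<in> Cc_inf H" and nn: "\<And>y. 0 <= u y" and x: "x \<in> H" and t: "0 <= t" and A: "A \<in> F t"
 shows "PI A x (XT \<beta> (hp \<beta> u) t) = PI A x (XT \<beta> (hm \<beta> u) t) + PI A x (XU \<beta> u t)"
proof -
 obtain C where C: "adm (hp \<beta> u) C" "adm (hm \<beta> u) C" "adm u C" using adm_h[OF u nn] by blast
 obtain N where N: "N \<in> sets borel" "emeasure lborel N = 0"
  and K: "\<forall>x\<in>H. \<forall>t\<ge>0. (AE w in P x. Z t w \<notin> N \<inter> H) --> (\<forall>A\<in>F t.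
  (PI A x (VT \<beta> (hp \<beta> u) t))
  = PI A x (VT \<beta> (hm \<beta> u) t) + PI A x (\<lambda>w. ennreal (u (Z t w))))"
  using K_ae[OF \<beta> u nn] by blast
 have "\<exists>s. t < s \<and> s < t + 1 / real (Suc n) \<and> (0 < s --> (AE w in P x. Z s w \<notin> N \<inter> H))" for n
  by (rule AE_ex_between[OF ae_notin_null[OF x N]]) simp
 then obtain q where q: "\<And>n. t < q n" "\<And>n. q n < t + 1 / real (Suc n)" "\<And>n. 0 < q n --> (AE w in P x. Z (q n) w \<notin> N \<inter> H)"
  by metis
 have qlim: "filterlim q (at_right t) sequentially"
 proof -
  have "(\<lambda>n. t + 1 / real (Suc n)) \<longlonglongrightarrow> t + 0" by (intro tendsto_add tendsto_const LIMSEQ_Suc lim_const_over_n)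
  then have "q \<longlonglongrightarrow> t" using q by (intro tendsto_sandwich[of "\<lambda>_. t" q sequentially "\<lambda>n. t + 1 / real (Suc n)"]) (auto intro!: always_eventually less_imp_le)
  then show ?thesis using q(1) by (auto simp: filterlim_at eventually_sequentially less_imp_neq[symmetric])
 qed
 have q0: "0 <= q n" "0 < q n" for n using q(1)[of n] t by linarith+
 note [measurable_cong] = sets_P[OF x]
 have As [measurable]: "A \<in> sets Msp" using A F_sub[OF t] by auto
 interpret E: finite_measure "EM \<beta>" by (rule EM_finite[OF \<beta>])
 have pull: "PI A x (\<lambda>w. c * V w) = c * (PI A x V)"
  if [measurable]: "V \<in> borel_measurable Msp" for c :: ennreal and V
  by (subst nn_integral_cmult[symmetric]) (auto simp: mult.left_commute)
 have eq: "PI A x (XT \<beta> (hp \<beta> u) (q n)) = PI A x (XT \<beta> (hm \<beta> u) (q n)) + PI A x (XU \<beta> u (q n))" for n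
 proof -
  note [measurable] = adm_meas[OF C(1)] adm_meas[OF C(2)] adm_meas[OF C(3)]
  have "A \<in> F (q n)" using A F_mono[OF t less_imp_le[OF q(1)]] by auto
  moreover have "AE w in P x. Z (q n) w \<notin> N \<inter> H" using q(3) q0 by blast
  ultimately show ?thesis using K[THEN bspec[OF _ x], rule_format, OF q0(1)]
   unfolding XT_def XU_def by (simp add: pull distrib_left)
 qed
 have L: "(\<lambda>n. PI A x (X (q n))) \<longlonglongrightarrow> PI A x (X t)" if "rc_proc X" for X
  using rc_proc_lim[OF that x As, of "\<lambda>n w. q n" "\<lambda>w. t"] q0 t qlim by simp
 note L = L[OF rc_proc_XT[OF \<beta> C(1)]] L[OF rc_proc_XT[OF \<beta> C(2)]] L[OF rc_proc_XU[OF \<beta> C(3)]]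
 show ?thesis using LIMSEQ_unique[OF L(1) tendsto_add[OF L(2,3), folded eq]] .
qed

end

context bproc begin

abbreviation finT :: "('w => ennreal) => 'w set" where "finT T \<equiv> {w \<in> space Msp. T w < \<infinity>}"

lemma sum_single_ennreal: "(\<Sum>j. (if j = i then c j else 0)) = (c i :: ennreal)"
 using sums_unique[OF sums_single[of i c]] by simp

text \<open>The time \<open>T\<close> is rounded up to the dyadic grid. On the slice where the
  rounded time is a fixed grid point \<open>K_all\<close> applies, since the slice is decided at
  that time; summing the slices and refining the grid gives the identity at
  \<open>T\<close>.\<close>

lemma optional_stopping:
 assumes \<beta>: "0 < \<beta>" and u: "u \<in> Cc_inf H" and nn: "\<And>y. 0 <= u y" and x: "x \<in> H" and T: "stop_time Msp F T"
 shows "PI (finT T) x (\<lambda>w. XT \<beta> (hp \<beta> u) (enn2real (T w)) w)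
  = PI (finT T) x (\<lambda>w. XT \<beta> (hm \<beta> u) (enn2real (T w)) w)
   + PI (finT T) x (\<lambda>w. XU \<beta> u (enn2real (T w)) w)"
proof -
 obtain C where C: "adm (hp \<beta> u) C" "adm (hm \<beta> u) C" "adm u C" using adm_h[OF u nn] by blast
 note X = rc_proc_XT[OF \<beta> C(1)] rc_proc_XT[OF \<beta> C(2)] rc_proc_XU[OF \<beta> C(3)]
 note [measurable_cong] = sets_P[OF x]
 have Tm [measurable]: "T \<in> borel_measurable Msp" by (rule stop_meas[OF T])
 \<comment> \<open>The slice is closed on the left and open on the right, matching
   \<open>dy\<close>, which lies strictly above its argument; so the slice is decided at its right
   end point.\<close>
 define A where "A n j = {w \<in> space Msp. T w < ennreal ((real j + 1) / 2 ^ n)} - {w \<in> space Msp. T w < ennreal (real j / 2 ^ n)}" for n j :: nat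
 have AF: "A n j \<in> F ((real j + 1) / 2 ^ n)" for n j
 proof -
  interpret sigma_algebra "space Msp" "F ((real j + 1) / 2 ^ n)" by (rule F_sa) simp
  have "{w \<in> space Msp. T w < ennreal (real j / 2 ^ n)} \<in> F (real j / 2 ^ n)" by (rule stop_less[OF T]) simp
  moreover have "F (real j / 2 ^ n) \<subseteq> F ((real j + 1) / 2 ^ n)" by (rule F_mono) (auto simp: divide_right_mono)
  moreover have "{w \<in> space Msp. T w < ennreal ((real j + 1) / 2 ^ n)} \<in> F ((real j + 1) / 2 ^ n)" by (rule stop_less[OF T]) simp
  ultimately show ?thesis unfolding A_def by (intro Diff) auto
 qed
 have Am [measurable]: "A n j \<in> sets Msp" for n j
  using AF[of n j] F_sub[of "(real j + 1) / 2 ^ n"] by auto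
 have A_iff: "w \<in> A n j \<longleftrightarrow> T w < \<infinity> \<and> j = nat \<lfloor>2 ^ n * enn2real (T w)\<rfloor>" if "w \<in> space Msp" for w n j
 proof (cases "T w")
  case (real r)
  have "w \<in> A n j \<longleftrightarrow> r < (real j + 1) / 2 ^ n \<and> real j / 2 ^ n <= r"
   using that real by (simp add: A_def ennreal_less_iff not_less del: ennreal_plus)
  also have "... \<longleftrightarrow> \<lfloor>2 ^ n * r\<rfloor> = int j" unfolding floor_eq_iff by (auto simp: field_simps)
  also have "... \<longleftrightarrow> j = nat \<lfloor>2 ^ n * r\<rfloor>" using real(1) by (auto simp: nat_eq_iff)
  finally show ?thesis using real by simp
 next
  case top
  then show ?thesis by (simp add: A_def)
 qed
 define S where "S n w = dy n (enn2real (T w))" for n w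
 have Sm [measurable]: "S n \<in> borel_measurable Msp" for n unfolding S_def by measurable
 have S0: "0 <= S n w" for n w unfolding S_def by (rule dy_nonneg) simp
 have split: "PI (finT T) x (\<lambda>w. X (S n w) w) = (\<Sum>j. PI (A n j) x (X ((real j + 1) / 2 ^ n)))"
  if X: "rc_proc X" for X :: "real => 'w => ennreal" and n
 proof -
  note [measurable] = rc_proc_meas_const[OF X]
  have "PI (finT T) x (\<lambda>w. X (S n w) w) = (\<integral>\<^sup>+w. (\<Sum>j. indicator (A n j) w * X ((real j + 1) / 2 ^ n) w) \<partial>P x)"
  proof (rule nn_integral_cong)
   fix w assume "w \<in> space (P x)"
   then have w: "w \<in> space Msp" using space_P[OF x] by simp
   show "indicator (finT T) w * X (S n w) w = (\<Sum>j. indicator (A n j) w * X ((real j + 1) / 2 ^ n) w)"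
   proof (cases "T w < \<infinity>")
    case True
    define i where "i = nat \<lfloor>2 ^ n * enn2real (T w)\<rfloor>"
    have "indicator (A n j) w * X ((real j + 1) / 2 ^ n) w = (if j = i then X ((real j + 1) / 2 ^ n) w else 0)" for j
     using A_iff[OF w, of n j] True by (auto simp: indicator_def i_def)
    then have "(\<Sum>j. indicator (A n j) w * X ((real j + 1) / 2 ^ n) w) = X ((real i + 1) / 2 ^ n) w"
     by (simp only: sum_single_ennreal)
    also have "(real i + 1) / 2 ^ n = S n w" unfolding S_def i_def by (rule dy_nat[symmetric]) simp
    finally show ?thesis using True w by simp
   next
    case False
    then show ?thesis using A_iff[OF w, of n] by simp
   qed
  qed
  also have "... = (\<Sum>j. PI (A n j) x (X ((real j + 1) / 2 ^ n)))"
   by (rule nn_integral_suminf) measurable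
  finally show ?thesis .
 qed
 have eq: "PI (finT T) x (\<lambda>w. XT \<beta> (hp \<beta> u) (S n w) w)
  = PI (finT T) x (\<lambda>w. XT \<beta> (hm \<beta> u) (S n w) w) + PI (finT T) x (\<lambda>w. XU \<beta> u (S n w) w)" for n
 proof -
  have "PI (A n j) x (XT \<beta> (hp \<beta> u) ((real j + 1) / 2 ^ n)) = PI (A n j) x (XT \<beta> (hm \<beta> u) ((real j + 1) / 2 ^ n)) + PI (A n j) x (XU \<beta> u ((real j + 1) / 2 ^ n))" for j
   by (rule K_all[OF \<beta> u nn x _ AF]) simp
  then show ?thesis unfolding split[OF X(1)] split[OF X(2)] split[OF X(3)] by (simp add: suminf_add)
 qed
 have L: "(\<lambda>n. PI (finT T) x (\<lambda>w. X (S n w) w)) \<longlonglongrightarrow> PI (finT T) x (\<lambda>w. X (enn2real (T w)) w)" if X: "rc_proc X" for X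
 proof (rule rc_proc_lim[OF X x _ Sm S0])
  show "filterlim (\<lambda>n. S n w) (at_right (enn2real (T w))) sequentially" for w
   unfolding S_def by (rule dy_filterlim)
 qed auto
 show ?thesis
  using LIMSEQ_unique[OF L[OF X(1)] tendsto_add[OF L[OF X(2)] L[OF X(3)], folded eq]] .
qed

text \<open>At time 0 the discounted integral splits into a part before \<open>T\<close>, an
  integral against \<open>occ\<close>, and a part after \<open>T\<close>. Optional stopping relates
  the parts after \<open>T\<close>, and the finite term for \<open>hm\<close> cancels. Positive and
  negative parts stay on opposite sides so that no subtraction occurs in
  \<open>ennreal\<close>.\<close>

lemma dynkin:
 assumes \<beta>: "0 < \<beta>" and u: "u \<in> Cc_inf H" and nn: "\<And>y. 0 <= u y" and x: "x \<in> H" and T: "stop_time Msp F T"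
 shows "(\<integral>\<^sup>+y. ennreal (hp \<beta> u y) \<partial>occ \<beta> T x) + PI (finT T) x (\<lambda>w. XU \<beta> u (enn2real (T w)) w)
  = (\<integral>\<^sup>+y. ennreal (hm \<beta> u y) \<partial>occ \<beta> T x) + ennreal (u x)"
proof -
 let ?b = "\<lambda>f w. \<integral>\<^sup>+r. before T r w * ennreal (f (Z r w)) \<partial>EM \<beta>"
 interpret Px: prob_space "P x" by (rule prob[OF x])
 interpret E: finite_measure "EM \<beta>" by (rule EM_finite[OF \<beta>])
 obtain C where C: "adm (hp \<beta> u) C" "adm (hm \<beta> u) C" "adm u C" using adm_h[OF u nn] by blast
 note [measurable_cong] = sets_P[OF x]
 have Tm [measurable]: "T \<in> borel_measurable Msp" by (rule stop_meas[OF T])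
 have Tr [measurable]: "(\<lambda>w. enn2real (T w)) \<in> borel_measurable Msp" by measurable
 define U where "U = PI (finT T) x (\<lambda>w. XU \<beta> u (enn2real (T w)) w)"
 define S where "S f = PI (finT T) x (\<lambda>w. XT \<beta> f (enn2real (T w)) w)" for f
 have dec: "(\<integral>\<^sup>+w. XT \<beta> f 0 w \<partial>P x) = (\<integral>\<^sup>+y. ennreal (f y) \<partial>occ \<beta> T x) + S f" if f: "adm f C" for f
 proof -
  note [measurable] = adm_meas[OF f]
  have XTm [measurable]: "(\<lambda>w. XT \<beta> f (enn2real (T w)) w) \<in> borel_measurable Msp" by (rule rc_proc_meas[OF rc_proc_XT[OF \<beta> f] Tr])
  have "(\<integral>\<^sup>+w. XT \<beta> f 0 w \<partial>P x) = (\<integral>\<^sup>+w. (?b f w) + indicator (finT T) w * XT \<beta> f (enn2real (T w)) w \<partial>P x)"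
  proof (rule nn_integral_cong)
   fix w assume "w \<in> space (P x)"
   then have w: "w \<in> space Msp" using space_P[OF x] by simp
   have zm [measurable]: "bmeas (\<lambda>s. Z s w)" using w by measurable
   show "XT \<beta> f 0 w = (?b f w) + indicator (finT T) w * XT \<beta> f (enn2real (T w)) w"
   proof (cases "T w")
    case (real \<tau>)
    have "XT \<beta> f 0 w = (\<integral>\<^sup>+r. ennreal (f (Z r w)) \<partial>EM \<beta>)" by (simp add: XT_def)
    also have "... = (\<integral>\<^sup>+r. before T r w * ennreal (f (Z r w)) + indicator {\<tau><..} r * ennreal (f (Z r w)) \<partial>EM \<beta>)"
    proof (rule nn_integral_cong_AE)
     have "AE r in lborel. r \<noteq> \<tau>" by (rule AE_lborel_singleton)
     then have "AE r in EM \<beta>. r \<noteq> \<tau>" unfolding EM_def by (subst AE_density) auto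
     then show "AE r in EM \<beta>. ennreal (f (Z r w)) = before T r w * ennreal (f (Z r w)) + indicator {\<tau><..} r * ennreal (f (Z r w))"
      using EM_pos by eventually_elim (auto simp: real ennreal_less_iff indicator_def)
    qed
    also have "... = (?b f w) + (\<integral>\<^sup>+r. indicator {\<tau><..} r * ennreal (f (Z r w)) \<partial>EM \<beta>)"
     by (rule nn_integral_add) measurable
    also have "(\<integral>\<^sup>+r. indicator {\<tau><..} r * ennreal (f (Z r w)) \<partial>EM \<beta>) = XT \<beta> f \<tau> w"
     unfolding XT_def by (rule EM_shift[OF _ real(1)]) measurable
    finally show ?thesis using real w by simp
   qed (simp add: XT_def)
  qed
  also have "... = (\<integral>\<^sup>+w. (?b f w) \<partial>P x) + S f"
  proof -
   have "(\<lambda>(w, r). before T r w * ennreal (f (Z r w))) \<in> borel_measurable (P x \<Otimes>\<^sub>M EM \<beta>)"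
    by measurable
   then have "(\<lambda>w. ?b f w) \<in> borel_measurable (P x)"
    by (rule E.borel_measurable_nn_integral)
   moreover have "(\<lambda>w. indicator (finT T) w * XT \<beta> f (enn2real (T w)) w) \<in> borel_measurable (P x)"
    unfolding indicator_def by measurable
   ultimately show ?thesis unfolding S_def by (rule nn_integral_add)
  qed
  also have "(\<integral>\<^sup>+w. (?b f w) \<partial>P x) = (\<integral>\<^sup>+y. ennreal (f y) \<partial>occ \<beta> T x)"
   by (rule nn_occ[OF \<beta> x Tm, symmetric]) measurable
  finally show ?thesis .
 qed
 have os: "S (hp \<beta> u) = S (hm \<beta> u) + U" unfolding S_def U_def by (rule optional_stopping[OF \<beta> u nn x T])
 have "PI (space Msp) x (XT \<beta> (hp \<beta> u) 0) = PI (space Msp) x (XT \<beta> (hm \<beta> u) 0) + PI (space Msp) x (XU \<beta> u 0)"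
 proof (rule K_all[OF \<beta> u nn x order_refl])
  interpret sigma_algebra "space Msp" "F 0" by (rule F_sa) simp
  show "space Msp \<in> F 0" by (rule top)
 qed
 moreover have "PI (space Msp) x X = (\<integral>\<^sup>+w. X w \<partial>P x)" for X :: "'w => ennreal"
  by (intro nn_integral_cong) (simp add: space_P[OF x])
 moreover have "(\<integral>\<^sup>+w. XU \<beta> u 0 w \<partial>P x) = ennreal (u x)"
 proof -
  have "(\<integral>\<^sup>+w. XU \<beta> u 0 w \<partial>P x) = (\<integral>\<^sup>+w. ennreal (u x) \<partial>P x)"
   by (rule nn_integral_cong_AE, use normal[OF x] in eventually_elim) (simp add: XU_def Z_def)
  then show ?thesis by (simp add: Px.emeasure_space_1)
 qed
 ultimately have "(\<integral>\<^sup>+w. XT \<beta> (hp \<beta> u) 0 w \<partial>P x) = (\<integral>\<^sup>+w. XT \<beta> (hm \<beta> u) 0 w \<partial>P x) + ennreal (u x)" by simp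
 then have "(\<integral>\<^sup>+y. ennreal (hp \<beta> u y) \<partial>occ \<beta> T x) + S (hp \<beta> u) = (\<integral>\<^sup>+y. ennreal (hm \<beta> u y) \<partial>occ \<beta> T x) + S (hm \<beta> u) + ennreal (u x)"
  unfolding dec[OF C(1)] dec[OF C(2)] by simp
 then have "S (hm \<beta> u) + ((\<integral>\<^sup>+y. ennreal (hp \<beta> u y) \<partial>occ \<beta> T x) + U) = S (hm \<beta> u) + ((\<integral>\<^sup>+y. ennreal (hm \<beta> u y) \<partial>occ \<beta> T x) + ennreal (u x))"
  unfolding os by (simp add: ac_simps)
 moreover have "S (hm \<beta> u) < \<top>"
 proof -
  obtain D where D: "D < \<infinity>" "\<forall>t\<ge>0. \<forall>w. XT \<beta> (hm \<beta> u) t w <= D" using rc_proc_le[OF rc_proc_XT[OF \<beta> C(2)]] by blast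
  then have "S (hm \<beta> u) <= (\<integral>\<^sup>+w. D \<partial>P x)" unfolding S_def by (intro nn_integral_mono) (auto simp: indicator_def)
  also have "... < \<top>" using D(1) by (simp add: Px.emeasure_space_1)
  finally show ?thesis .
 qed
 ultimately show ?thesis unfolding U_def[symmetric] using ennreal_add_left_cancel by (metis less_irrefl infinity_ennreal_def)
qed

lemma hf_integrable_occ:
 assumes \<beta>: "0 < \<beta>" and u: "u \<in> Cc_inf H" and nn: "\<And>y. 0 <= u y" and x: "x \<in> H" and T: "T \<in> borel_measurable Msp"
 shows "integrable (occ \<beta> T x) (hf \<beta>' u)"
proof -
 interpret finite_measure "occ \<beta> T x" by (rule occ_finite[OF \<beta> x T])
 obtain C where C: "C \<ge> 0" "\<And>x. \<bar>hf \<beta>' u x\<bar> <= C" using hf_bounded[OF u nn] by blast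
 show ?thesis using hf_meas[OF u] C by (intro integrable_const_bound[where B=C]) auto
qed

text \<open>The term at the exit time is nonnegative, whence the inequality; it vanishes by
  \<open>u_at_exit\<close> when \<open>u\<close> is zero off \<open>C\<close>, whence the
  equality.\<close>

lemma dynkin_le:
 assumes \<beta>: "0 < \<beta>" and u: "u \<in> Cc_inf H" and nn: "\<And>y. 0 <= u y" and x: "x \<in> H" and C: "closed C"
 shows "(\<integral>y. hf \<beta> u y \<partial>occ \<beta> (exitH C) x) <= u x"
  and "(\<And>y. y \<notin> C ==> u y = 0) ==> (\<integral>y. hf \<beta> u y \<partial>occ \<beta> (exitH C) x) = u x"
proof -
 define T where "T = exitH C"
 let ?i = "\<integral>y. hf \<beta> u y \<partial>occ \<beta> T x"
 let ?p = "\<integral>y. hp \<beta> u y \<partial>occ \<beta> T x"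
 let ?m = "\<integral>y. hm \<beta> u y \<partial>occ \<beta> T x"
 have st: "stop_time Msp F T" unfolding T_def by (rule exit_stop[OF C])
 have Tm: "T \<in> borel_measurable Msp" by (rule stop_meas[OF st])
 interpret finite_measure "occ \<beta> T x" by (rule occ_finite[OF \<beta> x Tm])
 obtain D where D: "adm (hp \<beta> u) D" "adm (hm \<beta> u) D" "adm u D" using adm_h[OF u nn] by blast
 have int: "integrable (occ \<beta> T x) f" if "adm f D" for f
  using adm_meas[OF that] adm_nonneg[OF that] adm_le[OF that] by (intro integrable_const_bound[where B=D]) auto
 have ex: "(\<integral>\<^sup>+y. ennreal (f y) \<partial>occ \<beta> T x) = ennreal (\<integral>y. f y \<partial>occ \<beta> T x)" if "adm f D" for f
  using int[OF that] adm_nonneg[OF that] by (intro nn_integral_eq_integral) auto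
 have n0: "0 <= (\<integral>y. f y \<partial>occ \<beta> T x)" if "adm f D" for f
  using adm_nonneg[OF that] by (intro Bochner_Integration.integral_nonneg) auto
 have "hf \<beta> u = (\<lambda>y. hp \<beta> u y - hm \<beta> u y)" by (auto simp: hp_def hm_def max_def)
 then have h: "(?i) = (?p) - (?m)"
  using int[OF D(1)] int[OF D(2)] by simp
 let ?U = "PI (finT T) x (\<lambda>w. XU \<beta> u (enn2real (T w)) w)"
 have dk: "ennreal (?p) + ?U = ennreal ((?m) + u x)"
  using dynkin[OF \<beta> u nn x st] n0[OF D(2)] nn[of x] unfolding ex[OF D(1)] ex[OF D(2)] by (simp add: ennreal_plus)
 have "ennreal (?p) <= ennreal ((?m) + u x)"
  unfolding dk[symmetric] by simp
 then show "(\<integral>y. hf \<beta> u y \<partial>occ \<beta> (exitH C) x) <= u x"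
  using h n0[OF D(2)] nn[of x] unfolding T_def[symmetric] by (simp add: ennreal_le_iff del: ennreal_plus)
 assume z: "\<And>y. y \<notin> C ==> u y = 0"
 have "?U = (\<integral>\<^sup>+w. 0 \<partial>P x)"
 proof (rule nn_integral_cong)
  fix w assume "w \<in> space (P x)"
  then have w: "w \<in> space Msp" using space_P[OF x] by simp
  have "u (Z (enn2real (T w)) w) = 0" if "T w < \<infinity>"
   unfolding T_def
   by (rule u_at_exit[OF w]) (use that Cc_inf_continuous[OF u] z Cc_inf_zero[OF u] in \<open>auto simp: T_def\<close>)
  then show "indicator (finT T) w * XU \<beta> u (enn2real (T w)) w = 0" by (auto simp: indicator_def XU_def)
 qed
 then have "ennreal (?p) = ennreal ((?m) + u x)"
  using dk by simp
 then show "(\<integral>y. hf \<beta> u y \<partial>occ \<beta> (exitH C) x) = u x"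
  using h n0[OF D(1)] n0[OF D(2)] nn[of x] unfolding T_def[symmetric] by (simp del: ennreal_plus)
qed

lemma occ_conc:
 assumes \<beta>: "0 < \<beta>" and x: "x \<in> H" and C: "closed C"
 shows "AE y in occ \<beta> (exitH C) x. y \<in> C \<inter> H"
proof -
 define T where "T = exitH C"
 have Tm: "T \<in> borel_measurable Msp" unfolding T_def by (rule stop_meas[OF exit_stop[OF C]])
 have Cb [measurable]: "C \<inter> H \<in> sets borel" using C by (intro sets.Int borel_closed halfsp_borel)
 define D where "D = - (C \<inter> H)"
 have [measurable]: "D \<in> sets borel" unfolding D_def using Cb by (rule borel_comp)
 have "(\<integral>\<^sup>+y. indicator D y \<partial>occ \<beta> T x) = (\<integral>\<^sup>+w. \<integral>\<^sup>+r. before T r w * indicator D (Z r w) \<partial>EM \<beta> \<partial>P x)"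
  by (rule nn_occ[OF \<beta> x Tm]) measurable
 also have "... = (\<integral>\<^sup>+w. \<integral>\<^sup>+r. 0 \<partial>EM \<beta> \<partial>P x)"
 proof (rule nn_integral_cong, rule nn_integral_cong_AE)
  fix w assume "w \<in> space (P x)"
  then have w: "w \<in> space Msp" using space_P[OF x] by simp
  show "AE r in EM \<beta>. before T r w * indicator D (Z r w) = (0::ennreal)"
   using EM_pos
  proof eventually_elim
   case (elim r)
   show ?case using before_exit[OF w elim, of "C \<inter> H"] by (auto simp: T_def D_def)
  qed
 qed
 finally have "emeasure (occ \<beta> T x) D = 0" by (simp add: nn_integral_indicator)
 then have "D \<in> null_sets (occ \<beta> T x)" by auto
 then have "AE y in occ \<beta> T x. y \<notin> D" by (rule AE_not_in)
 then show ?thesis unfolding T_def by eventually_elim (simp add: D_def)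
qed

end

section \<open>Convex truncation and barrier functions\<close>

definition ph :: "real => real => real" where "ph \<eta> s = s * gexp 0 (s / \<eta>)"
text \<open>The derivative of \<open>ph \<eta>\<close> at \<open>a > 0\<close>. The function
  \<open>ph \<eta>\<close> is a smooth convex substitute for the positive part: smoothness keeps the
  barrier in \<open>Cc_inf\<close>, convexity preserves lower bounds on the generator.\<close>

definition gam :: "real => real => real" where "gam \<eta> a = exp (- \<eta> / a) * (1 + \<eta> / a)"

lemma ph_pos: "0 < \<eta> ==> 0 < s ==> ph \<eta> s = s * exp (- \<eta> / s)"
 by (simp add: ph_def gexp_def)

lemma ph_nonpos: "0 < \<eta> ==> s <= 0 ==> ph \<eta> s = 0"
 by (auto simp: ph_def gexp_def zero_less_divide_iff)

lemma ph_nonneg: "0 < \<eta> ==> 0 <= ph \<eta> s"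
 using ph_pos[of \<eta> s] ph_nonpos[of \<eta> s] by (cases "0 < s") auto

lemma gam_bounds:
 assumes "0 < \<eta>" "0 < a" shows "0 < gam \<eta> a" "gam \<eta> a <= 1" "ph \<eta> a <= a * gam \<eta> a"
proof -
 have "1 + \<eta> / a <= exp (\<eta> / a)" by (rule exp_ge_add_one_self)
 then have "exp (- \<eta> / a) * (1 + \<eta> / a) <= exp (- \<eta> / a) * exp (\<eta> / a)" by (intro mult_left_mono) auto
 also have "... = 1" by (simp add: exp_add[symmetric])
 finally show "gam \<eta> a <= 1" by (simp add: gam_def)
 show "0 < gam \<eta> a" using assms by (simp add: gam_def add_pos_pos)
 have "a * (exp (- \<eta> / a) * 1) <= a * (exp (- \<eta> / a) * (1 + \<eta> / a))" using assms by (intro mult_left_mono) auto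
 then show "ph \<eta> a <= a * gam \<eta> a" using assms by (simp add: gam_def ph_pos)
qed

text \<open>The tangent line lies below a convex function; here this follows from 1 + x <= exp x at
  x = \<eta>/a - \<eta>/b.\<close>

lemma ph_convex:
 assumes \<eta>: "0 < \<eta>" and a: "0 < a" shows "gam \<eta> a * (b - a) <= ph \<eta> b - ph \<eta> a"
proof -
 define r where "r = \<eta> / a"
 have ra: "r * a = \<eta>" "0 < r" using \<eta> a by (auto simp: r_def)
 have e: "gam \<eta> a * (b - a) + ph \<eta> a = exp (- r) * (b * (1 + r) - \<eta>)"
  using ra a \<eta> by (simp add: gam_def ph_pos r_def[symmetric] algebra_simps minus_divide_left[symmetric])
 have "exp (- r) * (b * (1 + r) - \<eta>) <= ph \<eta> b"
 proof (cases "0 < b")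
  case True
  have "1 + (r - \<eta> / b) <= exp (r - \<eta> / b)" by (rule exp_ge_add_one_self)
  then have "exp (- r) * b * (1 + (r - \<eta> / b)) <= exp (- r) * b * exp (r - \<eta> / b)" using True by (intro mult_left_mono) auto
  also have "... = b * exp (- \<eta> / b)" by (simp add: exp_diff exp_minus field_simps)
  also have "exp (- r) * b * (1 + (r - \<eta> / b)) = exp (- r) * (b * (1 + r) - \<eta>)" using True by (simp add: field_simps)
  finally show ?thesis using \<eta> True by (simp add: ph_pos)
 next
  case False
  then have "b * (1 + r) <= 0" using ra by (simp add: mult_le_0_iff)
  then have "exp (- r) * (b * (1 + r) - \<eta>) <= 0" using \<eta> by (intro mult_nonneg_nonpos) auto
  then show ?thesis using False \<eta> by (simp add: ph_nonpos)
 qed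
 then show ?thesis using e by linarith
qed

context bkernel begin

text \<open>Convexity reduces the increments of \<open>u\<close> to those of \<open>h - m\<close>.
  Replacing the square by \<open>m\<close> does not alter \<open>u\<close>: where the square exceeds
  \<open>h\<close>, the argument of \<open>ph\<close> is negative in either form. The cap is needed
  because the available bound on \<open>jj\<close> does not make the square integrable at
  infinity.\<close>

lemma Dop_lower:
 fixes h :: "real^'n => real" and z :: "real^'n"
 defines "m \<equiv> \<lambda>y. min ((norm (y - z))^2) (h y)"
 assumes h: "\<And>y. y \<in> H ==> 0 <= h y" and \<eta>0: "0 < \<eta>0" and y: "y \<in> H" and a: "0 < a" "a = h y - (norm (y - z))^2 - \<eta>0"
  and u: "\<And>y. y \<in> H ==> u y = ph \<eta>0 (h y - (norm (y - z))^2 - \<eta>0)" and \<eta>: "\<eta> \<in> H"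
 shows "gam \<eta>0 a * (Dop h y \<eta> - ((m (y \<odot> \<eta>) - (norm (y - z))^2) + \<eta> $ k powr (\<alpha> - 1) * (m (y \<odot> ginv k \<eta>) - (norm (y - z))^2))) <= Dop u y \<eta>"
proof -
 have st: "gam \<eta>0 a * ((h y' - m y') - (h y - (norm (y - z))^2)) <= u y' - u y" if y': "y' \<in> H" for y'
 proof -
  have "ph \<eta>0 (h y' - m y' - \<eta>0) = u y'"
   using \<eta>0 h[OF y'] unfolding u[OF y'] m_def by (cases "(norm (y' - z))^2 <= h y'") (auto simp: ph_nonpos)
  moreover have "ph \<eta>0 a = u y" unfolding u[OF y] a(2) ..
  moreover have "h y' - m y' - \<eta>0 - a = (h y' - m y') - (h y - (norm (y - z))^2)" using a(2) by simp
  ultimately show ?thesis using ph_convex[OF \<eta>0 a(1), of "h y' - m y' - \<eta>0"] by (simp only:)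
 qed
 have 1: "gam \<eta>0 a * ((h (y \<odot> \<eta>) - m (y \<odot> \<eta>)) - (h y - (norm (y - z))^2)) <= u (y \<odot> \<eta>) - u y"
  by (rule st[OF gmul_halfsp[OF y \<eta>]])
 have "gam \<eta>0 a * ((h (y \<odot> ginv k \<eta>) - m (y \<odot> ginv k \<eta>)) - (h y - (norm (y - z))^2)) <= u (y \<odot> ginv k \<eta>) - u y"
  by (rule st[OF gmul_halfsp[OF y ginv_halfsp[OF \<eta>]]])
 then have "\<eta> $ k powr (\<alpha> - 1) * (gam \<eta>0 a * ((h (y \<odot> ginv k \<eta>) - m (y \<odot> ginv k \<eta>)) - (h y - (norm (y - z))^2)))
   <= \<eta> $ k powr (\<alpha> - 1) * (u (y \<odot> ginv k \<eta>) - u y)" by (intro mult_left_mono) auto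
 from add_mono[OF 1 this] show ?thesis unfolding Dop_def by (simp add: algebra_simps)
qed

lemma norm_add_scaled_sq: "(norm (v + c *\<^sub>R q))^2 = (norm v)^2 + 2 * c * (v \<bullet> q) + c^2 * (norm q)^2"
 for v q :: "real^'n"
 unfolding power2_norm_eq_inner
 by (simp del: dot_square_norm add: inner_add_left inner_add_right inner_commute[of q v] power2_eq_square algebra_simps)

text \<open>The cancellation of \<open>Dop_bound\<close> for an explicit quadratic. The inner
  products carry the factor 1 - t^(\<alpha> - 2), at most 16 |q|, which gives 32; the squares
  contribute 1 + 16 = 17.\<close>

lemma near_quadratic:
 assumes y: "y \<in> H" and \<eta>: "\<eta> \<in> nearset k \<kappa>" "0 < \<kappa>" "\<kappa> <= 1/2"
 shows "((norm (y \<odot> \<eta> - z))^2 - (norm (y - z))^2) + \<eta> $ k powr (\<alpha> - 1) * ((norm (y \<odot> ginv k \<eta> - z))^2 - (norm (y - z))^2)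
   <= (32 * y $ k * norm (y - z) + 17 * (y $ k)^2) * (norm (\<eta> - e))^2"
proof -
 define s t q where "s = y $ k" and "t = \<eta> $ k" and "q = \<eta> - e"
 have s: "0 < s" using y by (simp add: s_def halfsp_def)
 have t: "1/4 <= t" "t <= 2" using nearset_bounds[OF \<eta>(2,3,1)] by (auto simp: t_def)
 have tq: "\<bar>t - 1\<bar> <= norm q" unfolding t_def q_def by (rule abs_nth_sub_1_le)
 have p1: "t powr (\<alpha> - 1) * (s / t) = s * t powr (\<alpha> - 2)"
  using t powr_diff[of t "\<alpha> - 1" 1] by (simp add: field_simps)
 have p2: "t powr (\<alpha> - 1) * (s / t)^2 = s^2 * t powr (\<alpha> - 3)"
  using t powr_diff[of t "\<alpha> - 1" 2] by (simp add: field_simps)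
 have e1: "(norm (y \<odot> \<eta> - z))^2 - (norm (y - z))^2 = 2 * s * ((y - z) \<bullet> q) + s^2 * (norm q)^2"
 proof -
  have "y \<odot> \<eta> - z = (y - z) + s *\<^sub>R q" by (simp add: gmul_eq s_def q_def)
  then show ?thesis by (simp only: norm_add_scaled_sq)
 qed
 have e2: "(norm (y \<odot> ginv k \<eta> - z))^2 - (norm (y - z))^2 = - (2 * (s / t) * ((y - z) \<bullet> q)) + (s / t)^2 * (norm q)^2"
 proof -
  have "y \<odot> ginv k \<eta> - z = (y - z) + (- (s / t)) *\<^sub>R q" by (simp add: gmul_ginv_eq s_def q_def t_def)
  then show ?thesis by (simp only: norm_add_scaled_sq) simp
 qed
 have "((norm (y \<odot> \<eta> - z))^2 - (norm (y - z))^2) + t powr (\<alpha> - 1) * ((norm (y \<odot> ginv k \<eta> - z))^2 - (norm (y - z))^2)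
  = 2 * ((y - z) \<bullet> q) * (s - t powr (\<alpha> - 1) * (s / t)) + (s^2 + t powr (\<alpha> - 1) * (s / t)^2) * (norm q)^2"
  unfolding e1 e2 by (simp only: ring_distribs) (simp add: mult.commute mult.left_commute)
 also have "... = 2 * s * (((y - z) \<bullet> q) * (1 - t powr (\<alpha> - 2))) + s^2 * (1 + t powr (\<alpha> - 3)) * (norm q)^2"
  unfolding p1 p2 by (simp add: algebra_simps)
 also have "... <= 2 * s * ((norm (y - z) * norm q) * (16 * norm q)) + s^2 * 17 * (norm q)^2"
 proof (rule add_mono)
  have "((y - z) \<bullet> q) * (1 - t powr (\<alpha> - 2)) <= \<bar>(y - z) \<bullet> q\<bar> * \<bar>1 - t powr (\<alpha> - 2)\<bar>" by (simp add: abs_mult[symmetric])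
  also have "... <= (norm (y - z) * norm q) * (16 * norm q)"
   using powr_near(1)[OF t] tq Cauchy_Schwarz_ineq2[of "y - z" q] by (intro mult_mono) auto
  finally show "2 * s * (((y - z) \<bullet> q) * (1 - t powr (\<alpha> - 2))) <= 2 * s * ((norm (y - z) * norm q) * (16 * norm q))"
   using s by (intro mult_left_mono) auto
  show "s\<^sup>2 * (1 + t powr (\<alpha> - 3)) * (norm q)^2 <= s^2 * 17 * (norm q)^2"
   using powr_near(2)[OF t] by (intro mult_right_mono mult_left_mono) auto
 qed
 also have "... = (32 * s * norm (y - z) + 17 * s^2) * (norm q)^2" by (simp add: algebra_simps power2_eq_square)
 finally show ?thesis by (simp add: s_def t_def q_def)
qed

text \<open>On the near set the capped square is bounded by the square and
  \<open>near_quadratic\<close> applies; on the far set \<open>g\<close> majorises its increments.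
  The factor 2 arises because inversion gives the second increment the same integral.\<close>

lemma Lop_lower:
 fixes h :: "real^'n => real" and z :: "real^'n"
 assumes h: "\<And>y. y \<in> H ==> 0 <= h y" and \<eta>0: "0 < \<eta>0" and y: "y \<in> H" and a: "0 < a" "a = h y - (norm (y - z))^2 - \<eta>0"
  and u: "\<And>y. y \<in> H ==> u y = ph \<eta>0 (h y - (norm (y - z))^2 - \<eta>0)"
  and ut: "taylor2 M u" "bmeas u" and \<kappa>: "0 < \<kappa>" "\<kappa> <= 1/2"
  and hl: "\<And>\<eta>. \<eta> \<in> H ==> hl \<eta> <= Dop h y \<eta>" "integrable lborel (\<lambda>\<eta>. hl \<eta> * jj \<eta>)"
  and g: "bmeas g" "\<And>\<eta>. 0 <= g \<eta>" "integrable lborel (\<lambda>\<eta>. far \<kappa> \<eta> * g \<eta> * jj \<eta>)"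
   "\<And>\<eta>. \<eta> \<in> farset \<kappa> ==> min ((norm (y \<odot> \<eta> - z))^2) (h (y \<odot> \<eta>)) - (norm (y - z))^2 <= g \<eta>"
 shows "gam \<eta>0 a * (y $ k powr (- \<alpha>) / 2 * ((LI \<eta>. hl \<eta> * jj \<eta>)
   - (32 * y $ k * norm (y - z) + 17 * (y $ k)^2) * (LI \<eta>. near_q \<kappa> \<eta>)
   - 2 * (LI \<eta>. far \<kappa> \<eta> * g \<eta> * jj \<eta>))) <= Lop u y"
proof -
 define c where "c = 32 * y $ k * norm (y - z) + 17 * (y $ k)^2"
 define gf where "gf \<eta> = far \<kappa> \<eta> * g \<eta>" for \<eta>
 note [measurable] = g(1)
 have gm [measurable]: "bmeas gf" unfolding gf_def by measurable
 have g0: "0 <= gf \<eta>" for \<eta> using g(2) by (simp add: gf_def)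
 have gi: "integrable lborel (\<lambda>\<eta>. gf \<eta> * jj \<eta>)" using g(3) by (simp add: gf_def)
 define m where "m y = min ((norm (y - z))^2) (h y)" for y
 let ?T = "\<lambda>\<eta>. (m (y \<odot> \<eta>) - (norm (y - z))^2) + \<eta> $ k powr (\<alpha> - 1) * (m (y \<odot> ginv k \<eta>) - (norm (y - z))^2)"
 let ?W = "\<lambda>\<eta>. gam \<eta>0 a * (hl \<eta> * jj \<eta> - c * (near_q \<kappa> \<eta>) - (gf \<eta> * jj \<eta> + \<eta> $ k powr (\<alpha> - 1) * gf (ginv k \<eta>) * jj \<eta>))"
 note gs = integral_jj_ginv[OF gm g0 gi]
 obtain C where "\<forall>\<kappa>. 0 < \<kappa> \<and> \<kappa> <= 1/2 -->
   integrable lborel (near_q \<kappa>) \<and>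
   (LI \<eta>. near_q \<kappa> \<eta>) <= C * \<kappa> powr (2 - \<alpha>)" using near_int by blast
 then have ni: "integrable lborel (near_q \<kappa>)" using \<kappa> by blast
 have pw: "?W \<eta> <= Dop u y \<eta> * jj \<eta>" for \<eta>
 proof (cases "\<eta> \<in> H")
  case False
  then show ?thesis by (simp add: jj_zero)
 next
  case True
  have E: "?T \<eta>
    <= c * (near \<kappa> \<eta> * (norm (\<eta> - e))^2) + (gf \<eta> + \<eta> $ k powr (\<alpha> - 1) * gf (ginv k \<eta>))"
  proof (cases "\<eta> \<in> nearset k \<kappa>")
   case N: True
   have "?T \<eta>
    <= ((norm (y \<odot> \<eta> - z))^2 - (norm (y - z))^2) + \<eta> $ k powr (\<alpha> - 1) * ((norm (y \<odot> ginv k \<eta> - z))^2 - (norm (y - z))^2)"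
    by (intro add_mono mult_left_mono) (auto simp: m_def)
   also have "... <= c * (norm (\<eta> - e))^2" unfolding c_def by (rule near_quadratic[OF y N \<kappa>])
   also have "... <= c * (near \<kappa> \<eta> * (norm (\<eta> - e))^2) + (gf \<eta> + \<eta> $ k powr (\<alpha> - 1) * gf (ginv k \<eta>))"
    using N g0[of \<eta>] mult_nonneg_nonneg[OF powr_ge_zero g0[of "ginv k \<eta>"], of "\<eta> $ k" "\<alpha> - 1"] by simp
   finally show ?thesis .
  next
   case N: False
   have f1: "\<eta> \<in> farset \<kappa>" using True N by simp
   have f2: "ginv k \<eta> \<in> farset \<kappa>" using True N ginv_nearset[OF True] ginv_halfsp[OF True] by simp
   have "m (y \<odot> \<eta>) - (norm (y - z))^2 <= gf \<eta>" using g(4)[OF f1] f1 by (simp add: gf_def m_def)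
   moreover have "m (y \<odot> ginv k \<eta>) - (norm (y - z))^2 <= gf (ginv k \<eta>)" using g(4)[OF f2] f2 by (simp add: gf_def m_def)
   ultimately show ?thesis using N by (simp add: add_mono mult_left_mono)
  qed
  have gp: "0 < gam \<eta>0 a" by (rule gam_bounds(1)[OF \<eta>0 a(1)])
  have "gam \<eta>0 a * (hl \<eta> - c * (near \<kappa> \<eta> * (norm (\<eta> - e))^2) - (gf \<eta> + \<eta> $ k powr (\<alpha> - 1) * gf (ginv k \<eta>)))
   <= gam \<eta>0 a * (Dop h y \<eta> - (?T \<eta>))"
   using E hl(1)[OF True] gp by (intro mult_left_mono) auto
  also have "... <= Dop u y \<eta>" unfolding m_def by (rule Dop_lower[OF h \<eta>0 y a u True])
  finally have "gam \<eta>0 a * (hl \<eta> - c * (near \<kappa> \<eta> * (norm (\<eta> - e))^2) - (gf \<eta> + \<eta> $ k powr (\<alpha> - 1) * gf (ginv k \<eta>))) * jj \<eta> <= Dop u y \<eta> * jj \<eta>"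
   by (rule mult_right_mono[OF _ jj_nonneg])
  then show ?thesis by (simp add: algebra_simps)
 qed
 have "(LI \<eta>. ?W \<eta>) <= (LI \<eta>. Dop u y \<eta> * jj \<eta>)"
 proof (rule integral_mono[OF _ Dop_integrable[OF ut y] pw])
  show "integrable lborel (\<lambda>\<eta>. ?W \<eta>)"
   by (intro integrable_mult_right Bochner_Integration.integrable_diff Bochner_Integration.integrable_add hl(2) ni gi gs(1))
 qed
 also have "(LI \<eta>. ?W \<eta>)
  = gam \<eta>0 a * ((LI \<eta>. hl \<eta> * jj \<eta>) - c * (LI \<eta>. near_q \<kappa> \<eta>)
   - ((LI \<eta>. gf \<eta> * jj \<eta>) + (LI \<eta>. \<eta> $ k powr (\<alpha> - 1) * gf (ginv k \<eta>) * jj \<eta>)))"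
  using hl(2) ni gi gs(1) by (simp del: Bochner_Integration.integral_mult_right_zero add: Bochner_Integration.integral_mult_right[OF ni])
 also have "... = gam \<eta>0 a * ((LI \<eta>. hl \<eta> * jj \<eta>) - c * (LI \<eta>. near_q \<kappa> \<eta>)
   - 2 * (LI \<eta>. gf \<eta> * jj \<eta>))" unfolding gs(2) by simp
 finally have "y $ k powr (- \<alpha>) / 2 * (gam \<eta>0 a * ((LI \<eta>. hl \<eta> * jj \<eta>) - c * (LI \<eta>. near_q \<kappa> \<eta>)
   - 2 * (LI \<eta>. gf \<eta> * jj \<eta>))) <= Lop u y"
  unfolding Lop_def by (rule mult_left_mono) simp
 then show ?thesis unfolding c_def gf_def by (simp add: mult.left_commute)
qed

end

context bkernel begin

lemma jj_lower_ball:
 "\<exists>c>0. \<forall>\<eta>\<in>cball (3 *\<^sub>R e) 1. c <= jj \<eta>"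
proof -
 \<comment> \<open>The ball has heights at least 2 and distances at most 3 from \<open>e\<close>,
   whose height is 1; hence the factor 1/3.\<close>
 obtain b where b: "b > 0" "\<forall>x\<in>halfsp k. \<forall>y\<in>halfsp k. x \<noteq> y --> 1/3 * norm (x - y) <= min (x $ k) (y $ k) --> b <= B x y"
  using B_low[of "1/3"] by auto
 have "b * 3 powr (- (d + \<alpha>)) <= jj \<eta>" if \<eta>: "\<eta> \<in> cball (3 *\<^sub>R e) 1" for \<eta>
 proof -
  have n: "norm (\<eta> - 3 *\<^sub>R e) <= 1" using \<eta> by (simp add: dist_norm norm_minus_commute)
  have "\<bar>(\<eta> - 3 *\<^sub>R e) $ k\<bar> <= norm (\<eta> - 3 *\<^sub>R e)" by (rule component_le_norm_cart)
  then have t: "2 <= \<eta> $ k" using n by (simp add: ek_def axis_def)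
  have "norm (\<eta> - e) <= norm (\<eta> - 3 *\<^sub>R e) + norm (2 *\<^sub>R e :: real^'n)"
  proof -
   have "\<eta> - e = (\<eta> - 3 *\<^sub>R e) + 2 *\<^sub>R e" by (simp add: vec_eq_iff algebra_simps)
   then show ?thesis by (metis norm_triangle_ineq)
  qed
  also have "norm (2 *\<^sub>R e :: real^'n) = 2" by simp
  finally have n3: "norm (\<eta> - e) <= 3" using n by linarith
  have ne: "\<eta> \<noteq> e" using t by (auto simp: ek_def axis_def)
  have eH: "e \<in> H" by (simp add: halfsp_def ek_def axis_def)
  have \<eta>H: "\<eta> \<in> H" using t by (simp add: halfsp_def)
  have e1: "e $ k = 1" by (simp add: ek_def axis_def)
  have bB: "b <= B e \<eta>"
   using b(2)[rule_format, OF eH \<eta>H] ne n3 t e1 by (simp add: norm_minus_commute)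
  have "b * 3 powr (- (d + \<alpha>)) <= B e \<eta> * norm (e - \<eta>) powr (- (d + \<alpha>))"
  proof (rule mult_mono)
   have "0 <= d" by (simp add: d_eq)
   then show "3 powr (- (d + \<alpha>)) <= norm (e - \<eta>) powr (- (d + \<alpha>))"
    using n3 ne alpha by (intro powr_mono2') (auto simp: norm_minus_commute)
  qed (use bB b B_nonneg[OF eH \<eta>H] in auto)
  also have "... = jj \<eta>" using \<eta>H unfolding powr_dm by (simp add: jj_def Jk_def divide_inverse)
  finally show ?thesis .
 qed
 then show ?thesis using b by (intro exI[of _ "b * 3 powr (- (d + \<alpha>))"]) auto
qed

text \<open>For a power \<open>p\<close> of the height the symmetrised difference is that power
  times (t^p - 1) (1 - t^(\<alpha> - 1 - p)), with t the height of \<eta>. It vanishes for p =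
  \<alpha> - 1. For p = \<alpha>/2 both factors have the same sign because \<alpha>/2 - 1 is
  negative. The first power gives the boundary rate, the second a positive generator.\<close>

definition hA :: "real^'n => real" where "hA y = y $ k powr (\<alpha> - 1) + y $ k powr (\<alpha> / 2)"

lemma hA_Dop:
 assumes y: "y \<in> H" and \<eta>: "\<eta> \<in> H"
 shows "Dop hA y \<eta> = y $ k powr (\<alpha> / 2) * ((\<eta> $ k powr (\<alpha> / 2) - 1) * (1 - \<eta> $ k powr (\<alpha> / 2 - 1)))"
proof -
 define s t where "s = y $ k" and "t = \<eta> $ k"
 have st: "0 < s" "0 < t" using y \<eta> by (auto simp: s_def t_def halfsp_def)
 have n: "(y \<odot> \<eta>) $ k = s * t" "(y \<odot> ginv k \<eta>) $ k = s / t"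
  using st y \<eta> by (simp_all add: gmul_nth ginv_nth s_def t_def)
 have m: "(s * t) powr r = s powr r * t powr r" "(s / t) powr r = s powr r * t powr (- r)" for r
  using st by (simp_all add: powr_mult powr_divide powr_minus_divide)
 have "Dop hA y \<eta> = s powr (\<alpha> - 1) * (t powr (\<alpha> - 1) - 1 + t powr (\<alpha> - 1) * (t powr (- (\<alpha> - 1)) - 1))
   + s powr (\<alpha> / 2) * (t powr (\<alpha> / 2) - 1 + t powr (\<alpha> - 1) * (t powr (- (\<alpha> / 2)) - 1))"
  unfolding Dop_def hA_def n m s_def[symmetric] t_def[symmetric] by (simp add: algebra_simps)
 also have "t powr (\<alpha> - 1) * (t powr (- (\<alpha> - 1)) - 1) = 1 - t powr (\<alpha> - 1)"
  using st by (simp add: algebra_simps powr_add[symmetric])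
 also have "t powr (\<alpha> / 2) - 1 + t powr (\<alpha> - 1) * (t powr (- (\<alpha> / 2)) - 1) = (t powr (\<alpha> / 2) - 1) * (1 - t powr (\<alpha> / 2 - 1))"
  by (simp add: algebra_simps powr_add[symmetric])
 finally show ?thesis by (simp add: s_def t_def)
qed

lemma hA_Dop_nonneg:
 assumes y: "y \<in> H" and \<eta>: "\<eta> \<in> H" shows "0 <= Dop hA y \<eta>"
proof -
 have t: "0 < \<eta> $ k" using \<eta> by (simp add: halfsp_def)
 have "0 <= (\<eta> $ k powr (\<alpha> / 2) - 1) * (1 - \<eta> $ k powr (\<alpha> / 2 - 1))"
 proof (cases "1 <= \<eta> $ k")
  case True
  have "1 powr (\<alpha> / 2) <= \<eta> $ k powr (\<alpha> / 2)" using True alpha by (intro powr_mono2) auto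
  moreover have "\<eta> $ k powr (\<alpha> / 2 - 1) <= 1 powr (\<alpha> / 2 - 1)" using True alpha by (intro powr_mono2') auto
  ultimately show ?thesis by simp
 next
  case False
  have "\<eta> $ k powr (\<alpha> / 2) <= 1 powr (\<alpha> / 2)" using False t alpha by (intro powr_mono2) auto
  moreover have "1 powr (\<alpha> / 2 - 1) <= \<eta> $ k powr (\<alpha> / 2 - 1)" using False t alpha by (intro powr_mono2') auto
  ultimately show ?thesis by (simp add: mult_nonpos_nonpos)
 qed
 then show ?thesis unfolding hA_Dop[OF y \<eta>] by simp
qed

text \<open>On a ball about \<open>3 *\<^sub>R e\<close>, where heights are at least 2, both factors
  in \<open>hA_Dop\<close> and the kernel are bounded below; elsewhere nonnegativity is
  enough.\<close>

lemma hA_lower: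
 "\<exists>c0>0. \<exists>\<rho>. integrable lborel (\<lambda>\<eta>. \<rho> \<eta> * jj \<eta>) \<and> (LI \<eta>. \<rho> \<eta> * jj \<eta>) = c0
   \<and> (\<forall>y\<in>H. \<forall>\<eta>\<in>H. y $ k powr (\<alpha> / 2) * \<rho> \<eta> <= Dop hA y \<eta>)"
proof -
 define A where "A = cball (3 *\<^sub>R e :: real^'n) 1"
 define r0 where "r0 = (2 powr (\<alpha> / 2) - 1) * (1 - 2 powr (\<alpha> / 2 - 1))"
 have r0: "0 < r0"
 proof -
  have "1 < (2::real) powr (\<alpha> / 2)" using alpha by simp
  moreover have "(2::real) powr (\<alpha> / 2 - 1) < 2 powr 0" using alpha by (intro powr_less_mono) auto
  ultimately show ?thesis by (simp add: r0_def)
 qed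
 obtain c where c: "c > 0" "\<forall>\<eta>\<in>A. c <= jj \<eta>" using jj_lower_ball unfolding A_def by blast
 have Am [measurable]: "A \<in> sets borel" by (simp add: A_def)
 have Afin: "emeasure lborel A < \<infinity>" unfolding A_def by (rule emeasure_lborel_cball_finite)
 have At: "2 <= \<eta> $ k" "1 <= norm (\<eta> - e)" if "\<eta> \<in> A" for \<eta>
 proof -
  have "\<bar>(\<eta> - 3 *\<^sub>R e) $ k\<bar> <= norm (\<eta> - 3 *\<^sub>R e)" by (rule component_le_norm_cart)
  then show 1: "2 <= \<eta> $ k" using that by (simp add: ek_def axis_def A_def dist_norm norm_minus_commute)
  have "\<bar>\<eta> $ k - 1\<bar> <= norm (\<eta> - e)" by (rule abs_nth_sub_1_le)
  then show "1 <= norm (\<eta> - e)" using 1 by linarith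
 qed
 have jjA: "jj \<eta> <= CB" if "\<eta> \<in> A" for \<eta>
 proof -
  have "norm (\<eta> - e) powr (- (d + \<alpha>)) <= 1 powr (- (d + \<alpha>))" using At(2)[OF that] alpha by (intro powr_mono2') (auto simp: d_eq)
  then have "CB * norm (\<eta> - e) powr (- (d + \<alpha>)) <= CB * 1" using CB by (intro mult_left_mono) auto
  then show ?thesis using jj_bound[of \<eta>] by simp
 qed
 have ci: "integrable lborel (\<lambda>\<eta>. indicator A \<eta> * C)" for C :: real
  using Afin by simp
 have i: "integrable lborel (\<lambda>\<eta>. (r0 * indicator A \<eta>) * jj \<eta>)"
 proof (rule Bochner_Integration.integrable_bound[OF ci[of "r0 * CB"]])
  show "AE x in lborel. norm (r0 * indicator A x * jj x) <= norm (indicator A x * (r0 * CB))"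
   using jjA r0 CB jj_nonneg by (intro AE_I2) (auto simp: indicator_def)
 qed measurable
 have "(LI \<eta>. indicator A \<eta> * (r0 * c)) <= (LI \<eta>. (r0 * indicator A \<eta>) * jj \<eta>)"
  using c r0 by (intro integral_mono ci i) (auto simp: indicator_def)
 moreover have "0 < (LI \<eta>. indicator A \<eta> * (r0 * c))"
 proof -
  have "0 < measure lborel (ball (3 *\<^sub>R e :: real^'n) 1)" by (simp add: content_ball_pos)
  also have "... <= measure lborel A" unfolding A_def using emeasure_lborel_cball_finite[of "3 *\<^sub>R e :: real^'n" 1] by (intro measure_mono_fmeasurable) (auto simp: fmeasurable_def)
  finally show ?thesis using r0 c by simp
 qed
 ultimately have pos: "0 < (LI \<eta>. (r0 * indicator A \<eta>) * jj \<eta>)" by linarith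
 have low: "y $ k powr (\<alpha> / 2) * (r0 * indicator A \<eta>) <= Dop hA y \<eta>" if y: "y \<in> H" and \<eta>: "\<eta> \<in> H" for y \<eta>
 proof (cases "\<eta> \<in> A")
  case False then show ?thesis using hA_Dop_nonneg[OF y \<eta>] by simp
 next
  case True
  have "r0 <= (\<eta> $ k powr (\<alpha> / 2) - 1) * (1 - \<eta> $ k powr (\<alpha> / 2 - 1))"
   unfolding r0_def
  proof (rule mult_mono)
   have "2 powr (\<alpha> / 2) <= \<eta> $ k powr (\<alpha> / 2)" using At(1)[OF True] alpha by (intro powr_mono2) auto
   then show "2 powr (\<alpha> / 2) - 1 <= \<eta> $ k powr (\<alpha> / 2) - 1" by simp
   have 1: "1 <= (2::real) powr (\<alpha> / 2)" using alpha by (intro ge_one_powr_ge_zero) auto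
   then show "0 <= \<eta> $ k powr (\<alpha> / 2) - 1" using \<open>2 powr (\<alpha> / 2) <= \<eta> $ k powr (\<alpha> / 2)\<close> by linarith
   have "\<eta> $ k powr (\<alpha> / 2 - 1) <= 2 powr (\<alpha> / 2 - 1)" using At(1)[OF True] alpha by (intro powr_mono2') auto
   then show "1 - 2 powr (\<alpha> / 2 - 1) <= 1 - \<eta> $ k powr (\<alpha> / 2 - 1)" by simp
   have "(2::real) powr (\<alpha> / 2 - 1) <= 2 powr 0" using alpha by (intro powr_mono) auto
   then show "0 <= 1 - (2::real) powr (\<alpha> / 2 - 1)" by simp
  qed
  then have "y $ k powr (\<alpha> / 2) * r0 <= Dop hA y \<eta>" unfolding hA_Dop[OF y \<eta>] by (intro mult_left_mono) auto
  then show ?thesis using True by simp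
 qed
 show ?thesis
  by (intro exI[of _ "(LI \<eta>. (r0 * indicator A \<eta>) * jj \<eta>)"] exI[of _ "\<lambda>\<eta>. r0 * indicator A \<eta>"] conjI pos i refl ballI low)
qed

lemma powr_le_lin: "0 <= x ==> x <= X ==> 1 <= X ==> 0 <= r ==> r <= 1 ==> x powr r <= (X::real)"
 using powr_mono2[of r x X] powr_mono[of r 1 X] by simp

text \<open>For displacements up to 1 the square grows at most linearly; for larger ones the minimum
  is bounded by \<open>hA\<close>, whose exponents are below 1, so it is again at most linear.
  Linear growth is integrable against the far jumps because \<alpha> > 1.\<close>

lemma farA:
 assumes y: "y \<in> H" and \<eta>: "\<eta> \<in> H" and n: "norm y <= 2"
 shows "min ((norm (y \<odot> \<eta>))^2) (hA (y \<odot> \<eta>)) - (norm y)^2 <= 6 * y $ k * norm (\<eta> - e)"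
proof -
 define s r where "s = y $ k" and "r = norm (\<eta> - e)"
 have s: "0 < s" using y by (simp add: s_def halfsp_def)
 have s2: "s <= 2" using n component_le_norm_cart[of y k] by (simp add: s_def)
 have r0: "0 <= r" by (simp add: r_def)
 have sr0: "0 <= s * r" using s r0 by simp
 show ?thesis
 proof (cases "s * r <= 1")
  case True
  have "norm (y \<odot> \<eta>) <= norm y + norm (s *\<^sub>R (\<eta> - e))" unfolding gmul_eq s_def by (rule norm_triangle_ineq)
  then have "(norm (y \<odot> \<eta>))^2 <= (norm y + s * r)^2" using s by (intro power_mono) (auto simp: r_def)
  also have "... = (norm y)^2 + 2 * norm y * (s * r) + (s * r) * (s * r)" by (simp add: power2_eq_square algebra_simps)
  also have "... <= (norm y)^2 + 2 * 2 * (s * r) + (s * r) * 1"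
   using n True sr0 by (intro add_mono mult_right_mono mult_left_mono) auto
  finally have "(norm (y \<odot> \<eta>))^2 - (norm y)^2 <= 6 * (s * r)" using sr0 by linarith
  then have "min ((norm (y \<odot> \<eta>))^2) (hA (y \<odot> \<eta>)) - (norm y)^2 <= 6 * (s * r)" by linarith
  then show ?thesis by (simp add: s_def r_def)
 next
  case False
  have t: "\<bar>\<eta> $ k - 1\<bar> <= r" unfolding r_def by (rule abs_nth_sub_1_le)
  have t0: "0 < \<eta> $ k" using \<eta> by (simp add: halfsp_def)
  have st: "(y \<odot> \<eta>) $ k = s * \<eta> $ k" by (simp add: gmul_nth s_def)
  have "s * \<eta> $ k <= s * (1 + r)" using t s by (intro mult_left_mono) auto
  then have le: "s * \<eta> $ k <= 3 * (s * r)" using False s2 by (simp add: algebra_simps)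
  have "(s * \<eta> $ k) powr (\<alpha> - 1) <= 3 * (s * r)" "(s * \<eta> $ k) powr (\<alpha> / 2) <= 3 * (s * r)"
   using le False s t0 alpha by (intro powr_le_lin; simp)+
  then have "hA (y \<odot> \<eta>) <= 6 * (s * r)" unfolding hA_def st by linarith
  then have "min ((norm (y \<odot> \<eta>))^2) (hA (y \<odot> \<eta>)) - (norm y)^2 <= 6 * (s * r)"
   using zero_le_power2[of "norm y"] by linarith
  then show ?thesis by (simp add: s_def r_def)
 qed
qed

lemma hsm_shift_norm: "(\<lambda>y. (norm (y - z))^2) \<in> hsmooth k" for z :: "real^'n"
 by (rule hsm_norm_sq) (simp add: hsm_diff hsm_coord hsm_const)

lemma hsm_ph: "f \<in> hsmooth k ==> (\<lambda>y. ph \<eta> (f y)) \<in> hsmooth k"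
 unfolding ph_def using hsm_mult[OF _ hsm_gexp[OF hsm_cmult[of f k "1 / \<eta>"]], of f 0] by simp

text \<open>The packaging under which Dynkin's formula bounds an occupation time from below: \<beta>
  f - L f may be positive only at points of \<open>K\<close> of height at least \<open>h1\<close>,
  so the value \<open>v\<close> at \<open>x\<close> must be paid for by time spent there.\<close>

definition barrier :: "(real^'n => real) => (real^'n) set => real^'n => real => real => real => real => bool" where
 "barrier f K x C h1 b0 v \<longleftrightarrow> f \<in> hsmooth k \<and> compact K \<and> K \<subseteq> H \<and> K \<subseteq> cball x 5 \<and> (\<forall>y\<in>H - K. f y = 0) \<and> (\<forall>y. 0 <= f y)
   \<and> v <= f x \<and> (\<forall>y\<in>H. \<forall>\<beta>. 0 < \<beta> \<and> \<beta> <= b0 -->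
    \<beta> * f y - Lop (\<lambda>y. if y \<in> H then f y else 0) y <= C * indicator (K \<inter> {y. h1 <= y $ k}) y)"

lemma barrier_zero:
 assumes f: "f \<in> hsmooth k" and K: "compact K" "K \<subseteq> H" and z: "\<forall>y\<in>H - K. f y = 0" and nn: "\<forall>y. 0 <= f y"
  and y: "y \<in> H" "f y = 0"
 shows "0 <= Lop (\<lambda>y. if y \<in> H then f y else 0) y"
proof -
 let ?u = "\<lambda>y. if y \<in> H then f y else 0"
 have u: "?u \<in> Cc_inf H" using z by (intro Cc_inf_hsmooth[OF f K]) auto
 obtain M where M: "taylor2 M ?u" using Cc_inf_taylor2[OF u] by blast
 have "Lop ?u y = (LI z. indicator H z * (?u z * J y z))"
  by (rule Lop_zero[OF M Cc_inf_borel[OF u] y(1)]) (use nn y in auto)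
 also have "... \<ge> 0" using nn J_nonneg[OF y(1)] by (intro Bochner_Integration.integral_nonneg) (auto simp: indicator_def)
 finally show ?thesis .
qed

text \<open>The factor \<open>gam\<close> of \<open>Lop_lower\<close> cancels against the one in \<open>ph \<eta>0 a \<le> a * gam \<eta>0 a\<close>.\<close>
lemma barrierI:
 fixes h :: "real^'n => real" and z :: "real^'n" and \<eta>0 :: real
 defines "a \<equiv> \<lambda>y. h y - (norm (y - z))^2 - \<eta>0"
 assumes h: "h \<in> hsmooth k" "\<And>y. y \<in> H ==> 0 <= h y" and \<eta>0: "0 < \<eta>0" and K: "compact K" "K \<subseteq> H" "K \<subseteq> cball x 5"
  and pos: "\<And>y. y \<in> H ==> 0 < a y ==> y \<in> K" and v: "\<eta>0 <= a x" and C: "0 <= C"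
  and \<kappa>: "\<And>y. y \<in> K ==> 0 < \<kappa> y \<and> \<kappa> y <= 1/2"
  and hl: "\<And>y \<eta>. y \<in> K ==> \<eta> \<in> H ==> hl y \<eta> <= Dop h y \<eta>" "\<And>y. y \<in> K ==> integrable lborel (\<lambda>\<eta>. hl y \<eta> * jj \<eta>)"
  and g: "\<And>y. g y \<in> borel_measurable borel" "\<And>y \<eta>. y \<in> K ==> 0 <= g y \<eta>"
   "\<And>y. y \<in> K ==> integrable lborel (\<lambda>\<eta>. far (\<kappa> y) \<eta> * g y \<eta> * jj \<eta>)"
   "\<And>y \<eta>. y \<in> K ==> \<eta> \<in> farset (\<kappa> y) ==> min ((norm (y \<odot> \<eta> - z))^2) (h (y \<odot> \<eta>)) - (norm (y - z))^2 <= g y \<eta>"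
  and main: "\<And>y. y \<in> K ==> 0 < a y ==> b0 * a y - y $ k powr (- \<alpha>) / 2 * ((LI \<eta>. hl y \<eta> * jj \<eta>)
    - (32 * y $ k * norm (y - z) + 17 * (y $ k)^2) * (LI \<eta>. near_q (\<kappa> y) \<eta>)
    - 2 * (LI \<eta>. far (\<kappa> y) \<eta> * g y \<eta> * jj \<eta>)) <= C * indicator {y. h1 <= y $ k} y"
 shows "barrier (\<lambda>y. ph \<eta>0 (a y)) K x C h1 b0 (exp (-1) * \<eta>0)"
proof -
 let ?f = "\<lambda>y. ph \<eta>0 (a y)" and ?u = "\<lambda>y. if y \<in> H then ph \<eta>0 (a y) else 0"
 have fm: "?f \<in> hsmooth k" unfolding a_def by (intro hsm_ph hsm_diff h(1) hsm_shift_norm hsm_const)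
 have f0: "?f y = 0" if "y \<in> H - K" for y using pos[of y] that by (intro ph_nonpos \<eta>0) (auto simp: not_less[symmetric])
 have nn: "0 <= ?f y" for y by (rule ph_nonneg[OF \<eta>0])
 have u: "?u \<in> Cc_inf H" using f0 by (intro Cc_inf_hsmooth[OF fm K(1,2)]) auto
 obtain M1 where M1: "taylor2 M1 ?u" using Cc_inf_taylor2[OF u] by blast
 have val: "exp (-1) * \<eta>0 <= ?f x"
 proof -
  have "exp (-1) * \<eta>0 <= exp (- \<eta>0 / a x) * a x" using v \<eta>0 by (intro mult_mono) auto
  also have "... = ?f x" using v \<eta>0 by (simp add: ph_pos)
  finally show ?thesis .
 qed
 have "\<beta> * ?f y - Lop ?u y <= C * indicator (K \<inter> {y. h1 <= y $ k}) y" if y: "y \<in> H" and \<beta>: "0 < \<beta>" "\<beta> <= b0" for y \<beta>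
 proof (cases "0 < a y")
  case False
  then have z: "?f y = 0" by (intro ph_nonpos \<eta>0) simp
  have "0 <= Lop ?u y" by (rule barrier_zero[OF fm K(1,2) _ _ y z]) (use f0 nn in auto)
  then show ?thesis using z C by (auto simp: indicator_def intro: order_trans[of _ 0])
 next
  case a: True
  have yK: "y \<in> K" by (rule pos[OF y a])
  let ?T = "y $ k powr (- \<alpha>) / 2 * ((LI \<eta>. hl y \<eta> * jj \<eta>)
    - (32 * y $ k * norm (y - z) + 17 * (y $ k)^2) * (LI \<eta>. near_q (\<kappa> y) \<eta>)
    - 2 * (LI \<eta>. far (\<kappa> y) \<eta> * g y \<eta> * jj \<eta>))"
  have L: "gam \<eta>0 (a y) * ?T <= Lop ?u y"
   by (rule Lop_lower[where h=h and u="?u", OF h(2) \<eta>0 y a _ _ M1 Cc_inf_borel[OF u] conjunct1[OF \<kappa>[OF yK]] conjunct2[OF \<kappa>[OF yK]] hl(1)[OF yK] hl(2)[OF yK] g(1) g(2)[OF yK] g(3)[OF yK] g(4)[OF yK]])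
     (auto simp: a_def)
  note gb = gam_bounds[OF \<eta>0 a]
  have "\<beta> * ?f y <= b0 * (a y * gam \<eta>0 (a y))" using \<beta> gb nn by (intro mult_mono) auto
  then have "\<beta> * ?f y - Lop ?u y <= gam \<eta>0 (a y) * (b0 * a y - ?T)" using L by (simp add: right_diff_distrib mult_ac)
  also have "... <= gam \<eta>0 (a y) * (C * indicator {y. h1 <= y $ k} y)" using main[OF yK a] gb by (intro mult_left_mono) auto
  also have "... <= 1 * (C * indicator {y. h1 <= y $ k} y)" using C gb by (intro mult_right_mono) auto
  finally show ?thesis using yK by (simp add: indicator_def)
 qed
 then show ?thesis unfolding barrier_def using fm K f0 nn val by blast
qed

text \<open>With \<open>hA\<close> and centre 0 the generator at height t is, up to the factor
  \<open>gam\<close>, at least t^(-\<alpha>)/2 (c0 t^(\<alpha>/2) - M t). Since \<alpha>/2 < 1, the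
  first term wins below a height \<open>h1\<close> that does not depend on \<open>s\<close>; above
  \<open>h1\<close> the constant \<open>C\<close> absorbs the rest.\<close>

lemma barrier_boundary:
 "\<exists>C h1 b0. 0 <= C \<and> 0 < h1 \<and> h1 <= 1/2 \<and> 0 < b0 \<and> (\<forall>s. 0 < s \<and> s <= 1 --> (\<exists>f K. barrier f K (s *\<^sub>R e) C h1 b0 (exp (-1) * (s powr (\<alpha> - 1) / 2))))"
proof -
 obtain c0 \<rho> where c0: "0 < c0" "integrable lborel (\<lambda>\<eta>. \<rho> \<eta> * jj \<eta>)" "(LI \<eta>. \<rho> \<eta> * jj \<eta>) = c0"
   and \<rho>: "\<forall>y\<in>H. \<forall>\<eta>\<in>H. y $ k powr (\<alpha> / 2) * \<rho> \<eta> <= Dop hA y \<eta>" using hA_lower by blast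
 define C1 where "C1 = (LI \<eta>. near_q (1/2) \<eta>)"
 define C2 where "C2 = (LI \<eta>. far (1/2) \<eta> * norm (\<eta> - e) * jj \<eta>)"
 have C1: "0 <= C1" unfolding C1_def using jj_nonneg by (intro Bochner_Integration.integral_nonneg) auto
 have C2: "0 <= C2" unfolding C2_def using jj_nonneg by (intro Bochner_Integration.integral_nonneg) auto
 have C2i: "integrable lborel (\<lambda>\<eta>. far (1/2) \<eta> * norm (\<eta> - e) * jj \<eta>)"
  using far_int[of 1] alpha by (auto dest: spec[of _ "1/2"])
 \<comment> \<open>98 = 32 * 2 + 17 * 2, because heights and norms are at most 2 on the support; 12
   is twice the slope 6 of \<open>farA\<close>; the summand 1 makes \<open>M\<close>
   positive.\<close>
 define M where "M = 98 * C1 + 12 * C2 + 1"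
 have M: "0 < M" using C1 C2 by (simp add: M_def)
 define h1 where "h1 = min (1/2) ((c0 / (2 * M)) powr (1 / (1 - \<alpha> / 2)))"
 have h1: "0 < h1" "h1 <= 1/2" using c0 M by (auto simp: h1_def)
 have h1M: "M * s powr (1 - \<alpha> / 2) <= c0 / 2" if "0 < s" "s <= h1" for s
 proof -
  have "s powr (1 - \<alpha> / 2) <= ((c0 / (2 * M)) powr (1 / (1 - \<alpha> / 2))) powr (1 - \<alpha> / 2)"
   using that alpha by (intro powr_mono2) (auto simp: h1_def)
  also have "... = c0 / (2 * M)" using alpha c0 M by (simp add: powr_powr)
  finally show ?thesis using M by (simp add: field_simps)
 qed
 \<comment> \<open>Below \<open>h1\<close> the argument of \<open>ph\<close> is at most 2 while the
   generator bound is \<open>c0 / 4\<close>; at the remaining heights of the support the argument is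
   at most 4, which gives the term \<open>4 * b0\<close> in \<open>C\<close>.\<close>
 define b0 where "b0 = c0 / 8"
 define C where "C = 4 * b0 + M * h1 powr (1 - \<alpha>)"
 have b0: "0 < b0" using c0 by (simp add: b0_def)
 have C: "0 <= C" using b0 M by (simp add: C_def)
 have hAm: "hA \<in> hsmooth k" unfolding hA_def by (intro hsm_add hsm_powr)
 have "\<exists>f K. barrier f K (s *\<^sub>R e) C h1 b0 (exp (-1) * (s powr (\<alpha> - 1) / 2))" if s: "0 < s" "s <= 1" for s
 proof -
  \<comment> \<open>Half of the leading power at the starting point: since s^2 <= s^(\<alpha>/2),
    the argument of \<open>ph\<close> there is at least \<open>\<eta>0\<close>.\<close>
  define \<eta>0 where "\<eta>0 = s powr (\<alpha> - 1) / 2"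
  have \<eta>0: "0 < \<eta>0" "\<eta>0 <= 1/2" using s alpha powr_mono2[of "\<alpha> - 1" s 1] by (simp_all add: \<eta>0_def)
  \<comment> \<open>Below height \<open>c\<close> both powers in \<open>hA\<close> are at most
    \<open>\<eta>0 / 2\<close>, so the barrier vanishes there and has compact support in
    \<open>H\<close>.\<close>
  define c where "c = (\<eta>0 / 2) powr (1 / (\<alpha> - 1))"
  define K where "K = cball 0 2 \<inter> {y :: real^'n. c <= y $ k}"
  have c: "0 < c" "c <= 1" "2 * c powr (\<alpha> - 1) = \<eta>0"
   using \<eta>0 alpha powr_mono2[of "1 / (\<alpha> - 1)" "\<eta>0 / 2" 1] by (simp_all add: c_def powr_powr)
  have KD: "y \<in> H" "norm y <= 2" "0 < y $ k" "y $ k <= 2" if "y \<in> K" for y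
   using that c component_le_norm_cart[of y k] by (auto simp: K_def halfsp_def)
  have k1: "(s *\<^sub>R e :: real^'n) $ k = s" by (simp add: ek_def axis_def)
  have k2: "norm (s *\<^sub>R e :: real^'n) = s" using s by simp
  have "barrier (\<lambda>y. ph \<eta>0 (hA y - (norm (y - 0))^2 - \<eta>0)) K (s *\<^sub>R e) C h1 b0 (exp (-1) * \<eta>0)"
  proof (rule barrierI[OF hAm _ \<eta>0(1) _ _ _ _ _ C, where hl="\<lambda>y \<eta>. y $ k powr (\<alpha> / 2) * \<rho> \<eta>" and g="\<lambda>y \<eta>. 6 * y $ k * norm (\<eta> - e)" and \<kappa>="\<lambda>_. 1/2"])
   show "compact K" unfolding K_def by (intro compact_Int_closed compact_cball closed_Collect_le continuous_intros)
   show "K \<subseteq> cball (s *\<^sub>R e) 5"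
   proof
    fix y assume "y \<in> K"
    then show "y \<in> cball (s *\<^sub>R e) 5" using KD(2)[of y] norm_triangle_ineq4[of "s *\<^sub>R e" y] k2 s by (simp add: dist_norm)
   qed
   show "y \<in> K" if y: "y \<in> H" and p: "0 < hA y - (norm (y - 0))^2 - \<eta>0" for y
   proof -
    have yk: "y $ k <= norm y" "0 < y $ k" using component_le_norm_cart[of y k] y by (auto simp: halfsp_def)
    have "norm y <= 2"
    proof (rule ccontr)
     assume n: "\<not> norm y <= 2"
     have "y $ k powr (\<alpha> - 1) <= norm y" "y $ k powr (\<alpha> / 2) <= norm y"
      using yk n alpha by (intro powr_le_lin; simp)+
     then have "hA y <= 2 * norm y" by (simp add: hA_def)
     also have "... <= norm y * norm y" using n by (intro mult_right_mono) auto
     finally show False using p \<eta>0 by (simp add: power2_eq_square)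
    qed
    moreover have "c <= y $ k"
    proof (rule ccontr)
     assume yc: "\<not> c <= y $ k"
     have "y $ k powr (\<alpha> - 1) <= c powr (\<alpha> - 1)" "y $ k powr (\<alpha> / 2) <= c powr (\<alpha> / 2)" using yc yk alpha by (auto intro!: powr_mono2)
     moreover have "c powr (\<alpha> / 2) <= c powr (\<alpha> - 1)" using c alpha by (intro powr_mono') auto
     ultimately have "hA y <= \<eta>0" using c(3) unfolding hA_def by linarith
     then show False using p by (smt (verit) zero_le_power2)
    qed
    ultimately show ?thesis by (simp add: K_def)
   qed
   have "s powr 2 <= s powr (\<alpha> / 2)" using s alpha by (intro powr_mono') auto
   then show "\<eta>0 <= hA (s *\<^sub>R e) - (norm (s *\<^sub>R e - 0 :: real^'n))^2 - \<eta>0" unfolding hA_def diff_zero k1 k2 using s by (simp add: \<eta>0_def)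
   show "integrable lborel (\<lambda>\<eta>. y $ k powr (\<alpha> / 2) * \<rho> \<eta> * jj \<eta>)" for y
    using integrable_mult_right[OF c0(2), of "y $ k powr (\<alpha> / 2)"] by (simp add: mult.assoc)
   show "integrable lborel (\<lambda>\<eta>. far (1/2) \<eta> * (6 * y $ k * norm (\<eta> - e)) * jj \<eta>)" for y
    using integrable_mult_right[OF C2i, of "6 * y $ k"] by (simp add: mult.assoc mult.left_commute)
   show "min ((norm (y \<odot> \<eta> - 0))^2) (hA (y \<odot> \<eta>)) - (norm (y - 0))^2 <= 6 * y $ k * norm (\<eta> - e)" if "y \<in> K" "\<eta> \<in> farset (1/2)" for y \<eta>
    using farA[OF KD(1)[OF that(1)] _ KD(2)[OF that(1)], of \<eta>] that by simp
   fix y assume yK: "y \<in> K" and a: "0 < hA y - (norm (y - 0))^2 - \<eta>0"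
   define a t T where "a = hA y - (norm (y - 0))^2 - \<eta>0" and "t = y $ k"
    and "T = t powr (- \<alpha>) / 2 * (t powr (\<alpha> / 2) * c0 - (32 * t * norm y + 17 * t^2) * C1 - 2 * (6 * t * C2))"
   have t: "0 < t" "t <= 2" using KD[OF yK] by (auto simp: t_def)
   have a0: "0 < a" using a by (simp add: a_def)
   have aX: "a <= 2 * X" if "t powr (\<alpha> - 1) <= X" "t powr (\<alpha> / 2) <= X" for X
    using that \<eta>0 unfolding a_def hA_def t_def by (smt (verit) zero_le_power2)
   have "32 * t * norm y <= 32 * t * 2" "17 * t * t <= 17 * t * 2" using KD(2)[OF yK] t by (intro mult_left_mono; simp)+
   then have "(32 * t * norm y + 17 * t^2) * C1 <= (98 * t) * C1" by (intro mult_right_mono C1) (simp add: power2_eq_square)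
   then have "t powr (\<alpha> / 2) * c0 - M * t <= t powr (\<alpha> / 2) * c0 - (32 * t * norm y + 17 * t^2) * C1 - 2 * (6 * t * C2)"
    using t by (simp add: M_def algebra_simps)
   then have T: "t powr (- \<alpha>) / 2 * (t powr (\<alpha> / 2) * c0 - M * t) <= T" unfolding T_def by (intro mult_left_mono) auto
   have "b0 * a - T <= C * indicator {y. h1 <= y $ k} y"
   proof (cases "t < h1")
    case True
    have tt: "t = t powr (\<alpha> / 2) * t powr (1 - \<alpha> / 2)" using t by (simp add: powr_add[symmetric])
    have "M * t = t powr (\<alpha> / 2) * (M * t powr (1 - \<alpha> / 2))" by (subst tt) simp
    also have "... <= t powr (\<alpha> / 2) * (c0 / 2)" using h1M[of t] t True by (intro mult_left_mono) auto
    finally have "t powr (\<alpha> / 2) * (c0 / 2) <= t powr (\<alpha> / 2) * c0 - M * t" by (simp add: algebra_simps)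
    then have "t powr (- \<alpha>) / 2 * (t powr (\<alpha> / 2) * (c0 / 2)) <= t powr (- \<alpha>) / 2 * (t powr (\<alpha> / 2) * c0 - M * t)" by (intro mult_left_mono) auto
    moreover have "t powr (- \<alpha>) / 2 * (t powr (\<alpha> / 2) * (c0 / 2)) = t powr (- (\<alpha> / 2)) * (c0 / 4)"
     by (simp add: powr_add[symmetric])
    moreover have "1 * (c0 / 4) <= t powr (- (\<alpha> / 2)) * (c0 / 4)"
     using powr_mono2'[of "- (\<alpha> / 2)" t 1] t True h1 alpha c0 by (intro mult_right_mono) auto
    moreover have "t powr (\<alpha> - 1) <= 1" "t powr (\<alpha> / 2) <= 1" using t True h1 alpha by (intro powr_le_one_le powr_le1; simp)+
    then have "b0 * a <= b0 * 2" using aX[of 1] b0 by (intro mult_left_mono) auto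
    ultimately have "b0 * a - T <= 0" using T unfolding b0_def by linarith
    then show ?thesis using C by (auto simp: indicator_def intro: order_trans[of _ 0])
   next
    case False
    have "t powr (\<alpha> - 1) <= 2" "t powr (\<alpha> / 2) <= 2" using t alpha by (intro powr_le_lin; simp)+
    then have "b0 * a <= b0 * 4" using aX[of 2] b0 by (intro mult_left_mono) auto
    moreover have "- (M * t powr (1 - \<alpha>) / 2) <= T"
    proof -
     have "t powr (- \<alpha>) / 2 * (- (M * t)) <= T" using c0 by (intro order_trans[OF mult_left_mono T]) auto
     moreover have "t powr (1 - \<alpha>) = t powr (- \<alpha>) * t" using t powr_add[of t "- \<alpha>" 1] by simp
     ultimately show ?thesis by (simp add: mult_ac)
    qed
    moreover have "M * t powr (1 - \<alpha>) <= M * h1 powr (1 - \<alpha>)" using M False h1 alpha by (intro mult_left_mono powr_mono2') auto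
    moreover have "0 <= M * t powr (1 - \<alpha>)" using M by simp
    ultimately have "b0 * a - T <= C" unfolding C_def by linarith
    then show ?thesis using False by (simp add: t_def)
   qed
   moreover have "(LI \<eta>. (y $ k powr (\<alpha> / 2) * \<rho> \<eta>) * jj \<eta>) = t powr (\<alpha> / 2) * c0"
    using c0(3) by (simp add: t_def mult.assoc)
   moreover have "(LI \<eta>. far (1/2) \<eta> * (6 * y $ k * norm (\<eta> - e)) * jj \<eta>) = 6 * t * C2"
    unfolding C2_def integral_mult_right_zero[symmetric] by (intro Bochner_Integration.integral_cong) (auto simp: t_def)
   ultimately show "b0 * (hA y - (norm (y - 0))^2 - \<eta>0) - y $ k powr (- \<alpha>) / 2 * ((LI \<eta>. y $ k powr (\<alpha> / 2) * \<rho> \<eta> * jj \<eta>)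
    - (32 * y $ k * norm (y - 0) + 17 * (y $ k)^2) * (LI \<eta>. near_q (1/2) \<eta>)
    - 2 * (LI \<eta>. far (1/2) \<eta> * (6 * y $ k * norm (\<eta> - e)) * jj \<eta>)) <= C * indicator {y. h1 <= y $ k} y"
    by (simp add: T_def a_def t_def C1_def)
  qed (use \<rho> KD in \<open>auto simp: hA_def less_imp_le\<close>)
  then show ?thesis unfolding \<eta>0_def by blast
 qed
 then have *: "\<forall>s. 0 < s \<and> s <= 1 --> (\<exists>f K. barrier f K (s *\<^sub>R e) C h1 b0 (exp (-1) * (s powr (\<alpha> - 1) / 2)))" by simp
 show ?thesis by (intro exI[of _ C] exI[of _ h1] exI[of _ b0] conjI C h1 b0 *)
qed

end

text \<open>The class \<open>hsmooth\<close> is syntactic, so composition needs its own induction.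
  Equality is claimed on the half-space alone, where the substituted heights and their powers have
  expressions in the class.\<close>

lemma hsm_subst:
 fixes T :: "real^'n::finite => real^'n"
 assumes f: "f \<in> hsmooth k" and T: "\<And>i. \<exists>g\<in>hsmooth k. \<forall>y\<in>halfsp k. g y = T y $ i"
  and Tk: "\<And>q. \<exists>g\<in>hsmooth k. \<forall>y\<in>halfsp k. g y = T y $ k powr q"
 shows "\<exists>f'\<in>hsmooth k. \<forall>y\<in>halfsp k. f' y = f (T y)"
 using f
proof induction
 case (hsm_const c)
 show ?case by (intro bexI[of _ "\<lambda>_. c"]) (auto intro: hsmooth.intros)
next
 case (hsm_coord i)
 show ?case by (rule T)
next
 case (hsm_powr q)
 show ?case by (rule Tk)
next
 case (hsm_add f g)
 then obtain f' g' where "f' \<in> hsmooth k" "g' \<in> hsmooth k" "\<forall>y\<in>halfsp k. f' y = f (T y)" "\<forall>y\<in>halfsp k. g' y = g (T y)" by auto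
 then show ?case by (intro bexI[of _ "\<lambda>y. f' y + g' y"] hsmooth.hsm_add) auto
next
 case (hsm_mult f g)
 then obtain f' g' where "f' \<in> hsmooth k" "g' \<in> hsmooth k" "\<forall>y\<in>halfsp k. f' y = f (T y)" "\<forall>y\<in>halfsp k. g' y = g (T y)" by auto
 then show ?case by (intro bexI[of _ "\<lambda>y. f' y * g' y"] hsmooth.hsm_mult) auto
next
 case (hsm_gexp f n)
 then obtain f' where "f' \<in> hsmooth k" "\<forall>y\<in>halfsp k. f' y = f (T y)" by auto
 then show ?case by (intro bexI[of _ "\<lambda>y. gexp n (f' y)"] hsmooth.hsm_gexp) auto
qed

context bkernel begin

text \<open>Away from the boundary a truncated parabola about \<open>x\<close> suffices, with
  constant \<open>h\<close>, whose symmetrised difference is 0. At height t the near set has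
  \<kappa> = 1/(4t), so near and far are separated by jumps of Euclidean size of order 1, and all
  powers of t cancel uniformly in \<open>s\<close>.\<close>

lemma barrier_interior:
 "\<exists>C. 0 <= C \<and> (\<forall>s\<ge>1. \<exists>f K. barrier f K (s *\<^sub>R e) C (1/2) 1 (exp (-1) * (1/8)))"
proof -
 obtain Cn where Cn: "0 <= Cn" "\<forall>\<kappa>. 0 < \<kappa> \<and> \<kappa> <= 1/2 -->
   integrable lborel (near_q \<kappa>) \<and>
   (LI \<eta>. near_q \<kappa> \<eta>) <= Cn * \<kappa> powr (2 - \<alpha>)" using near_int by blast
 obtain Cf where Cf: "0 <= Cf" "\<forall>\<kappa>. 0 < \<kappa> \<and> \<kappa> <= 1/2 -->
   integrable lborel (\<lambda>\<eta>. far \<kappa> \<eta> * jj \<eta>) \<and>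
   (LI \<eta>. far \<kappa> \<eta> * jj \<eta>) <= Cf * \<kappa> powr (- \<alpha>)" using far_int0 by blast
 define C where "C = 1 + (49 * Cn + 8 * Cf)"
 have C: "0 <= C" using Cn Cf by (simp add: C_def)
 have "\<exists>f K. barrier f K (s *\<^sub>R e) C (1/2) 1 (exp (-1) * (1/8))" if s: "1 <= s" for s
 proof -
  define x where "x = s *\<^sub>R e"
  have xk: "x $ k = s" by (simp add: x_def ek_def axis_def)
  define K where "K = cball x (1/2)"
  have KD: "1/2 <= y $ k" "norm (y - x) <= 1/2" "y \<in> H" if "y \<in> K" for y
  proof -
   show n: "norm (y - x) <= 1/2" using that by (simp add: K_def dist_norm norm_minus_commute)
   have "\<bar>(y - x) $ k\<bar> <= norm (y - x)" by (rule component_le_norm_cart)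
   then show "1/2 <= y $ k" "y \<in> H" using n xk s by (auto simp: halfsp_def)
  qed
  define \<kappa> where "\<kappa> y = 1 / (4 * y $ k)" for y :: "real^'n"
  have \<kappa>: "0 < \<kappa> y" "\<kappa> y <= 1/2" if "y \<in> K" for y using KD(1)[OF that] by (auto simp: \<kappa>_def field_simps)
  have "barrier (\<lambda>y. ph (1/8) (1/4 - (norm (y - x))^2 - 1/8)) K x C (1/2) 1 (exp (-1) * (1/8))"
  proof (rule barrierI[OF hsm_const, where hl="\<lambda>y \<eta>. 0" and g="\<lambda>y \<eta>. 1/4" and \<kappa>=\<kappa>])
   show "K \<subseteq> cball x 5" unfolding K_def by (rule subset_cball) simp
   show "y \<in> K" if "0 < 1/4 - (norm (y - x))^2 - 1/8" for y
   proof -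
    have "(norm (y - x))^2 <= (1/2)^2" using that by (simp add: power2_eq_square)
    then have "norm (y - x) <= 1/2" by (rule power2_le_imp_le) simp
    then show ?thesis by (simp add: K_def dist_norm norm_minus_commute)
   qed
   show "integrable lborel (\<lambda>\<eta>. far (\<kappa> y) \<eta> * (1/4) * jj \<eta>)" if "y \<in> K" for y
    using Cf(2) \<kappa>[OF that] integrable_mult_right[of "1/4" lborel "\<lambda>\<eta>. far (\<kappa> y) \<eta> * jj \<eta>"] by (simp add: mult.left_commute)
   show "min ((norm (y \<odot> \<eta> - x))^2) (1/4) - (norm (y - x))^2 <= 1/4" for y \<eta>
    using min.cobounded2[of "(norm (y \<odot> \<eta> - x))^2" "1/4"] zero_le_power2[of "norm (y - x)"] by linarith
   fix y assume yK: "y \<in> K"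
   define t N Fa where "t = y $ k" and "N = (LI \<eta>. near_q (\<kappa> y) \<eta>)"
    and "Fa = (LI \<eta>. far (\<kappa> y) \<eta> * jj \<eta>)"
   note ny = KD(2)[OF yK]
   have t: "1/2 <= t" using KD(1)[OF yK] by (simp add: t_def)
   have N: "0 <= N" "N <= Cn * \<kappa> y powr (2 - \<alpha>)" and Fa: "Fa <= Cf * \<kappa> y powr (- \<alpha>)"
    using Cn(2) Cf(2) \<kappa>[OF yK] jj_nonneg unfolding N_def Fa_def by (auto intro!: Bochner_Integration.integral_nonneg)
   have bN: "(32 * t * norm (y - x) + 17 * t^2) * N <= (49 * t^2) * (Cn * (1 / t powr (2 - \<alpha>)))"
   proof (rule mult_mono)
    have "32 * t * norm (y - x) <= 32 * t * (1/2)" using ny t by (intro mult_left_mono) auto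
    also have "... <= 32 * t * t" using t by (intro mult_left_mono) auto
    finally show "32 * t * norm (y - x) + 17 * t^2 <= 49 * t^2" by (simp add: power2_eq_square)
    have "\<kappa> y powr (2 - \<alpha>) <= (1 / t) powr (2 - \<alpha>)" using t alpha by (intro powr_mono2) (auto simp: \<kappa>_def t_def field_simps)
    also have "... = 1 / t powr (2 - \<alpha>)" using t by (simp add: powr_divide)
    finally show "N <= Cn * (1 / t powr (2 - \<alpha>))" using N(2) Cn(1) by (meson mult_left_mono order_trans)
   qed (use N in auto)
   have bF: "Fa <= 16 * Cf * t powr \<alpha>"
   proof -
    have "\<kappa> y powr (- \<alpha>) = 4 powr \<alpha> * t powr \<alpha>" using t by (simp add: \<kappa>_def t_def powr_minus powr_divide powr_mult)
    also have "... <= 4 powr 2 * t powr \<alpha>" using alpha by (intro mult_right_mono powr_mono) auto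
    finally have "Cf * \<kappa> y powr (- \<alpha>) <= Cf * (16 * t powr \<alpha>)" using Cf(1) by (intro mult_left_mono) auto
    then show ?thesis using Fa by simp
   qed
   have m1: "t powr (- \<alpha>) * (t^2 * (1 / t powr (2 - \<alpha>))) = 1"
   proof -
    have "t powr (- \<alpha>) * (t powr 2 * t powr (- (2 - \<alpha>))) = t powr (- \<alpha> + (2 + - (2 - \<alpha>)))" by (simp only: powr_add)
    also have "... = 1" using t by simp
    also have "t powr 2 = t^2" using t by simp
    also have "t powr (- (2 - \<alpha>)) = 1 / t powr (2 - \<alpha>)" by (rule powr_minus_divide)
    finally show ?thesis .
   qed
   have m2: "t powr (- \<alpha>) * t powr \<alpha> = 1" using t by (simp add: powr_add[symmetric])
   have "t powr (- \<alpha>) / 2 * ((32 * t * norm (y - x) + 17 * t^2) * N + Fa / 2) <= t powr (- \<alpha>) / 2 * ((49 * t^2) * (Cn * (1 / t powr (2 - \<alpha>))) + 16 * Cf * t powr \<alpha> / 2)"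
    using bN bF by (intro mult_left_mono) auto
   also have "... = 49 * Cn / 2 * (t powr (- \<alpha>) * (t^2 * (1 / t powr (2 - \<alpha>)))) + 4 * Cf * (t powr (- \<alpha>) * t powr \<alpha>)"
    by (simp add: distrib_left)
   also have "... = 49 * Cn / 2 + 4 * Cf" unfolding m1 m2 by simp
   finally have X: "t powr (- \<alpha>) / 2 * ((32 * t * norm (y - x) + 17 * t^2) * N + Fa / 2) <= 49 * Cn / 2 + 4 * Cf" .
   have "(LI \<eta>. far (\<kappa> y) \<eta> * (1/4) * jj \<eta>) = 1/4 * Fa"
    unfolding Fa_def integral_mult_right_zero[symmetric] by (intro Bochner_Integration.integral_cong) auto
   then have E: "y $ k powr (- \<alpha>) / 2 * ((LI (\<eta> :: real^'n). 0 * jj \<eta>) - (32 * y $ k * norm (y - x) + 17 * (y $ k)^2) * (LI \<eta>. near_q (\<kappa> y) \<eta>)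
    - 2 * (LI \<eta>. far (\<kappa> y) \<eta> * (1/4) * jj \<eta>)) = - (t powr (- \<alpha>) / 2 * ((32 * t * norm (y - x) + 17 * t^2) * N + Fa / 2))"
    unfolding N_def[symmetric] t_def[symmetric] by (simp add: algebra_simps)
   have "1/4 - (norm (y - x))^2 - 1/8 <= 1" using zero_le_power2[of "norm (y - x)"] by linarith
   with X show "1 * (1/4 - (norm (y - x))^2 - 1/8) - y $ k powr (- \<alpha>) / 2 * ((LI (\<eta> :: real^'n). 0 * jj \<eta>) - (32 * y $ k * norm (y - x) + 17 * (y $ k)^2) * (LI \<eta>. near_q (\<kappa> y) \<eta>)
    - 2 * (LI \<eta>. far (\<kappa> y) \<eta> * (1/4) * jj \<eta>)) <= C * indicator {y. 1/2 <= y $ k} y" unfolding E using KD(1)[OF yK] Cn(1) Cf(1) by (simp add: C_def)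
  qed (use \<kappa> C KD in \<open>auto simp: K_def Dop_def\<close>)
  then show ?thesis unfolding x_def by blast
 qed
 then show ?thesis using C by blast
qed

lemma barrier_mono:
 assumes "barrier f K x C h1 b0 v" "C <= C'" "0 <= C'" "h1' <= h1" "b0' <= b0" "v' <= v"
 shows "barrier f K x C' h1' b0' v'"
proof -
 have "C * indicator (K \<inter> {y. h1 <= y $ k}) y <= C' * indicator (K \<inter> {y. h1' <= y $ k}) y" for y
  using assms by (auto simp: indicator_def)
 then show ?thesis using assms unfolding barrier_def by (meson order_trans)
qed

lemma barrier_ex:
 "\<exists>C h1 b0 c1. 0 < C \<and> 0 < h1 \<and> h1 <= 1/2 \<and> 0 < b0 \<and> 0 < c1 \<and>
   (\<forall>s>0. \<exists>f K. barrier f K (s *\<^sub>R e) C h1 b0 (c1 * (min s 1) powr (\<alpha> - 1)))"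
proof -
 obtain C h1 b0 where A: "0 <= C" "0 < h1" "h1 <= 1/2" "0 < b0"
  "\<forall>s. 0 < s \<and> s <= 1 --> (\<exists>f K. barrier f K (s *\<^sub>R e) C h1 b0 (exp (-1) * (s powr (\<alpha> - 1) / 2)))" using barrier_boundary by blast
 obtain C' where B: "0 <= C'" "\<forall>s\<ge>1. \<exists>f K. barrier f K (s *\<^sub>R e) C' (1/2) 1 (exp (-1) * (1/8))" using barrier_interior by blast
 define C2 b2 c1 where "C2 = max C C' + 1" and "b2 = min b0 1" and "c1 = exp (-1) / (8 :: real)"
 have "\<exists>f K. barrier f K (s *\<^sub>R e) C2 h1 b2 (c1 * (min s 1) powr (\<alpha> - 1))" if s: "0 < s" for s
 proof (cases "s <= 1")
  case True
  then obtain f K where "barrier f K (s *\<^sub>R e) C h1 b0 (exp (-1) * (s powr (\<alpha> - 1) / 2))" using A(5) s by blast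
  then have "barrier f K (s *\<^sub>R e) C2 h1 b2 (c1 * (min s 1) powr (\<alpha> - 1))"
   by (rule barrier_mono) (use True A B in \<open>auto simp: C2_def b2_def c1_def min_absorb1\<close>)
  then show ?thesis by blast
 next
  case False
  then obtain f K where "barrier f K (s *\<^sub>R e) C' (1/2) 1 (exp (-1) * (1/8))" using B(2) by force
  then have "barrier f K (s *\<^sub>R e) C2 h1 b2 (c1 * (min s 1) powr (\<alpha> - 1))"
   by (rule barrier_mono) (use False A B in \<open>auto simp: C2_def b2_def c1_def min_absorb2\<close>)
  then show ?thesis by blast
 qed
 moreover have "0 < C2" "0 < b2" "0 < c1" using A B by (auto simp: C2_def b2_def c1_def)
 ultimately show ?thesis using A(2,3) by (intro exI[of _ C2] exI[of _ h1] exI[of _ b2] exI[of _ c1] conjI) auto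
qed

lemma gmul_halfsp_iff2: "\<gamma> \<in> H ==> \<gamma> \<odot> y \<in> H \<longleftrightarrow> y \<in> H"
 by (simp add: halfsp_def zero_less_mult_iff)

text \<open>\<open>Dop\<close> moves its point by multiplication on the right, which commutes with
  multiplication by \<open>\<gamma>\<close> on the left; only the power of the height
  rescales.\<close>

lemma Lop_gmul:
 assumes \<gamma>: "\<gamma> \<in> H" and y: "y \<in> H"
 shows "Lop (\<lambda>y. v (\<gamma> \<odot> y)) y = \<gamma> $ k powr \<alpha> * Lop v (\<gamma> \<odot> y)"
proof -
 have p: "0 < \<gamma> $ k" "0 < y $ k" using assms by (auto simp: halfsp_def)
 have "Dop (\<lambda>y. v (\<gamma> \<odot> y)) y \<eta> = Dop v (\<gamma> \<odot> y) \<eta>" for \<eta>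
  unfolding Dop_def by (simp add: gmul_assoc)
 moreover have "\<gamma> $ k powr \<alpha> * (\<gamma> \<odot> y) $ k powr (- \<alpha>) = y $ k powr (- \<alpha>)"
  using p by (simp add: gmul_nth powr_mult powr_minus)
 ultimately show ?thesis unfolding Lop_def by (simp add: mult.assoc[symmetric])
qed

lemma gmul_preimage:
 assumes \<gamma>: "\<gamma> \<in> H"
 shows "{y. \<gamma> \<odot> y \<in> K} = (\<lambda>y. ginv k \<gamma> \<odot> y) ` K"
proof (intro equalityI subsetI)
 fix y assume "y \<in> {y. \<gamma> \<odot> y \<in> K}"
 then show "y \<in> (\<lambda>y. ginv k \<gamma> \<odot> y) ` K"
  by (intro image_eqI[of _ _ "\<gamma> \<odot> y"]) (simp_all add: gmul_ginv_cancel[OF \<gamma>])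
qed (auto simp: gmul_ginv_cancel2[OF \<gamma>])

lemma Cc_inf_gmul:
 assumes f: "f \<in> hsmooth k" and K: "compact K" "K \<subseteq> H" and z: "\<And>y. y \<in> H - K ==> f y = 0" and \<gamma>: "\<gamma> \<in> H"
 shows "(\<lambda>y. if y \<in> H then f (\<gamma> \<odot> y) else 0) \<in> Cc_inf H" "compact {y. \<gamma> \<odot> y \<in> K}" "{y. \<gamma> \<odot> y \<in> K} \<subseteq> H"
proof -
 show K1: "compact {y. \<gamma> \<odot> y \<in> K}" unfolding gmul_preimage[OF \<gamma>] unfolding gmul_eq
  by (intro compact_continuous_image K continuous_intros)
 show K2: "{y. \<gamma> \<odot> y \<in> K} \<subseteq> H" using K(2) gmul_halfsp_iff2[OF \<gamma>] by auto
 have "\<exists>f'\<in>hsmooth k. \<forall>y\<in>H. f' y = f (\<gamma> \<odot> y)"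
 proof (rule hsm_subst[OF f])
  fix i
  have "(\<lambda>y. \<gamma> $ i + \<gamma> $ k * (y $ i - e $ i)) \<in> hsmooth k" by (intro hsm_add hsm_cmult hsm_diff hsm_const hsm_coord)
  then show "\<exists>g\<in>hsmooth k. \<forall>y\<in>H. g y = (\<gamma> \<odot> y) $ i" by (rule bexI[rotated]) (auto simp: gmul_eq)
  fix q
  have "(\<lambda>y. \<gamma> $ k powr q * y $ k powr q) \<in> hsmooth k" by (intro hsm_cmult hsm_powr)
  then show "\<exists>g\<in>hsmooth k. \<forall>y\<in>H. g y = (\<gamma> \<odot> y) $ k powr q"
   by (rule bexI[rotated]) (use \<gamma> in \<open>auto simp: gmul_nth powr_mult halfsp_def\<close>)
 qed
 then obtain f' where f': "f' \<in> hsmooth k" "\<forall>y\<in>H. f' y = f (\<gamma> \<odot> y)" by blast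
 have "(\<lambda>y. if y \<in> H then f' y else 0) \<in> Cc_inf H"
  by (rule Cc_inf_hsmooth[OF f'(1) K1 K2]) (use f'(2) z gmul_halfsp[OF \<gamma>] in auto)
 moreover have "(\<lambda>y. if y \<in> H then f' y else 0) = (\<lambda>y. if y \<in> H then f (\<gamma> \<odot> y) else 0)" using f'(2) by auto
 ultimately show "(\<lambda>y. if y \<in> H then f (\<gamma> \<odot> y) else 0) \<in> Cc_inf H" by simp
qed

lemma gmul_dist: "norm (\<gamma> \<odot> y - \<gamma> \<odot> x) = \<bar>\<gamma> $ k\<bar> * norm (y - x)"
proof -
 have "\<gamma> \<odot> y - \<gamma> \<odot> x = \<gamma> $ k *\<^sub>R (y - x)" by (simp add: gmul_eq algebra_simps)
 then show ?thesis by simp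
qed

text \<open>The group element \<open>\<gamma>\<close> taking \<open>x\<close> to
  \<open>s *\<^sub>R e\<close> with s = x_k/\<delta> divides lengths by \<delta>. Composing with it
  transports the barrier from unit scale to scale \<delta>, and the generator acquires the factor
  \<delta>^(-\<alpha>).\<close>

lemma barrier_scaled:
 "\<exists>C h1 b0 c1. 0 < C \<and> 0 < h1 \<and> h1 <= 1/2 \<and> 0 < b0 \<and> 0 < c1 \<and> (\<forall>\<delta>>0. \<forall>x\<in>H. \<exists>u K.
   u \<in> Cc_inf H \<and> (\<forall>y. 0 <= u y) \<and> compact K \<and> K \<subseteq> H \<inter> cball x (5 * \<delta>) \<and> (\<forall>y. y \<notin> K --> u y = 0)
   \<and> c1 * (min (x $ k / \<delta>) 1) powr (\<alpha> - 1) <= u x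
   \<and> (\<forall>y\<in>H. \<forall>\<beta>. 0 < \<beta> \<and> \<beta> <= b0 * \<delta> powr (- \<alpha>) -->
     \<beta> * u y - Lop u y <= \<delta> powr (- \<alpha>) * C * indicator (K \<inter> {y. h1 * \<delta> <= y $ k}) y))"
proof -
 obtain C h1 b0 c1 where A: "0 < C" "0 < h1" "h1 <= 1/2" "0 < b0" "0 < c1"
   "\<forall>s>0. \<exists>f K. barrier f K (s *\<^sub>R e) C h1 b0 (c1 * (min s 1) powr (\<alpha> - 1))" using barrier_ex by blast
 have main: "\<exists>u K. u \<in> Cc_inf H \<and> (\<forall>y. 0 <= u y) \<and> compact K \<and> K \<subseteq> H \<inter> cball x (5 * \<delta>) \<and> (\<forall>y. y \<notin> K --> u y = 0)
   \<and> c1 * (min (x $ k / \<delta>) 1) powr (\<alpha> - 1) <= u x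
   \<and> (\<forall>y\<in>H. \<forall>\<beta>. 0 < \<beta> \<and> \<beta> <= b0 * \<delta> powr (- \<alpha>) -->
     \<beta> * u y - Lop u y <= \<delta> powr (- \<alpha>) * C * indicator (K \<inter> {y. h1 * \<delta> <= y $ k}) y)"
  if \<delta>: "0 < \<delta>" and x: "x \<in> H" for \<delta> x
 proof -
  define s where "s = x $ k / \<delta>"
  have xk: "0 < x $ k" using x by (simp add: halfsp_def)
  have s: "0 < s" using \<delta> xk by (simp add: s_def)
  obtain f K where "barrier f K (s *\<^sub>R e) C h1 b0 (c1 * (min s 1) powr (\<alpha> - 1))" using A(6) s by blast
  then have f: "f \<in> hsmooth k" "compact K" "K \<subseteq> H" "K \<subseteq> cball (s *\<^sub>R e) 5" and f0: "\<forall>y\<in>H - K. f y = 0" and nn: "\<forall>y. 0 <= f y"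
   and val: "c1 * (min s 1) powr (\<alpha> - 1) <= f (s *\<^sub>R e)"
   and L: "\<forall>y\<in>H. \<forall>\<beta>. 0 < \<beta> \<and> \<beta> <= b0 --> \<beta> * f y - Lop (\<lambda>y. if y \<in> H then f y else 0) y <= C * indicator (K \<inter> {y. h1 <= y $ k}) y"
   unfolding barrier_def by blast+
  have seH: "s *\<^sub>R e \<in> H" using s by (simp add: halfsp_def ek_def axis_def)
  define \<gamma> where "\<gamma> = (s *\<^sub>R e) \<odot> ginv k x"
  have \<gamma>H: "\<gamma> \<in> H" unfolding \<gamma>_def by (intro gmul_halfsp seH ginv_halfsp x)
  have \<gamma>k: "\<gamma> $ k = 1 / \<delta>"
  proof -
   have "\<gamma> $ k = s * (1 / x $ k)" using xk unfolding \<gamma>_def by (simp add: ek_def axis_def)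
   then show ?thesis using xk by (simp add: s_def)
  qed
  have \<gamma>x: "\<gamma> \<odot> x = s *\<^sub>R e" unfolding \<gamma>_def using x seH ginv_halfsp[OF x] by (simp add: gmul_assoc ginv_gmul gmul_ek)
  define K' where "K' = {y. \<gamma> \<odot> y \<in> K}"
  define u where "u = (\<lambda>y. if y \<in> H then f (\<gamma> \<odot> y) else 0)"
  note cg = Cc_inf_gmul[OF f(1-3) _ \<gamma>H, folded u_def K'_def]
  have u: "u \<in> Cc_inf H" and K': "compact K'" "K' \<subseteq> H" using cg f0 by blast+
  have u0: "u y = 0" if "y \<notin> K'" for y using that f0 gmul_halfsp[OF \<gamma>H] by (auto simp: u_def K'_def)
  have K5: "K' \<subseteq> cball x (5 * \<delta>)"
  proof
   fix y assume "y \<in> K'"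
   then have "norm (\<gamma> \<odot> y - \<gamma> \<odot> x) <= 5" using f(4) unfolding \<gamma>x K'_def by (auto simp: dist_norm norm_minus_commute)
   then have "norm (y - x) / \<delta> <= 5" using \<delta> by (simp add: gmul_dist \<gamma>k)
   then show "y \<in> cball x (5 * \<delta>)" using \<delta> by (simp add: dist_norm norm_minus_commute field_simps)
  qed
  let ?v = "\<lambda>y. if y \<in> H then f y else 0"
  have uv: "u = (\<lambda>y. ?v (\<gamma> \<odot> y))" unfolding u_def using gmul_halfsp_iff2[OF \<gamma>H] by auto
  have L': "\<beta> * u y - Lop u y <= \<delta> powr (- \<alpha>) * C * indicator (K' \<inter> {y. h1 * \<delta> <= y $ k}) y" if y: "y \<in> H" and \<beta>: "0 < \<beta>" "\<beta> <= b0 * \<delta> powr (- \<alpha>)" for y \<beta>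
  proof -
   have gy: "\<gamma> \<odot> y \<in> H" by (rule gmul_halfsp[OF \<gamma>H y])
   have pd: "(1 / \<delta>) powr \<alpha> = \<delta> powr (- \<alpha>)" using \<delta> by (simp add: powr_divide powr_minus_divide)
   have dd: "\<delta> powr (- \<alpha>) * \<delta> powr \<alpha> = 1" using \<delta> by (simp add: powr_add[symmetric])
   have "\<beta> * \<delta> powr \<alpha> <= (b0 * \<delta> powr (- \<alpha>)) * \<delta> powr \<alpha>" using \<beta> by (intro mult_right_mono) auto
   then have b1: "\<beta> * \<delta> powr \<alpha> <= b0" using dd by (simp add: mult.assoc)
   have b2: "0 < \<beta> * \<delta> powr \<alpha>" using \<beta> \<delta> by simp
   have "Lop u y = Lop (\<lambda>y. ?v (\<gamma> \<odot> y)) y" using uv by (rule arg_cong[where f="\<lambda>u. Lop u y"])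
   also have "... = \<gamma> $ k powr \<alpha> * Lop ?v (\<gamma> \<odot> y)" by (rule Lop_gmul[OF \<gamma>H y, of ?v])
   finally have "Lop u y = \<delta> powr (- \<alpha>) * Lop ?v (\<gamma> \<odot> y)" unfolding \<gamma>k pd .
   then have "\<beta> * u y - Lop u y = \<beta> * f (\<gamma> \<odot> y) - \<delta> powr (- \<alpha>) * Lop ?v (\<gamma> \<odot> y)" using y by (simp add: u_def)
   also have "\<beta> * f (\<gamma> \<odot> y) = (\<delta> powr (- \<alpha>) * \<delta> powr \<alpha>) * (\<beta> * f (\<gamma> \<odot> y))" unfolding dd by simp
   also have "(\<delta> powr (- \<alpha>) * \<delta> powr \<alpha>) * (\<beta> * f (\<gamma> \<odot> y)) - \<delta> powr (- \<alpha>) * Lop ?v (\<gamma> \<odot> y)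
     = \<delta> powr (- \<alpha>) * ((\<beta> * \<delta> powr \<alpha>) * f (\<gamma> \<odot> y) - Lop ?v (\<gamma> \<odot> y))" by (simp add: algebra_simps)
   also have "... <= \<delta> powr (- \<alpha>) * (C * indicator (K \<inter> {y. h1 <= y $ k}) (\<gamma> \<odot> y))"
    using L[rule_format, OF gy conjI[OF b2 b1]] by (intro mult_left_mono) auto
   also have "indicator (K \<inter> {y. h1 <= y $ k}) (\<gamma> \<odot> y) = indicator (K' \<inter> {y. h1 * \<delta> <= y $ k}) y"
    using \<delta> by (simp add: indicator_def K'_def gmul_nth \<gamma>k field_simps)
   finally show ?thesis by (simp add: mult.assoc)
  qed
  have "c1 * (min (x $ k / \<delta>) 1) powr (\<alpha> - 1) <= u x" using val x unfolding u_def \<gamma>x s_def by simp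
  moreover have "0 <= u y" for y using nn by (simp add: u_def)
  ultimately show ?thesis using u K' K5 u0 L' by (intro exI[of _ u] exI[of _ K'] conjI) auto
 qed
 show ?thesis
  by (rule exI[of _ C], rule exI[of _ h1], rule exI[of _ b0], rule exI[of _ c1], intro conjI A(1-5) allI impI ballI main)
qed

end

context bproc begin

text \<open>Dynkin's formula writes the barrier at \<open>x\<close> as the occupation integral of
  \<beta> u - L u, which is positive at most on the high part of \<open>K\<close>. Uniformity in
  \<open>D\<close> and \<beta> is essential: at one end the path will be killed on leaving
  \<open>K\<close> itself, at the other on leaving a large set and with vanishing discount.\<close>

lemma occ_lower:
 "\<exists>C h1 b0. 0 < C \<and> 0 < h1 \<and> h1 <= 1/2 \<and> 0 < b0 \<and> (\<forall>\<delta>>0. \<forall>x\<in>H. \<exists>K.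
   compact K \<and> K \<subseteq> H \<inter> cball x (5 * \<delta>) \<and> (\<forall>\<beta> D. 0 < \<beta> \<and> \<beta> <= b0 * \<delta> powr (- \<alpha>) \<and> closed D \<and> K \<subseteq> D -->
    C * \<delta> powr \<alpha> * (min (x $ k / \<delta>) 1) powr (\<alpha> - 1) <= measure (occ \<beta> (exitH D) x) (K \<inter> {y. h1 * \<delta> <= y $ k})))"
proof -
 let ?m = "\<lambda>x \<delta>. (min (x $ k / \<delta>) 1) powr (\<alpha> - 1)"
 obtain C h1 b0 c1 where A: "0 < C" "0 < h1" "h1 <= 1/2" "0 < b0" "0 < c1" and
  B: "\<forall>\<delta>>0. \<forall>x\<in>H. \<exists>u K.
   u \<in> Cc_inf H \<and> (\<forall>y. 0 <= u y) \<and> compact K \<and> K \<subseteq> H \<inter> cball x (5 * \<delta>) \<and> (\<forall>y. y \<notin> K --> u y = 0)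
   \<and> c1 * ?m x \<delta> <= u x
   \<and> (\<forall>y\<in>H. \<forall>\<beta>. 0 < \<beta> \<and> \<beta> <= b0 * \<delta> powr (- \<alpha>) -->
     \<beta> * u y - Lop u y <= \<delta> powr (- \<alpha>) * C * indicator (K \<inter> {y. h1 * \<delta> <= y $ k}) y)"
  using barrier_scaled by blast
 have main: "\<exists>K. compact K \<and> K \<subseteq> H \<inter> cball x (5 * \<delta>) \<and> (\<forall>\<beta> D. 0 < \<beta> \<and> \<beta> <= b0 * \<delta> powr (- \<alpha>) \<and> closed D \<and> K \<subseteq> D -->
    (c1 / C) * \<delta> powr \<alpha> * ?m x \<delta> <= measure (occ \<beta> (exitH D) x) (K \<inter> {y. h1 * \<delta> <= y $ k}))"
  if \<delta>: "0 < \<delta>" and x: "x \<in> H" for \<delta> x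
 proof -
  obtain u K where u: "u \<in> Cc_inf H" "\<And>y. 0 <= u y" and K: "compact K" "K \<subseteq> H \<inter> cball x (5 * \<delta>)" "\<And>y. y \<notin> K ==> u y = 0"
   and v: "c1 * ?m x \<delta> <= u x"
   and L: "\<And>y \<beta>. y \<in> H ==> 0 < \<beta> \<and> \<beta> <= b0 * \<delta> powr (- \<alpha>) ==>
     \<beta> * u y - Lop u y <= \<delta> powr (- \<alpha>) * C * indicator (K \<inter> {y. h1 * \<delta> <= y $ k}) y"
   using B[rule_format, OF \<delta> x] by blast
  define E where "E = K \<inter> {y. h1 * \<delta> <= y $ k}"
  have Em: "E \<in> sets borel" unfolding E_def by (intro borel_closed closed_Int compact_imp_closed K closed_Collect_le continuous_intros)
  have *: "(c1 / C) * \<delta> powr \<alpha> * ?m x \<delta> <= measure (occ \<beta> (exitH D) x) E"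
   if \<beta>: "0 < \<beta>" "\<beta> <= b0 * \<delta> powr (- \<alpha>)" and D: "closed D" "K \<subseteq> D" for \<beta> D
  proof -
   have Tm: "exitH D \<in> borel_measurable Msp" by (rule stop_meas[OF exit_stop[OF D(1)]])
   interpret finite_measure "occ \<beta> (exitH D) x" by (rule occ_finite[OF \<beta>(1) x Tm])
   have "c1 * ?m x \<delta> <= u x" by (rule v)
   also have "u x = (\<integral>y. hf \<beta> u y \<partial>occ \<beta> (exitH D) x)"
    by (rule dynkin_le(2)[OF \<beta>(1) u x D(1), symmetric]) (use K(3) D(2) in auto)
   also have "... <= (\<integral>y. \<delta> powr (- \<alpha>) * C * indicator E y \<partial>occ \<beta> (exitH D) x)"
   proof (rule integral_mono[OF hf_integrable_occ[OF \<beta>(1) u x Tm]])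
    show "integrable (occ \<beta> (exitH D) x) (\<lambda>y. \<delta> powr (- \<alpha>) * C * indicator E y)"
     using Em by (intro integrable_mult_right integrable_real_indicator) (auto simp: emeasure_eq_measure)
    show "hf \<beta> u y <= \<delta> powr (- \<alpha>) * C * indicator E y" for y
     using L[of y \<beta>] \<beta> A(1) unfolding E_def by (auto simp: hf_def)
   qed
   also have "... = \<delta> powr (- \<alpha>) * C * measure (occ \<beta> (exitH D) x) E"
    using Em by simp
   finally have "\<delta> powr \<alpha> / C * (c1 * ?m x \<delta>) <= \<delta> powr \<alpha> / C * (\<delta> powr (- \<alpha>) * C * measure (occ \<beta> (exitH D) x) E)"
    using A by (intro mult_left_mono) auto
   also have "... = (\<delta> powr \<alpha> * \<delta> powr (- \<alpha>)) * measure (occ \<beta> (exitH D) x) E" using A(1) by simp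
   also have "\<delta> powr \<alpha> * \<delta> powr (- \<alpha>) = 1" using \<delta> by (simp add: powr_add[symmetric])
   finally show ?thesis by (simp add: mult_ac)
  qed
  show ?thesis by (rule exI[of _ K]) (use K(1,2) * in \<open>auto simp: E_def\<close>)
 qed
 have c: "0 < c1 / C" using A by simp
 show ?thesis
  by (rule exI[of _ "c1 / C"], rule exI[of _ h1], rule exI[of _ b0], intro conjI c A allI impI ballI main)
qed

end

section \<open>Dual bump functions on the group\<close>

context bkernel begin

definition psi :: "real => real^'n => real" where
 "psi \<rho> \<gamma> = (if \<gamma> \<in> H then gexp 0 (\<rho>^2 - (norm (\<gamma> - e))^2) else 0)"

lemma psi_nonneg: "0 <= psi \<rho> \<gamma>" by (simp add: psi_def gexp_def)

lemma psi_supp: assumes "0 < \<rho>" "psi \<rho> \<gamma> \<noteq> 0" shows "\<gamma> \<in> H" "norm (\<gamma> - e) < \<rho>"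
proof -
 show "\<gamma> \<in> H" using assms(2) by (auto simp: psi_def split: if_splits)
 have "(norm (\<gamma> - e))^2 < \<rho>^2" using assms(2) by (auto simp: psi_def gexp_def split: if_splits)
 then show "norm (\<gamma> - e) < \<rho>" using assms(1) by (intro power_less_imp_less_base[of _ 2 \<rho>]) auto
qed

lemma psi_pos: "\<gamma> \<in> H ==> norm (\<gamma> - e) < \<rho> ==> 0 < psi \<rho> \<gamma>"
 by (simp add: psi_def gexp_def power_strict_mono)

lemma psi_hsm: "(\<lambda>\<gamma>. gexp 0 (\<rho>^2 - (norm (\<gamma> - e))^2)) \<in> hsmooth k"
 by (intro hsm_gexp hsm_diff hsm_const hsm_shift_norm)

lemma ball_e:
 assumes "\<rho> <= 1/4" "norm (\<gamma> - e) <= \<rho>" shows "3/4 <= \<gamma> $ k" "\<gamma> $ k <= 5/4"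
 using abs_nth_sub_1_le[of \<gamma> k] assms by linarith+

lemma psi_K:
 assumes "0 < \<rho>" "\<rho> <= 1/4"
 shows "cball e \<rho> \<subseteq> H" "\<gamma> \<in> H - cball e \<rho> ==> gexp 0 (\<rho>^2 - (norm (\<gamma> - e))^2) = 0"
proof -
 show "cball e \<rho> \<subseteq> H"
 proof
  fix \<gamma> assume "\<gamma> \<in> cball e \<rho>"
  then show "\<gamma> \<in> H" using ball_e(1)[OF assms(2), of \<gamma>] by (simp add: halfsp_def dist_norm norm_minus_commute)
 qed
 assume "\<gamma> \<in> H - cball e \<rho>"
 then have "\<rho> <= norm (\<gamma> - e)" by (simp add: dist_norm norm_minus_commute)
 then have "\<rho>\<^sup>2 <= (norm (\<gamma> - e))^2" using assms(1) by (intro power_mono) auto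
 then show "gexp 0 (\<rho>^2 - (norm (\<gamma> - e))^2) = 0" by (simp add: gexp_def)
qed

lemma psi_Cc: assumes "0 < \<rho>" "\<rho> <= 1/4" shows "psi \<rho> \<in> Cc_inf H"
proof -
 have "(\<lambda>\<gamma>. if \<gamma> \<in> H then gexp 0 (\<rho>^2 - (norm (\<gamma> - e))^2) else 0) \<in> Cc_inf H"
  by (rule Cc_inf_hsmooth[OF psi_hsm, of "cball e \<rho>"]) (use psi_K[OF assms] in auto)
 then show ?thesis unfolding psi_def[abs_def] .
qed

lemma psi_meas [measurable]: "psi \<rho> \<in> borel_measurable borel"
 unfolding psi_def gexp_def by measurable

text \<open>A function of y b^(-1) in the group: moving \<open>y\<close> by \<open>\<eta>\<close> on
  the right has the same effect as moving \<open>b\<close> by \<open>ginv k \<eta>\<close>. This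
  links the generators in the two variables.\<close>

definition psib :: "real => real^'n => real^'n => real" where
 "psib \<rho> b y = psi \<rho> (y \<odot> ginv k b)"

lemma psib_meas [measurable (raw)]:
 assumes [measurable]: "f \<in> borel_measurable M" "g \<in> borel_measurable M"
 shows "(\<lambda>w. psib \<rho> (f w) (g w)) \<in> borel_measurable M"
 unfolding psib_def by measurable

lemma psib_nonneg: "0 <= psib \<rho> b y" by (simp add: psib_def psi_nonneg)

lemma psib_Cc:
 assumes \<rho>: "0 < \<rho>" "\<rho> <= 1/4" and b: "b \<in> H" shows "psib \<rho> b \<in> Cc_inf H"
proof -
 define c where "c = ginv k b"
 have c: "c \<in> H" unfolding c_def by (rule ginv_halfsp[OF b])
 have "\<exists>f'\<in>hsmooth k. \<forall>y\<in>H. f' y = gexp 0 (\<rho>^2 - (norm (y \<odot> c - e))^2)"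
 proof (rule hsm_subst[OF psi_hsm])
  fix i
  have "(\<lambda>y. y $ i + (c $ i - e $ i) * y $ k) \<in> hsmooth k" by (intro hsm_add hsm_cmult hsm_coord)
  then show "\<exists>g\<in>hsmooth k. \<forall>y\<in>H. g y = (y \<odot> c) $ i" by (rule bexI[rotated]) (simp add: gmul_eq)
  fix q
  have "(\<lambda>y. c $ k powr q * y $ k powr q) \<in> hsmooth k" by (intro hsm_cmult hsm_powr)
  then show "\<exists>g\<in>hsmooth k. \<forall>y\<in>H. g y = (y \<odot> c) $ k powr q"
   by (rule bexI[rotated]) (use c in \<open>auto simp: powr_mult halfsp_def\<close>)
 qed
 then obtain f' where f': "f' \<in> hsmooth k" "\<forall>y\<in>H. f' y = gexp 0 (\<rho>^2 - (norm (y \<odot> c - e))^2)" by blast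
 define K where "K = (\<lambda>\<gamma>. \<gamma> \<odot> b) ` cball e \<rho>"
 have K: "compact K" unfolding K_def gmul_def by (intro compact_continuous_image continuous_intros) simp
 have KH: "K \<subseteq> H" using psi_K(1)[OF \<rho>] b unfolding K_def by (auto intro!: gmul_halfsp)
 have "(\<lambda>y. if y \<in> H then f' y else 0) \<in> Cc_inf H"
 proof (rule Cc_inf_hsmooth[OF f'(1) K KH])
  fix y assume y: "y \<in> H" "y \<notin> K"
  have "y = (y \<odot> c) \<odot> b" using b by (simp add: gmul_assoc c_def)
  then have "y \<odot> c \<notin> cball e \<rho>" using y(2) unfolding K_def by blast
  then show "f' y = 0" using f'(2) y psi_K(2)[OF \<rho>, of "y \<odot> c"] gmul_halfsp[OF y(1) c] by simp
 qed
 moreover have "(\<lambda>y. if y \<in> H then f' y else 0) = psib \<rho> b"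
  using f'(2) gmul_halfsp_iff[OF c] by (auto simp: psib_def psi_def c_def)
 ultimately show ?thesis by simp
qed

text \<open>The weight compensates for the exchange of \<open>\<eta>\<close> with its inverse when
  the generator passes from \<open>y\<close> to \<open>b\<close>: replacing \<open>b\<close> by
  \<open>b \<odot> \<eta>\<close> multiplies it by exactly the factor t^(\<alpha> - 1) of
  \<open>Dop\<close>.\<close>

definition Psi :: "real => real^'n => real^'n => real" where
 "Psi \<rho> y b = (if b \<in> H then psib \<rho> b y * ((y $ k / b $ k) powr (- \<alpha>) / b $ k) else 0)"

lemma Psi_nonneg: "0 <= Psi \<rho> y b"
 by (simp add: Psi_def psib_nonneg halfsp_def)

text \<open>Writing \<open>b\<close> as \<gamma>^(-1) y with \<gamma> close to \<open>e\<close>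
  gives the distance bound. It grows with |y - e| since small group elements move remote points far,
  so \<rho> has to be adapted to the set of \<open>y\<close> under consideration.\<close>

lemma psib_supp:
 assumes \<rho>: "0 < \<rho>" "\<rho> <= 1/4" and b: "b \<in> H" and nz: "psib \<rho> b y \<noteq> 0"
 shows "y \<in> H" "norm (b - y) <= 2 * \<rho> * (1 + norm (y - e))" "3/4 <= y $ k / b $ k" "y $ k / b $ k <= 5/4"
proof -
 define \<gamma> where "\<gamma> = y \<odot> ginv k b"
 have \<gamma>: "\<gamma> \<in> H" "norm (\<gamma> - e) < \<rho>" using psi_supp[OF \<rho>(1), of \<gamma>] nz by (auto simp: psib_def \<gamma>_def)
 show yH: "y \<in> H" using \<gamma>(1) gmul_halfsp_iff[OF ginv_halfsp[OF b]] by (simp add: \<gamma>_def)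
 have bk: "0 < b $ k" using b by (simp add: halfsp_def)
 have \<gamma>k: "\<gamma> $ k = y $ k / b $ k" using bk by (simp add: \<gamma>_def)
 have \<gamma>b: "3/4 <= \<gamma> $ k" "\<gamma> $ k <= 5/4" using ball_e[OF \<rho>(2), of \<gamma>] \<gamma>(2) by auto
 show "3/4 <= y $ k / b $ k" "y $ k / b $ k <= 5/4" using \<gamma>b by (auto simp: \<gamma>k)
 have "b = ginv k \<gamma> \<odot> y"
 proof -
  have "\<gamma> \<odot> b = y" using b by (simp add: \<gamma>_def gmul_assoc)
  then show ?thesis using gmul_ginv_cancel[OF \<gamma>(1), of b] by simp
 qed
 also have "... = ginv k \<gamma> + (1 / \<gamma> $ k) *\<^sub>R (y - e)" using \<gamma>b by (simp add: gmul_eq)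
 finally have "b - y = (ginv k \<gamma> - e) + (1 / \<gamma> $ k - 1) *\<^sub>R (y - e)" by (simp add: algebra_simps)
 then have "norm (b - y) <= norm (ginv k \<gamma> - e) + \<bar>1 / \<gamma> $ k - 1\<bar> * norm (y - e)" by (metis norm_triangle_ineq norm_scaleR)
 also have "norm (ginv k \<gamma> - e) = norm (\<gamma> - e) / \<gamma> $ k" unfolding ginv_minus_ek using \<gamma>b by simp
 also have "norm (\<gamma> - e) / \<gamma> $ k <= 2 * \<rho>"
 proof -
  have "norm (\<gamma> - e) <= \<rho> * 1" using \<gamma>(2) by simp
  also have "... <= \<rho> * (2 * \<gamma> $ k)" using \<gamma>b \<rho> by (intro mult_left_mono) auto
  finally show ?thesis using \<gamma>b by (simp add: field_simps)
 qed
 also have "\<bar>1 / \<gamma> $ k - 1\<bar> * norm (y - e) <= (2 * \<rho>) * norm (y - e)"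
 proof (rule mult_right_mono)
  have "\<bar>1 / \<gamma> $ k - 1\<bar> = \<bar>\<gamma> $ k - 1\<bar> / \<gamma> $ k" using \<gamma>b by (simp add: field_simps abs_if)
  also have "... <= norm (\<gamma> - e) / \<gamma> $ k" using \<gamma>b by (intro divide_right_mono abs_nth_sub_1_le) auto
  also have "... <= 2 * \<rho>" by fact
  finally show "\<bar>1 / \<gamma> $ k - 1\<bar> <= 2 * \<rho>" .
 qed simp
 finally show "norm (b - y) <= 2 * \<rho> * (1 + norm (y - e))" by (simp add: algebra_simps)
qed

text \<open>The inversion of \<open>b\<close> costs only a power of the height with exponent -1, so
  the substitution stays inside \<open>hsmooth\<close>.\<close>

lemma Psi_Cc:
 assumes \<rho>: "0 < \<rho>" "\<rho> <= 1/4" and y: "y \<in> H" shows "Psi \<rho> y \<in> Cc_inf H"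
proof -
 have yk: "0 < y $ k" using y by (simp add: halfsp_def)
 have "\<exists>f'\<in>hsmooth k. \<forall>b\<in>H. f' b = gexp 0 (\<rho>^2 - (norm (y \<odot> ginv k b - e))^2)"
 proof (rule hsm_subst[OF psi_hsm])
  fix i
  have "(\<lambda>b. y $ i - (y $ k * b $ k powr (- 1)) * (b $ i - e $ i)) \<in> hsmooth k"
   by (intro hsm_diff hsm_mult hsm_const hsm_coord hsm_powr)
  then show "\<exists>g\<in>hsmooth k. \<forall>b\<in>H. g b = (y \<odot> ginv k b) $ i"
   by (rule bexI[rotated]) (auto simp: gmul_ginv_eq halfsp_def powr_minus_divide)
  fix q
  have "(\<lambda>b. y $ k powr q * b $ k powr (- q)) \<in> hsmooth k" by (intro hsm_cmult hsm_powr)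
  then show "\<exists>g\<in>hsmooth k. \<forall>b\<in>H. g b = (y \<odot> ginv k b) $ k powr q"
   by (rule bexI[rotated]) (use yk in \<open>auto simp: powr_divide powr_minus_divide halfsp_def\<close>)
 qed
 then obtain f' where f': "f' \<in> hsmooth k" "\<forall>b\<in>H. f' b = gexp 0 (\<rho>^2 - (norm (y \<odot> ginv k b - e))^2)" by blast
 define f where "f b = f' b * (y $ k powr (- \<alpha>) * b $ k powr (\<alpha> - 1))" for b
 have fm: "f \<in> hsmooth k" unfolding f_def by (intro hsm_mult f'(1) hsm_const hsm_powr)
 define K where "K = (\<lambda>\<gamma>. ginv k \<gamma> \<odot> y) ` cball e \<rho>"
 have "\<gamma> $ k \<noteq> 0" if "\<gamma> \<in> cball e \<rho>" for \<gamma> using psi_K(1)[OF \<rho>] that by (auto simp: halfsp_def)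
 then have K: "compact K" unfolding K_def gmul_def ginv_def by (intro compact_continuous_image continuous_intros) auto
 have KH: "K \<subseteq> H" using psi_K(1)[OF \<rho>] y unfolding K_def by (auto intro!: gmul_halfsp ginv_halfsp)
 have "(\<lambda>b. if b \<in> H then f b else 0) \<in> Cc_inf H"
 proof (rule Cc_inf_hsmooth[OF fm K KH])
  fix b assume b: "b \<in> H" "b \<notin> K"
  have gH: "y \<odot> ginv k b \<in> H" by (intro gmul_halfsp y ginv_halfsp b)
  have "b = ginv k (y \<odot> ginv k b) \<odot> y"
  proof -
   have "(y \<odot> ginv k b) \<odot> b = y" using b by (simp add: gmul_assoc)
   then show ?thesis using gmul_ginv_cancel[OF gH, of b] by simp
  qed
  then have "y \<odot> ginv k b \<notin> cball e \<rho>" using b(2) unfolding K_def by blast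
  then show "f b = 0" using f'(2) b psi_K(2)[OF \<rho>, of "y \<odot> ginv k b"] gH by (simp add: f_def)
 qed
 moreover have "(\<lambda>b. if b \<in> H then f b else 0) = Psi \<rho> y"
 proof
  fix b
  show "(if b \<in> H then f b else 0) = Psi \<rho> y b"
  proof (cases "b \<in> H")
   case True
   then have bk: "0 < b $ k" by (simp add: halfsp_def)
   have gH: "y \<odot> ginv k b \<in> H" by (intro gmul_halfsp y ginv_halfsp True)
   have "b $ k powr (\<alpha> - 1) = b $ k powr \<alpha> / b $ k" using bk by (simp add: powr_diff)
   moreover have "(y $ k / b $ k) powr (- \<alpha>) = y $ k powr (- \<alpha>) * b $ k powr \<alpha>"
    using yk bk by (simp add: powr_divide powr_minus_divide)
   ultimately show ?thesis using True f'(2) gH by (simp add: f_def Psi_def psib_def psi_def)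
  qed (simp add: Psi_def)
 qed
 ultimately show ?thesis by simp
qed

text \<open>The two families are dual to each other: the generator acting in \<open>b\<close> on one is the generator
 acting in \<open>y\<close> on the other, so a double occupation integral can be evaluated in both orders.\<close>

lemma Psi_Lop:
 assumes y: "y \<in> H" and b: "b \<in> H"
 shows "Lop (Psi \<rho> y) b = 1 / b $ k * Lop (psib \<rho> b) y"
proof -
 let ?c = "(y $ k / b $ k) powr (- \<alpha>)"
 have p: "0 < y $ k" "0 < b $ k" using y b by (auto simp: halfsp_def)
 have D: "Dop (Psi \<rho> y) b \<eta> * jj \<eta> = ?c / b $ k * (Dop (psib \<rho> b) y \<eta> * jj \<eta>)" for \<eta>
 proof (cases "\<eta> \<in> H")
  case False
  then show ?thesis by (simp add: jj_zero)
 next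
  case True
  define t where "t = \<eta> $ k"
  have t: "0 < t" using True by (simp add: t_def halfsp_def)
  have H1: "b \<odot> \<eta> \<in> H" "b \<odot> ginv k \<eta> \<in> H" by (intro gmul_halfsp b True ginv_halfsp)+
  have inv: "ginv k (u \<odot> v) = ginv k v \<odot> ginv k u" if "u \<in> H" "v \<in> H" for u v
  proof -
   have uv: "u \<odot> v \<in> H" by (rule gmul_halfsp[OF that])
   have "(u \<odot> v) \<odot> (ginv k v \<odot> ginv k u) = u \<odot> ((v \<odot> ginv k v) \<odot> ginv k u)" by (simp only: gmul_assoc)
   also have "... = e" using that by simp
   finally show ?thesis using gmul_ginv_cancel[OF uv, of "ginv k v \<odot> ginv k u"] by simp
  qed
  have s1: "psib \<rho> (b \<odot> \<eta>) y = psib \<rho> b (y \<odot> ginv k \<eta>)"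
   by (simp add: psib_def inv[OF b True] gmul_assoc)
  have s2: "psib \<rho> (b \<odot> ginv k \<eta>) y = psib \<rho> b (y \<odot> \<eta>)"
   using True by (simp add: psib_def inv[OF b ginv_halfsp[OF True]] gmul_assoc)
  have w1: "(y $ k / (b $ k * t)) powr (- \<alpha>) / (b $ k * t) = ?c / b $ k * t powr (\<alpha> - 1)"
  proof -
   have "(y $ k / (b $ k * t)) powr (- \<alpha>) = ((y $ k / b $ k) / t) powr (- \<alpha>)" by simp
   also have "... = ?c * t powr \<alpha>" using p t by (subst powr_divide) (auto simp: powr_minus_divide)
   finally show ?thesis using t by (simp add: powr_diff)
  qed
  have w2: "(y $ k / (b $ k / t)) powr (- \<alpha>) / (b $ k / t) = ?c / b $ k * (t * t powr (- \<alpha>))"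
  proof -
   have "(y $ k / (b $ k / t)) powr (- \<alpha>) = ((y $ k / b $ k) * t) powr (- \<alpha>)" by simp
   also have "... = ?c * t powr (- \<alpha>)" using p t by (subst powr_mult) auto
   finally show ?thesis using t by simp
  qed
  have w3: "t powr (\<alpha> - 1) * (t * t powr (- \<alpha>)) = 1"
  proof -
   have "t powr (\<alpha> - 1) * (t powr 1 * t powr (- \<alpha>)) = t powr (\<alpha> - 1 + (1 + - \<alpha>))" by (simp only: powr_add)
   then show ?thesis using t by simp
  qed
  have P1: "Psi \<rho> y (b \<odot> \<eta>) = ?c / b $ k * (t powr (\<alpha> - 1) * psib \<rho> b (y \<odot> ginv k \<eta>))"
   using H1(1) w1 by (simp add: Psi_def s1 t_def[symmetric])
  have P2: "t powr (\<alpha> - 1) * Psi \<rho> y (b \<odot> ginv k \<eta>) = ?c / b $ k * psib \<rho> b (y \<odot> \<eta>)"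
  proof -
   have "Psi \<rho> y (b \<odot> ginv k \<eta>) = psib \<rho> b (y \<odot> \<eta>) * ((y $ k / (b $ k / t)) powr (- \<alpha>) / (b $ k / t))"
    using H1(2) t by (simp add: Psi_def s2 t_def[symmetric])
   then have "t powr (\<alpha> - 1) * Psi \<rho> y (b \<odot> ginv k \<eta>) = (t powr (\<alpha> - 1) * (t * t powr (- \<alpha>))) * (?c / b $ k * psib \<rho> b (y \<odot> \<eta>))"
    unfolding w2 by (simp only: mult_ac)
   then show ?thesis unfolding w3 by simp
  qed
  have P0: "Psi \<rho> y b = ?c / b $ k * psib \<rho> b y" using b by (simp add: Psi_def)
  have "Dop (Psi \<rho> y) b \<eta> = Psi \<rho> y (b \<odot> \<eta>) - Psi \<rho> y b + (t powr (\<alpha> - 1) * Psi \<rho> y (b \<odot> ginv k \<eta>) - t powr (\<alpha> - 1) * Psi \<rho> y b)"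
   by (simp add: Dop_def t_def right_diff_distrib)
  also have "... = ?c / b $ k * Dop (psib \<rho> b) y \<eta>"
   unfolding P1 P2 P0 by (simp add: Dop_def t_def[symmetric] algebra_simps)
  finally show ?thesis by simp
 qed
 have "Lop (Psi \<rho> y) b = b $ k powr (- \<alpha>) / 2 * (?c / b $ k * (LI \<eta>. Dop (psib \<rho> b) y \<eta> * jj \<eta>))"
  unfolding Lop_def D by (simp only: integral_mult_right_zero)
 also have "... = (b $ k powr (- \<alpha>) * ?c) * (1 / b $ k / 2 * (LI \<eta>. Dop (psib \<rho> b) y \<eta> * jj \<eta>))"
  by simp
 also have "b $ k powr (- \<alpha>) * ?c = y $ k powr (- \<alpha>)"
  using p by (simp add: powr_divide powr_minus_divide)
 finally show ?thesis by (simp add: Lop_def)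
qed

text \<open>As a function of \<open>y\<close> the right translation is linear with norm at most 1 +
  |c - e|, so the Taylor constants grow at most by the square of that.\<close>

lemma taylor2_gmul:
 assumes u: "taylor2 M u" shows "taylor2 (M * (1 + norm (c - e))^2) (\<lambda>y. u (y \<odot> c))"
proof -
 define q where "q = norm (c - e)"
 have q: "0 <= q" by (simp add: q_def)
 have q1: "1 <= 1 + q" "1 + q <= (1 + q)^2" "1 <= (1 + q)^2" using q by (auto simp: power2_eq_square algebra_simps)
 obtain g where M: "0 <= M" "\<And>x. \<bar>u x\<bar> <= M" and g: "\<And>x z. \<bar>g x \<bullet> z\<bar> <= M * norm z" "\<And>x z. \<bar>u (x + z) - u x - g x \<bullet> z\<bar> <= M * (norm z)^2"
  using u unfolding taylor2_def by blast
 define S where "S z = z + (z $ k) *\<^sub>R (c - e)" for z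
 have S: "norm (S z) <= norm z * (1 + q)" for z
 proof -
  have "norm (S z) <= norm z + \<bar>z $ k\<bar> * q" unfolding S_def q_def using norm_triangle_ineq[of z "(z $ k) *\<^sub>R (c - e)"] by simp
  also have "... <= norm z + norm z * q" using q by (intro add_left_mono mult_right_mono component_le_norm_cart)
  finally show ?thesis by (simp add: algebra_simps)
 qed
 define g' where "g' x = g (x \<odot> c) + (g (x \<odot> c) \<bullet> (c - e)) *\<^sub>R e" for x
 have ek: "e \<bullet> z = z $ k" for z by (simp add: ek_def inner_axis')
 have g'S: "g' x \<bullet> z = g (x \<odot> c) \<bullet> S z" for x z
  unfolding g'_def S_def by (simp add: inner_add_left inner_add_right ek mult.commute)
 have add: "(x + z) \<odot> c = x \<odot> c + S z" for x z by (simp add: gmul_eq S_def algebra_simps)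
 have 1: "\<bar>g' x \<bullet> z\<bar> <= (M * (1 + q)^2) * norm z" for x z
 proof -
  have "\<bar>g' x \<bullet> z\<bar> <= M * norm (S z)" unfolding g'S by (rule g(1))
  also have "... <= M * (norm z * (1 + q)^2)" using M q1 S[of z] by (intro mult_left_mono order_trans[OF S mult_left_mono]) auto
  finally show ?thesis by (simp add: mult_ac)
 qed
 have 2: "\<bar>u ((x + z) \<odot> c) - u (x \<odot> c) - g' x \<bullet> z\<bar> <= (M * (1 + q)^2) * (norm z)^2" for x z
 proof -
  have "\<bar>u ((x + z) \<odot> c) - u (x \<odot> c) - g' x \<bullet> z\<bar> <= M * (norm (S z))^2" unfolding g'S add by (rule g(2))
  also have "... <= M * (norm z * (1 + q))^2" using M S by (intro mult_left_mono power_mono) auto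
  finally show ?thesis by (simp add: power_mult_distrib mult_ac)
 qed
 have 3: "\<bar>u (x \<odot> c)\<bar> <= M * (1 + q)^2" for x
 proof -
  have "\<bar>u (x \<odot> c)\<bar> <= M * 1" using M by simp
  also have "... <= M * (1 + q)^2" using M q1 by (intro mult_left_mono) auto
  finally show ?thesis .
 qed
 show ?thesis unfolding taylor2_def q_def[symmetric]
  using M(1) 1 2 3 by (intro conjI exI[of _ g'] allI) auto
qed

definition ll :: "real => real^'n => real^'n => real" where
 "ll \<rho> y b = 1 / b $ k * Lop (psib \<rho> b) y"

lemma ll_meas [measurable]: "(\<lambda>p. ll \<rho> (fst p) (snd p)) \<in> borel_measurable (borel \<Otimes>\<^sub>M borel)"
proof -
 have "(\<lambda>(p, \<eta>). Dop (psib \<rho> (snd p)) (fst p) \<eta> * jj \<eta>) \<in> borel_measurable ((borel \<Otimes>\<^sub>M borel) \<Otimes>\<^sub>M lborel)"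
  unfolding Dop_def split_beta' by measurable
 then have [measurable]: "(\<lambda>p. (LI \<eta>. Dop (psib \<rho> (snd p)) (fst p) \<eta> * jj \<eta>)) \<in> borel_measurable (borel \<Otimes>\<^sub>M borel)"
  by (rule lborel.borel_measurable_lebesgue_integral)
 show ?thesis unfolding ll_def Lop_def by measurable
qed

text \<open>Joint boundedness on compact sets is what Fubini needs for two finite occupation
  measures. It follows from \<open>Lop_bound\<close> with the explicit Taylor constants of right
  translates.\<close>

lemma ll_bounded:
 assumes \<rho>: "0 < \<rho>" "\<rho> <= 1/4" and K: "compact K" "K \<subseteq> H" and D: "compact D" "D \<subseteq> H"
 shows "\<exists>C\<ge>0. \<forall>y\<in>K. \<forall>b\<in>D. \<bar>ll \<rho> y b\<bar> <= C"
proof -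
 obtain M where M: "taylor2 M (psi \<rho>)" using Cc_inf_taylor2[OF psi_Cc[OF \<rho>]] by blast
 have M0: "0 <= M" using M by (simp add: taylor2_def)
 define I where "I = integral\<^sup>L lborel Gf"
 have I0: "0 <= I" unfolding I_def using Gf_nonneg by (intro Bochner_Integration.integral_nonneg) auto
 define f where "f y = y $ k powr (- \<alpha>) / 2 * (17 * (y $ k + (y $ k)^2) + 2)" for y :: "real^'n"
 define g where "g b = 1 / b $ k * (1 + norm (ginv k b - e))^2" for b :: "real^'n"
 have bd: "\<exists>C\<ge>0. \<forall>x\<in>S. \<bar>h x\<bar> <= C" if "compact S" "continuous_on S h" for S and h :: "real^'n => real"
 proof -
  have "bounded (h ` S)" by (intro compact_imp_bounded compact_continuous_image that)
  then obtain C where C: "\<forall>x\<in>h ` S. norm x <= C" unfolding bounded_iff by blast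
  then have "\<forall>x\<in>S. \<bar>h x\<bar> <= max C 0" by (auto intro: order_trans)
  then show ?thesis by (intro exI[of _ "max C 0"]) auto
 qed
 have "continuous_on K f" unfolding f_def by (intro continuous_intros) (use K in \<open>auto simp: halfsp_def\<close>)
 then obtain C1 where C1: "0 <= C1" "\<forall>y\<in>K. \<bar>f y\<bar> <= C1" using bd[OF K(1)] by blast
 have "continuous_on D g" unfolding g_def ginv_def by (intro continuous_intros) (use D in \<open>auto simp: halfsp_def\<close>)
 then obtain C2 where C2: "0 <= C2" "\<forall>y\<in>D. \<bar>g y\<bar> <= C2" using bd[OF D(1)] by blast
 have "\<bar>ll \<rho> y b\<bar> <= C1 * C2 * (M * I)" if y: "y \<in> K" and b: "b \<in> D" for y b
 proof -
  have yH: "y \<in> H" and bH: "b \<in> H" using y b K D by auto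
  have yk: "0 < y $ k" "0 < b $ k" using yH bH by (auto simp: halfsp_def)
  have t: "taylor2 (M * (1 + norm (ginv k b - e))^2) (psib \<rho> b)"
   unfolding psib_def[abs_def] by (rule taylor2_gmul[OF M])
  have "\<bar>Lop (psib \<rho> b) y\<bar> <= y $ k powr (- \<alpha>) / 2 * ((M * (1 + norm (ginv k b - e))^2) * (17 * (y $ k + (y $ k)^2) + 2) * I)"
   unfolding I_def by (rule Lop_bound[OF t _ yH]) measurable
  then have "\<bar>ll \<rho> y b\<bar> <= 1 / b $ k * (y $ k powr (- \<alpha>) / 2 * ((M * (1 + norm (ginv k b - e))^2) * (17 * (y $ k + (y $ k)^2) + 2) * I))"
   unfolding ll_def abs_mult using yk by (intro mult_mono) auto
  also have "... = f y * g b * (M * I)" by (simp add: f_def g_def mult_ac)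
  also have "... <= C1 * C2 * (M * I)"
  proof (rule mult_right_mono)
   have "f y <= C1" "g b <= C2" using C1 C2 y b by (auto simp: abs_le_iff)
   moreover have "0 <= g b" using yk by (simp add: g_def)
   ultimately show "f y * g b <= C1 * C2" using C1 by (intro mult_mono) auto
  qed (use M0 I0 in auto)
  finally show ?thesis .
 qed
 then show ?thesis using C1 C2 M0 I0 by (intro exI[of _ "C1 * C2 * (M * I)"]) auto
qed

text \<open>Division by \<open>b $ k\<close> turns Lebesgue measure into the measure invariant under
  right translation of \<open>b\<close>, so the total integral will not depend on
  \<open>y\<close>.\<close>

definition gk :: "real => real^'n => real^'n => real" where
 "gk \<rho> y b = (if b \<in> H then psib \<rho> b y / b $ k else 0)"

lemma gk_nonneg: "0 <= gk \<rho> y b" by (simp add: gk_def psib_nonneg halfsp_def)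

lemma gk_meas [measurable]: "gk \<rho> y \<in> borel_measurable borel"
 unfolding gk_def by measurable

lemma Psi_meas [measurable]: "Psi \<rho> y \<in> borel_measurable borel"
 unfolding Psi_def by measurable

text \<open>On the support the ratio of heights lies in [3/4, 5/4] and \<alpha> < 2, so its power
  with exponent -\<alpha> lies between 1/4 and 2.\<close>

lemma Psi_gk:
 assumes \<rho>: "0 < \<rho>" "\<rho> <= 1/4"
 shows "gk \<rho> y b / 4 <= Psi \<rho> y b" "Psi \<rho> y b <= 2 * gk \<rho> y b"
proof -
 have "gk \<rho> y b / 4 <= Psi \<rho> y b \<and> Psi \<rho> y b <= 2 * gk \<rho> y b"
 proof (cases "b \<in> H \<and> psib \<rho> b y \<noteq> 0")
  case False
  then show ?thesis by (auto simp: gk_def Psi_def)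
 next
  case True
  define t where "t = y $ k / b $ k"
  have t: "3/4 <= t" "t <= 5/4" using psib_supp[OF \<rho>, of b y] True by (auto simp: t_def)
  have bk: "0 < b $ k" using True by (simp add: halfsp_def)
  have g0: "0 <= psib \<rho> b y / b $ k" using bk psib_nonneg by simp
  have "2 powr (- 2) <= (2::real) powr (- \<alpha>)" using alpha by (intro powr_mono) auto
  also have "... <= t powr (- \<alpha>)" using t alpha by (intro powr_mono2') auto
  finally have l: "1/4 <= t powr (- \<alpha>)" by (simp add: powr_minus_divide)
  have "t powr (- \<alpha>) <= (3/4) powr (- \<alpha>)" using t alpha by (intro powr_mono2') auto
  also have "... = (4/3) powr \<alpha>" by (simp add: powr_minus_divide powr_divide)
  also have "... <= (4/3) powr 2" using alpha by (intro powr_mono) auto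
  also have "... <= 2" by (simp add: power2_eq_square)
  finally have "t powr (- \<alpha>) <= 2" .
  then show ?thesis using l True g0 mult_right_mono[OF l g0] mult_right_mono[OF _ g0, of "t powr (- \<alpha>)" 2]
   by (simp add: gk_def Psi_def t_def[symmetric] mult.commute)
 qed
 then show "gk \<rho> y b / 4 <= Psi \<rho> y b" "Psi \<rho> y b <= 2 * gk \<rho> y b" by auto
qed

lemma gk_nn_integral_eq:
 assumes y: "y \<in> H" and y': "y' \<in> H"
 shows "(NI b. ennreal (gk \<rho> y b)) = (NI b. ennreal (gk \<rho> y' b))"
proof -
 define \<eta> where "\<eta> = ginv k y' \<odot> y"
 have \<eta>: "\<eta> \<in> H" unfolding \<eta>_def by (intro gmul_halfsp ginv_halfsp y y')
 have p: "0 < y $ k" "0 < y' $ k" "0 < \<eta> $ k" using y y' \<eta> by (auto simp: halfsp_def)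
 have e: "\<eta> $ k * gk \<rho> y (b \<odot> \<eta>) = gk \<rho> y' b" for b
 proof (cases "b \<in> H")
  case True
  have b\<eta>: "b \<odot> \<eta> \<in> H" by (rule gmul_halfsp[OF True \<eta>])
  have "y \<odot> ginv k (b \<odot> \<eta>) = y' \<odot> ginv k b"
  proof -
   have "(y' \<odot> ginv k b) \<odot> (b \<odot> \<eta>) = y' \<odot> ((ginv k b \<odot> b) \<odot> \<eta>)" by (simp only: gmul_assoc)
   also have "... = y" using True y' by (simp add: \<eta>_def gmul_ginv_cancel2)
   finally have "y \<odot> ginv k (b \<odot> \<eta>) = (y' \<odot> ginv k b) \<odot> ((b \<odot> \<eta>) \<odot> ginv k (b \<odot> \<eta>))" by (metis gmul_assoc)
   then show ?thesis using b\<eta> by simp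
  qed
  then show ?thesis using True b\<eta> p by (simp add: gk_def psib_def)
 next
  case False
  then show ?thesis using gmul_halfsp_iff[OF \<eta>, of b] by (simp add: gk_def)
 qed
 have "(NI b. ennreal (gk \<rho> y b)) = ennreal (\<eta> $ k) * (NI b. ennreal (gk \<rho> y (b \<odot> \<eta>)))"
  by (rule nn_integral_gmul_left[OF \<eta>]) measurable
 also have "... = (NI b. ennreal (\<eta> $ k) * ennreal (gk \<rho> y (b \<odot> \<eta>)))"
  by (rule nn_integral_cmult[symmetric]) measurable
 also have "... = (NI b. ennreal (gk \<rho> y' b))"
  using p gk_nonneg by (intro nn_integral_cong) (simp add: ennreal_mult[symmetric] e)
 finally show ?thesis .
qed

lemma gk_pos:
 assumes \<rho>: "0 < \<rho>" "\<rho> <= 1/4" and y: "y \<in> H"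
 shows "0 < (NI b. ennreal (gk \<rho> y b))"
proof -
 have eH: "e \<in> H" by (simp add: halfsp_def ek_def)
 have "(NI b. ennreal (gk \<rho> e b)) \<noteq> 0"
 proof
  assume "(NI b. ennreal (gk \<rho> e b)) = 0"
  then have "AE b in lborel. ennreal (gk \<rho> e b) = 0" by (subst (asm) nn_integral_0_iff_AE) auto
  then have "AE b in lborel. b \<notin> ball e (\<rho> / 2)"
  proof eventually_elim
   case (elim b)
   show ?case
   proof
    assume "b \<in> ball e (\<rho> / 2)"
    then have n: "norm (b - e) < \<rho> / 2" by (simp add: dist_norm norm_minus_commute)
    then have bk: "3/4 <= b $ k" using ball_e(1)[of \<rho> b] \<rho> by simp
    then have bH: "b \<in> H" by (simp add: halfsp_def)
    have "norm (ginv k b - e) = norm (b - e) / b $ k" unfolding ginv_minus_ek using bk by simp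
    also have "... < \<rho>"
    proof -
     have "\<rho> * (3/4) <= \<rho> * b $ k" using bk \<rho> by (intro mult_left_mono) auto
     then have "norm (b - e) < \<rho> * b $ k" using n \<rho> by linarith
     then show ?thesis using bk by (simp add: pos_divide_less_eq)
    qed
    finally have "0 < psi \<rho> (ginv k b)" by (rule psi_pos[OF ginv_halfsp[OF bH]])
    then show False using elim bH bk by (simp add: gk_def psib_def)
   qed
  qed
  then have "ball e (\<rho> / 2) \<in> null_sets lborel" by (subst AE_iff_null_sets) auto
  then show False using \<rho> content_ball_pos[of "\<rho> / 2" e] by (auto simp: null_sets_def measure_def)
 qed
 then show ?thesis unfolding gk_nn_integral_eq[OF y eH] by (simp add: zero_less_iff_neq_zero)
qed

lemma gk_finite:
 assumes \<rho>: "0 < \<rho>" "\<rho> <= 1/4" and y: "y \<in> H"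
 shows "(NI b. ennreal (gk \<rho> y b)) < \<infinity>"
proof -
 define A where "A = cball y (2 * \<rho> * (1 + norm (y - e)))"
 define C where "C = 2 / y $ k"
 have yk: "0 < y $ k" using y by (simp add: halfsp_def)
 have le: "gk \<rho> y b <= C * indicator A b" for b
 proof (cases "b \<in> H \<and> psib \<rho> b y \<noteq> 0")
  case False
  then show ?thesis using yk by (auto simp: gk_def C_def)
 next
  case True
  have bk: "0 < b $ k" using True by (simp add: halfsp_def)
  have s: "norm (b - y) <= 2 * \<rho> * (1 + norm (y - e))" "y $ k / b $ k <= 5/4" using psib_supp[OF \<rho>, of b y] True by auto
  have bA: "b \<in> A" using s(1) by (simp add: A_def dist_norm norm_minus_commute)
  have "psib \<rho> b y <= 1" by (auto simp: psib_def psi_def gexp_def)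
  then have "gk \<rho> y b <= 1 / b $ k" using True bk by (simp add: gk_def divide_right_mono)
  also have "... <= C" using s(2) yk bk by (simp add: C_def field_simps)
  finally show ?thesis using bA by simp
 qed
 have "(NI b. ennreal (gk \<rho> y b)) <= (NI b. ennreal C * indicator A b)"
 proof (rule nn_integral_mono)
  fix b show "ennreal (gk \<rho> y b) <= ennreal C * indicator A b" using le[of b] by (auto simp: indicator_def ennreal_neg intro: ennreal_leI)
 qed
 also have "... = ennreal C * emeasure lborel A" by (rule nn_integral_cmult_indicator) (simp add: A_def)
 also have "... < \<infinity>" using emeasure_lborel_cball_finite[of y "2 * \<rho> * (1 + norm (y - e))"] by (simp add: A_def ennreal_mult_less_top)
 finally show ?thesis .
qed

end

lemma le_of_small:
 assumes "0 < B" "0 <= c" "\<And>\<beta>. 0 < \<beta> ==> \<beta> <= B ==> a <= b + \<beta> * (c :: real)"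
 shows "a <= b"
proof (rule field_le_epsilon)
 fix e :: real assume e: "0 < e"
 define \<beta> where "\<beta> = min B (e / (c + 1))"
 have \<beta>: "0 < \<beta>" "\<beta> <= B" using assms e by (auto simp: \<beta>_def)
 have "\<beta> * c <= (e / (c + 1)) * c" using assms(2) by (intro mult_right_mono) (auto simp: \<beta>_def)
 also have "... <= e" using assms(2) e by (simp add: field_simps)
 finally show "a <= b + e" using assms(3)[OF \<beta>] by linarith
qed

context bkernel begin

lemma gk_integral:
 assumes \<rho>: "0 < \<rho>" "\<rho> <= 1/4"
 obtains I where "0 < I" "\<And>y. y \<in> H ==> (NI b. ennreal (gk \<rho> y b)) = ennreal I"
  "\<And>y. y \<in> H ==> integrable lborel (gk \<rho> y)" "\<And>y. y \<in> H ==> integral\<^sup>L lborel (gk \<rho> y) = I"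
proof -
 have eH: "e \<in> H" by (simp add: halfsp_def ek_def)
 define I where "I = enn2real (NI b. ennreal (gk \<rho> e b))"
 have I: "0 < I" unfolding I_def using gk_pos[OF \<rho> eH] gk_finite[OF \<rho> eH] by (simp add: enn2real_positive_iff)
 have eq: "(NI b. ennreal (gk \<rho> y b)) = ennreal I" if "y \<in> H" for y
  unfolding I_def gk_nn_integral_eq[OF that eH] using gk_finite[OF \<rho> eH] by simp
 have "integrable lborel (gk \<rho> y)" "integral\<^sup>L lborel (gk \<rho> y) = I" if "y \<in> H" for y
 proof -
  show "integrable lborel (gk \<rho> y)" using eq[OF that] gk_nonneg by (intro integrableI_nonneg) auto
  show "integral\<^sup>L lborel (gk \<rho> y) = I" using eq[OF that] gk_nonneg I by (subst integral_eq_nn_integral) auto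
 qed
 then show ?thesis using that[OF I eq] by blast
qed

text \<open>At a point \<open>b\<close> off the support the generator is the jump integral of
  \<open>Lop_zero\<close>, hence at least \<open>j0\<close> times the integral of
  \<open>Psi \<rho> y\<close>, which is at least \<open>I / 4\<close>.\<close>

lemma Lop_Psi_lower:
 assumes \<rho>: "0 < \<rho>" "\<rho> <= 1/4" and y: "y \<in> H" and b: "b \<in> H" and \<sigma>: "2 * \<rho> * (1 + norm (y - e)) <= \<sigma>"
  and sep: "0 < r0" "r0 + \<sigma> <= norm (b - y)" and I: "integrable lborel (gk \<rho> y)" "integral\<^sup>L lborel (gk \<rho> y) = I"
  and j0: "0 <= j0" "\<And>z. z \<in> H ==> norm (z - y) <= \<sigma> ==> j0 <= J b z"
 shows "j0 * I / 4 <= Lop (Psi \<rho> y) b"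
proof -
 let ?F = "\<lambda>z. indicator H z * (Psi \<rho> y z * J b z)"
 have PC: "Psi \<rho> y \<in> Cc_inf H" by (rule Psi_Cc[OF \<rho> y])
 obtain M where M: "taylor2 M (Psi \<rho> y)" using Cc_inf_taylor2[OF PC] by blast
 have supp: "z \<in> H" "norm (z - y) <= \<sigma>" if "Psi \<rho> y z \<noteq> 0" for z
  using that psib_supp(2)[OF \<rho>, of z y] \<sigma> by (auto simp: Psi_def split: if_splits)
 have P0: "Psi \<rho> y b = 0"
 proof (rule ccontr)
  assume "Psi \<rho> y b \<noteq> 0"
  then show False using supp(2)[of b] sep by simp
 qed
 have L: "Lop (Psi \<rho> y) b = (LI z. ?F z)"
  by (rule Lop_zero[OF M Psi_meas b Psi_nonneg P0])
 have Pi: "integrable lborel (Psi \<rho> y)"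
 proof (rule Bochner_Integration.integrable_bound[of _ "\<lambda>b. 2 * gk \<rho> y b"])
  show "AE z in lborel. norm (Psi \<rho> y z) <= norm (2 * gk \<rho> y z)"
   using Psi_gk(2)[OF \<rho>] Psi_nonneg gk_nonneg by (intro AE_I2) (simp add: abs_of_nonneg)
 qed (use I(1) in auto)
 have PI: "I / 4 <= integral\<^sup>L lborel (Psi \<rho> y)"
 proof -
  have "(LI z. gk \<rho> y z / 4) <= integral\<^sup>L lborel (Psi \<rho> y)"
   using I(1) Pi Psi_gk(1)[OF \<rho>] by (intro integral_mono) auto
  then show ?thesis using I(2) by simp
 qed
 \<comment> \<open>This upper bound on the jump density secures integrability; its size does not
   enter the result.\<close>
 define Q where "Q = CB * r0 powr (- (d + \<alpha>))"
 have JQ: "J b z <= Q" if "z \<in> H" "norm (z - y) <= \<sigma>" for z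
 proof -
  have "r0 <= norm (b - z)" using sep(2) that(2) norm_triangle_ineq[of "b - z" "z - y"] by simp
  then have "norm (b - z) powr (- (d + \<alpha>)) <= r0 powr (- (d + \<alpha>))" using sep(1) alpha by (intro powr_mono2') (auto simp: d_eq)
  then have "CB * norm (b - z) powr (- (d + \<alpha>)) <= Q" unfolding Q_def using CB by (intro mult_left_mono) auto
  then show ?thesis using J_bound[OF b that(1)] by linarith
 qed
 have Li: "integrable lborel (\<lambda>z. ?F z)"
 proof (rule Bochner_Integration.integrable_bound[of _ "\<lambda>z. Q * Psi \<rho> y z"])
  show "AE z in lborel. norm (?F z) <= norm (Q * Psi \<rho> y z)"
  proof (rule AE_I2)
   fix z
   show "norm (?F z) <= norm (Q * Psi \<rho> y z)"
   proof (cases "Psi \<rho> y z = 0")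
    case False
    note s = supp[OF False]
    have "0 <= J b z" "J b z <= Q" using J_nonneg[OF b s(1)] JQ[OF s] by auto
    then have "J b z * Psi \<rho> y z <= \<bar>Q\<bar> * Psi \<rho> y z" using Psi_nonneg[of \<rho> y z] by (intro mult_right_mono) auto
    then have "Psi \<rho> y z * J b z <= \<bar>Q\<bar> * Psi \<rho> y z" by (subst mult.commute)
    then show ?thesis using s(1) Psi_nonneg[of \<rho> y z] \<open>0 <= J b z\<close> by (simp add: abs_mult)
   qed simp
  qed
 qed (use Pi in auto)
 have "j0 * I / 4 <= j0 * integral\<^sup>L lborel (Psi \<rho> y)" using PI j0(1) mult_left_mono[OF PI j0(1)] by simp
 also have "... = (LI z. j0 * Psi \<rho> y z)" by simp
 also have "... <= (LI z. ?F z)"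
 proof (rule integral_mono[OF _ Li])
  show "integrable lborel (\<lambda>z. j0 * Psi \<rho> y z)" using Pi by simp
  show "j0 * Psi \<rho> y z <= ?F z" for z
  proof (cases "Psi \<rho> y z = 0")
   case False
   note s = supp[OF False]
   show ?thesis using mult_left_mono[OF j0(2)[OF s] Psi_nonneg[of \<rho> y z]] s(1) by (simp add: mult.commute)
  qed simp
 qed
 finally show ?thesis unfolding L .
qed

end

section \<open>From occupation measures to the Green function\<close>

context bproc begin

text \<open>Let \<open>\<nu>\<close> and \<open>\<kappa>\<close> be the occupation measures from
  \<open>y\<close> and \<open>x\<close>, and let \<open>l y' b\<close> be the common value of the
  generator of \<open>Psi\<close> in \<open>b\<close> and the weighted generator of
  \<open>psib\<close> in \<open>y'\<close>. With \<open>b\<close> integrated first, Dynkin's formula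
  at \<open>x\<close> bounds the double integral above by a term of order \<beta>. With
  \<open>y'\<close> integrated first, Dynkin's formula at \<open>y\<close> bounds the inner integral
  below by \<open>- gk \<rho> y b\<close>, while for \<open>b\<close> in \<open>Ax\<close> the jumps
  from \<open>b\<close> to the neighbourhood of \<open>Ay\<close> give at least
  \<open>c * n0\<close>. Against \<open>\<kappa>\<close> the bump \<open>gk \<rho> y\<close> has
  integral at most about G(x,y) times \<open>I\<close>, and comparing the two orders gives the
  claim.\<close>

lemma green_core:
 fixes x y w0 :: "real^'n" and R :: real
 defines "V \<equiv> ball w0 R \<inter> H"
 assumes w0: "w0 $ k = 0" "0 < R" and x: "x \<in> V" and y: "y \<in> V" and xy: "x \<noteq> y"
  and D: "compact D" "D \<subseteq> V" and Ky: "compact Ky" "Ky \<subseteq> H" and nb: "\<And>y'. y' \<in> Ky ==> cball y' \<sigma> \<subseteq> D"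
  and A: "Ay \<in> sets borel" "Ay \<subseteq> Ky" "Ax \<in> sets borel" "Ax \<subseteq> D" and \<sigma>: "0 < \<sigma>" "0 < r0"
  and sepx: "\<And>y'. y' \<in> Ky ==> r0 + \<sigma> <= norm (x - y')"
  and sepA: "\<And>b y'. b \<in> Ax ==> y' \<in> Ky ==> r0 + \<sigma> <= norm (b - y')"
  and j0: "0 <= j0" "\<And>b y' z. b \<in> Ax ==> y' \<in> Ay ==> z \<in> H ==> norm (z - y') <= \<sigma> ==> j0 <= J b z"
  and n0: "0 < \<beta>1" "0 <= n0" "n0 <= measure (occ \<beta>1 (exitH Ky) y) Ay"
  and k0: "0 < \<beta>0" "0 <= k0" "\<And>\<beta>. 0 < \<beta> ==> \<beta> <= \<beta>0 ==> k0 <= measure (occ \<beta> (exitH D) x) Ax"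
 shows "j0 * n0 * k0 / 4 <= G V x y"
proof (rule field_le_epsilon)
 fix \<epsilon> :: real assume \<epsilon>: "0 < \<epsilon>"
 have gr: "green_fun V P Y \<zeta> (G V)" unfolding V_def by (rule green[OF w0])
 have G0: "0 <= G V x b" if "b \<in> V" for b using gr x that by (auto simp: green_fun_def)
 have Gc: "continuous_on (V - {x}) (G V x)" using gr x by (auto simp: green_fun_def)
 have xH: "x \<in> H" and yH: "y \<in> H" using x y by (auto simp: V_def)
 have DH: "D \<inter> H = D" "D \<subseteq> H" using D by (auto simp: V_def)
 have KyH: "Ky \<inter> H = Ky" using Ky by auto
 have Vo: "open (V - {x})" unfolding V_def by (intro open_Diff open_Int open_ball halfsp_open closed_singleton)
 have "bounded ((\<lambda>y'. y' - e) ` Ky)"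
  by (intro compact_imp_bounded compact_continuous_image continuous_intros Ky)
 then obtain Rb0 where "\<forall>z\<in>(\<lambda>y'. y' - e) ` Ky. norm z <= Rb0" unfolding bounded_iff by blast
 then obtain Rb where Rb: "0 <= Rb" "\<And>y'. y' \<in> Ky ==> norm (y' - e) <= Rb" by (metis image_eqI max.cobounded1 max.cobounded2 order_trans)
 obtain s1 where s1: "0 < s1" "ball y s1 \<subseteq> V - {x}" using Vo y xy open_contains_ball[of "V - {x}"] by auto
 have "isCont (G V x) y" using Gc Vo y xy continuous_on_eq_continuous_at by blast
 then obtain s2 where s2: "0 < s2" "\<And>b. dist b y < s2 ==> dist (G V x b) (G V x y) < \<epsilon>"
  using \<epsilon> unfolding continuous_at_eps_delta by blast
 define m N Q where "m = min s1 s2" and "N = 1 + norm (y - e)" and "Q = 1 + Rb"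
 have mNQ: "0 < m" "0 < N" "0 < Q" "m <= s1" "m <= s2" using s1 s2 Rb(1) by (auto simp: m_def N_def Q_def add_pos_nonneg)
 \<comment> \<open>Three demands: the bumps are supported in \<open>H\<close>, those belonging to
   points of \<open>Ky\<close> have radius at most \<sigma>, and the one at \<open>y\<close> lives
   where the Green function differs from its value at \<open>y\<close> by less than
   \<epsilon>.\<close>
 define \<rho> where "\<rho> = min (1/4) (min (\<sigma> / (2 * Q)) (m / (4 * N)))"
 have \<rho>: "0 < \<rho>" "\<rho> <= 1/4" unfolding \<rho>_def using \<sigma> mNQ by (auto intro: divide_pos_pos)
 have \<rho>\<sigma>: "2 * \<rho> * (1 + norm (y' - e)) <= \<sigma>" if "y' \<in> Ky" for y'
 proof -
  have "2 * \<rho> * (1 + norm (y' - e)) <= 2 * \<rho> * Q" using Rb(2)[OF that] \<rho> by (intro mult_left_mono) (auto simp: Q_def)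
  also have "... <= 2 * (\<sigma> / (2 * Q)) * Q" using mNQ by (intro mult_right_mono mult_left_mono) (auto simp: \<rho>_def)
  also have "... = \<sigma>" using mNQ by simp
  finally show ?thesis .
 qed
 have \<rho>s: "2 * \<rho> * (1 + norm (y - e)) < m"
 proof -
  have "2 * \<rho> * N <= 2 * (m / (4 * N)) * N" using mNQ by (intro mult_right_mono mult_left_mono) (auto simp: \<rho>_def)
  also have "... = m / 2" using mNQ by simp
  also have "... < m" using mNQ by simp
  finally show ?thesis unfolding N_def .
 qed
 obtain I where I: "0 < I" "\<And>y. y \<in> H ==> (NI b. ennreal (gk \<rho> y b)) = ennreal I"
  "\<And>y. y \<in> H ==> integrable lborel (gk \<rho> y)" "\<And>y. y \<in> H ==> integral\<^sup>L lborel (gk \<rho> y) = I" using gk_integral[OF \<rho>] by blast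
 \<comment> \<open>\<open>G V x\<close> is continuous off its pole \<open>x\<close>, so on this
   compact set away from the pole a bound \<open>Mg\<close> exists. Its size is harmless, as it will
   be multiplied by \<beta>.\<close>
 define S where "S = D - ball x r0"
 have S: "compact S" "S \<subseteq> V - {x}" unfolding S_def using D \<sigma> by (auto intro: compact_diff)
 obtain Mg where Mg: "0 <= Mg" "\<And>b. b \<in> S ==> G V x b <= Mg"
 proof -
  have "bounded (G V x ` S)" by (intro compact_imp_bounded compact_continuous_image S continuous_on_subset[OF Gc])
  then obtain C where C: "\<forall>z\<in>G V x ` S. norm z <= C" unfolding bounded_iff by blast
  have "G V x b <= max C 0" if "b \<in> S" for b using C that by (force simp: abs_le_iff)
  then show ?thesis using that[of "max C 0"] by auto
 qed
 define g where "g = G V x y + \<epsilon>"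
 have g0: "0 <= g" using G0[OF y] \<epsilon> by (simp add: g_def)
 have Dc: "closed D" and Kc: "closed Ky" using D Ky compact_imp_closed by auto
 have kf: "(\<integral>\<^sup>+b. ennreal (f b) \<partial>occ \<beta> (exitH D) x) <= ennreal (C * I)"
  if \<beta>: "0 < \<beta>" and [measurable]: "bmeas f" and f: "\<And>b. 0 <= f b" and C: "0 <= C" and q: "q \<in> H"
   and le: "\<And>b. b \<in> V ==> f b \<noteq> 0 ==> G V x b * f b <= C * gk \<rho> q b" for \<beta> f C q
 proof -
  have "(\<integral>\<^sup>+b. ennreal (f b) \<partial>occ \<beta> (exitH D) x) <= (\<integral>\<^sup>+b\<in>V. ennreal (G V x b * f b) \<partial>lborel)"
   using occ_le_green[OF \<beta> Dc w0 _ _ that(2) f] D x unfolding V_def by auto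
  also have "... <= (NI b. ennreal C * ennreal (gk \<rho> q b))"
  proof (rule nn_integral_mono)
   fix b
   have "b \<in> V ==> G V x b * f b <= C * gk \<rho> q b" using le[of b] C gk_nonneg[of \<rho> q b] by (cases "f b = 0") auto
   then show "ennreal (G V x b * f b) * indicator V b <= ennreal C * ennreal (gk \<rho> q b)"
    using C gk_nonneg[of \<rho> q b] by (auto simp: indicator_def ennreal_mult[symmetric] intro: ennreal_leI)
  qed
  also have "... = ennreal C * ennreal I" unfolding I(2)[OF q, symmetric] by (rule nn_integral_cmult) measurable
  finally show ?thesis using C I(1) by (simp add: ennreal_mult)
 qed
 \<comment> \<open>The bump is concentrated near \<open>y\<close>, so the Green density may be
   replaced there by \<open>g\<close>. This is where the value of \<open>G V x y\<close>
   enters.\<close>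
 have kgk: "(\<integral>\<^sup>+b. ennreal (gk \<rho> y b) \<partial>occ \<beta> (exitH D) x) <= ennreal (g * I)" if \<beta>: "0 < \<beta>" for \<beta>
 proof (rule kf[OF \<beta> gk_meas gk_nonneg g0 yH])
  fix b assume "b \<in> V" "gk \<rho> y b \<noteq> 0"
  then have "norm (b - y) < s2" using psib_supp(2)[OF \<rho>, of b y] \<rho>s mNQ(5) by (auto simp: gk_def split: if_splits)
  then have "G V x b <= g" using s2(2)[of b] by (simp add: dist_norm g_def abs_less_iff)
  then show "G V x b * gk \<rho> y b <= g * gk \<rho> y b" by (rule mult_right_mono[OF _ gk_nonneg])
 qed
 have kPsi: "(\<integral>\<^sup>+b. ennreal (Psi \<rho> y' b) \<partial>occ \<beta> (exitH D) x) <= ennreal (2 * Mg * I)" if \<beta>: "0 < \<beta>" and y': "y' \<in> Ky" for \<beta> y'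
 proof (rule kf[OF \<beta> Psi_meas Psi_nonneg, where q=y'])
  fix b assume b: "b \<in> V" "Psi \<rho> y' b \<noteq> 0"
  then have "norm (b - y') <= \<sigma>" using psib_supp(2)[OF \<rho>, of b y'] \<rho>\<sigma>[OF y'] by (auto simp: Psi_def split: if_splits)
  moreover have "r0 + \<sigma> <= norm (x - y')" by (rule sepx[OF y'])
  ultimately have "b \<in> S" using nb[OF y'] norm_triangle_ineq[of "x - b" "b - y'"] unfolding S_def by (auto simp: dist_norm norm_minus_commute)
  then have "G V x b * Psi \<rho> y' b <= Mg * (2 * gk \<rho> y' b)"
   using Mg Psi_gk(2)[OF \<rho>] Psi_nonneg by (intro mult_mono) auto
  then show "G V x b * Psi \<rho> y' b <= (2 * Mg) * gk \<rho> y' b" by simp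
 qed (use Mg(1) y' Ky in auto)
 obtain Bd where Bd: "0 <= Bd" "\<forall>y\<in>Ky. \<forall>b\<in>D. \<bar>ll \<rho> y b\<bar> <= Bd" using ll_bounded[OF \<rho> Ky D(1) DH(2)] by blast
 have Kyb [measurable]: "Ky \<in> sets borel" and Db [measurable]: "D \<in> sets borel" using Dc Kc by auto
 note [measurable] = A(1) A(3)
 \<comment> \<open>Cutting off to \<open>Ky\<close> and \<open>D\<close> makes the integrand
   globally bounded and changes nothing almost everywhere, as the two occupation measures live on
   these sets.\<close>
 define l where "l y' b = indicator Ky y' * indicator D b * ll \<rho> y' b" for y' b
 have lm [measurable]: "(\<lambda>p. l (fst p) (snd p)) \<in> borel_measurable (borel \<Otimes>\<^sub>M borel)"
  unfolding l_def using ll_meas by measurable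
 have lB: "\<bar>l y' b\<bar> <= Bd" for y' b using Bd by (auto simp: l_def indicator_def)
 have ll_Psi: "l y' b = Lop (Psi \<rho> y') b" "l y' b = 1 / b $ k * Lop (psib \<rho> b) y'" if "y' \<in> Ky" "b \<in> D" for y' b
 proof -
  have "y' \<in> H" "b \<in> H" using that Ky DH by auto
  then show "l y' b = Lop (Psi \<rho> y') b" "l y' b = 1 / b $ k * Lop (psib \<rho> b) y'"
   using that Psi_Lop[of y' b \<rho>] by (auto simp: l_def ll_def)
 qed
 define c where "c = j0 * I / 4"
 have c0: "0 <= c" using j0(1) I(1) by (simp add: c_def)
 define \<nu> where "\<nu> = occ \<beta>1 (exitH Ky) y"
 have Tm1: "exitH Ky \<in> borel_measurable Msp" by (rule stop_meas[OF exit_stop[OF Kc]])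
 have Tm2: "exitH D \<in> borel_measurable Msp" by (rule stop_meas[OF exit_stop[OF Dc]])
 interpret \<nu>: finite_measure \<nu> unfolding \<nu>_def by (rule occ_finite[OF n0(1) yH Tm1])
 have sets_\<nu> [measurable_cong, simp]: "sets \<nu> = sets borel" and space_\<nu> [simp]: "space \<nu> = UNIV" by (simp_all add: \<nu>_def)
 have \<nu>K: "AE y' in \<nu>. y' \<in> Ky \<inter> H" unfolding \<nu>_def by (rule occ_conc[OF n0(1) yH Kc])
 have \<nu>1: "measure \<nu> UNIV <= 1 / \<beta>1"
  using occ_total[OF n0(1) yH Tm1] n0(1) unfolding \<nu>_def[symmetric] \<nu>.emeasure_eq_measure by simp
 have li1: "integrable \<nu> (\<lambda>y'. l y' b)" for b
 proof (rule \<nu>.integrable_const_bound[where B=Bd])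
  show "(\<lambda>y'. l y' b) \<in> borel_measurable \<nu>" using measurable_compose[OF measurable_Pair2'[of b borel borel] lm] by simp
 qed (use lB in auto)
 have low: "- gk \<rho> y b + indicator Ax b * (c * n0) <= (\<integral>y'. l y' b \<partial>\<nu>)" if b: "b \<in> D" for b
 proof (cases "b \<in> Ax")
  case True
  have bH: "b \<in> H" using b DH by auto
  have "c * n0 <= c * measure \<nu> Ay" using n0(3) c0 unfolding \<nu>_def by (rule mult_left_mono)
  also have "... = (\<integral>y'. c * indicator Ay y' \<partial>\<nu>)" by simp
  also have "... <= (\<integral>y'. l y' b \<partial>\<nu>)"
  proof (rule integral_mono_AE[OF _ li1])
   show "integrable \<nu> (\<lambda>y'. c * indicator Ay y')" by (intro integrable_mult_right integrable_real_indicator) (auto simp: \<nu>.emeasure_eq_measure)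
   show "AE y' in \<nu>. c * indicator Ay y' <= l y' b" using \<nu>K
   proof eventually_elim
    case (elim y')
    then have y'K: "y' \<in> Ky" and y'H: "y' \<in> H" by auto
    \<comment> \<open>One application, with lower bound \<open>j0\<close> or 0, treats
      \<open>Ay\<close> and the rest of \<open>Ky\<close> together.\<close>
    have j: "(if y' \<in> Ay then j0 else 0) * I / 4 <= Lop (Psi \<rho> y') b"
     by (rule Lop_Psi_lower[OF \<rho> y'H bH \<rho>\<sigma>[OF y'K] \<sigma>(2) sepA[OF True y'K] I(3)[OF y'H] I(4)[OF y'H]])
      (use j0 True J_nonneg[OF bH] in auto)
    then show ?case unfolding ll_Psi(1)[OF y'K b] c_def by (cases "y' \<in> Ay") auto
   qed
  qed
  finally show ?thesis using True gk_nonneg[of \<rho> y b] by simp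
 next
  case False
  have bH: "b \<in> H" using b DH by auto
  have bk: "0 < b $ k" using bH by (simp add: halfsp_def)
  \<comment> \<open>The bump \<open>psib \<rho> b\<close> need not vanish off \<open>Ky\<close>, so
    Dynkin's formula is used as an inequality; its direction is the one required, and the discount
    term has the right sign to be dropped.\<close>
  have u: "psib \<rho> b \<in> Cc_inf H" by (rule psib_Cc[OF \<rho> bH])
  have "(\<integral>y'. - (b $ k) * l y' b \<partial>\<nu>) <= (\<integral>y'. hf \<beta>1 (psib \<rho> b) y' \<partial>\<nu>)"
  proof (rule integral_mono_AE)
   show "integrable \<nu> (\<lambda>y'. - (b $ k) * l y' b)" by (intro integrable_mult_right li1)
   show "integrable \<nu> (hf \<beta>1 (psib \<rho> b))" unfolding \<nu>_def by (rule hf_integrable_occ[OF n0(1) u psib_nonneg yH Tm1])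
   show "AE y' in \<nu>. - (b $ k) * l y' b <= hf \<beta>1 (psib \<rho> b) y'" using \<nu>K
   proof eventually_elim
    case (elim y')
    then have y'K: "y' \<in> Ky" and y'H: "y' \<in> H" by auto
    have "- (b $ k) * l y' b = - Lop (psib \<rho> b) y'" unfolding ll_Psi(2)[OF y'K b] using bk by simp
    moreover have "0 <= \<beta>1 * psib \<rho> b y'" using n0(1) psib_nonneg by simp
    ultimately show ?case using y'H by (simp add: hf_def)
   qed
  qed
  also have "... <= psib \<rho> b y" unfolding \<nu>_def by (rule dynkin_le(1)[OF n0(1) u psib_nonneg yH Kc])
  finally have "- (b $ k) * (\<integral>y'. l y' b \<partial>\<nu>) <= psib \<rho> b y" by simp
  then have "- psib \<rho> b y <= (\<integral>y'. l y' b \<partial>\<nu>) * b $ k" by (simp add: mult.commute)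
  then have "(- psib \<rho> b y) / b $ k <= (\<integral>y'. l y' b \<partial>\<nu>)" by (simp only: pos_divide_le_eq[OF bk])
  then show ?thesis using False bH by (simp add: gk_def)
 qed
 have claim: "c * n0 * k0 <= g * I + \<beta> * (2 * Mg * I / \<beta>1)" if \<beta>: "0 < \<beta>" "\<beta> <= \<beta>0" for \<beta>
 proof -
  define \<kappa> where "\<kappa> = occ \<beta> (exitH D) x"
  interpret \<kappa>: finite_measure \<kappa> unfolding \<kappa>_def by (rule occ_finite[OF \<beta>(1) xH Tm2])
  have sets_\<kappa> [measurable_cong, simp]: "sets \<kappa> = sets borel" and space_\<kappa> [simp]: "space \<kappa> = UNIV" by (simp_all add: \<kappa>_def)
  have \<kappa>D: "AE b in \<kappa>. b \<in> D \<inter> H" unfolding \<kappa>_def by (rule occ_conc[OF \<beta>(1) xH Dc])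
  interpret pair_sigma_finite \<nu> \<kappa> ..
  interpret fin: finite_measure "\<nu> \<Otimes>\<^sub>M \<kappa>" by (rule finite_measure_pair_measure) unfold_locales
  have li: "integrable (\<nu> \<Otimes>\<^sub>M \<kappa>) (\<lambda>(y', b). l y' b)"
  proof (rule fin.integrable_const_bound[where B=Bd])
   show "(\<lambda>(y', b). l y' b) \<in> borel_measurable (\<nu> \<Otimes>\<^sub>M \<kappa>)" using lm by (simp add: split_beta' cong: measurable_cong_sets sets_pair_measure_cong)
  qed (use lB in auto)
  have fub: "(\<integral>b. (\<integral>y'. l y' b \<partial>\<nu>) \<partial>\<kappa>) = (\<integral>y'. (\<integral>b. l y' b \<partial>\<kappa>) \<partial>\<nu>)" by (rule Fubini_integral[OF li])
  have gki: "integrable \<kappa> (gk \<rho> y)" "integral\<^sup>L \<kappa> (gk \<rho> y) <= g * I"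
   using bochner_of_nn_bound[of "gk \<rho> y" \<kappa> "g * I"] gk_nonneg kgk[OF \<beta>(1)] g0 I(1) unfolding \<kappa>_def by auto
  have "c * n0 * k0 <= c * n0 * measure \<kappa> Ax" using k0(3)[OF \<beta>] c0 n0(2) unfolding \<kappa>_def by (intro mult_left_mono) auto
  then have "c * n0 * k0 - g * I <= (c * n0) * measure \<kappa> Ax - integral\<^sup>L \<kappa> (gk \<rho> y)" using gki(2) by linarith
  also have "... = (\<integral>b. - gk \<rho> y b + indicator Ax b * (c * n0) \<partial>\<kappa>)"
  proof -
   have "integrable \<kappa> (indicator Ax :: _ => real)" by (intro integrable_real_indicator) (auto simp: \<kappa>.emeasure_eq_measure)
   then show ?thesis using gki(1) by simp
  qed
  also have "... <= (\<integral>b. (\<integral>y'. l y' b \<partial>\<nu>) \<partial>\<kappa>)"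
  proof (rule integral_mono_AE)
   have "integrable \<kappa> (indicator Ax :: _ => real)" by (intro integrable_real_indicator) (auto simp: \<kappa>.emeasure_eq_measure)
   then show "integrable \<kappa> (\<lambda>b. - gk \<rho> y b + indicator Ax b * (c * n0))" using gki(1) by simp
   show "integrable \<kappa> (\<lambda>b. \<integral>y'. l y' b \<partial>\<nu>)" by (rule integrable_snd[OF li])
   show "AE b in \<kappa>. - gk \<rho> y b + indicator Ax b * (c * n0) <= (\<integral>y'. l y' b \<partial>\<nu>)"
    using \<kappa>D by eventually_elim (rule low, simp)
  qed
  also have "... <= (\<integral>y'. \<beta> * (2 * Mg * I) \<partial>\<nu>)" unfolding fub
  proof (rule integral_mono_AE)
   show "integrable \<nu> (\<lambda>y'. \<integral>b. l y' b \<partial>\<kappa>)" using integrable_fst[OF li] by simp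
   show "AE y' in \<nu>. (\<integral>b. l y' b \<partial>\<kappa>) <= \<beta> * (2 * Mg * I)" using \<nu>K
   proof eventually_elim
    case (elim y')
    then have y'K: "y' \<in> Ky" and y'H: "y' \<in> H" by auto
    have u: "Psi \<rho> y' \<in> Cc_inf H" by (rule Psi_Cc[OF \<rho> y'H])
    have Pi: "integrable \<kappa> (Psi \<rho> y')" "integral\<^sup>L \<kappa> (Psi \<rho> y') <= 2 * Mg * I"
     using bochner_of_nn_bound[of "Psi \<rho> y'" \<kappa> "2 * Mg * I"] Psi_nonneg kPsi[OF \<beta>(1) y'K] Mg(1) I(1) unfolding \<kappa>_def by auto
    have hi: "integrable \<kappa> (hf \<beta> (Psi \<rho> y'))" unfolding \<kappa>_def by (rule hf_integrable_occ[OF \<beta>(1) u Psi_nonneg xH Tm2])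
    have supp: "Psi \<rho> y' b = 0" if "b \<notin> D" for b
    proof (rule ccontr)
     assume "Psi \<rho> y' b \<noteq> 0"
     then have "norm (b - y') <= \<sigma>" using psib_supp(2)[OF \<rho>, of b y'] \<rho>\<sigma>[OF y'K] by (auto simp: Psi_def split: if_splits)
     then have "b \<in> cball y' \<sigma>" by (simp add: dist_norm norm_minus_commute)
     then show False using nb[OF y'K] that by blast
    qed
    \<comment> \<open>Since \<open>Psi \<rho> y'\<close> is supported in \<open>D\<close>, Dynkin's
      formula is an equality; only the nonnegativity of its value at \<open>x\<close> is
      used.\<close>
    have "(\<integral>b. hf \<beta> (Psi \<rho> y') b \<partial>\<kappa>) = Psi \<rho> y' x" unfolding \<kappa>_def
     by (rule dynkin_le(2)[OF \<beta>(1) u Psi_nonneg xH Dc supp])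
    then have h0: "0 <= (\<integral>b. hf \<beta> (Psi \<rho> y') b \<partial>\<kappa>)" using Psi_nonneg[of \<rho> y' x] by simp
    have "(\<integral>b. l y' b \<partial>\<kappa>) = (\<integral>b. \<beta> * Psi \<rho> y' b - hf \<beta> (Psi \<rho> y') b \<partial>\<kappa>)"
    proof (rule integral_cong_AE)
     show "(\<lambda>b. l y' b) \<in> borel_measurable \<kappa>" using measurable_compose[OF measurable_Pair1'[of y' borel borel] lm] by simp
     show "(\<lambda>b. \<beta> * Psi \<rho> y' b - hf \<beta> (Psi \<rho> y') b) \<in> borel_measurable \<kappa>" using hf_meas[OF u, of \<beta>] by measurable
     show "AE b in \<kappa>. l y' b = \<beta> * Psi \<rho> y' b - hf \<beta> (Psi \<rho> y') b"
      using \<kappa>D by eventually_elim (use ll_Psi(1)[OF y'K] in \<open>auto simp: hf_def\<close>)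
    qed
    also have "... = \<beta> * integral\<^sup>L \<kappa> (Psi \<rho> y') - (\<integral>b. hf \<beta> (Psi \<rho> y') b \<partial>\<kappa>)" using Pi(1) hi by simp
    also have "... <= \<beta> * integral\<^sup>L \<kappa> (Psi \<rho> y')" using h0 by simp
    also have "... <= \<beta> * (2 * Mg * I)" using Pi(2) \<beta> by (intro mult_left_mono) auto
    finally show ?case .
   qed
  qed simp
  also have "... = \<beta> * (2 * Mg * I) * measure \<nu> UNIV" by simp
  also have "... <= \<beta> * (2 * Mg * I) * (1 / \<beta>1)" using \<nu>1 \<beta> Mg(1) I(1) by (intro mult_left_mono) auto
  finally show ?thesis by simp
 qed
 \<comment> \<open>The discount \<open>\<beta>1\<close> at \<open>y\<close> stays fixed while the
   discount \<beta> at \<open>x\<close> tends to 0.\<close>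
 have "c * n0 * k0 <= g * I"
  by (rule le_of_small[OF k0(1) _ claim]) (use Mg(1) I(1) n0(1) in auto)
 then have "(j0 * n0 * k0 / 4) * I <= g * I" by (simp add: c_def mult_ac)
 then show "j0 * n0 * k0 / 4 <= G V x y + \<epsilon>" using I(1) unfolding g_def by (rule mult_right_le_imp_le)
qed

end

context bproc begin

text \<open>With r = |x - y|, the occupations at both ends contribute r^\<alpha> times a boundary
  factor each, and the jump density across distance r has order r^(-d-\<alpha>); the product has
  order r^(\<alpha>-d).\<close>

lemma green_lower:
 assumes \<epsilon>: "0 < \<epsilon>" "\<epsilon> < 1/4"
 shows "\<exists>C>0. \<forall>w R x y. w $ k = 0 \<and> 0 < R \<and> x \<in> ball w ((1 - \<epsilon>) * R) \<inter> H \<and> y \<in> ball w ((1 - \<epsilon>) * R) \<inter> H \<and> x \<noteq> y -->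
   C * (min (x $ k / norm (x - y)) 1) powr (\<alpha> - 1) * (min (y $ k / norm (x - y)) 1) powr (\<alpha> - 1) / norm (x - y) powr (d - \<alpha>)
   <= G (ball w R \<inter> H) x y"
proof -
 obtain C0 h1 b0 where C0: "0 < C0" "0 < h1" "h1 <= 1/2" "0 < b0" and occ: "\<forall>\<delta>>0. \<forall>x\<in>H. \<exists>K.
   compact K \<and> K \<subseteq> H \<inter> cball x (5 * \<delta>) \<and> (\<forall>\<beta> D. 0 < \<beta> \<and> \<beta> <= b0 * \<delta> powr (- \<alpha>) \<and> closed D \<and> K \<subseteq> D -->
    C0 * \<delta> powr \<alpha> * (min (x $ k / \<delta>) 1) powr (\<alpha> - 1) <= measure (occ \<beta> (exitH D) x) (K \<inter> {y. h1 * \<delta> <= y $ k}))"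
  using occ_lower by blast
 \<comment> \<open>The two ends of the jump will be at distance at most 2r and at heights at least
   h1 \<delta>/2 with \<delta> = \<epsilon> r/32; the quotient of these is h1
   \<epsilon>/128.\<close>
 have cp: "0 < h1 * \<epsilon> / 128" using C0 \<epsilon> by simp
 obtain bJ where bJ: "bJ > 0" "\<And>x y. x \<in> H ==> y \<in> H ==> x \<noteq> y ==> h1 * \<epsilon> / 128 * norm (x - y) <= min (x $ k) (y $ k) ==> bJ <= B x y"
  using B_low[OF cp] by blast
 define C where "C = bJ * 2 powr (- (d + \<alpha>)) * C0^2 * ((\<epsilon> / 32) powr \<alpha>)^2 / 4"
 have C: "0 < C" using bJ C0 \<epsilon> by (simp add: C_def)
 have "C * (min (x $ k / norm (x - y)) 1) powr (\<alpha> - 1) * (min (y $ k / norm (x - y)) 1) powr (\<alpha> - 1) / norm (x - y) powr (d - \<alpha>)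
   <= G (ball w R \<inter> H) x y"
  if w: "w $ k = 0" and R: "0 < R" and x: "x \<in> ball w ((1 - \<epsilon>) * R) \<inter> H" and y: "y \<in> ball w ((1 - \<epsilon>) * R) \<inter> H" and xy: "x \<noteq> y"
  for w :: "real^'n" and R x y
 proof -
  define r where "r = norm (x - y)"
  \<comment> \<open>The factor \<epsilon>/32 keeps the balls of radius 6\<delta> about
    \<open>x\<close> and \<open>y\<close> far apart and inside the ball of radius (1 - \<epsilon>/2)
    R.\<close>
  define \<delta> where "\<delta> = \<epsilon> * r / 32"
  have r: "0 < r" using xy by (simp add: r_def)
  have \<delta>: "0 < \<delta>" using r \<epsilon> by (simp add: \<delta>_def)
  have xH: "x \<in> H" and yH: "y \<in> H" using x y by auto
  have nx: "norm (x - w) < (1 - \<epsilon>) * R" and ny: "norm (y - w) < (1 - \<epsilon>) * R"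
   using x y by (auto simp: dist_norm norm_minus_commute)
  have "r <= norm (x - w) + norm (y - w)" unfolding r_def using norm_triangle_ineq4[of "x - w" "y - w"] by simp
  then have "r < 2 * ((1 - \<epsilon>) * R)" using nx ny by linarith
  also have "... <= 2 * (1 * R)" using \<epsilon> R by (intro mult_left_mono mult_right_mono) auto
  finally have "r < 2 * R" by simp
  then have "\<epsilon> * r < \<epsilon> * (2 * R)" using \<epsilon> by (intro mult_strict_left_mono) auto
  then have \<delta>R: "16 * \<delta> < \<epsilon> * R" by (simp add: \<delta>_def)
  have "\<epsilon> * r <= 1/4 * r" using \<epsilon> r by (intro mult_right_mono) auto
  then have \<delta>r: "128 * \<delta> <= r" by (simp add: \<delta>_def)
  obtain Ky where Ky: "compact Ky" "Ky \<subseteq> H \<inter> cball y (5 * \<delta>)" and oy: "\<And>\<beta> D. 0 < \<beta> ==> \<beta> <= b0 * \<delta> powr (- \<alpha>) ==> closed D ==> Ky \<subseteq> D ==>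
    C0 * \<delta> powr \<alpha> * (min (y $ k / \<delta>) 1) powr (\<alpha> - 1) <= measure (occ \<beta> (exitH D) y) (Ky \<inter> {y. h1 * \<delta> <= y $ k})"
   using occ[rule_format, OF \<delta> yH] by blast
  obtain Kx where Kx: "compact Kx" "Kx \<subseteq> H \<inter> cball x (5 * \<delta>)" and ox: "\<And>\<beta> D. 0 < \<beta> ==> \<beta> <= b0 * \<delta> powr (- \<alpha>) ==> closed D ==> Kx \<subseteq> D ==>
    C0 * \<delta> powr \<alpha> * (min (x $ k / \<delta>) 1) powr (\<alpha> - 1) <= measure (occ \<beta> (exitH D) x) (Kx \<inter> {y. h1 * \<delta> <= y $ k})"
   using occ[rule_format, OF \<delta> xH] by blast
  \<comment> \<open>A lowest point of the two supports; inserting \<open>x\<close> makes the set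
    nonempty. The set \<open>D\<close> is cut at half this height, so that it is compact in
    \<open>H\<close> and still contains neighbourhoods of \<open>Ky\<close>.\<close>
  have "\<exists>m\<in>insert x (Kx \<union> Ky). \<forall>z\<in>insert x (Kx \<union> Ky). m $ k <= z $ k"
   using Kx(1) Ky(1) by (intro continuous_attains_inf continuous_intros compact_insert compact_Un) auto
  then obtain m where m: "m \<in> insert x (Kx \<union> Ky)" "\<And>z. z \<in> Kx \<union> Ky ==> m $ k <= z $ k" by blast
  have mH: "m \<in> H" using m(1) xH Kx(2) Ky(2) by auto
  define h where "h = m $ k"
  have h: "0 < h" using mH by (simp add: h_def halfsp_def)
  define D where "D = cball w ((1 - \<epsilon> / 2) * R) \<inter> {z. h / 2 <= z $ k}"
  have Dcl: "closed {z :: real^'n. h / 2 <= z $ k}" by (intro closed_Collect_le continuous_intros)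
  have Dc: "compact D" unfolding D_def by (intro compact_Int_closed compact_cball Dcl)
  have "(1 - \<epsilon> / 2) * R < 1 * R" using \<epsilon> R by (intro mult_strict_right_mono) auto
  then have DV: "D \<subseteq> ball w R \<inter> H" unfolding D_def using h by (auto simp: halfsp_def)
  \<comment> \<open>The three bounds keep the neighbourhoods of \<open>Ky\<close> above the lower
    edge of \<open>D\<close>, those of \<open>Ay\<close> at height at least h1 \<delta>/2, and all
    of them within 6\<delta> of \<open>y\<close>.\<close>
  define \<sigma> where "\<sigma> = min (h / 2) (min (h1 * \<delta> / 2) \<delta>)"
  have \<sigma>: "0 < \<sigma>" "\<sigma> <= h / 2" "\<sigma> <= h1 * \<delta> / 2" "\<sigma> <= \<delta>"
  proof -
   have "0 < h1 * \<delta>" using C0 \<delta> by simp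
   then show "0 < \<sigma>" "\<sigma> <= h / 2" "\<sigma> <= h1 * \<delta> / 2" "\<sigma> <= \<delta>" unfolding \<sigma>_def using h \<delta> by linarith+
  qed
  have inD: "z \<in> D" if z: "norm (z - u) <= 6 * \<delta>" "norm (u - w) < (1 - \<epsilon>) * R" "h / 2 <= z $ k" for z u
  proof -
   have "norm (z - w) <= norm (z - u) + norm (u - w)" using norm_triangle_ineq[of "z - u" "u - w"] by simp
   then have "norm (z - w) <= 6 * \<delta> + (1 - \<epsilon>) * R" using z by linarith
   also have "... <= (1 - \<epsilon> / 2) * R" using \<delta>R \<delta> by (simp add: algebra_simps)
   finally show ?thesis using z(3) by (simp add: D_def dist_norm norm_minus_commute)
  qed
  have ky: "norm (y' - y) <= 5 * \<delta>" "y' \<in> H" "h <= y' $ k" if "y' \<in> Ky" for y'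
   using that Ky(2) m(2)[of y'] by (auto simp: dist_norm norm_minus_commute h_def)
  have kx: "norm (x' - x) <= 5 * \<delta>" "x' \<in> H" "h <= x' $ k" if "x' \<in> Kx" for x'
   using that Kx(2) m(2)[of x'] by (auto simp: dist_norm norm_minus_commute h_def)
  have nb: "cball y' \<sigma> \<subseteq> D" if y': "y' \<in> Ky" for y'
  proof
   fix z assume "z \<in> cball y' \<sigma>"
   then have z: "norm (z - y') <= \<sigma>" by (simp add: dist_norm norm_minus_commute)
   have "norm (z - y) <= norm (z - y') + norm (y' - y)" using norm_triangle_ineq[of "z - y'" "y' - y"] by simp
   then have 1: "norm (z - y) <= 6 * \<delta>" using z \<sigma>(4) ky(1)[OF y'] by linarith
   have "\<bar>(z - y') $ k\<bar> <= norm (z - y')" by (rule component_le_norm_cart)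
   then have "h / 2 <= z $ k" using z \<sigma>(2) ky(3)[OF y'] by simp
   then show "z \<in> D" by (rule inD[OF 1 ny])
  qed
  have KxD: "Kx \<subseteq> D"
  proof
   fix z assume z: "z \<in> Kx"
   show "z \<in> D" by (rule inD[OF _ nx]) (use kx[OF z] \<delta> h in auto)
  qed
  define Ay where "Ay = Ky \<inter> {y. h1 * \<delta> <= y $ k}"
  define Ax where "Ax = Kx \<inter> {y. h1 * \<delta> <= y $ k}"
  have cl: "closed {y :: real^'n. h1 * \<delta> <= y $ k}" by (intro closed_Collect_le continuous_intros)
  have Ab: "Ay \<in> sets borel" "Ax \<in> sets borel" unfolding Ay_def Ax_def
   using Kx(1) Ky(1) cl by (auto intro!: borel_closed closed_Int dest: compact_imp_closed)
  define \<beta>0 where "\<beta>0 = b0 * \<delta> powr (- \<alpha>)"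
  have \<beta>0: "0 < \<beta>0" using C0 \<delta> by (simp add: \<beta>0_def)
  define n0 where "n0 = C0 * \<delta> powr \<alpha> * (min (y $ k / \<delta>) 1) powr (\<alpha> - 1)"
  define k0 where "k0 = C0 * \<delta> powr \<alpha> * (min (x $ k / \<delta>) 1) powr (\<alpha> - 1)"
  define j0 where "j0 = bJ * (2 * r) powr (- (d + \<alpha>))"
  have nk0: "0 <= n0" "0 <= k0" "0 <= j0" using C0 bJ by (auto simp: n0_def k0_def j0_def)
  have sep: "r / 2 + \<sigma> <= norm (b - y')" if b: "norm (b - x) <= 5 * \<delta>" and y': "y' \<in> Ky" for b y'
  proof -
   have "r <= norm (x - b) + norm (b - y') + norm (y' - y)"
    unfolding r_def using norm_triangle_ineq[of "x - b" "b - y'"] norm_triangle_ineq[of "x - y'" "y' - y"] by simp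
   then show ?thesis using b ky(1)[OF y'] \<sigma>(4) \<delta>r \<delta> by (simp add: norm_minus_commute)
  qed
  have jb: "j0 <= J b z" if b: "b \<in> Ax" and y': "y' \<in> Ay" and z: "z \<in> H" "norm (z - y') <= \<sigma>" for b y' z
  proof -
   have bK: "b \<in> Kx" "h1 * \<delta> <= b $ k" and yK: "y' \<in> Ky" "h1 * \<delta> <= y' $ k" using b y' by (auto simp: Ax_def Ay_def)
   note bb = kx[OF bK(1)] and yy = ky[OF yK(1)]
   have s: "r / 2 + \<sigma> <= norm (b - y')" by (rule sep[OF bb(1) yK(1)])
   have "norm (b - y') <= norm (b - z) + norm (z - y')" using norm_triangle_ineq[of "b - z" "z - y'"] by simp
   then have bz: "0 < norm (b - z)" using s z(2) r by linarith
   have "norm (b - z) <= norm (b - x) + norm (x - y) + norm (y - y') + norm (y' - z)"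
    using norm_triangle_ineq[of "b - x" "x - y"] norm_triangle_ineq[of "b - y" "y - y'"] norm_triangle_ineq[of "b - y'" "y' - z"] by simp
   then have bz2: "norm (b - z) <= 2 * r"
    using bb(1) yy(1) z(2) \<sigma>(4) \<delta>r \<delta> unfolding r_def[symmetric] by (simp add: norm_minus_commute)
   have "\<bar>(z - y') $ k\<bar> <= norm (z - y')" by (rule component_le_norm_cart)
   then have zk: "h1 * \<delta> / 2 <= z $ k" using z(2) \<sigma>(3) yK(2) by simp
   have "h1 * \<epsilon> / 128 * norm (b - z) <= h1 * \<epsilon> / 128 * (2 * r)" using bz2 C0 \<epsilon> by (intro mult_left_mono) auto
   also have "... = h1 * \<delta> / 2" by (simp add: \<delta>_def)
   finally have le: "h1 * \<epsilon> / 128 * norm (b - z) <= h1 * \<delta> / 2" .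
   have hd: "0 < h1 * \<delta>" using C0 \<delta> by simp
   have "h1 * \<epsilon> / 128 * norm (b - z) <= min (b $ k) (z $ k)" using le zk bK(2) hd by (intro min.boundedI) linarith+
   then have Bl: "bJ <= B b z" using bz by (intro bJ(2) bb(2) z(1)) auto
   have "j0 <= B b z * norm (b - z) powr (- (d + \<alpha>))" unfolding j0_def
   proof (rule mult_mono)
    show "(2 * r) powr (- (d + \<alpha>)) <= norm (b - z) powr (- (d + \<alpha>))"
     using bz bz2 alpha by (intro powr_mono2') (auto simp: d_eq)
   qed (use Bl bJ in auto)
   also have "... = J b z" unfolding powr_dm by (simp add: Jk_def divide_inverse)
   finally show ?thesis .
  qed
  have "j0 * n0 * k0 / 4 <= G (ball w R \<inter> H) x y"
  proof (rule green_core[OF w R _ _ xy Dc DV Ky(1) _ nb Ab(1) _ Ab(2) _ \<sigma>(1)])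
   have "(1 - \<epsilon>) * R <= 1 * R" using \<epsilon> R by (intro mult_right_mono) auto
   then show "x \<in> ball w R \<inter> H" "y \<in> ball w R \<inter> H" using x y by auto
   show "Ky \<subseteq> H" using Ky by auto
   show "Ay \<subseteq> Ky" by (simp add: Ay_def)
   show "Ax \<subseteq> D" using KxD by (auto simp: Ax_def)
   show "0 < r / 2" using r by simp
   show "r / 2 + \<sigma> <= norm (x - y')" if "y' \<in> Ky" for y' by (rule sep[OF _ that]) (use \<delta> in simp)
   show "r / 2 + \<sigma> <= norm (b - y')" if "b \<in> Ax" "y' \<in> Ky" for b y' by (rule sep[OF kx(1) that(2)]) (use that(1) in \<open>simp add: Ax_def\<close>)
   show "0 <= j0" "0 <= n0" "0 <= k0" by (rule nk0)+
   show "j0 <= J b z" if "b \<in> Ax" "y' \<in> Ay" "z \<in> H" "norm (z - y') <= \<sigma>" for b y' z by (rule jb[OF that])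
   show "0 < \<beta>0" by (rule \<beta>0)
   show "0 < \<beta>0" by (rule \<beta>0)
   show "n0 <= measure (occ \<beta>0 (exitH Ky) y) Ay" unfolding n0_def Ay_def
    by (rule oy[OF \<beta>0 _ compact_imp_closed[OF Ky(1)]]) (auto simp: \<beta>0_def)
   show "k0 <= measure (occ \<beta> (exitH D) x) Ax" if "0 < \<beta>" "\<beta> <= \<beta>0" for \<beta> unfolding k0_def Ax_def
    by (rule ox[OF that(1) _ compact_imp_closed[OF Dc] KxD]) (use that(2) in \<open>simp add: \<beta>0_def\<close>)
  qed
  moreover have "C * (min (x $ k / r) 1) powr (\<alpha> - 1) * (min (y $ k / r) 1) powr (\<alpha> - 1) / r powr (d - \<alpha>) <= j0 * n0 * k0 / 4"
  proof -
   \<comment> \<open>Passing from scale \<delta> to the larger scale r can only decrease the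
     boundary factors.\<close>
   have mm: "(min (z $ k / r) 1) powr (\<alpha> - 1) <= (min (z $ k / \<delta>) 1) powr (\<alpha> - 1)" if "z \<in> H" for z :: "real^'n"
   proof (rule powr_mono2)
    have zk: "0 < z $ k" using that by (simp add: halfsp_def)
    show "0 <= min (z $ k / r) 1" using zk r by simp
    have "z $ k / r <= z $ k / \<delta>" using zk \<delta> \<delta>r by (intro divide_left_mono) auto
    then show "min (z $ k / r) 1 <= min (z $ k / \<delta>) 1" by auto
   qed (use alpha in auto)
   define S where "S = bJ * (2 * r) powr (- (d + \<alpha>)) * (C0 * \<delta> powr \<alpha>) * (C0 * \<delta> powr \<alpha>) / 4"
   have S0: "0 <= S" using bJ C0 by (simp add: S_def)
   have "C / r powr (d - \<alpha>) = S"
   proof -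
    have "\<delta> powr \<alpha> = (\<epsilon> / 32) powr \<alpha> * r powr \<alpha>" using \<epsilon> r by (simp add: \<delta>_def powr_mult[symmetric])
    moreover have "(2 * r) powr (- (d + \<alpha>)) = 2 powr (- (d + \<alpha>)) * r powr (- (d + \<alpha>))" using r by (simp add: powr_mult)
    moreover have "r powr (- (d + \<alpha>)) * (r powr \<alpha> * r powr \<alpha>) = 1 / r powr (d - \<alpha>)"
    proof -
     have "r powr (- (d + \<alpha>)) * (r powr \<alpha> * r powr \<alpha>) = r powr (- (d + \<alpha>) + (\<alpha> + \<alpha>))" by (simp only: powr_add)
     also have "- (d + \<alpha>) + (\<alpha> + \<alpha>) = - (d - \<alpha>)" by simp
     finally show ?thesis by (simp only: powr_minus_divide)
    qed
    moreover have "bJ * (a * c) * (C0 * (m * n)) * (C0 * (m * n)) / 4 = (bJ * a * C0^2 * m^2 / 4) * (c * (n * n))" for a c m n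
     by (simp add: power2_eq_square)
    ultimately have "S = C * (1 / r powr (d - \<alpha>))" unfolding S_def C_def by (simp only:)
    then show ?thesis by simp
   qed
   then have "C * (min (x $ k / r) 1) powr (\<alpha> - 1) * (min (y $ k / r) 1) powr (\<alpha> - 1) / r powr (d - \<alpha>)
     = S * ((min (x $ k / r) 1) powr (\<alpha> - 1) * (min (y $ k / r) 1) powr (\<alpha> - 1))" by (simp add: mult_ac flip: times_divide_eq_left)
   also have "... <= S * ((min (x $ k / \<delta>) 1) powr (\<alpha> - 1) * (min (y $ k / \<delta>) 1) powr (\<alpha> - 1))"
    using S0 mm[OF xH] mm[OF yH] by (intro mult_left_mono mult_mono) auto
   also have "... = j0 * n0 * k0 / 4" by (simp add: S_def j0_def n0_def k0_def mult_ac)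
   finally show ?thesis .
  qed
  ultimately show ?thesis unfolding r_def by (rule order_trans[rotated])
 qed
 then show ?thesis using C by blast
qed

end

section \<open>Bounds for the kernel and conclusion\<close>

lemma powr_ln_bounded:
 fixes b g :: real
 assumes "0 <= b" "0 <= g" "g > 0 --> b > 0"
 shows "\<exists>C\<ge>0. \<forall>s u. 0 < s \<and> s <= 1 \<and> 0 <= u \<and> u <= 1 / s --> s powr b * (ln (1 + u)) powr g <= C"
proof (cases "g = 0")
 case True
 have "s powr b * (ln (1 + u)) powr g <= 1" if s: "0 < s" "s <= 1" for s u :: real
 proof -
  have "s powr b <= 1 powr b" using s assms by (intro powr_mono2) auto
  then have "s powr b * (ln (1 + u)) powr g <= 1 * 1" using True by (intro mult_mono) auto
  then show ?thesis by simp
 qed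
 then show ?thesis by (intro exI[of _ 1]) auto
next
 case False
 then have p: "0 < g" "0 < b" using assms by auto
 \<comment> \<open>A logarithm is dominated by every positive power; this exponent makes the
   resulting power of \<open>s\<close> cancel exactly against the prefactor.\<close>
 define q where "q = b / g"
 have q: "0 < q" "q * g = b" using p by (auto simp: q_def)
 have "s powr b * (ln (1 + u)) powr g <= 2 powr b / q powr g" if s: "0 < s" "s <= 1" "0 <= u" "u <= 1 / s" for s u :: real
 proof -
  have "1 <= 1 / s" using s by simp
  then have "1 + u <= 2 / s" using s(4) by simp
  then have "ln (1 + u) <= ln (2 / s)" using s by (intro ln_mono) auto
  also have "... <= (2 / s) powr q / q" using s q by (intro ln_powr_bound) (auto simp: field_simps)
  finally have "(ln (1 + u)) powr g <= ((2 / s) powr q / q) powr g" using s p by (intro powr_mono2) auto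
  also have "... = ((2 / s) powr q) powr g / q powr g" by (rule powr_divide)
  also have "... = (2 / s) powr b / q powr g" unfolding powr_powr q(2) ..
  finally have "s powr b * (ln (1 + u)) powr g <= s powr b * ((2 / s) powr b / q powr g)" by (rule mult_left_mono) simp
  also have "... = 2 powr b / q powr g" using s by (simp add: powr_divide)
  finally show ?thesis .
 qed
 then show ?thesis by (intro exI[of _ "2 powr b / q powr g"]) auto
qed

text \<open>Writing the quotients through s, t, u, v separates the kernel into two products of the
  type in \<open>powr_ln_bounded\<close>. As u and v are at least 1, the same form also serves the
  lower bound.\<close>

lemma Btil_facts:
 fixes x y :: "real^'n::finite"
 assumes x: "x \<in> halfsp k" and y: "y \<in> halfsp k" and xy: "x \<noteq> y"
 obtains s t u v where "0 < s" "s <= 1" "0 < t" "t <= 1" "1 <= u" "u <= 1 / s" "1 <= v" "v <= 1 / t"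
  "min (min (x $ k) (y $ k) / norm (x - y)) 1 = s" "s <= t"
  "\<And>b1 b2 b3 b4. Btil k b1 b2 b3 b4 x y = (s powr b1 * (ln (1 + u)) powr b3) * (t powr b2 * (ln (1 + v)) powr b4)"
proof -
 define r a b where "r = norm (x - y)" and "a = min (x $ k) (y $ k)" and "b = max (x $ k) (y $ k)"
 have p: "0 < r" "0 < a" "a <= b" using assms by (auto simp: r_def a_def b_def halfsp_def)
 have mr: "min (c / r) 1 = min c r / r" for c using p by (auto simp: min_def field_simps)
 show ?thesis
 proof (rule that[of "min (a / r) 1" "min (b / r) 1" "min b r / min a r" "r / min b r"])
  show "min (min (x $ k) (y $ k) / norm (x - y)) 1 = min (a / r) 1" by (simp add: a_def r_def)
  show "Btil k b1 b2 b3 b4 x y = (min (a / r) 1) powr b1 * (ln (1 + min b r / min a r)) powr b3 * ((min (b / r) 1) powr b2 * (ln (1 + r / min b r)) powr b4)" for b1 b2 b3 b4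
   unfolding Btil_def Let_def a_def[symmetric] b_def[symmetric] r_def[symmetric] by (simp only: mult_ac)
  show "min b r / min a r <= 1 / min (a / r) 1" unfolding mr using p by (simp add: divide_right_mono)
  show "r / min b r <= 1 / min (b / r) 1" unfolding mr by simp
  show "min (a / r) 1 <= min (b / r) 1" using p by (intro min.mono divide_right_mono) auto
 qed (use p in auto)
qed

theorem theorem6p7:
  fixes k :: "'n::finite"
    and \<alpha> \<beta>1 \<beta>2 \<beta>3 \<beta>4 :: real
    and B :: "real^'n \<Rightarrow> real^'n \<Rightarrow> real"
    and Msp :: "'w measure"
    and P :: "real^'n \<Rightarrow> 'w measure"
    and Y :: "real \<Rightarrow> 'w \<Rightarrow> real^'n"
    and \<zeta> :: "'w \<Rightarrow> ennreal"
    and F :: "real \<Rightarrow> 'w set set"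
    and G :: "(real^'n) set \<Rightarrow> real^'n \<Rightarrow> real^'n \<Rightarrow> real"
  assumes alpha: "1 < \<alpha>" "\<alpha> < 2"
    and betas: "0 \<le> \<beta>1" "0 \<le> \<beta>2" "0 \<le> \<beta>3" "0 \<le> \<beta>4"
      "\<beta>3 > 0 \<longrightarrow> \<beta>1 > 0" "\<beta>4 > 0 \<longrightarrow> \<beta>2 > 0"
    and dim: "real CARD('n) > min (\<alpha> + \<beta>1 + \<beta>2) 2"
    and B: "B_hyps k \<alpha> \<beta>1 \<beta>2 \<beta>3 \<beta>4 B"
    and hunt: "hunt_process (halfsp k) Msp P Y \<zeta> F"
    and assoc: "associated k (Jk \<alpha> B) P Y \<zeta>"
    and green: "\<forall>w R. w $ k = 0 \<and> 0 < R \<longrightarrow>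
                  green_fun (ball w R \<inter> halfsp k) P Y \<zeta> (G (ball w R \<inter> halfsp k))"
  shows "\<forall>\<epsilon>. 0 < \<epsilon> \<and> \<epsilon> < 1/4 \<longrightarrow> (\<exists>C>0. \<forall>w R x y.
           w $ k = 0 \<and> 0 < R \<and> x \<in> ball w ((1 - \<epsilon>) * R) \<inter> halfsp k
           \<and> y \<in> ball w ((1 - \<epsilon>) * R) \<inter> halfsp k \<and> x \<noteq> y \<longrightarrow>
           G (ball w R \<inter> halfsp k) x y \<ge>
             C * (min (x $ k / norm (x - y)) 1) powr (\<alpha> - 1)
               * (min (y $ k / norm (x - y)) 1) powr (\<alpha> - 1)
               / norm (x - y) powr (real CARD('n) - \<alpha>))"
proof -
 let ?T = "Btil k \<beta>1 \<beta>2 \<beta>3 \<beta>4"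
 let ?H = "halfsp k"
 have B_meas: "bmeas (\<lambda>z. B (fst z) (snd z))"
  and B_nonneg: "\<And>x y. x \<in> ?H ==> y \<in> ?H ==> 0 <= B x y"
  and B_sym: "\<And>x y. x \<in> ?H ==> y \<in> ?H ==> B x y = B y x"
  and B_scale: "\<And>a x y. 0 < a ==> x \<in> ?H ==> y \<in> ?H ==> B (a *\<^sub>R x) (a *\<^sub>R y) = B x y"
  and B_trans: "\<And>z x y. z $ k = 0 ==> x \<in> ?H ==> y \<in> ?H ==> B (x + z) (y + z) = B x y"
  and B_cmp: "\<exists>C\<ge>1. \<forall>x\<in>halfsp k. \<forall>y\<in>halfsp k. x \<noteq> y -->
     ?T x y / C <= B x y \<and> B x y <= C * ?T x y"
  using B unfolding B_hyps_def by simp_all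
 obtain C where C: "C \<ge> 1" "\<And>x y. x \<in> ?H ==> y \<in> ?H ==> x \<noteq> y ==> ?T x y / C <= B x y"
  "\<And>x y. x \<in> ?H ==> y \<in> ?H ==> x \<noteq> y ==> B x y <= C * ?T x y" using B_cmp by blast
 obtain C1 where C1: "0 <= C1" "\<And>s u. 0 < s ==> s <= 1 ==> 0 <= u ==> u <= 1 / s ==> s powr \<beta>1 * (ln (1 + u)) powr \<beta>3 <= C1"
  using powr_ln_bounded[OF betas(1,3,5)] by blast
 obtain C2 where C2: "0 <= C2" "\<And>s u. 0 < s ==> s <= 1 ==> 0 <= u ==> u <= 1 / s ==> s powr \<beta>2 * (ln (1 + u)) powr \<beta>4 <= C2"
  using powr_ln_bounded[OF betas(2,4,6)] by blast
 have B_bound: "B x y <= C * (C1 * C2)" if xy: "x \<in> ?H" "y \<in> ?H" "x \<noteq> y" for x y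
 proof (rule Btil_facts[OF xy], goal_cases)
  case f: (1 s t u v)
  have "?T x y <= C1 * C2" unfolding f(11)
   using f C1 C2 by (intro mult_mono C1(2) C2(2)) auto
  then have "C * ?T x y <= C * (C1 * C2)" using C(1) by (intro mult_left_mono) auto
  then show ?thesis using C(3)[OF xy] by linarith
 qed
 have B_low: "\<exists>b>0. \<forall>x\<in>halfsp k. \<forall>y\<in>halfsp k. x \<noteq> y --> c * norm (x - y) <= min (x $ k) (y $ k) --> b <= B x y" if c: "0 < c" for c
 proof -
  \<comment> \<open>When c times the distance is at most both heights, s and t are at least
    \<open>m\<close>, and both logarithms are at least ln 2.\<close>
  define m where "m = min c 1"
  define b where "b = (m powr \<beta>1 * (ln 2) powr \<beta>3) * (m powr \<beta>2 * (ln 2) powr \<beta>4) / C"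
  have m: "0 < m" using c by (simp add: m_def)
  have "0 < (ln 2 :: real)" by simp
  then have b: "0 < b" using m C(1) by (simp add: b_def)
  have "b <= B x y" if xy: "x \<in> ?H" "y \<in> ?H" "x \<noteq> y" and n: "c * norm (x - y) <= min (x $ k) (y $ k)" for x y
  proof (rule Btil_facts[OF xy], goal_cases)
   case f: (1 s t u v)
   have "c <= min (x $ k) (y $ k) / norm (x - y)" using n xy(3) by (simp add: pos_le_divide_eq)
   then have ms: "m <= s" unfolding f(9)[symmetric] m_def by (intro min.mono) auto
   have l: "ln 2 <= ln (1 + u)" "ln 2 <= ln (1 + v)" using f by auto
   have "(m powr \<beta>1 * (ln 2) powr \<beta>3) * (m powr \<beta>2 * (ln 2) powr \<beta>4) <= ?T x y"
    unfolding f(11) using ms m f(1,10) l betas by (intro mult_mono powr_mono2) auto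
   then have "b <= ?T x y / C" unfolding b_def using C(1) by (intro divide_right_mono) auto
   then show ?thesis using C(2)[OF xy] by linarith
  qed
  then show ?thesis using b by blast
 qed
 interpret bproc k "real CARD('n)" \<alpha> "C * (C1 * C2)" B P Y \<zeta> Msp F G
 proof
  show "0 <= C * (C1 * C2)" using C C1 C2 by auto
  show "green_fun (ball w R \<inter> ?H) P Y \<zeta> (G (ball w R \<inter> ?H))" if "w $ k = 0" "0 < R" for w R
   using green that by blast
 qed (fact refl alpha B_meas B_nonneg B_sym B_bound B_scale B_trans B_low assoc hunt)+
 show ?thesis by (intro allI impI green_lower) auto
qed

end
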